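(* Fix the parameters and set $p_\infty(t)\equiv p_{\infty,*}$ in (RS). For arbitrary fixed $M_0>0$, let $(\rho_*[M_0],R_*[M_0])$ denote the unique spherically symmetric equilibrium with bubble mass $M_0$, i.e. $M_0=\frac43\pi\rho_*[M_0](R_*[M_0])^3$. There exists $\eta_0>0$ such that the following holds for all $0<\eta\le\eta_0$. Let $(\rho(r,t),R(t))$ be the global in time solution of (RS) with initial data $\rho(r,0)=\rho_0(r)$, $R(0)=R_0$, $\dot R(0)=\dot R_0$ which is a mass preserving and small perturbation of $(\rho_*[M_0],R_*[M_0])$, i.e. $$M_0=\int_{B_{R_0}}\rho_0\qquad\text{and}\qquad |||(\rho_0-\rho_*[M_0],R_0-R_*[M_0],\dot R_0)|||\le\eta .$$ Then, as $t\to+\infty$, $$|||(\rho(\cdot,t)-\rho_*[M_0],R(t)-R_*[M_0],\dot R(t))|||\to0 .$$ Moreover, $|\ddot R(t)|+|\dddot R(t)|\to0$ as $t\to+\infty$.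
   Context: Fixed constants: $\kappa,\mathcal R_g,c_v,\sigma,\rho_l,T_\infty,p_{\infty,*}>0$, $\mu_l\ge 0$, $\gamma=1+\mathcal R_g/c_v>1$, and $0<\alpha<\tfrac12$. $B_R=\{x\in\mathbb R^3:|x|<R\}$; $\Delta_r f=r^{-2}\partial_r(r^2\partial_r f)$. (RS): free boundary problem for $\rho(r,t)>0$, $0\le r\le R(t)$, and $R(t)>0$, with $p(t)=\mathcal R_gT_\infty\rho(R(t),t)$: for $t>0$, $$\partial_t\rho=\frac{\kappa}{\gamma c_v}\Delta_r\log\rho+\frac1\gamma\frac{\partial_tp}{p}\Big(\frac13r\partial_r\rho+\rho\Big),\quad 0\le r\le R(t),$$ $$\dot R=-\frac{\kappa}{\gamma c_v}\frac{\partial_r\rho(R(t),t)}{\rho(R(t),t)^2}-\frac{R}{3\gamma}\frac{\partial_tp}{p},$$ $$\rho(R(t),t)=\frac1{\mathcal R_gT_\infty}\Big[p_\infty(t)+\frac{2\sigma}{R}+4\mu_l\frac{\dot R}{R}+\rho_l\Big(R\ddot R+\frac32\dot R^2\Big)\Big],$$ with initial data $\rho_0\in C^{2+2\alpha}$ (radial on $B_{R_0}$), $R_0>0$, $\dot R_0\in\mathbb R$, compatible with the system at $t=0$. Solutions are in the class $\rho\in C^{1+\alpha}_tC^{2+2\alpha}_r$, $R\in C^{3+\alpha}_t$. Equilibria: for $M>0$, $R_*[M]$ is the unique positive root of $p_{\infty,*}R^3+2\sigma R^2-\frac{3\mathcal R_gT_\infty M}{4\pi}=0$ and $\rho_*[M]=\frac{1}{\mathcal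 R_gT_\infty}(p_{\infty,*}+\frac{2\sigma}{R_*[M]})$. Norm: with $\overline\rho_i(y)=\rho_i(R_iy)$, $|||(\rho_1-\rho_2,R_1-R_2,\dot R_1-\dot R_2)|||=\|\overline\rho_1-\overline\rho_2\|_{C^{2+2\alpha}_y(B_1)}+|R_1-R_2|+|\dot R_1-\dot R_2|$. *)

theory Defs
  imports "HOL-Analysis.Analysis"
begin

section \<open>Hoelder spaces\<close>

definition partial_deriv :: "'a::euclidean_space \<Rightarrow> ('a \<Rightarrow> real) \<Rightarrow> 'a \<Rightarrow> real" where
  "partial_deriv i f x = frechet_derivative f (at x) i"

definition holder_on :: "real \<Rightarrow> 'a::metric_space set \<Rightarrow> ('a \<Rightarrow> real) \<Rightarrow> bool" where
  "holder_on \<beta> S f \<longleftrightarrow> (\<exists>C. \<forall>x\<in>S. \<forall>y\<in>S. \<bar>f x - f y\<bar> \<le> C * dist x y powr \<beta>)"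

definition sup_norm :: "'a set \<Rightarrow> ('a \<Rightarrow> real) \<Rightarrow> real" where
  "sup_norm U f = (SUP x\<in>U. \<bar>f x\<bar>)"

definition holder_seminorm :: "real \<Rightarrow> 'a::metric_space set \<Rightarrow> ('a \<Rightarrow> real) \<Rightarrow> real" where
  "holder_seminorm \<beta> U f =
     (SUP (x, y)\<in>{(x, y). x \<in> U \<and> y \<in> U \<and> x \<noteq> y}. \<bar>f x - f y\<bar> / dist x y powr \<beta>)"

text \<open>The space \<open>C\<^sup>2\<^sup>+\<^sup>\<beta>\<close> of the closure of an open set \<open>U\<close>, for \<open>0 < \<beta> < 1\<close>.  Derivatives are taken
  in \<open>U\<close>; the Hoelder bound is what lets them extend continuously to the closure.\<close>

definition C2_holder :: "real \<Rightarrow> 'a::euclidean_space set \<Rightarrow> ('a \<Rightarrow> real) \<Rightarrow> bool" where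
  "C2_holder \<beta> U f \<longleftrightarrow>
     continuous_on (closure U) f \<and> bounded (f ` U) \<and> f differentiable_on U \<and>
     (\<forall>i\<in>Basis. bounded (partial_deriv i f ` U) \<and> partial_deriv i f differentiable_on U) \<and>
     (\<forall>i\<in>Basis. \<forall>j\<in>Basis. bounded (partial_deriv j (partial_deriv i f) ` U) \<and>
        holder_on \<beta> U (partial_deriv j (partial_deriv i f)))"

text \<open>Only meaningful for functions satisfying \<^const>\<open>C2_holder\<close>, since the suprema are taken
  in \<^typ>\<open>real\<close>.\<close>

definition C2_holder_norm :: "real \<Rightarrow> 'a::euclidean_space set \<Rightarrow> ('a \<Rightarrow> real) \<Rightarrow> real" where
  "C2_holder_norm \<beta> U f =
     sup_norm U f + (\<Sum>i\<in>Basis. sup_norm U (partial_deriv i f)) +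
     (\<Sum>i\<in>Basis. \<Sum>j\<in>Basis. sup_norm U (partial_deriv j (partial_deriv i f)) +
        holder_seminorm \<beta> U (partial_deriv j (partial_deriv i f)))"

text \<open>Derivative on the half-line \<open>t \<ge> 0\<close>: two-sided for \<open>t > 0\<close>, one-sided at \<open>t = 0\<close>.\<close>

definition time_deriv :: "(real \<Rightarrow> real) \<Rightarrow> real \<Rightarrow> real" where
  "time_deriv f t = vector_derivative f (at t within {0..})"

text \<open>The Hoelder constants in time may depend on the horizon \<open>T\<close>: no uniformity as
  \<open>T\<close> tends to infinity is built into the solution class.\<close>

definition C3_holder_time :: "real \<Rightarrow> (real \<Rightarrow> real) \<Rightarrow> bool" where
  "C3_holder_time \<alpha> f \<longleftrightarrow>
     (\<forall>k<3. (time_deriv ^^ k) f differentiable_on {0..}) \<and>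
     (\<forall>T>0. holder_on \<alpha> {0..T} ((time_deriv ^^ 3) f))"

definition parabolic_holder_on ::
    "real \<Rightarrow> ('a::metric_space \<times> real) set \<Rightarrow> ('a \<times> real \<Rightarrow> real) \<Rightarrow> bool" where
  "parabolic_holder_on \<alpha> S g \<longleftrightarrow>
     (\<exists>C. \<forall>(x, s)\<in>S. \<forall>(y, t)\<in>S.
        \<bar>g (x, s) - g (y, t)\<bar> \<le> C * (dist x y powr (2 * \<alpha>) + \<bar>s - t\<bar> powr \<alpha>))"

text \<open>The parabolic class (\<open>C\<^sup>1\<^sup>+\<^sup>\<alpha>\<close> in time, \<open>C\<^sup>2\<^sup>+\<^sup>2\<^sup>\<alpha>\<close> in space) on the closure of \<open>U \<times> [0, T]\<close>
  for every \<open>T\<close>, where \<open>U\<close> is bounded, open and convex; the bounds on the lower-order derivatives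
  then follow from those on the top-order ones.\<close>

definition parabolic_C2_holder ::
    "real \<Rightarrow> 'a::euclidean_space set \<Rightarrow> ('a \<Rightarrow> real \<Rightarrow> real) \<Rightarrow> bool" where
  "parabolic_C2_holder \<alpha> U u \<longleftrightarrow>
     continuous_on (closure U \<times> {0..}) (\<lambda>(x, t). u x t) \<and>
     (\<forall>t\<ge>0. (\<lambda>x. u x t) differentiable_on U \<and>
        (\<forall>i\<in>Basis. partial_deriv i (\<lambda>x. u x t) differentiable_on U)) \<and>
     (\<forall>x\<in>U. u x differentiable_on {0..}) \<and>
     (\<forall>T>0. parabolic_holder_on \<alpha> (U \<times> {0..T}) (\<lambda>(x, t). time_deriv (u x) t) \<and>
        (\<forall>i\<in>Basis. \<forall>j\<in>Basis. parabolic_holder_on \<alpha> (U \<times> {0..T})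
           (\<lambda>(x, t). partial_deriv j (partial_deriv i (\<lambda>x. u x t)) x)))"

section \<open>The reduced bubble system\<close>

record bubble_params =
  kappa :: real
  Rg :: real
  cv :: real
  sigma :: real
  rho_l :: real
  T_inf :: real
  p_inf_star :: real
  mu_l :: real

definition admissible_params :: "bubble_params \<Rightarrow> bool" where
  "admissible_params P \<longleftrightarrow> kappa P > 0 \<and> Rg P > 0 \<and> cv P > 0 \<and> sigma P > 0 \<and> rho_l P > 0 \<and>
     T_inf P > 0 \<and> p_inf_star P > 0 \<and> mu_l P \<ge> 0"

definition gam :: "bubble_params \<Rightarrow> real" where
  "gam P = 1 + Rg P / cv P"

text \<open>Radial derivative on \<open>[0, b]\<close>, one-sided at the endpoints; the radial Laplacian is used only
  for \<open>0 < r \<le> b\<close>.\<close>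

definition radial_deriv :: "real \<Rightarrow> (real \<Rightarrow> real) \<Rightarrow> real \<Rightarrow> real" where
  "radial_deriv b f r = vector_derivative f (at r within {0..b})"

definition radial_laplacian :: "real \<Rightarrow> (real \<Rightarrow> real) \<Rightarrow> real \<Rightarrow> real" where
  "radial_laplacian b f r = radial_deriv b (\<lambda>s. s\<^sup>2 * radial_deriv b f s) r / r\<^sup>2"

text \<open>Right-hand sides of the three equations.  Here \<open>b\<close>, \<open>V\<close>, \<open>A\<close> are the values of the radius
  and of its first and second time derivatives, \<open>f\<close> is the density profile on \<open>[0, b]\<close>, and \<open>q\<close>
  is the value of \<open>\<partial>\<^sub>t p / p\<close>.\<close>

definition density_rhs :: "bubble_params \<Rightarrow> real \<Rightarrow> (real \<Rightarrow> real) \<Rightarrow> real \<Rightarrow> real \<Rightarrow> real" where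
  "density_rhs P b f q r =
     kappa P / (gam P * cv P) * radial_laplacian b (\<lambda>s. ln (f s)) r +
     1 / gam P * q * (1 / 3 * r * radial_deriv b f r + f r)"

definition wall_velocity :: "bubble_params \<Rightarrow> real \<Rightarrow> (real \<Rightarrow> real) \<Rightarrow> real \<Rightarrow> real" where
  "wall_velocity P b f q =
     - (kappa P / (gam P * cv P)) * (radial_deriv b f b / (f b)\<^sup>2) - b / (3 * gam P) * q"

definition wall_density :: "bubble_params \<Rightarrow> real \<Rightarrow> real \<Rightarrow> real \<Rightarrow> real \<Rightarrow> real" where
  "wall_density P pinf b V A =
     1 / (Rg P * T_inf P) *
       (pinf + 2 * sigma P / b + 4 * mu_l P * (V / b) + rho_l P * (b * A + 3 / 2 * V\<^sup>2))"

text \<open>Compatibility at \<open>t = 0\<close>: the equations hold there for some values \<open>q\<close> of \<open>\<partial>\<^sub>t p / p\<close> and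
  \<open>A\<close> of the second derivative of the radius.  The last conjunct is the density equation at the
  wall, obtained by expressing \<open>\<partial>\<^sub>t p / p\<close> through the total derivative of \<open>\<rho>(R(t), t)\<close>.\<close>

definition compatible_data ::
    "bubble_params \<Rightarrow> real \<Rightarrow> (real \<Rightarrow> real) \<Rightarrow> real \<Rightarrow> real \<Rightarrow> bool" where
  "compatible_data P pinf0 \<rho>0 R0 V0 \<longleftrightarrow>
     (\<exists>q A. V0 = wall_velocity P R0 \<rho>0 q \<and> \<rho>0 R0 = wall_density P pinf0 R0 V0 A \<and>
        \<rho>0 R0 * q = density_rhs P R0 \<rho>0 q R0 + V0 * radial_deriv R0 \<rho>0 R0)"

definition initial_data ::
    "bubble_params \<Rightarrow> real \<Rightarrow> real \<Rightarrow> (real \<Rightarrow> real) \<Rightarrow> real \<Rightarrow> real \<Rightarrow> bool" where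
  "initial_data P \<alpha> pinf0 \<rho>0 R0 V0 \<longleftrightarrow>
     R0 > 0 \<and> (\<forall>r\<in>{0..R0}. \<rho>0 r > 0) \<and>
     C2_holder (2 * \<alpha>) (ball 0 R0) (\<lambda>x::real^3. \<rho>0 (norm x)) \<and>
     compatible_data P pinf0 \<rho>0 R0 V0"

definition wall_pressure ::
    "bubble_params \<Rightarrow> (real \<Rightarrow> real \<Rightarrow> real) \<Rightarrow> (real \<Rightarrow> real) \<Rightarrow> real \<Rightarrow> real" where
  "wall_pressure P \<rho> R t = Rg P * T_inf P * \<rho> (R t) t"

text \<open>Global solutions; \<open>\<rho> r t\<close> is relevant only for \<open>0 \<le> r \<le> R t\<close> and \<open>t \<ge> 0\<close>.  Regularity of
  \<open>\<rho>\<close> up to the moving boundary is expressed for the radial function on the fixed unit ball of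
  \<open>\<real>\<^sup>3\<close> obtained by scaling with \<open>R t\<close>.  The density equation is imposed in the interior
  \<open>0 < r < R t\<close>; it extends to \<open>r = 0\<close> and \<open>r = R t\<close> by continuity of the derivatives.  (At these
  points \<open>r\<^sup>-\<^sup>2\<close>, respectively a derivative in \<open>t\<close> at fixed \<open>r\<close>, has no direct meaning.)\<close>

definition RS_global_solution ::
    "bubble_params \<Rightarrow> real \<Rightarrow> (real \<Rightarrow> real) \<Rightarrow> (real \<Rightarrow> real) \<Rightarrow> real \<Rightarrow> real \<Rightarrow>
     (real \<Rightarrow> real \<Rightarrow> real) \<Rightarrow> (real \<Rightarrow> real) \<Rightarrow> bool" where
  "RS_global_solution P \<alpha> pinf \<rho>0 R0 V0 \<rho> R \<longleftrightarrow>
     (\<forall>t\<ge>0. R t > 0 \<and> (\<forall>r\<in>{0..R t}. \<rho> r t > 0)) \<and>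
     parabolic_C2_holder \<alpha> (ball 0 1) (\<lambda>(y::real^3) t. \<rho> (R t * norm y) t) \<and>
     C3_holder_time \<alpha> R \<and>
     (\<forall>t>0.
        (let q = time_deriv (wall_pressure P \<rho> R) t / wall_pressure P \<rho> R t in
          (\<forall>r. 0 < r \<and> r < R t \<longrightarrow>
             time_deriv (\<lambda>s. \<rho> r s) t = density_rhs P (R t) (\<lambda>s. \<rho> s t) q r) \<and>
          time_deriv R t = wall_velocity P (R t) (\<lambda>s. \<rho> s t) q) \<and>
        \<rho> (R t) t = wall_density P (pinf t) (R t) (time_deriv R t) ((time_deriv ^^ 2) R t)) \<and>
     (\<forall>r\<in>{0..R0}. \<rho> r 0 = \<rho>0 r) \<and> R 0 = R0 \<and> time_deriv R 0 = V0"

section \<open>Equilibria and the distance between states\<close>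

definition R_eq :: "bubble_params \<Rightarrow> real \<Rightarrow> real" where
  "R_eq P M = (THE R. R > 0 \<and>
     p_inf_star P * R ^ 3 + 2 * sigma P * R\<^sup>2 - 3 * Rg P * T_inf P * M / (4 * pi) = 0)"

definition rho_eq :: "bubble_params \<Rightarrow> real \<Rightarrow> real" where
  "rho_eq P M = 1 / (Rg P * T_inf P) * (p_inf_star P + 2 * sigma P / R_eq P M)"

definition bubble_mass :: "(real \<Rightarrow> real) \<Rightarrow> real \<Rightarrow> real" where
  "bubble_mass f b = integral (ball 0 b) (\<lambda>x::real^3. f (norm x))"

text \<open>The arguments are the two states (density profile, radius, radial velocity) whose
  difference is measured.\<close>

definition state_dist ::
    "real \<Rightarrow> (real \<Rightarrow> real) \<times> real \<times> real \<Rightarrow> (real \<Rightarrow> real) \<times> real \<times> real \<Rightarrow> real" where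
  "state_dist \<alpha> = (\<lambda>(f1, b1, V1) (f2, b2, V2).
     C2_holder_norm (2 * \<alpha>) (ball 0 1) (\<lambda>y::real^3. f1 (b1 * norm y) - f2 (b2 * norm y)) +
     \<bar>b1 - b2\<bar> + \<bar>V1 - V2\<bar>)"

end

theory Submission
  imports Defs
begin

text \<open>The total energy (kinetic energy of the liquid, surface energy, work of the ambient pressure and free
  energy of the gas) does not increase. At fixed mass it controls the distance of \<open>R\<close>, \<open>R'\<close> and of the
  wall density \<open>P\<close> to equilibrium, so these stay small for all time. In the coordinate \<open>x = r P\<^bsup>1/(3\<gamma>)\<^esup>\<close>
  the function \<open>Y = ln (\<rho> / P\<^bsup>1/\<gamma>\<^esup>)\<close> solves \<open>Y\<^sub>t = a(t) e\<^bsup>-Y\<^esup> \<Delta>Y\<close> without drift, so the maximum principle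
  keeps \<open>Y\<close> near its equilibrium value. The boundary value of \<open>v = Y\<^sub>t\<close> is given by \<open>R'\<close> and the
  boundary gradient of \<open>Y\<close>; interpolating that gradient between the smallness of \<open>Y\<close> and a bound for
  \<open>\<Delta>Y\<close> closes a bootstrap which makes \<open>v\<close> small for all time. A barrier at the wall and doubling of the
  spatial variable then bound a spatial Hoelder seminorm of \<open>v\<close>, hence of \<open>\<Delta>Y\<close>, with any exponent below \<open>1\<close>,
  uniformly in time. Since the energy converges, the dissipation tends to zero and \<open>Y\<close> to a constant;
  interpolation with the Hoelder bound gives \<open>\<Delta>Y \<rightarrow> 0\<close> in the \<open>2\<alpha>\<close>-Hoelder norm. For radial functions the
  Laplacian controls the whole \<open>C\<^sup>2\<^sup>+\<^sup>2\<^sup>\<alpha>\<close> norm.\<close>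

section \<open>Maximum principle\<close>

text \<open>Two weaknesses of the solution class shape the estimates. Its constants depend on the
  time horizon, so every bound uniform in time has to be derived. And \<open>v\<close> is not known
  to be differentiable, so comparison is run on time difference quotients of \<open>Y\<close>. Their
  source term comes from the change of the coefficient and is quadratic in the sizes of
  \<open>v\<close> and \<open>q\<close>; this is what lets the bootstrap close with a size
  \<open>\<mu>\<close> fixed before the energy smallness \<open>\<epsilon>\<close>. In the new
  coordinate the end point \<open>Lam\<close> moves with a speed proportional to the wall gradient,
  so that smallness of this gradient also controls the moving domain. The wall value of
  \<open>v\<close> has Hoelder exponent 1/2 in time, because \<open>L\<close> is Lipschitz in time
  and its gradient Lipschitz in space. Under parabolic scaling this amounts to one derivative in
  space, and the barriers reach each exponent \<open>\<beta> < 1\<close>. Since \<alpha> < 1/2, some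
  \<open>\<beta>\<close> lies strictly between 2\<alpha> and 1; this gap is spent in the final
  interpolation.\<close>

lemma interior_max_derivs:
  fixes f f' :: "real \<Rightarrow> real"
  assumes x: "a < x" "x < b"
    and max: "\<And>y. a < y \<Longrightarrow> y < b \<Longrightarrow> f y \<le> f x"
    and d1: "\<And>y. a < y \<Longrightarrow> y < b \<Longrightarrow> (f has_real_derivative f' y) (at y)"
    and d2: "(f' has_real_derivative f2) (at x)"
  shows "f' x = 0" "f2 \<le> 0"
proof -
  define d where "d = min (x - a) (b - x)"
  have d: "d > 0" using x by (auto simp: d_def)
  show f0: "f' x = 0"
  proof (rule DERIV_local_max[OF d1 d])
    show "a < x" "x < b" using x by auto
    show "\<forall>y. \<bar>x - y\<bar> < d \<longrightarrow> f y \<le> f x" using max by (auto simp: d_def abs_if split: if_splits)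
  qed
  show "f2 \<le> 0"
  proof (rule ccontr)
    assume "\<not> f2 \<le> 0"
    then have "f2 > 0" by simp
    from DERIV_pos_inc_right[OF d2 this] obtain e where e: "e > 0" "\<And>h. h > 0 \<Longrightarrow> h < e \<Longrightarrow> f' x < f' (x + h)"
      by auto
    define h where "h = min e d / 2"
    have h: "h > 0" "h < e" "h < d" using e d by (auto simp: h_def)
    have "\<exists>z>x. z < x + h \<and> f (x + h) - f x = (x + h - x) * f' z"
      by (rule MVT2) (use h d x in \<open>auto simp: d_def intro!: d1\<close>)
    then obtain z where z: "z > x" "z < x + h" "f (x + h) - f x = h * f' z" by auto
    have "f' z > 0" using e(2)[of "z - x"] z h f0 by auto
    then have "f (x + h) > f x" using z h by (smt (verit) mult_pos_pos)
    moreover have "f (x + h) \<le> f x" using h x by (intro max) (auto simp: d_def)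
    ultimately show False by simp
  qed
qed

text \<open>Only earlier times are compared, because a maximum over a space-time region may sit at
  its final time.\<close>

lemma left_max_deriv_nonneg:
  fixes f :: "real \<Rightarrow> real"
  assumes "t0 < t" and max: "\<And>s. t0 < s \<Longrightarrow> s < t \<Longrightarrow> f s \<le> f t"
    and d: "(f has_real_derivative D) (at t)"
  shows "D \<ge> 0"
proof (rule ccontr)
  assume "\<not> D \<ge> 0"
  then have "D < 0" by simp
  from DERIV_neg_dec_left[OF d this] obtain e where e: "e > 0" "\<And>h. h > 0 \<Longrightarrow> h < e \<Longrightarrow> f t < f (t - h)"
    by auto
  define h where "h = min e (t - t0) / 2"
  have h: "h > 0" "h < e" "h < t - t0" using e assms(1) by (auto simp: h_def min_def field_simps)
  show False using e(2)[of h] max[of "t - h"] h by auto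
qed

lemma derivative_along_curve:
  fixes F Fs :: "real \<Rightarrow> real \<Rightarrow> real" and a :: "real \<Rightarrow> real"
  assumes at: "l < a t" "a t < u" and t: "t \<in> T"
    and ds: "\<And>s \<tau>. l < s \<Longrightarrow> s < u \<Longrightarrow> \<tau> \<in> T \<Longrightarrow> ((\<lambda>s. F s \<tau>) has_real_derivative Fs s \<tau>) (at s)"
    and cont: "continuous_on ({l<..<u} \<times> T) (\<lambda>(s, t). Fs s t)"
    and dt: "(F (a t) has_real_derivative Ft) (at t within T)"
    and da: "(a has_real_derivative a') (at t within T)"
  shows "((\<lambda>\<tau>. F (a \<tau>) \<tau>) has_real_derivative (Ft + Fs (a t) t * a')) (at t within T)"
proof -
  \<comment> \<open>Mean value point as a function of \<open>\<tau>\<close>; where \<open>a\<close>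
    has no increment the identity is trivial and the limit point itself is taken.\<close>
  define \<xi> where "\<xi> \<tau> = (if a \<tau> = a t then a t else SOME z. \<bar>z - a t\<bar> \<le> \<bar>a \<tau> - a t\<bar> \<and>
      F (a \<tau>) \<tau> - F (a t) \<tau> = (a \<tau> - a t) * Fs z \<tau>)" for \<tau>
  have xi: "\<bar>\<xi> \<tau> - a t\<bar> \<le> \<bar>a \<tau> - a t\<bar> \<and> F (a \<tau>) \<tau> - F (a t) \<tau> = (a \<tau> - a t) * Fs (\<xi> \<tau>) \<tau>"
    if "l < a \<tau>" "a \<tau> < u" "\<tau> \<in> T" for \<tau>
  proof (cases "a \<tau> = a t")
    case True then show ?thesis by (simp add: \<xi>_def)
  next
    case False
    have "\<exists>z. \<bar>z - a t\<bar> \<le> \<bar>a \<tau> - a t\<bar> \<and> F (a \<tau>) \<tau> - F (a t) \<tau> = (a \<tau> - a t) * Fs z \<tau>"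
    proof (cases "a \<tau> < a t")
      case True
      have "\<exists>z>a \<tau>. z < a t \<and> F (a t) \<tau> - F (a \<tau>) \<tau> = (a t - a \<tau>) * Fs z \<tau>"
        by (rule MVT2[OF True]) (use that at in \<open>auto intro!: ds\<close>)
      then obtain z where "z > a \<tau>" "z < a t" "F (a t) \<tau> - F (a \<tau>) \<tau> = (a t - a \<tau>) * Fs z \<tau>" by auto
      then show ?thesis by (intro exI[of _ z]) (auto simp: algebra_simps)
    next
      case F: False
      then have "a t < a \<tau>" using False by auto
      have "\<exists>z>a t. z < a \<tau> \<and> F (a \<tau>) \<tau> - F (a t) \<tau> = (a \<tau> - a t) * Fs z \<tau>"
        by (rule MVT2[OF \<open>a t < a \<tau>\<close>]) (use that at in \<open>auto intro!: ds\<close>)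
      then obtain z where "z > a t" "z < a \<tau>" "F (a \<tau>) \<tau> - F (a t) \<tau> = (a \<tau> - a t) * Fs z \<tau>" by auto
      then show ?thesis by (intro exI[of _ z]) (auto simp: algebra_simps)
    qed
    from someI_ex[OF this] False show ?thesis by (simp add: \<xi>_def)
  qed
  have a_lim: "(a \<longlongrightarrow> a t) (at t within T)"
    using DERIV_continuous[OF da] by (simp add: continuous_within)
  have ev: "eventually (\<lambda>\<tau>. l < a \<tau> \<and> a \<tau> < u \<and> \<tau> \<in> T \<and> \<tau> \<noteq> t) (at t within T)"
  proof (intro eventually_conj)
    show "\<forall>\<^sub>F \<tau> in at t within T. l < a \<tau>" using a_lim at(1) by (rule order_tendstoD(1))
    show "\<forall>\<^sub>F \<tau> in at t within T. a \<tau> < u" using a_lim at(2) by (rule order_tendstoD(2))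
  qed (auto simp: eventually_at intro: exI[of _ 1])
  have xi_lim: "(\<xi> \<longlongrightarrow> a t) (at t within T)"
  proof (rule Lim_transform[OF a_lim], rule Lim_null_comparison)
    show "\<forall>\<^sub>F \<tau> in at t within T. norm (\<xi> \<tau> - a \<tau>) \<le> 2 * \<bar>a \<tau> - a t\<bar>"
      using ev
    proof eventually_elim
      case (elim \<tau>)
      then have "\<bar>\<xi> \<tau> - a t\<bar> \<le> \<bar>a \<tau> - a t\<bar>" using xi by blast
      then show ?case unfolding real_norm_def by (auto simp: abs_if split: if_splits)
    qed
    show "((\<lambda>\<tau>. 2 * \<bar>a \<tau> - a t\<bar>) \<longlongrightarrow> 0) (at t within T)"
      by (rule tendsto_eq_intros a_lim | simp)+
  qed
  have Fs_lim: "((\<lambda>\<tau>. Fs (\<xi> \<tau>) \<tau>) \<longlongrightarrow> Fs (a t) t) (at t within T)"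
  proof -
    have "((\<lambda>(s, t). Fs s t) \<longlongrightarrow> Fs (a t) t) (at (a t, t) within ({l<..<u} \<times> T))"
      using cont at t by (fastforce simp: continuous_on_def)
    moreover have "filterlim (\<lambda>\<tau>. (\<xi> \<tau>, \<tau>)) (at (a t, t) within ({l<..<u} \<times> T)) (at t within T)"
      unfolding filterlim_at
    proof
      show "((\<lambda>\<tau>. (\<xi> \<tau>, \<tau>)) \<longlongrightarrow> (a t, t)) (at t within T)"
        by (intro tendsto_Pair xi_lim) simp
      have "\<forall>\<^sub>F \<tau> in at t within T. l < \<xi> \<tau>" "\<forall>\<^sub>F \<tau> in at t within T. \<xi> \<tau> < u"
        using order_tendstoD[OF xi_lim] at by auto
      then show "\<forall>\<^sub>F x in at t within T. (\<xi> x, x) \<in> {l<..<u} \<times> T \<and> (\<xi> x, x) \<noteq> (a t, t)"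
        using ev by eventually_elim auto
    qed
    ultimately have "((\<lambda>\<tau>. (\<lambda>(s, t). Fs s t) (\<xi> \<tau>, \<tau>)) \<longlongrightarrow> Fs (a t) t) (at t within T)"
      by (rule filterlim_compose)
    then show ?thesis by simp
  qed
  have "((\<lambda>\<tau>. (F (a t) \<tau> - F (a t) t) / (\<tau> - t) + (a \<tau> - a t) / (\<tau> - t) * Fs (\<xi> \<tau>) \<tau>)
      \<longlongrightarrow> Ft + a' * Fs (a t) t) (at t within T)"
    using dt da Fs_lim unfolding has_field_derivative_iff by (intro tendsto_intros)
  then have "((\<lambda>\<tau>. (F (a \<tau>) \<tau> - F (a t) t) / (\<tau> - t)) \<longlongrightarrow> Ft + a' * Fs (a t) t) (at t within T)"
  proof (rule Lim_transform_eventually)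
    show "\<forall>\<^sub>F \<tau> in at t within T. (F (a t) \<tau> - F (a t) t) / (\<tau> - t) + (a \<tau> - a t) / (\<tau> - t) * Fs (\<xi> \<tau>) \<tau>
        = (F (a \<tau>) \<tau> - F (a t) t) / (\<tau> - t)"
      using ev
    proof eventually_elim
      case (elim \<tau>)
      then have "F (a \<tau>) \<tau> - F (a t) \<tau> = (a \<tau> - a t) * Fs (\<xi> \<tau>) \<tau>" using xi by blast
      then show ?case by (simp add: field_simps flip: add_divide_distrib)
    qed
  qed
  then show ?thesis unfolding has_field_derivative_iff by (simp add: mult.commute)
qed

text \<open>A sign change of the derivative suffices, so that one fact serves both the radius
  potential \<open>W\<close> and \<open>x - ln x\<close>. The second conclusion localises sublevel
  sets: by monotonicity \<open>f\<close> outside a neighbourhood of \<open>x0\<close> lies above its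
  values at the two end points.\<close>

lemma well_of_sign_change:
  fixes f f' :: "real \<Rightarrow> real"
  assumes x0: "x0 > 0" and d: "\<And>x. x > 0 \<Longrightarrow> (f has_real_derivative f' x) (at x)"
    and neg: "\<And>x. 0 < x \<Longrightarrow> x < x0 \<Longrightarrow> f' x < 0" and pos: "\<And>x. x > x0 \<Longrightarrow> f' x > 0"
  shows "x > 0 \<Longrightarrow> f x0 \<le> f x"
    and "\<epsilon> > 0 \<Longrightarrow> \<exists>\<delta>>0. \<forall>x>0. f x \<le> f x0 + \<delta> \<longrightarrow> \<bar>x - x0\<bar> < \<epsilon>"
proof -
  have inc: "f a < f b" if "x0 \<le> a" "a < b" for a b
  proof -
    have "\<exists>z>a. z < b \<and> f b - f a = (b - a) * f' z"
      by (rule MVT2) (use that x0 in \<open>auto intro!: d\<close>)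
    then obtain z where z: "z > a" "z < b" "f b - f a = (b - a) * f' z" by auto
    then have "(b - a) * f' z > 0" using pos[of z] that by (intro mult_pos_pos) auto
    with z show ?thesis by simp
  qed
  have dec: "f b < f a" if "0 < a" "a < b" "b \<le> x0" for a b
  proof -
    have "\<exists>z>a. z < b \<and> f b - f a = (b - a) * f' z"
      by (rule MVT2) (use that x0 in \<open>auto intro!: d\<close>)
    then obtain z where z: "z > a" "z < b" "f b - f a = (b - a) * f' z" by auto
    then have "(b - a) * f' z < 0" using neg[of z] that by (intro mult_pos_neg) auto
    with z show ?thesis by simp
  qed
  show "f x0 \<le> f x" if "x > 0" using inc[of x0 x] dec[of x x0] that by (cases x x0 rule: linorder_cases) auto
  assume e: "\<epsilon> > 0"
  define e where "e = min \<epsilon> (x0 / 2)"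
  have e': "e > 0" "e \<le> \<epsilon>" "e < x0" using e x0 by (auto simp: e_def)
  define \<delta> where "\<delta> = min (f (x0 + e) - f x0) (f (x0 - e) - f x0) / 2"
  have dd: "f (x0 + e) - f x0 > 0" "f (x0 - e) - f x0 > 0" using inc[of x0 "x0 + e"] dec[of "x0 - e" x0] e' by auto
  then have dpos: "\<delta> > 0" by (auto simp: \<delta>_def)
  have d': "\<delta> < f (x0 + e) - f x0" "\<delta> < f (x0 - e) - f x0" using dd by (auto simp: \<delta>_def min_def field_simps)
  show "\<exists>\<delta>>0. \<forall>x>0. f x \<le> f x0 + \<delta> \<longrightarrow> \<bar>x - x0\<bar> < \<epsilon>"
  proof (intro exI[of _ \<delta>] conjI allI impI dpos)
    fix x :: real assume x: "x > 0" "f x \<le> f x0 + \<delta>"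
    have "x < x0 + e" using inc[of "x0 + e" x] x d' e' by (cases "x = x0 + e") (force)+
    moreover have "x > x0 - e" using dec[of x "x0 - e"] x d' e' by (cases "x = x0 - e") (force)+
    ultimately show "\<bar>x - x0\<bar> < \<epsilon>" using e' by auto
  qed
qed

section \<open>Calculus on the half-line of times and the unit interval of radii\<close>

lemma at_within_half_line: "t > 0 \<Longrightarrow> at t within {0..} = at (t::real)"
  by (rule at_within_interior) simp

lemma mvt_half_line:
  fixes f f' :: "real \<Rightarrow> real"
  assumes "0 \<le> a" "a < b" and d: "\<And>t. t \<ge> 0 \<Longrightarrow> (f has_real_derivative f' t) (at t within {0..})"
  shows "\<exists>z. a < z \<and> z < b \<and> f b - f a = (b - a) * f' z"
proof -
  have "continuous_on {0..} f"
    by (rule DERIV_continuous_on) (use d in auto)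
  then have c: "continuous_on {a..b} f" by (rule continuous_on_subset) (use assms in auto)
  have d': "(f has_derivative (\<lambda>h. f' x * h)) (at x)" if "a < x" "x < b" for x
  proof -
    have "(f has_real_derivative f' x) (at x within {0..})" using that assms by (intro d) auto
    then have "(f has_real_derivative f' x) (at x)"
      using that \<open>0 \<le> a\<close> at_within_half_line[of x] by simp
    then show ?thesis by (simp add: has_field_derivative_def)
  qed
  from mvt[OF \<open>a < b\<close> c d'] obtain \<xi> where "a < \<xi>" "\<xi> < b" "f b - f a = f' \<xi> * (b - a)" by metis
  then show ?thesis by (intro exI[of _ \<xi>]) (simp add: mult.commute)
qed

lemma has_real_derivative_integral_01:
  fixes f ft :: "real \<Rightarrow> real \<Rightarrow> real"
  assumes d: "\<And>t s. t \<ge> 0 \<Longrightarrow> 0 \<le> s \<Longrightarrow> s \<le> 1 \<Longrightarrow> ((\<lambda>t. f t s) has_real_derivative ft t s) (at t within {0..})"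
    and c: "\<And>t. t \<ge> 0 \<Longrightarrow> continuous_on {0..1} (f t)"
    and ct: "continuous_on ({0..} \<times> {0..1}) (\<lambda>(t, s). ft t s)"
    and t: "t \<ge> 0"
  shows "((\<lambda>t. integral {0..1} (f t)) has_real_derivative integral {0..1} (ft t)) (at t within {0..})"
  using leibniz_rule_field_derivative[where U="{0..}" and a=0 and b="1::real" and f=f and fx=ft and ?x0.0=t]
  by (simp add: d c ct t integrable_continuous_real)

lemma integral_derivative_01:
  fixes f f' :: "real \<Rightarrow> real"
  assumes "continuous_on {0..1} f" "\<And>s. 0 < s \<Longrightarrow> s < 1 \<Longrightarrow> (f has_real_derivative f' s) (at s)"
  shows "(f' has_integral f 1 - f 0) {0..1}"
  using fundamental_theorem_of_calculus_interior[of 0 1 f f'] assms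
  by (auto simp: has_real_derivative_iff_has_vector_derivative)

section \<open>Energy law\<close>

text \<open>Here \<open>kap = \<kappa> / (\<gamma> c\<^sub>v)\<close>, \<open>c0 = \<R>\<^sub>g T\<^sub>\<infinity>\<close>, and \<open>m\<close> is the bubble mass divided by \<open>4 \<pi>\<close>.\<close>

locale bubble_par =
  fixes kap gm c0 sg pin rl mu m Rs :: real
  assumes par: "kap > 0" "gm > 1" "c0 > 0" "sg > 0" "pin > 0" "rl > 0" "mu \<ge> 0" "m > 0"
    and Rs: "Rs > 0" "pin * Rs ^ 3 + 2 * sg * Rs\<^sup>2 = 3 * c0 * m"
begin

text \<open>For the physical parameters this is \<open>cv * T_inf\<close>, since
  \<open>gm - 1 = Rg / cv\<close>; it is the weight of the thermal terms in the energy.\<close>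

definition "cT = c0 / (gm - 1)"

text \<open>Density at rest: the wall pressure law with vanishing velocity and acceleration. The
  cubic for \<open>Rs\<close> turns it into the mass identity
  \<open>rs * Rs ^ 3 = 3 * m\<close>.\<close>

definition "rs = (pin + 2 * sg / Rs) / c0"

lemma cT: "cT > 0" "cT * (gm - 1) = c0" using par by (auto simp: cT_def)

lemma rs: "rs > 0" "rs * Rs ^ 3 = 3 * m"
  using par Rs by (auto simp: rs_def field_simps power3_eq_cube power2_eq_square intro!: add_pos_pos)

text \<open>Up to a constant, the energy divided by \<open>4 * pi\<close> of a bubble of uniform
  density at ambient temperature, as a function of the radius; the logarithm is the isothermal
  compression work at mass \<open>m\<close>. The derivative is the equilibrium cubic divided by
  \<open>R\<close>.\<close>

definition "W R = sg * R\<^sup>2 + pin * R ^ 3 / 3 - 3 * c0 * m * ln R"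

end

text \<open>The density is \<open>\<rho> = exp L\<close> in the coordinate \<open>s = r / R(t)\<close>; \<open>Ls\<close> and \<open>Lt\<close> are the derivatives of \<open>L\<close> in
  \<open>s\<close> and \<open>t\<close>, and \<open>LL = L\<^sub>s\<^sub>s + 2 L\<^sub>s / s\<close> is its Laplacian, continuous up to \<open>s = 0\<close>.\<close>

locale bubble_flow = bubble_par +
  fixes L Ls LL Lt :: "real \<Rightarrow> real \<Rightarrow> real" and R R1 R2 R3 :: "real \<Rightarrow> real"
  assumes contL: "continuous_on ({0..1} \<times> {0..}) (\<lambda>(s, t). L s t)"
    and contLs: "continuous_on ({0..1} \<times> {0..}) (\<lambda>(s, t). Ls s t)"
    and contLL: "continuous_on ({0..1} \<times> {0..}) (\<lambda>(s, t). LL s t)"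
    and contLt: "continuous_on ({0..1} \<times> {0..}) (\<lambda>(s, t). Lt s t)"
    and dL: "\<And>s t. 0 < s \<Longrightarrow> s < 1 \<Longrightarrow> t \<ge> 0 \<Longrightarrow> ((\<lambda>s. L s t) has_real_derivative Ls s t) (at s)"
    and dLs: "\<And>s t. 0 < s \<Longrightarrow> s < 1 \<Longrightarrow> t \<ge> 0 \<Longrightarrow>
      ((\<lambda>s. Ls s t) has_real_derivative (LL s t - 2 * Ls s t / s)) (at s)"
    and Ls0: "\<And>t. t \<ge> 0 \<Longrightarrow> Ls 0 t = 0"
    and dLt: "\<And>s t. 0 \<le> s \<Longrightarrow> s \<le> 1 \<Longrightarrow> t \<ge> 0 \<Longrightarrow> (L s has_real_derivative Lt s t) (at t within {0..})"
    and pde: "\<And>s t. 0 \<le> s \<Longrightarrow> s \<le> 1 \<Longrightarrow> t \<ge> 0 \<Longrightarrow> Lt s t = kap / (R t)\<^sup>2 *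
      (exp (- L s t) * LL s t - Ls 1 t / exp (L 1 t) * s * Ls s t) + Lt 1 t / gm"
    and Rpos: "\<And>t. t \<ge> 0 \<Longrightarrow> R t > 0"
    and dR: "\<And>t. t \<ge> 0 \<Longrightarrow> (R has_real_derivative R1 t) (at t within {0..})"
    and dR1: "\<And>t. t \<ge> 0 \<Longrightarrow> (R1 has_real_derivative R2 t) (at t within {0..})"
    and dR2: "\<And>t. t \<ge> 0 \<Longrightarrow> (R2 has_real_derivative R3 t) (at t within {0..})"
    and wallv: "\<And>t. t \<ge> 0 \<Longrightarrow> R1 t = - kap * (Ls 1 t / exp (L 1 t)) / R t - R t * Lt 1 t / (3 * gm)"
    and wallp: "\<And>t. t \<ge> 0 \<Longrightarrow> c0 * exp (L 1 t) = pin + 2 * sg / R t + 4 * mu * R1 t / R t +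
      rl * (R t * R2 t + 3 / 2 * (R1 t)\<^sup>2)"
    and mass0: "R 0 ^ 3 * integral {0..1} (\<lambda>s. s\<^sup>2 * exp (L s 0)) = m"
begin

text \<open>In terms of the density, \<open>gf\<close> is \<open>\<rho>_s / \<rho>^2\<close> at the
  wall, and \<open>q\<close> below is the logarithmic derivative of the wall pressure.\<close>

definition "gf t = Ls 1 t / exp (L 1 t)"
definition "q t = Lt 1 t"

lemma cont_comp:
  assumes "continuous_on A f" "continuous_on A g" "\<And>z. z \<in> A \<Longrightarrow> 0 \<le> f z \<and> f z \<le> 1" "\<And>z. z \<in> A \<Longrightarrow> 0 \<le> g z"
  shows "continuous_on A (\<lambda>z. L (f z) (g z))" "continuous_on A (\<lambda>z. Ls (f z) (g z))"
    "continuous_on A (\<lambda>z. LL (f z) (g z))" "continuous_on A (\<lambda>z. Lt (f z) (g z))"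
proof -
  have c: "continuous_on A (\<lambda>z. (f z, g z))" and i: "(\<lambda>z. (f z, g z)) ` A \<subseteq> {0..1} \<times> {0..}"
    using assms by (auto intro!: continuous_intros)
  show "continuous_on A (\<lambda>z. L (f z) (g z))" using continuous_on_compose2[OF contL c i] by simp
  show "continuous_on A (\<lambda>z. Ls (f z) (g z))" using continuous_on_compose2[OF contLs c i] by simp
  show "continuous_on A (\<lambda>z. LL (f z) (g z))" using continuous_on_compose2[OF contLL c i] by simp
  show "continuous_on A (\<lambda>z. Lt (f z) (g z))" using continuous_on_compose2[OF contLt c i] by simp
qed

lemma contR: "continuous_on {0..} R" "continuous_on {0..} R1" "continuous_on {0..} R2"
  by (rule DERIV_continuous_on; use dR dR1 dR2 in auto)+

lemma contR_comp:
  assumes "continuous_on A g" "\<And>z. z \<in> A \<Longrightarrow> 0 \<le> g z"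
  shows "continuous_on A (\<lambda>z. R (g z))" "continuous_on A (\<lambda>z. R1 (g z))" "continuous_on A (\<lambda>z. R2 (g z))"
  using continuous_on_compose2[OF contR(1), of A g] continuous_on_compose2[OF contR(2), of A g]
    continuous_on_compose2[OF contR(3), of A g] assms by auto

lemma pde': "0 \<le> s \<Longrightarrow> s \<le> 1 \<Longrightarrow> t \<ge> 0 \<Longrightarrow>
    Lt s t = kap / (R t)\<^sup>2 * (exp (- L s t) * LL s t - gf t * s * Ls s t) + q t / gm"
  unfolding gf_def q_def by (rule pde)

lemma wallv': "t \<ge> 0 \<Longrightarrow> q t / gm = - 3 * R1 t / R t - 3 * kap * gf t / (R t)\<^sup>2"
proof -
  assume t: "t \<ge> 0"
  have R: "R t \<noteq> 0" and g: "gm \<noteq> 0" using Rpos[OF t] par by auto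
  show ?thesis unfolding wallv[OF t] gf_def q_def using R g
    by (simp add: diff_divide_distrib add_divide_distrib power2_eq_square)
qed

lemma gf: "Ls 1 t = gf t * exp (L 1 t)" by (simp add: gf_def)

text \<open>Eliminating \<open>q\<close> through the wall velocity law leaves a pure divergence:
  \<open>s^2 * LL\<close> is the derivative of \<open>s^2 * Ls\<close>, and the bracket multiplying
  \<open>gf\<close> is the derivative of \<open>s^3 * exp L\<close>.\<close>

lemma mass_density_deriv:
  assumes "t \<ge> 0" "0 \<le> s" "s \<le> 1"
  shows "((\<lambda>t. (R t) ^ 3 * (s\<^sup>2 * exp (L s t))) has_real_derivative
     kap * R t * (s\<^sup>2 * LL s t - gf t * (s ^ 3 * exp (L s t) * Ls s t + 3 * s\<^sup>2 * exp (L s t)))) (at t within {0..})"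
proof -
  have "((\<lambda>t. (R t) ^ 3 * (s\<^sup>2 * exp (L s t))) has_real_derivative
     3 * (R t)\<^sup>2 * R1 t * (s\<^sup>2 * exp (L s t)) + R t ^ 3 * (s\<^sup>2 * (exp (L s t) * Lt s t))) (at t within {0..})"
    using assms by (auto intro!: derivative_eq_intros dR dLt)
  also have "3 * (R t)\<^sup>2 * R1 t * (s\<^sup>2 * exp (L s t)) + R t ^ 3 * (s\<^sup>2 * (exp (L s t) * Lt s t)) =
     kap * R t * (s\<^sup>2 * LL s t - gf t * (s ^ 3 * exp (L s t) * Ls s t + 3 * s\<^sup>2 * exp (L s t)))"
    unfolding pde'[OF assms(2,3,1)] wallv'[OF assms(1)]
    using Rpos[OF assms(1)] by (simp add: exp_minus field_simps power2_eq_square power3_eq_cube)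
  finally show ?thesis .
qed

lemma mass: "t \<ge> 0 \<Longrightarrow> integral {0..1} (\<lambda>s. R t ^ 3 * (s\<^sup>2 * exp (L s t))) = m"
proof -
  define G where "G t s = kap * R t * (s\<^sup>2 * LL s t - gf t * (s ^ 3 * exp (L s t) * Ls s t + 3 * s\<^sup>2 * exp (L s t)))" for t s
  have d: "((\<lambda>t. integral {0..1} (\<lambda>s. R t ^ 3 * (s\<^sup>2 * exp (L s t)))) has_real_derivative integral {0..1} (G t)) (at t within {0..})"
    if "t \<ge> 0" for t
  proof (rule has_real_derivative_integral_01[OF _ _ _ that])
    show "continuous_on ({0..} \<times> {0..1}) (\<lambda>(t, s). G t s)"
      unfolding G_def gf_def split_beta
      by (intro continuous_intros cont_comp contR_comp) auto
    show "continuous_on {0..1} (\<lambda>s. R t ^ 3 * (s\<^sup>2 * exp (L s t)))" if "t \<ge> 0" for t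
      by (intro continuous_intros cont_comp contR_comp) (use that in auto)
  qed (use mass_density_deriv in \<open>auto simp: G_def\<close>)
  have G0: "integral {0..1} (G t) = 0" if "t \<ge> 0" for t
  proof (rule integral_unique)
    \<comment> \<open>Flux through the sphere of scaled radius \<open>s\<close>: it vanishes at
      \<open>0\<close>, and at \<open>1\<close> because \<open>gf t\<close> is
      \<open>Ls 1 t / exp (L 1 t)\<close>.\<close>
    let ?f = "\<lambda>s. kap * R t * (s\<^sup>2 * Ls s t - gf t * (s ^ 3 * exp (L s t)))"
    have "(G t has_integral ?f 1 - ?f 0) {0..1}"
    proof (rule integral_derivative_01)
      show "continuous_on {0..1} ?f"
        by (intro continuous_intros cont_comp contR_comp) (use that in auto)
      show "(?f has_real_derivative G t s) (at s)" if s: "0 < s" "s < 1" for s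
        unfolding G_def using s \<open>t \<ge> 0\<close>
        by (auto intro!: derivative_eq_intros dL dLs simp: field_simps power2_eq_square power3_eq_cube)
    qed
    then show "(G t has_integral 0) {0..1}" using gf[of t] by simp
  qed
  have "\<exists>c. \<forall>t\<in>{0..}. integral {0..1} (\<lambda>s. R t ^ 3 * (s\<^sup>2 * exp (L s t))) = c"
    by (rule has_field_derivative_zero_constant) (use d G0 in auto)
  then obtain c where c: "\<And>t. t \<ge> 0 \<Longrightarrow> integral {0..1} (\<lambda>s. R t ^ 3 * (s\<^sup>2 * exp (L s t))) = c" by auto
  have "c = m" using c[of 0] mass0 by simp
  then show "t \<ge> 0 \<Longrightarrow> ?thesis" using c by simp
qed

text \<open>Up to a constant this is the specific entropy of the gas divided by
  \<open>- cv * gm\<close>.\<close>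

definition "Z s t = L s t - L 1 t / gm"
text \<open>Total energy divided by \<open>4 * pi\<close>. In the gas part the term with
  \<open>exp (L 1 t)\<close> is the internal energy at uniform pressure, and the integral of
  \<open>Z\<close> stands for minus the ambient temperature times the entropy.\<close>

definition "E t = rl * (R t) ^ 3 * (R1 t)\<^sup>2 / 2 + sg * (R t)\<^sup>2 + pin * (R t) ^ 3 / 3 +
  cT * (exp (L 1 t) * (R t) ^ 3 / 3 + gm * integral {0..1} (\<lambda>s. R t ^ 3 * (s\<^sup>2 * exp (L s t)) * Z s t))"
definition "D t = integral {0..1} (\<lambda>s. s\<^sup>2 * (Ls s t)\<^sup>2)"

lemma dZt: "0 \<le> s \<Longrightarrow> s \<le> 1 \<Longrightarrow> t \<ge> 0 \<Longrightarrow>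
   (Z s has_real_derivative kap / (R t)\<^sup>2 * (exp (- L s t) * LL s t - gf t * s * Ls s t)) (at t within {0..})"
proof -
  assume a: "0 \<le> s" "s \<le> 1" "t \<ge> 0"
  have "(Z s has_real_derivative Lt s t - Lt 1 t / gm) (at t within {0..})"
    unfolding Z_def using a by (intro DERIV_diff DERIV_cdivide dLt) auto
  then show ?thesis using pde'[OF a] unfolding q_def by simp
qed

text \<open>Integration by parts in \<open>s\<close>, based on the divergence form of the mass
  equation. Since \<open>Z\<close> and \<open>L\<close> have the same gradient, the interior term is
  \<open>- D\<close>; the mass flux vanishes at the wall, so only the heat flux
  \<open>Ls 1 t\<close> remains there.\<close>

lemma entropy_deriv:
  assumes "t \<ge> 0"
  shows "((\<lambda>t. integral {0..1} (\<lambda>s. R t ^ 3 * (s\<^sup>2 * exp (L s t)) * Z s t)) has_real_derivative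
    kap * R t * (Ls 1 t - D t)) (at t within {0..})"
proof -
  define G where "G t s = kap * R t * (s\<^sup>2 * LL s t - gf t * (s ^ 3 * exp (L s t) * Ls s t + 3 * s\<^sup>2 * exp (L s t))) * Z s t
    + kap * R t * (s\<^sup>2 * LL s t - gf t * s ^ 3 * exp (L s t) * Ls s t)" for t s
  have eq: "(R t ^ 3 * (s\<^sup>2 * exp (L s t))) * (kap / (R t)\<^sup>2 * (exp (- L s t) * LL s t - gf t * s * Ls s t))
    = kap * R t * (s\<^sup>2 * LL s t - gf t * s ^ 3 * exp (L s t) * Ls s t)" if "t \<ge> 0" for s t
    using Rpos[OF that] by (simp add: exp_minus field_simps power2_eq_square power3_eq_cube)
  have d: "((\<lambda>t. integral {0..1} (\<lambda>s. R t ^ 3 * (s\<^sup>2 * exp (L s t)) * Z s t)) has_real_derivative integral {0..1} (G t)) (at t within {0..})"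
  proof (rule has_real_derivative_integral_01[OF _ _ _ assms])
    show "continuous_on ({0..} \<times> {0..1}) (\<lambda>(t, s). G t s)"
      unfolding G_def gf_def Z_def split_beta using par
      by (intro continuous_intros cont_comp contR_comp) auto
    show "continuous_on {0..1} (\<lambda>s. R t ^ 3 * (s\<^sup>2 * exp (L s t)) * Z s t)" if "t \<ge> 0" for t
      unfolding Z_def by (intro continuous_intros cont_comp contR_comp) (use that par in auto)
    show "((\<lambda>t. R t ^ 3 * (s\<^sup>2 * exp (L s t)) * Z s t) has_real_derivative G t s) (at t within {0..})"
      if "t \<ge> 0" "0 \<le> s" "s \<le> 1" for t s
      using DERIV_mult[OF mass_density_deriv[OF that] dZt[OF that(2,3,1)]]
      unfolding G_def using eq[of t s] that by (simp add: mult.commute add.commute)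
  qed
  have "integral {0..1} (G t) = kap * R t * (Ls 1 t - D t)"
  proof (rule integral_unique)
    let ?f = "\<lambda>s. kap * R t * ((s\<^sup>2 * Ls s t - gf t * (s ^ 3 * exp (L s t))) * Z s t + s\<^sup>2 * Ls s t)"
    \<comment> \<open>Adding the dissipation density makes the integrand an exact
      \<open>s\<close>-derivative, with primitive \<open>?f\<close>.\<close>
    define G1 where "G1 s = G t s + kap * R t * (s\<^sup>2 * (Ls s t)\<^sup>2)" for s
    have 1: "(G1 has_integral ?f 1 - ?f 0) {0..1}"
    proof (rule integral_derivative_01)
      show "continuous_on {0..1} ?f" unfolding Z_def
        by (intro continuous_intros cont_comp contR_comp) (use assms par in auto)
      show "(?f has_real_derivative G1 s) (at s)" if s: "0 < s" "s < 1" for s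
        unfolding G_def G1_def Z_def using s assms
        apply (auto intro!: derivative_eq_intros dL dLs)
        apply (simp add: field_simps power2_eq_square power3_eq_cube)
        done
    qed
    have 2: "((\<lambda>s. kap * R t * (s\<^sup>2 * (Ls s t)\<^sup>2)) has_integral kap * R t * D t) {0..1}"
      unfolding D_def
      by (intro has_integral_mult_right integrable_integral integrable_continuous_real continuous_intros cont_comp)
        (use assms in auto)
    have "((\<lambda>s. G1 s - kap * R t * (s\<^sup>2 * (Ls s t)\<^sup>2)) has_integral (?f 1 - ?f 0) - kap * R t * D t) {0..1}"
      by (rule has_integral_diff[OF 1 2])
    then show "(G t has_integral kap * R t * (Ls 1 t - D t)) {0..1}"
      using gf[of t] by (simp add: G1_def algebra_simps)
  qed
  with d show ?thesis by simp
qed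

text \<open>The wall pressure law multiplied by \<open>(R t)\<^sup>2 * R1 t\<close> turns the
  mechanical terms into pressure work minus viscous loss. In the gas terms the wall velocity law
  cancels the heat flux at the wall and leaves the opposite pressure work, because
  \<open>cT * (gm - 1) = c0\<close>.\<close>

lemma energy_deriv:
  assumes "t \<ge> 0"
  shows "(E has_real_derivative - 4 * mu * R t * (R1 t)\<^sup>2 - cT * gm * kap * R t * D t) (at t within {0..})"
proof -
  let ?P = "exp (L 1 t)"
  have dP: "((\<lambda>t. exp (L 1 t)) has_real_derivative ?P * q t) (at t within {0..})"
    using assms by (auto intro!: derivative_eq_intros dLt simp: q_def)
  have d: "(E has_real_derivative
     (rl * (3 * (R t)\<^sup>2 * R1 t) * (R1 t)\<^sup>2 / 2 + rl * R t ^ 3 * (R1 t * R2 t)) + 2 * sg * R t * R1 t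
     + pin * (R t)\<^sup>2 * R1 t + cT * ((?P * q t * R t ^ 3 + ?P * (3 * (R t)\<^sup>2 * R1 t)) / 3
     + gm * (kap * R t * (Ls 1 t - D t)))) (at t within {0..})"
    unfolding E_def
    by (rule derivative_eq_intros dP dR[OF assms] dR1[OF assms] entropy_deriv[OF assms] refl | simp add: field_simps)+
  have R: "R t > 0" by (rule Rpos[OF assms])
  have w: "rl * (R t * R2 t) = c0 * ?P - pin - 2 * sg / R t - 4 * mu * R1 t / R t - rl * (3 / 2 * (R1 t)\<^sup>2)"
    using wallp[OF assms] by (simp add: algebra_simps)
  have e1: "rl * (3 * (R t)\<^sup>2 * R1 t) * (R1 t)\<^sup>2 / 2 + rl * R t ^ 3 * (R1 t * R2 t) + 2 * sg * R t * R1 t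
     + pin * (R t)\<^sup>2 * R1 t = c0 * ?P * (R t)\<^sup>2 * R1 t - 4 * mu * R t * (R1 t)\<^sup>2"
  proof -
    have "rl * R t ^ 3 * (R1 t * R2 t) = (R t)\<^sup>2 * R1 t * (rl * (R t * R2 t))" by (simp add: power2_eq_square power3_eq_cube)
    also have "\<dots> = (R t)\<^sup>2 * R1 t * (c0 * ?P - pin - 2 * sg / R t - 4 * mu * R1 t / R t - rl * (3 / 2 * (R1 t)\<^sup>2))"
      by (simp only: w)
    finally have A: "rl * R t ^ 3 * (R1 t * R2 t) = \<dots>" .
    show ?thesis unfolding A using R by (simp add: field_simps power2_eq_square power3_eq_cube)
  qed
  have q: "q t = gm * (- 3 * R1 t / R t - 3 * kap * gf t / (R t)\<^sup>2)" using wallv'[OF assms] par by (simp add: field_simps)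
  have e2: "cT * ((?P * q t * R t ^ 3 + ?P * (3 * (R t)\<^sup>2 * R1 t)) / 3 + gm * (kap * R t * (Ls 1 t - D t)))
     = - (cT * (gm - 1)) * ?P * (R t)\<^sup>2 * R1 t - cT * gm * kap * R t * D t"
    unfolding q gf using R par by (simp add: field_simps power2_eq_square power3_eq_cube)
  show ?thesis
    by (rule DERIV_cong[OF d[unfolded e1 e2 cT(2)]]) (simp add: algebra_simps)
qed

end

lemma compact_moving_interval:
  fixes \<l> :: "real \<Rightarrow> real"
  assumes "continuous_on {T0..T1} \<l>" "\<And>t. T0 \<le> t \<Longrightarrow> t \<le> T1 \<Longrightarrow> \<l> t > 0"
  shows "compact {(x, t). T0 \<le> t \<and> t \<le> T1 \<and> 0 \<le> x \<and> x \<le> \<l> t}"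
proof -
  have "{(x, t). T0 \<le> t \<and> t \<le> T1 \<and> 0 \<le> x \<and> x \<le> \<l> t} = (\<lambda>(s, t). (s * \<l> t, t)) ` ({0..1} \<times> {T0..T1})" (is "?A = ?B")
  proof (intro equalityI subsetI)
    fix z assume "z \<in> ?A"
    then obtain x t where z: "z = (x, t)" "T0 \<le> t" "t \<le> T1" "0 \<le> x" "x \<le> \<l> t" by auto
    then have "z = (\<lambda>(s, t). (s * \<l> t, t)) (x / \<l> t, t)" using assms(2)[of t] by auto
    moreover have "(x / \<l> t, t) \<in> {0..1} \<times> {T0..T1}" using z assms(2)[of t] by auto
    ultimately show "z \<in> ?B" by blast
  next
    fix z assume "z \<in> ?B"
    then obtain y where y: "y \<in> {0..1} \<times> {T0..T1}" "z = (\<lambda>(s, t). (s * \<l> t, t)) y" by blast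
    obtain s t where "y = (s, t)" by (cases y)
    with y have z: "z = (s * \<l> t, t)" "0 \<le> s" "s \<le> 1" "T0 \<le> t" "t \<le> T1" by auto
    have "\<l> t > 0" by (rule assms(2)) (use z in auto)
    then have "s * \<l> t \<le> 1 * \<l> t" "0 \<le> s * \<l> t" using z by (auto intro: mult_right_mono)
    with z show "z \<in> ?A" by auto
  qed
  moreover have "continuous_on ({0..1} \<times> {T0..T1}) (\<lambda>(s, t). (s * \<l> t, t))"
  proof -
    have "continuous_on ({0..1} \<times> {T0..T1}) (\<lambda>z::real \<times> real. \<l> (snd z))"
      by (rule continuous_on_compose2[OF assms(1)]) (auto intro!: continuous_intros)
    then show ?thesis unfolding split_beta by (intro continuous_intros) auto
  qed
  ultimately show ?thesis by (simp only: compact_continuous_image compact_Times compact_Icc)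
qed

section \<open>Comparison principle and stability in the energy norm\<close>

text \<open>The barrier need not be smooth at the centre: if \<open>w - S\<close> increases in \<open>x\<close> near \<open>x = 0\<close>, its maximum is not attained there.\<close>

lemma parabolic_comparison:
  fixes w wx wxx wt S Sx Sxx St :: "real \<Rightarrow> real \<Rightarrow> real" and \<l> :: "real \<Rightarrow> real"
  assumes T: "T0 \<le> T1" and cl: "continuous_on {T0..T1} \<l>" and lpos: "\<And>t. T0 \<le> t \<Longrightarrow> t \<le> T1 \<Longrightarrow> \<l> t > 0"
    and cont: "continuous_on {(x, t). T0 \<le> t \<and> t \<le> T1 \<and> 0 \<le> x \<and> x \<le> \<l> t} (\<lambda>(x, t). w x t - S x t)"
    and dw: "\<And>x t. 0 < x \<Longrightarrow> x < \<l> t \<Longrightarrow> T0 < t \<Longrightarrow> t \<le> T1 \<Longrightarrow> ((\<lambda>x. w x t) has_real_derivative wx x t) (at x)"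
      "\<And>x t. 0 < x \<Longrightarrow> x < \<l> t \<Longrightarrow> T0 < t \<Longrightarrow> t \<le> T1 \<Longrightarrow> ((\<lambda>x. wx x t) has_real_derivative wxx x t) (at x)"
      "\<And>x t. 0 < x \<Longrightarrow> x < \<l> t \<Longrightarrow> T0 < t \<Longrightarrow> t \<le> T1 \<Longrightarrow> (w x has_real_derivative wt x t) (at t)"
    and dS: "\<And>x t. 0 < x \<Longrightarrow> x < \<l> t \<Longrightarrow> T0 < t \<Longrightarrow> t \<le> T1 \<Longrightarrow> ((\<lambda>x. S x t) has_real_derivative Sx x t) (at x)"
      "\<And>x t. 0 < x \<Longrightarrow> x < \<l> t \<Longrightarrow> T0 < t \<Longrightarrow> t \<le> T1 \<Longrightarrow> ((\<lambda>x. Sx x t) has_real_derivative Sxx x t) (at x)"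
      "\<And>x t. 0 < x \<Longrightarrow> x < \<l> t \<Longrightarrow> T0 < t \<Longrightarrow> t \<le> T1 \<Longrightarrow> (S x has_real_derivative St x t) (at t)"
    and strict: "\<And>x t. 0 < x \<Longrightarrow> x < \<l> t \<Longrightarrow> T0 < t \<Longrightarrow> t \<le> T1 \<Longrightarrow> wx x t = Sx x t \<Longrightarrow> wxx x t \<le> Sxx x t \<Longrightarrow>
      w x t - S x t > c \<Longrightarrow> wt x t < St x t"
    and centre: "\<And>t. T0 < t \<Longrightarrow> t \<le> T1 \<Longrightarrow> \<exists>\<epsilon>>0. \<forall>x. 0 < x \<and> x < \<epsilon> \<longrightarrow> wx x t > Sx x t"
    and bdry: "\<And>t. T0 \<le> t \<Longrightarrow> t \<le> T1 \<Longrightarrow> w (\<l> t) t - S (\<l> t) t \<le> c"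
    and init: "\<And>x. 0 \<le> x \<Longrightarrow> x \<le> \<l> T0 \<Longrightarrow> w x T0 - S x T0 \<le> c"
    and xt: "T0 \<le> t" "t \<le> T1" "0 \<le> x" "x \<le> \<l> t"
  shows "w x t - S x t \<le> c"
proof (rule ccontr)
  assume neg: "\<not> w x t - S x t \<le> c"
  define Q where "Q = {(x, t). T0 \<le> t \<and> t \<le> T1 \<and> 0 \<le> x \<and> x \<le> \<l> t}"
  have Q: "compact Q" unfolding Q_def by (rule compact_moving_interval[OF cl lpos])
  have xtQ: "(x, t) \<in> Q" using xt by (simp add: Q_def)
  have "\<exists>z\<in>Q. \<forall>y\<in>Q. (\<lambda>(x, t). w x t - S x t) y \<le> (\<lambda>(x, t). w x t - S x t) z"
    by (rule continuous_attains_sup[OF Q _ cont[folded Q_def]]) (use xtQ in auto)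
  then obtain x1 t1 where z: "(x1, t1) \<in> Q" and max: "\<And>x t. (x, t) \<in> Q \<Longrightarrow> w x t - S x t \<le> w x1 t1 - S x1 t1"
    by fast
  have big: "w x1 t1 - S x1 t1 > c" using max[OF xtQ] neg by simp
  have z': "T0 \<le> t1" "t1 \<le> T1" "0 \<le> x1" "x1 \<le> \<l> t1" using z by (auto simp: Q_def)
  have t1: "T0 < t1" using z' big init[of x1] by (cases "t1 = T0") auto
  have x1l: "x1 < \<l> t1" using z' big bdry[of t1] by (cases "x1 = \<l> t1") auto
  have lp: "\<l> t1 > 0" using lpos z' by auto
  have x1: "0 < x1"
  proof (rule ccontr)
    assume "\<not> 0 < x1"
    then have x10: "x1 = 0" using z' by simp
    obtain \<epsilon> where e: "\<epsilon> > 0" "\<And>x. 0 < x \<Longrightarrow> x < \<epsilon> \<Longrightarrow> wx x t1 > Sx x t1"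
      using centre[of t1] t1 z' by auto
    define h where "h = min \<epsilon> (\<l> t1) / 2"
    have h: "h > 0" "h < \<epsilon>" "h < \<l> t1" using e lp by (auto simp: h_def min_def)
    have "continuous_on {0..h} ((\<lambda>(x, t). w x t - S x t) \<circ> (\<lambda>x. (x, t1)))"
      by (rule continuous_on_compose) (auto intro!: continuous_intros continuous_on_subset[OF cont] simp: z' h(3) order.trans[OF _ less_imp_le[OF h(3)]])
    then have c: "continuous_on {0..h} (\<lambda>x. w x t1 - S x t1)" by (simp add: o_def)
    have "\<exists>l z. 0 < z \<and> z < h \<and> ((\<lambda>x. w x t1 - S x t1) has_real_derivative l) (at z) \<and>
       (w h t1 - S h t1) - (w 0 t1 - S 0 t1) = (h - 0) * l"
    proof (rule MVT[OF h(1) c])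
      fix x assume "0 < x" "x < h"
      then have "((\<lambda>x. w x t1 - S x t1) has_real_derivative wx x t1 - Sx x t1) (at x)"
        using h t1 z' by (intro DERIV_diff dw dS) auto
      then show "(\<lambda>x. w x t1 - S x t1) differentiable at x" using real_differentiable_def by blast
    qed
    then obtain l z where lz: "0 < z" "z < h" "((\<lambda>x. w x t1 - S x t1) has_real_derivative l) (at z)"
      "(w h t1 - S h t1) - (w 0 t1 - S 0 t1) = h * l" by auto
    have "((\<lambda>x. w x t1 - S x t1) has_real_derivative wx z t1 - Sx z t1) (at z)"
      using lz h t1 z' by (intro DERIV_diff dw dS) auto
    then have "l = wx z t1 - Sx z t1" using lz(3) DERIV_unique by blast
    then have "l > 0" using e(2)[of z] lz h by simp
    then have "h * l > 0" using h by simp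
    moreover have "w h t1 - S h t1 \<le> w 0 t1 - S 0 t1" using max[of h t1] h z' x10 by (auto simp: Q_def)
    ultimately show False using lz(4) by linarith
  qed
  have m: "wx x1 t1 - Sx x1 t1 = 0" "wxx x1 t1 - Sxx x1 t1 \<le> 0"
  proof -
    have mm: "w y t1 - S y t1 \<le> w x1 t1 - S x1 t1" if "0 < y" "y < \<l> t1" for y
      using max[of y t1] that z' by (auto simp: Q_def)
    have d1: "((\<lambda>x. w x t1 - S x t1) has_real_derivative wx y t1 - Sx y t1) (at y)" if "0 < y" "y < \<l> t1" for y
      using that t1 z' by (intro DERIV_diff dw dS) auto
    have d2: "((\<lambda>x. wx x t1 - Sx x t1) has_real_derivative wxx x1 t1 - Sxx x1 t1) (at x1)"
      using x1 x1l t1 z' by (intro DERIV_diff dw dS) auto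
    note im = interior_max_derivs[OF x1 x1l mm d1 d2]
    from im show "wx x1 t1 - Sx x1 t1 = 0" "wxx x1 t1 - Sxx x1 t1 \<le> 0" by auto
  qed
  have "wt x1 t1 - St x1 t1 \<ge> 0"
  proof -
    \<comment> \<open>Earlier points \<open>(x1, s)\<close> must lie in the moving region to be
      compared with the maximum; continuity of \<open>\<l>\<close> guarantees this just before
      \<open>t1\<close>.\<close>
    have "eventually (\<lambda>t. \<l> t > x1) (at t1 within {T0..T1})"
      using cl t1 z' x1l by (intro order_tendstoD(1)[where y="\<l> t1"]) (auto simp: continuous_on_def)
    then obtain d where d: "d > 0" "\<And>t. t \<in> {T0..T1} \<Longrightarrow> t \<noteq> t1 \<Longrightarrow> dist t t1 < d \<Longrightarrow> \<l> t > x1"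
      by (auto simp: eventually_at)
    define t0 where "t0 = max T0 (t1 - d)"
    have t0: "t0 < t1" using d t1 by (auto simp: t0_def)
    show ?thesis
    proof (rule left_max_deriv_nonneg[OF t0])
      show "((\<lambda>t. w x1 t - S x1 t) has_real_derivative wt x1 t1 - St x1 t1) (at t1)"
        using x1 x1l t1 z' by (intro DERIV_diff dw dS) auto
      fix s assume s: "t0 < s" "s < t1"
      then have "x1 < \<l> s" using d(2)[of s] z' by (auto simp: t0_def dist_real_def)
      then show "w x1 s - S x1 s \<le> w x1 t1 - S x1 t1"
        using max[of x1 s] s z' x1 by (auto simp: Q_def t0_def)
    qed
  qed
  with strict[OF x1 x1l t1 z'(2)] m big show False by simp
qed

section \<open>Strict minimality of the equilibrium for the energy\<close>

context bubble_par
begin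

lemma W_deriv: "r > 0 \<Longrightarrow> (W has_real_derivative (pin * r ^ 3 + 2 * sg * r\<^sup>2 - 3 * c0 * m) / r) (at r)"
  unfolding W_def
  by (auto intro!: derivative_eq_intros simp: field_simps power2_eq_square power3_eq_cube)

lemma W_sign:
  shows "0 < r \<Longrightarrow> r < Rs \<Longrightarrow> (pin * r ^ 3 + 2 * sg * r\<^sup>2 - 3 * c0 * m) / r < 0"
    and "r > Rs \<Longrightarrow> (pin * r ^ 3 + 2 * sg * r\<^sup>2 - 3 * c0 * m) / r > 0"
proof -
  have mono: "pin * a ^ 3 + 2 * sg * a\<^sup>2 < pin * b ^ 3 + 2 * sg * b\<^sup>2" if "0 < a" "a < b" for a b
  proof (rule add_strict_mono)
    show "pin * a ^ 3 < pin * b ^ 3" using that par by (intro mult_strict_left_mono power_strict_mono) auto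
    show "2 * sg * a\<^sup>2 < 2 * sg * b\<^sup>2" using that par by (intro mult_strict_left_mono power_strict_mono) auto
  qed
  show "0 < r \<Longrightarrow> r < Rs \<Longrightarrow> (pin * r ^ 3 + 2 * sg * r\<^sup>2 - 3 * c0 * m) / r < 0"
    using mono[of r Rs] Rs by (intro divide_neg_pos) auto
  show "r > Rs \<Longrightarrow> (pin * r ^ 3 + 2 * sg * r\<^sup>2 - 3 * c0 * m) / r > 0"
    using mono[of Rs r] Rs by (intro divide_pos_pos) auto
qed

text \<open>The three summands are minimal separately, at \<open>V = 0\<close>,
  \<open>r = Rs\<close> and \<open>\<theta> = 1\<close>, so an excess of at most
  \<open>\<delta>\<close> in the sum bounds the excess of each. The kinetic term controls
  \<open>V\<close> only while \<open>r\<close> stays away from zero, which closeness of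
  \<open>r\<close> to \<open>Rs\<close> supplies.\<close>

lemma equilibrium_strict_minimum:
  assumes "\<epsilon> > 0"
  shows "\<exists>\<delta>>0. \<forall>r V \<theta>. r > 0 \<and> \<theta> > 0 \<and>
     rl * r ^ 3 * V\<^sup>2 / 2 + W r + cT * m * (\<theta> - ln \<theta>) \<le> W Rs + cT * m + \<delta> \<longrightarrow>
     \<bar>r - Rs\<bar> < \<epsilon> \<and> \<bar>V\<bar> < \<epsilon> \<and> \<bar>\<theta> - 1\<bar> < \<epsilon>"
proof -
  define e where "e = min \<epsilon> (Rs / 2)"
  have e: "e > 0" "e \<le> \<epsilon>" "e \<le> Rs / 2" using assms Rs by (auto simp: e_def)
  note wW = well_of_sign_change[OF Rs(1) W_deriv W_sign]
  obtain d1 where d1: "d1 > 0" "\<And>x. x > 0 \<Longrightarrow> W x \<le> W Rs + d1 \<Longrightarrow> \<bar>x - Rs\<bar> < e"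
    using wW(2)[OF _ _ _ _ e(1)] by auto
  have hd: "((\<lambda>x. x - ln x) has_real_derivative 1 - 1 / x) (at x)" if "x > 0" for x :: real
    using that by (auto intro!: derivative_eq_intros simp: field_simps)
  have hs: "1 - 1 / x < 0" if "0 < x" "x < 1" for x :: real using that by (simp add: field_simps)
  have hs': "1 - 1 / x > 0" if "x > 1" for x :: real using that by (simp add: field_simps)
  note wh = well_of_sign_change[OF zero_less_one hd hs hs']
  obtain d2 where d2: "d2 > 0" "\<And>x::real. x > 0 \<Longrightarrow> x - ln x \<le> 1 + d2 \<Longrightarrow> \<bar>x - 1\<bar> < \<epsilon>"
    using wh(2)[OF _ _ _ _ assms] by auto
  \<comment> \<open>Kinetic energy at speed \<open>\<epsilon>\<close> and radius
    \<open>Rs / 2\<close>; the cap \<open>e \<le> Rs / 2\<close> keeps the radius above that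
    value.\<close>
  define d3 where "d3 = rl * (Rs / 2) ^ 3 * \<epsilon>\<^sup>2 / 2"
  have d3: "d3 > 0" using par Rs assms by (simp add: d3_def)
  define \<delta> where "\<delta> = min d1 (min (cT * m * d2) d3) / 2"
  have dpos: "\<delta> > 0" using d1 d2 d3 cT par by (simp add: \<delta>_def)
  have dl: "\<delta> < d1" "\<delta> < cT * m * d2" "\<delta> < d3" using d1(1) d2(1) d3 cT par dpos unfolding \<delta>_def by (auto simp: min_def split: if_splits)
  show ?thesis
  proof (intro exI[of _ \<delta>] conjI dpos allI impI, goal_cases)
    case (1 r V \<theta>)
    then have r: "r > 0" "\<theta> > 0" and le: "rl * r ^ 3 * V\<^sup>2 / 2 + W r + cT * m * (\<theta> - ln \<theta>) \<le> W Rs + cT * m + \<delta>" by auto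
    have k0: "rl * r ^ 3 * V\<^sup>2 / 2 \<ge> 0" using par r by simp
    have h0: "cT * m * 1 \<le> cT * m * (\<theta> - ln \<theta>)" using wh(1)[of \<theta>] r cT par by (intro mult_left_mono) auto
    have W0: "W Rs \<le> W r" using wW(1)[of r] r by auto
    have "W r \<le> W Rs + d1" using le k0 h0 dl by linarith
    then show ?case using d1(2)[OF r(1)] e by linarith
  next
    case (2 r V \<theta>)
    then have r: "r > 0" "\<theta> > 0" and le: "rl * r ^ 3 * V\<^sup>2 / 2 + W r + cT * m * (\<theta> - ln \<theta>) \<le> W Rs + cT * m + \<delta>" by auto
    have k0: "rl * r ^ 3 * V\<^sup>2 / 2 \<ge> 0" using par r by simp
    have h0: "cT * m * 1 \<le> cT * m * (\<theta> - ln \<theta>)" using wh(1)[of \<theta>] r cT par by (intro mult_left_mono) auto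
    have W0: "W Rs \<le> W r" using wW(1)[of r] r by auto
    have "W r \<le> W Rs + d1" using le k0 h0 dl by linarith
    then have rr: "r \<ge> Rs / 2" using d1(2)[OF r(1)] e by linarith
    show ?case
    proof (rule ccontr)
      assume "\<not> \<bar>V\<bar> < \<epsilon>"
      then have "\<bar>\<epsilon>\<bar> \<le> \<bar>V\<bar>" using assms by simp
      then have "\<epsilon>\<^sup>2 \<le> V\<^sup>2" by (simp add: abs_le_square_iff)
      moreover have "rl * (Rs / 2) ^ 3 \<le> rl * r ^ 3"
        using rr r par Rs by (intro mult_left_mono power_mono) auto
      moreover have "0 \<le> rl * r ^ 3" using r par by simp
      ultimately have "rl * (Rs / 2) ^ 3 * \<epsilon>\<^sup>2 \<le> rl * r ^ 3 * V\<^sup>2" by (simp add: mult_mono)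
      then have "d3 \<le> rl * r ^ 3 * V\<^sup>2 / 2" by (simp add: d3_def)
      then show False using le h0 W0 dl by linarith
    qed
  next
    case (3 r V \<theta>)
    then have r: "r > 0" "\<theta> > 0" and le: "rl * r ^ 3 * V\<^sup>2 / 2 + W r + cT * m * (\<theta> - ln \<theta>) \<le> W Rs + cT * m + \<delta>" by auto
    have k0: "rl * r ^ 3 * V\<^sup>2 / 2 \<ge> 0" using par r by simp
    have W0: "W Rs \<le> W r" using wW(1)[of r] r by auto
    have "cT * m * (\<theta> - ln \<theta>) \<le> cT * m * (1 + d2)" using le k0 W0 dl by (simp add: algebra_simps)
    then have "\<theta> - ln \<theta> \<le> 1 + d2" using cT par by (simp add: mult_le_cancel_left)
    then show ?case using d2(2)[OF r(2)] by linarith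
  qed
qed

text \<open>Continuity at \<open>(Rs, 0, 0)\<close>. The term in \<open>\<xi>\<close> is the bound
  for the gas energy when the log density differs from its wall value by at most
  \<open>\<xi>\<close>.\<close>

lemma energy_near_equilibrium:
  assumes "\<delta> > 0"
  shows "\<exists>\<epsilon>>0. \<forall>r V \<xi>. \<bar>r - Rs\<bar> \<le> \<epsilon> \<and> \<bar>V\<bar> \<le> \<epsilon> \<and> \<bar>\<xi>\<bar> \<le> \<epsilon> \<longrightarrow>
     rl * r ^ 3 * V\<^sup>2 / 2 + W r + cT * m * (exp \<xi> + (2 * gm - 1) * \<xi>) \<le> W Rs + cT * m + \<delta>"
proof -
  define F where "F z = (case z of (r, V, \<xi>) \<Rightarrow> rl * r ^ 3 * V\<^sup>2 / 2 + W r + cT * m * (exp \<xi> + (2 * gm - 1) * \<xi>))" for z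
  have "continuous_on ({0<..} \<times> UNIV \<times> UNIV) F"
    unfolding F_def W_def split_beta by (intro continuous_intros) auto
  then obtain d where d: "d > 0" "\<And>z. z \<in> {0<..} \<times> UNIV \<times> UNIV \<Longrightarrow> dist z (Rs, 0, 0) < d \<Longrightarrow> dist (F z) (F (Rs, 0, 0)) < \<delta>"
    using assms Rs(1) unfolding continuous_on_iff by fastforce
  define e where "e = min (d / 4) (Rs / 2)"
  have e: "e > 0" "e \<le> d / 4" "e < Rs" using d Rs by (auto simp: e_def)
  show ?thesis
  proof (intro exI[of _ e] conjI allI impI e)
    fix r V \<xi> :: real assume a: "\<bar>r - Rs\<bar> \<le> e \<and> \<bar>V\<bar> \<le> e \<and> \<bar>\<xi>\<bar> \<le> e"
    have "dist (r, V, \<xi>) (Rs, 0, 0) \<le> \<bar>r - Rs\<bar> + (\<bar>V\<bar> + \<bar>\<xi>\<bar>)"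
      unfolding dist_Pair_Pair using sqrt_sum_squares_le_sum_abs[of "dist r Rs" "sqrt ((dist V 0)\<^sup>2 + (dist \<xi> 0)\<^sup>2)"]
        sqrt_sum_squares_le_sum_abs[of "dist V 0" "dist \<xi> 0"] by (simp add: dist_real_def)
    also have "\<dots> < d" using a e d by linarith
    finally have "dist (F (r, V, \<xi>)) (F (Rs, 0, 0)) < \<delta>" using a e by (intro d(2)) auto
    then show "rl * r ^ 3 * V\<^sup>2 / 2 + W r + cT * m * (exp \<xi> + (2 * gm - 1) * \<xi>) \<le> W Rs + cT * m + \<delta>"
      unfolding F_def by (simp add: dist_real_def)
  qed
qed

end

context bubble_flow
begin

text \<open>Mass of a bubble filled uniformly with gas of the wall density, divided by the true
  mass; together with \<open>R\<close> it determines the wall density.\<close>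

definition "Th t = exp (L 1 t) * (R t) ^ 3 / (3 * m)"

lemma Th_pos: "t \<ge> 0 \<Longrightarrow> Th t > 0" using Rpos[of t] par by (simp add: Th_def)

lemma lP_eq: "t \<ge> 0 \<Longrightarrow> L 1 t = ln (3 * m) + ln (Th t) - 3 * ln (R t)"
proof -
  assume t: "t \<ge> 0"
  have "exp (L 1 t) = 3 * m * Th t / (R t) ^ 3" using Rpos[OF t] par by (simp add: Th_def)
  then have "L 1 t = ln (3 * m * Th t / (R t) ^ 3)" by (metis ln_exp)
  also have "\<dots> = ln (3 * m) + ln (Th t) - 3 * ln (R t)"
    using Rpos[OF t] par Th_pos[OF t] by (simp add: ln_div ln_mult ln_realpow)
  finally show ?thesis .
qed

lemma integrable_L:
  assumes "t \<ge> 0"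
  shows "(\<lambda>s. R t ^ 3 * (s\<^sup>2 * exp (L s t)) * Z s t) integrable_on {0..1}"
    "(\<lambda>s. R t ^ 3 * (s\<^sup>2 * exp (L s t))) integrable_on {0..1}"
  unfolding Z_def by (intro integrable_continuous_real continuous_intros cont_comp; use assms par in auto)+

lemma int_sq: "((\<lambda>s::real. s\<^sup>2) has_integral 1 / 3) {0..1}"
proof -
  have "((\<lambda>s::real. s\<^sup>2) has_integral 1 ^ 3 / 3 - 0 ^ 3 / 3) {0..1}"
    by (rule integral_derivative_01) (auto intro!: derivative_eq_intros continuous_intros)
  then show ?thesis by simp
qed

text \<open>Convexity of the exponential, weighted with the mass density. The tangent point is
  shifted by \<open>ln (Th t)\<close> so that the integral of the exponential equals the mass;
  thereby the gas energy is bounded below by a function of \<open>R\<close> plus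
  \<open>Th - ln Th\<close>.\<close>

lemma E_lower:
  assumes t: "t \<ge> 0"
  shows "E t \<ge> rl * (R t) ^ 3 * (R1 t)\<^sup>2 / 2 + W (R t) + cT * m * (Th t - ln (Th t)) + c0 * m * ln (3 * m)"
proof -
  let ?\<mu> = "\<lambda>s. R t ^ 3 * (s\<^sup>2 * exp (L s t))" and ?P = "exp (L 1 t)" and ?\<theta> = "Th t"
  have R: "R t > 0" by (rule Rpos[OF t])
  have th: "?\<theta> > 0" by (rule Th_pos[OF t])
  have pw: "?\<mu> s * ((1 - 1 / gm) * L 1 t + 1 - ln ?\<theta>) - R t ^ 3 * ?P / ?\<theta> * s\<^sup>2 \<le> ?\<mu> s * Z s t" for s
  proof -
    have "L 1 t - L s t - ln ?\<theta> \<le> exp (L 1 t - L s t) / ?\<theta> - 1"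
      using exp_ge_add_one_self[of "L 1 t - L s t - ln ?\<theta>"] th by (simp add: exp_diff)
    then have "?\<mu> s * (L 1 t - L s t - ln ?\<theta> + 1) \<le> ?\<mu> s * (exp (L 1 t - L s t) / ?\<theta>)"
      using R by (intro mult_left_mono) auto
    also have "\<dots> = R t ^ 3 * ?P / ?\<theta> * s\<^sup>2" by (simp add: exp_diff)
    finally show ?thesis by (simp add: Z_def algebra_simps)
  qed
  have I: "integral {0..1} (\<lambda>s. ?\<mu> s * ((1 - 1 / gm) * L 1 t + 1 - ln ?\<theta>) - R t ^ 3 * ?P / ?\<theta> * s\<^sup>2) =
      m * ((1 - 1 / gm) * L 1 t + 1 - ln ?\<theta>) - R t ^ 3 * ?P / ?\<theta> * (1 / 3)"
  proof (intro integral_unique has_integral_diff has_integral_mult_left has_integral_mult_right int_sq)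
    show "(?\<mu> has_integral m) {0..1}" using mass[OF t] integrable_L(2)[OF t] by (metis integrable_integral)
  qed
  have "m * ((1 - 1 / gm) * L 1 t + 1 - ln ?\<theta>) - R t ^ 3 * ?P / ?\<theta> * (1 / 3) \<le> integral {0..1} (\<lambda>s. ?\<mu> s * Z s t)"
    unfolding I[symmetric]
    by (rule integral_le) (use pw in \<open>auto intro!: integrable_L[OF t] integrable_continuous_real continuous_intros cont_comp t less_imp_neq[OF th, symmetric]\<close>)
  moreover have "R t ^ 3 * ?P / ?\<theta> * (1 / 3) = m" using R par th by (simp add: Th_def)
  ultimately have "m * ((1 - 1 / gm) * L 1 t - ln ?\<theta>) \<le> integral {0..1} (\<lambda>s. ?\<mu> s * Z s t)" by (simp add: algebra_simps)
  then have "gm * (m * ((1 - 1 / gm) * L 1 t - ln ?\<theta>)) \<le> gm * integral {0..1} (\<lambda>s. ?\<mu> s * Z s t)"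
    using par by (intro mult_left_mono) auto
  moreover have "gm * (m * ((1 - 1 / gm) * L 1 t - ln ?\<theta>)) = m * ((gm - 1) * L 1 t - gm * ln ?\<theta>)"
    using par by (simp add: field_simps)
  ultimately have "cT * (?P * R t ^ 3 / 3 + m * ((gm - 1) * L 1 t - gm * ln ?\<theta>)) \<le> cT * (?P * R t ^ 3 / 3 + gm * integral {0..1} (\<lambda>s. ?\<mu> s * Z s t))"
    using cT by (intro mult_left_mono) auto
  moreover have "?P * R t ^ 3 / 3 = m * ?\<theta>" using par by (simp add: Th_def)
  moreover have "cT * (m * ?\<theta> + m * ((gm - 1) * L 1 t - gm * ln ?\<theta>))
     = cT * m * (?\<theta> - ln ?\<theta>) + (cT * (gm - 1)) * m * (ln (3 * m) - 3 * ln (R t))"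
    unfolding lP_eq[OF t] by (simp add: algebra_simps)
  ultimately show ?thesis unfolding E_def W_def cT(2) by (simp add: algebra_simps)
qed

text \<open>The oscillation bound enters twice: in \<open>Z\<close> directly, and in
  \<open>Th t \<le> exp \<xi>\<close>, which follows by comparing the density with its wall value in
  the mass integral.\<close>

lemma E_upper:
  assumes t: "t \<ge> 0" and \<xi>: "\<And>s. 0 \<le> s \<Longrightarrow> s \<le> 1 \<Longrightarrow> \<bar>L s t - L 1 t\<bar> \<le> \<xi>"
  shows "E t \<le> rl * (R t) ^ 3 * (R1 t)\<^sup>2 / 2 + W (R t) + cT * m * (exp \<xi> + (2 * gm - 1) * \<xi>) + c0 * m * ln (3 * m)"
proof -
  let ?\<mu> = "\<lambda>s. R t ^ 3 * (s\<^sup>2 * exp (L s t))" and ?P = "exp (L 1 t)" and ?\<theta> = "Th t"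
  have R: "R t > 0" by (rule Rpos[OF t])
  have th: "?\<theta> > 0" by (rule Th_pos[OF t])
  have hm: "(?\<mu> has_integral m) {0..1}" using mass[OF t] integrable_L(2)[OF t] by (metis integrable_integral)
  have x0: "\<xi> \<ge> 0" using \<xi>[of 1] by simp
  have "integral {0..1} (\<lambda>s. ?\<mu> s * Z s t) \<le> integral {0..1} (\<lambda>s. ?\<mu> s * ((1 - 1 / gm) * L 1 t + \<xi>))"
  proof (rule integral_le)
    fix s :: real assume s: "s \<in> {0..1}"
    have "Z s t \<le> (1 - 1 / gm) * L 1 t + \<xi>" using \<xi>[of s] s by (simp add: Z_def algebra_simps)
    then show "?\<mu> s * Z s t \<le> ?\<mu> s * ((1 - 1 / gm) * L 1 t + \<xi>)" using R by (intro mult_left_mono) auto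
  qed (auto intro!: integrable_L[OF t] integrable_continuous_real continuous_intros cont_comp t)
  also have "\<dots> = m * ((1 - 1 / gm) * L 1 t + \<xi>)" by (intro integral_unique has_integral_mult_left hm)
  finally have "gm * integral {0..1} (\<lambda>s. ?\<mu> s * Z s t) \<le> gm * (m * ((1 - 1 / gm) * L 1 t + \<xi>))"
    using par by (intro mult_left_mono) auto
  moreover have "gm * (m * ((1 - 1 / gm) * L 1 t + \<xi>)) = m * ((gm - 1) * L 1 t + gm * \<xi>)" using par by (simp add: field_simps)
  moreover have "?P * R t ^ 3 / 3 = m * ?\<theta>" using par by (simp add: Th_def)
  moreover have th1: "?\<theta> \<le> exp \<xi>"
  proof -
    have "integral {0..1} (\<lambda>s. ?P * R t ^ 3 * s\<^sup>2) \<le> integral {0..1} (\<lambda>s. ?\<mu> s * exp \<xi>)"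
    proof (rule integral_le)
      fix s :: real assume s: "s \<in> {0..1}"
      have "?P \<le> exp (L s t) * exp \<xi>" unfolding exp_add[symmetric] using \<xi>[of s] s by simp
      then have "R t ^ 3 * s\<^sup>2 * ?P \<le> R t ^ 3 * s\<^sup>2 * (exp (L s t) * exp \<xi>)" using R by (intro mult_left_mono) auto
      then show "?P * R t ^ 3 * s\<^sup>2 \<le> ?\<mu> s * exp \<xi>" by (simp add: mult_ac)
    qed (auto intro!: integrable_continuous_real continuous_intros cont_comp t)
    also have "\<dots> = m * exp \<xi>" by (intro integral_unique has_integral_mult_left hm)
    also have "integral {0..1} (\<lambda>s. ?P * R t ^ 3 * s\<^sup>2) = ?P * R t ^ 3 * (1 / 3)"
      by (intro integral_unique has_integral_mult_right int_sq)
    finally show ?thesis using par by (simp add: Th_def field_simps)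
  qed
  ultimately have "cT * (?P * R t ^ 3 / 3 + gm * integral {0..1} (\<lambda>s. ?\<mu> s * Z s t)) \<le> cT * (m * ?\<theta> + m * ((gm - 1) * L 1 t + gm * \<xi>))"
    using cT by (intro mult_left_mono) auto
  also have "\<dots> = cT * m * (?\<theta> + (gm - 1) * ln ?\<theta> + gm * \<xi>) + (cT * (gm - 1)) * m * (ln (3 * m) - 3 * ln (R t))"
    unfolding lP_eq[OF t] by (simp add: algebra_simps)
  also have "cT * m * (?\<theta> + (gm - 1) * ln ?\<theta> + gm * \<xi>) \<le> cT * m * (exp \<xi> + (2 * gm - 1) * \<xi>)"
  proof (rule mult_left_mono)
    have "ln ?\<theta> \<le> \<xi>" using th1 th by (metis ln_exp ln_le_cancel_iff exp_gt_zero)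
    then have "(gm - 1) * ln ?\<theta> \<le> (gm - 1) * \<xi>" using par by (intro mult_left_mono) auto
    then show "?\<theta> + (gm - 1) * ln ?\<theta> + gm * \<xi> \<le> exp \<xi> + (2 * gm - 1) * \<xi>" using th1 by (simp add: algebra_simps)
  qed (use cT par in auto)
  finally show ?thesis unfolding E_def W_def cT(2) by (simp add: algebra_simps)
qed

lemma D_nonneg: "t \<ge> 0 \<Longrightarrow> D t \<ge> 0"
  unfolding D_def by (intro integral_nonneg integrable_continuous_real continuous_intros cont_comp) auto

lemma energy_deriv_nonpos:
  assumes "t \<ge> 0"
  shows "- 4 * mu * R t * (R1 t)\<^sup>2 - cT * gm * kap * R t * D t \<le> 0"
proof -
  have "4 * mu * R t * (R1 t)\<^sup>2 \<ge> 0" "cT * gm * kap * R t * D t \<ge> 0"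
    using par Rpos[OF assms] D_nonneg[OF assms] cT by (auto intro!: mult_nonneg_nonneg)
  then show ?thesis by simp
qed

lemma E_antimono: "0 \<le> a \<Longrightarrow> a \<le> b \<Longrightarrow> E b \<le> E a"
proof (cases "a = b")
  case False
  assume ab: "0 \<le> a" "a \<le> b"
  then have "a < b" using False by simp
  from mvt_half_line[OF ab(1) this energy_deriv] obtain z where z: "a < z" "z < b"
    "E b - E a = (b - a) * (- 4 * mu * R z * (R1 z)\<^sup>2 - cT * gm * kap * R z * D z)" by metis
  then show ?thesis using energy_deriv_nonpos[of z] ab mult_nonneg_nonpos[of "b - a" "- 4 * mu * R z * (R1 z)\<^sup>2 - cT * gm * kap * R z * D z"] by linarith
qed simp

end

context bubble_par
begin

text \<open>Lyapunov argument: the lower bound at time \<open>t\<close>, monotonicity, and the upper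
  bound at time \<open>0\<close>; the common constant cancels. Only wall quantities are obtained,
  since the energy gives no pointwise control of the interior profile.\<close>

lemma low_norm_stability:
  assumes "\<epsilon> > 0"
  shows "\<exists>\<delta>>0. \<forall>L Ls LL Lt R R1 R2 R3. bubble_flow kap gm c0 sg pin rl mu m Rs L Ls LL Lt R R1 R2 R3 \<and>
     (\<forall>s. 0 \<le> s \<and> s \<le> 1 \<longrightarrow> \<bar>L s 0 - ln rs\<bar> \<le> \<delta>) \<and> \<bar>R 0 - Rs\<bar> \<le> \<delta> \<and> \<bar>R1 0\<bar> \<le> \<delta> \<longrightarrow>
     (\<forall>t\<ge>0. \<bar>R t - Rs\<bar> < \<epsilon> \<and> \<bar>R1 t\<bar> < \<epsilon> \<and> \<bar>L 1 t - ln rs\<bar> < \<epsilon>)"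
proof -
  have "isCont (\<lambda>r. ln r) Rs" "isCont (\<lambda>r. ln r) (1::real)" using Rs by (auto intro!: continuous_intros)
  then obtain d1 d2 where d1: "d1 > 0" "\<And>r. \<bar>r - Rs\<bar> < d1 \<Longrightarrow> \<bar>ln r - ln Rs\<bar> < \<epsilon> / 8"
    and d2: "d2 > 0" "\<And>r. \<bar>r - 1\<bar> < d2 \<Longrightarrow> \<bar>ln r - ln (1::real)\<bar> < \<epsilon> / 8"
    using assms unfolding continuous_at_eps_delta dist_real_def by (metis zero_less_divide_iff zero_less_numeral)
  define e where "e = min \<epsilon> (min d1 d2)"
  have e: "e > 0" "e \<le> \<epsilon>" "e \<le> d1" "e \<le> d2" using assms d1 d2 by (auto simp: e_def)
  obtain \<delta>1 where a: "\<delta>1 > 0" "\<And>r V \<theta>. r > 0 \<and> \<theta> > 0 \<and>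
     rl * r ^ 3 * V\<^sup>2 / 2 + W r + cT * m * (\<theta> - ln \<theta>) \<le> W Rs + cT * m + \<delta>1 \<Longrightarrow>
     \<bar>r - Rs\<bar> < e \<and> \<bar>V\<bar> < e \<and> \<bar>\<theta> - 1\<bar> < e"
    using equilibrium_strict_minimum[OF e(1)] by blast
  obtain \<delta>2 where b: "\<delta>2 > 0" "\<And>r V \<xi>. \<bar>r - Rs\<bar> \<le> \<delta>2 \<and> \<bar>V\<bar> \<le> \<delta>2 \<and> \<bar>\<xi>\<bar> \<le> \<delta>2 \<Longrightarrow>
     rl * r ^ 3 * V\<^sup>2 / 2 + W r + cT * m * (exp \<xi> + (2 * gm - 1) * \<xi>) \<le> W Rs + cT * m + \<delta>1"
    using energy_near_equilibrium[OF a(1)] by blast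
  show ?thesis
  proof (rule exI[of _ "\<delta>2 / 2"], rule conjI, use b in simp, intro allI impI, elim conjE)
    fix L Ls LL Lt R R1 R2 R3 and t :: real
    assume fl: "bubble_flow kap gm c0 sg pin rl mu m Rs L Ls LL Lt R R1 R2 R3"
      and i: "\<forall>s. 0 \<le> s \<and> s \<le> 1 \<longrightarrow> \<bar>L s 0 - ln rs\<bar> \<le> \<delta>2 / 2" "\<bar>R 0 - Rs\<bar> \<le> \<delta>2 / 2" "\<bar>R1 0\<bar> \<le> \<delta>2 / 2"
      and t: "t \<ge> 0"
    interpret bubble_flow kap gm c0 sg pin rl mu m Rs L Ls LL Lt R R1 R2 R3 by (rule fl)
    have "\<bar>L s 0 - L 1 0\<bar> \<le> \<delta>2" if "0 \<le> s" "s \<le> 1" for s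
      using i(1)[rule_format, of s] i(1)[rule_format, of 1] that by (auto simp: abs_if split: if_splits)
    from E_upper[OF order_refl this] have "E 0 \<le> W Rs + cT * m + \<delta>1 + c0 * m * ln (3 * m)"
      using b(2)[of "R 0" "R1 0" \<delta>2] i b(1) by force
    then have "rl * (R t) ^ 3 * (R1 t)\<^sup>2 / 2 + W (R t) + cT * m * (Th t - ln (Th t)) \<le> W Rs + cT * m + \<delta>1"
      using E_lower[OF t] E_antimono[of 0 t] t by linarith
    with a(2)[of "R t" "Th t" "R1 t"] Rpos[OF t] Th_pos[OF t]
    have c: "\<bar>R t - Rs\<bar> < e" "\<bar>R1 t\<bar> < e" "\<bar>Th t - 1\<bar> < e" by auto
    have "ln rs = ln (3 * m) - 3 * ln Rs"
    proof -
      have "rs = 3 * m / Rs ^ 3" using rs Rs by (simp add: field_simps)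
      then show ?thesis using Rs par by (simp add: ln_div ln_realpow)
    qed
    moreover have "\<bar>ln (R t) - ln Rs\<bar> < \<epsilon> / 8" "\<bar>ln (Th t) - ln 1\<bar> < \<epsilon> / 8"
      using d1(2)[of "R t"] d2(2)[of "Th t"] c e by auto
    ultimately have "\<bar>L 1 t - ln rs\<bar> < \<epsilon>" using lP_eq[OF t] assms
      unfolding abs_less_iff ln_one by linarith
    then show "\<bar>R t - Rs\<bar> < \<epsilon> \<and> \<bar>R1 t\<bar> < \<epsilon> \<and> \<bar>L 1 t - ln rs\<bar> < \<epsilon>" using c e by auto
  qed
qed

end

section \<open>The drift-free coordinate\<close>

context bubble_flow
begin

text \<open>In the coordinate \<open>x = r P\<^bsup>1/(3\<gamma>)\<^esup>\<close>, where \<open>P\<close> is the density at the wall, the equation for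
  \<open>Y = ln (\<rho> / P\<^bsup>1/\<gamma>\<^esup>)\<close> has no drift: \<open>Y\<^sub>t = a(t) e\<^bsup>-Y\<^esup> \<Delta>Y\<close> on \<open>0 \<le> x \<le> Lam t\<close>.\<close>

definition "Lam t = R t * exp (L 1 t / (3 * gm))"
definition "Lam1 t = - kap * gf t * Lam t / (R t)\<^sup>2"
definition "Y x t = L (x / Lam t) t - L 1 t / gm"
definition "Yx x t = Ls (x / Lam t) t / Lam t"
definition "YL x t = LL (x / Lam t) t / (Lam t)\<^sup>2"
definition "A x t = kap * exp (- (L 1 t / (3 * gm))) * exp (- Y x t)"
definition "v x t = A x t * YL x t"

lemma Lam_pos: "t \<ge> 0 \<Longrightarrow> Lam t > 0" using Rpos by (simp add: Lam_def)

lemma A_pos: "A x t > 0" using par by (simp add: A_def)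

lemma v_eq: "t \<ge> 0 \<Longrightarrow> v x t = kap / (R t)\<^sup>2 * (exp (- L (x / Lam t) t) * LL (x / Lam t) t)"
proof -
  assume t: "t \<ge> 0"
  have R: "R t > 0" by (rule Rpos[OF t])
  have e: "exp (- (L 1 t / (3 * gm))) * exp (L 1 t / gm) = (exp (L 1 t / (3 * gm)))\<^sup>2"
    unfolding power2_eq_square exp_add[symmetric] using par by (simp add: field_simps)
  have "A x t = kap * (exp (- (L 1 t / (3 * gm))) * exp (L 1 t / gm)) * exp (- L (x / Lam t) t)"
    unfolding A_def Y_def by (simp add: exp_diff exp_minus field_simps)
  then show ?thesis unfolding v_def YL_def e Lam_def using R by (simp add: power_mult_distrib field_simps)
qed

text \<open>The logarithmic derivative of \<open>Lam\<close> is
  \<open>R1 / R + q / (3 * gm)\<close>, and the wall velocity law combines both terms into the wall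
  flux.\<close>

lemma dLam: "t \<ge> 0 \<Longrightarrow> (Lam has_real_derivative Lam1 t) (at t within {0..})"
proof -
  assume t: "t \<ge> 0"
  have R: "R t > 0" by (rule Rpos[OF t])
  have g: "gm \<noteq> 0" using par by simp
  have "(Lam has_real_derivative R1 t * exp (L 1 t / (3 * gm)) + R t * (exp (L 1 t / (3 * gm)) * (q t / (3 * gm)))) (at t within {0..})"
    unfolding Lam_def using g t by (auto intro!: derivative_eq_intros dR dLt simp: q_def)
  moreover have Q: "q t / (3 * gm) = (- 3 * R1 t / R t - 3 * kap * gf t / (R t)\<^sup>2) / 3"
    using wallv'[OF t] by simp
  have "R1 t * exp (L 1 t / (3 * gm)) + R t * (exp (L 1 t / (3 * gm)) * (q t / (3 * gm))) = Lam1 t"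
    unfolding Q Lam1_def Lam_def using R by (simp add: field_simps power2_eq_square)
  ultimately show ?thesis by simp
qed

lemma contLam: "continuous_on {0..} Lam" by (rule DERIV_continuous_on) (use dLam in auto)

lemma frac_in: "t \<ge> 0 \<Longrightarrow> 0 \<le> x \<Longrightarrow> x \<le> Lam t \<Longrightarrow> 0 \<le> x / Lam t \<and> x / Lam t \<le> 1"
  using Lam_pos[of t] by simp

lemma frac_in': "t \<ge> 0 \<Longrightarrow> 0 < x \<Longrightarrow> x < Lam t \<Longrightarrow> 0 < x / Lam t \<and> x / Lam t < 1"
  using Lam_pos[of t] by simp

lemma contY:
  assumes "continuous_on B f" "continuous_on B g" "\<And>z. z \<in> B \<Longrightarrow> 0 \<le> g z" "\<And>z. z \<in> B \<Longrightarrow> 0 \<le> f z \<and> f z \<le> Lam (g z)"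
  shows "continuous_on B (\<lambda>z. Y (f z) (g z))" "continuous_on B (\<lambda>z. Yx (f z) (g z))" "continuous_on B (\<lambda>z. v (f z) (g z))"
proof -
  have cl: "continuous_on B (\<lambda>z. Lam (g z))"
    using continuous_on_compose2[OF contLam assms(2)] assms(3) by force
  have nz: "Lam (g z) \<noteq> 0" if "z \<in> B" for z using Lam_pos[OF assms(3)[OF that]] by simp
  have cf: "continuous_on B (\<lambda>z. f z / Lam (g z))"
    by (intro continuous_intros assms(1) cl) (use nz in auto)
  have i: "0 \<le> f z / Lam (g z) \<and> f z / Lam (g z) \<le> 1" if "z \<in> B" for z
    using frac_in assms(3,4)[OF that] by blast
  note cc = cont_comp[OF cf assms(2) i assms(3)]
  have c1: "continuous_on B (\<lambda>z. L 1 (g z))"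
    by (intro cont_comp assms(2) continuous_intros) (use assms(3) in auto)
  show cY: "continuous_on B (\<lambda>z. Y (f z) (g z))" unfolding Y_def
    using par by (intro continuous_intros cc(1) c1) auto
  show "continuous_on B (\<lambda>z. Yx (f z) (g z))" unfolding Yx_def
    by (intro continuous_intros cc(2) cl) (use nz in auto)
  show "continuous_on B (\<lambda>z. v (f z) (g z))" unfolding v_def A_def YL_def
    using par by (intro continuous_intros cc(3) cl cY c1) (use nz in auto)
qed

lemma dYx: "t \<ge> 0 \<Longrightarrow> 0 < x \<Longrightarrow> x < Lam t \<Longrightarrow> ((\<lambda>x. Y x t) has_real_derivative Yx x t) (at x)"
proof -
  assume a: "t \<ge> 0" "0 < x" "x < Lam t"
  have "((\<lambda>x. L (x / Lam t) t) has_real_derivative Ls (x / Lam t) t * (1 / Lam t)) (at x)"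
    by (rule DERIV_chain'[where f="\<lambda>x. x / Lam t" and g="\<lambda>s. L s t", rotated])
      (use dL[of "x / Lam t" t] frac_in'[OF a] a(1) in \<open>auto intro!: derivative_eq_intros\<close>)
  then show ?thesis unfolding Y_def Yx_def by (auto intro!: derivative_eq_intros)
qed

lemma dYxx: "t \<ge> 0 \<Longrightarrow> 0 < x \<Longrightarrow> x < Lam t \<Longrightarrow> ((\<lambda>x. Yx x t) has_real_derivative (YL x t - 2 * Yx x t / x)) (at x)"
proof -
  assume a: "t \<ge> 0" "0 < x" "x < Lam t"
  have l: "Lam t > 0" by (rule Lam_pos[OF a(1)])
  have "((\<lambda>x. Ls (x / Lam t) t) has_real_derivative (LL (x / Lam t) t - 2 * Ls (x / Lam t) t / (x / Lam t)) * (1 / Lam t)) (at x)"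
    by (rule DERIV_chain'[where f="\<lambda>x. x / Lam t" and g="\<lambda>s. Ls s t", rotated])
      (use dLs[of "x / Lam t" t] frac_in'[OF a] a(1) in \<open>auto intro!: derivative_eq_intros\<close>)
  from DERIV_cdivide[OF this, of "Lam t"] show ?thesis unfolding Yx_def YL_def
    by (rule DERIV_cong) (use l a in \<open>simp add: field_simps power2_eq_square\<close>)
qed

text \<open>At fixed \<open>x\<close> the scaled point \<open>x / Lam \<tau>\<close> moves with
  exactly the speed that cancels the transport term \<open>gf t * s * Ls s t\<close> of the
  equation.\<close>

lemma dYt: "t \<ge> 0 \<Longrightarrow> 0 \<le> x \<Longrightarrow> x < Lam t \<Longrightarrow> (Y x has_real_derivative v x t) (at t within {0..})"
proof -
  assume a: "t \<ge> 0" "0 \<le> x" "x < Lam t"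
  have l: "Lam t > 0" by (rule Lam_pos[OF a(1)])
  have f: "0 \<le> x / Lam t" "x / Lam t \<le> 1" using a l by auto
  have d1: "((\<lambda>t. L 1 t / gm) has_real_derivative q t / gm) (at t within {0..})"
    unfolding q_def using a by (intro DERIV_cdivide dLt) auto
  have "((\<lambda>\<tau>. L (x / Lam \<tau>) \<tau>) has_real_derivative
     Lt (x / Lam t) t + Ls (x / Lam t) t * (- x * Lam1 t / (Lam t)\<^sup>2)) (at t within {0..})"
  proof (cases "x = 0")
    \<comment> \<open>At the centre the curve is constant, while the chain rule needs an interior
      point.\<close>
    case True then show ?thesis using dLt[of 0 t] a by simp
  next
    case False
    then have x: "0 < x" using a by simp
    have da: "((\<lambda>\<tau>. x / Lam \<tau>) has_real_derivative (- x * Lam1 t / (Lam t)\<^sup>2)) (at t within {0..})"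
      using l by (auto intro!: derivative_eq_intros dLam a simp: power2_eq_square)
    have c: "continuous_on ({0<..<1} \<times> {0..}) (\<lambda>(s, t). Ls s t)"
      by (rule continuous_on_subset[OF contLs]) auto
    show ?thesis
      by (rule derivative_along_curve[where l=0 and u=1 and F=L and Fs=Ls and a="\<lambda>\<tau>. x / Lam \<tau>", OF _ _ _ _ c _ da])
        (use frac_in'[OF a(1) x a(3)] a in \<open>auto intro: dL dLt\<close>)
  qed
  from DERIV_diff[OF this d1] show ?thesis unfolding Y_def
  proof (rule DERIV_cong)
    show "Lt (x / Lam t) t + Ls (x / Lam t) t * (- x * Lam1 t / (Lam t)\<^sup>2) - q t / gm = v x t"
      unfolding pde'[OF f a(1)] v_eq[OF a(1)] Lam1_def using l Rpos[OF a(1)]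
      by (simp add: field_simps power2_eq_square)
  qed
qed

lemma Y_at_wall: "t \<ge> 0 \<Longrightarrow> Y (Lam t) t = (1 - 1 / gm) * L 1 t"
  using Lam_pos[of t] by (simp add: Y_def algebra_simps)

lemma v_at_wall: "t \<ge> 0 \<Longrightarrow> v (Lam t) t = (1 - 1 / gm) * q t + kap / (R t)\<^sup>2 * gf t * Ls 1 t"
  using pde'[of 1 t] Lam_pos[of t] v_eq[of t "Lam t"] unfolding q_def[of t, symmetric]
  by (simp add: algebra_simps)

lemma Ls_wall: "t \<ge> 0 \<Longrightarrow> Ls 1 t = Lam t * Yx (Lam t) t"
  using Lam_pos[of t] by (simp add: Yx_def)

text \<open>Integration of \<open>(x^2 Y_x)' = x^2 \<Delta>Y\<close> from the centre, where the
  gradient vanishes. It is carried out by the mean value theorem for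
  \<open>e * x^2 * Yx - c * x^3 / 3\<close> with both signs \<open>e\<close>.\<close>

lemma Yx_bound:
  assumes t: "t \<ge> 0" and x: "0 < x" "x \<le> Lam t" and c: "\<And>y. 0 < y \<Longrightarrow> y < x \<Longrightarrow> \<bar>YL y t\<bar> \<le> c"
  shows "\<bar>Yx x t\<bar> \<le> c * x / 3"
proof -
  have Yx0: "Yx 0 t = 0" using Ls0[OF t] by (simp add: Yx_def)
  have cY: "continuous_on {0..x} (\<lambda>y. Yx y t)"
    by (intro contY continuous_intros) (use t x in auto)
  have aux: "e * (x\<^sup>2 * Yx x t) - c * x ^ 3 / 3 \<le> 0" if e: "e = 1 \<or> e = -1" for e
  proof -
    let ?f = "\<lambda>y. e * (y\<^sup>2 * Yx y t) - c * y ^ 3 / 3"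
    have cf: "continuous_on {0..x} ?f" by (intro continuous_intros cY) auto
    have d: "(?f has_real_derivative y\<^sup>2 * (e * YL y t - c)) (at y)" if "0 < y" "y < x" for y
      using that x by (auto intro!: derivative_eq_intros dYxx t simp: field_simps power2_eq_square)
    have "\<exists>l z. 0 < z \<and> z < x \<and> (?f has_real_derivative l) (at z) \<and> ?f x - ?f 0 = (x - 0) * l"
      by (rule MVT[OF x(1) cf]) (use d real_differentiable_def in blast)
    then obtain l z where z: "0 < z" "z < x" "(?f has_real_derivative l) (at z)" "?f x - ?f 0 = x * l" by auto
    have "l = z\<^sup>2 * (e * YL z t - c)" using DERIV_unique[OF z(3) d[OF z(1,2)]] .
    moreover have "e * YL z t - c \<le> 0" using c[OF z(1,2)] e by auto
    ultimately have "l \<le> 0" by (simp add: mult_nonneg_nonpos)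
    then have "x * l \<le> 0" using x by (simp add: mult_nonneg_nonpos)
    then show ?thesis using z(4) Yx0 by simp
  qed
  have "e * Yx x t \<le> c * x / 3" if "e = 1 \<or> e = -1" for e
  proof -
    have "x\<^sup>2 * (e * Yx x t) \<le> x\<^sup>2 * (c * x / 3)"
      using aux[OF that] by (simp add: power2_eq_square power3_eq_cube mult_ac)
    then show ?thesis using x by simp
  qed
  from this[of 1] this[of "-1"] show ?thesis by (simp add: abs_le_iff)
qed

lemma YL_v: "YL x t = v x t / A x t" using A_pos[of x t] by (simp add: v_def)

end

section \<open>Smallness of the time derivative\<close>

text \<open>Packages the outcome of the energy argument. The caps \<open>\<epsilon> \<le> 1\<close>
  and \<open>\<epsilon> \<le> Rs / 2\<close> make the bounds for the domain and the coefficient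
  depend on the parameters alone.\<close>

locale bubble_near = bubble_flow +
  fixes \<epsilon> :: real
  assumes eps: "0 < \<epsilon>" "\<epsilon> \<le> 1" "\<epsilon> \<le> Rs / 2"
    and near: "\<And>t. t \<ge> 0 \<Longrightarrow> \<bar>R t - Rs\<bar> \<le> \<epsilon>" "\<And>t. t \<ge> 0 \<Longrightarrow> \<bar>R1 t\<bar> \<le> \<epsilon>" "\<And>t. t \<ge> 0 \<Longrightarrow> \<bar>L 1 t - ln rs\<bar> \<le> \<epsilon>"
    and near0: "\<And>s. 0 \<le> s \<Longrightarrow> s \<le> 1 \<Longrightarrow> \<bar>L s 0 - ln rs\<bar> \<le> \<epsilon>"

context bubble_par
begin

text \<open>Equilibrium value of \<open>Y\<close>. The four constants after it bound
  \<open>Lam\<close> and \<open>A\<close>, allowing a factor 2 for the radius, an error 1 in the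
  wall log density and an error 2 in \<open>Y\<close>.\<close>

definition "ys = (1 - 1 / gm) * ln rs"
definition "lam1 = Rs / 2 * exp ((ln rs - 1) / (3 * gm))"
definition "lam2 = 2 * Rs * exp ((ln rs + 1) / (3 * gm))"
definition "amin = kap * exp (- ((ln rs + 1) / (3 * gm))) * exp (- (ys + 2))"
definition "amax = kap * exp (- ((ln rs - 1) / (3 * gm))) * exp (- (ys - 2))"

lemma const_pos: "lam1 > 0" "lam2 > 0" "amin > 0" "amax > 0"
  using par Rs by (auto simp: lam1_def lam2_def amin_def amax_def)

end

context bubble_near
begin

lemma R_bounds: "t \<ge> 0 \<Longrightarrow> Rs / 2 \<le> R t" "t \<ge> 0 \<Longrightarrow> R t \<le> 2 * Rs"
  using near(1)[of t] eps Rs unfolding abs_le_iff by linarith+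

lemma L1_bounds: "t \<ge> 0 \<Longrightarrow> ln rs - 1 \<le> L 1 t" "t \<ge> 0 \<Longrightarrow> L 1 t \<le> ln rs + 1"
  using near(3)[of t] eps unfolding abs_le_iff by linarith+

lemma Lam_bounds: assumes "t \<ge> 0" shows "lam1 \<le> Lam t" "Lam t \<le> lam2"
proof -
  have "(ln rs - 1) / (3 * gm) \<le> L 1 t / (3 * gm)" "L 1 t / (3 * gm) \<le> (ln rs + 1) / (3 * gm)"
    using L1_bounds[OF assms] par by (auto intro: divide_right_mono)
  then show "lam1 \<le> Lam t" "Lam t \<le> lam2"
    unfolding lam1_def lam2_def Lam_def using R_bounds[OF assms] Rs
    by (intro mult_mono; simp)+
qed

text \<open>At the wall the deviation is at most \<open>\<epsilon>\<close> by the energy bound, and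
  initially at most \<open>2 * \<epsilon>\<close>, as both the profile and the wall value deviate.
  The equation has no source, so the larger bound persists.\<close>

lemma Y_near: assumes "t \<ge> 0" "0 \<le> x" "x \<le> Lam t" shows "\<bar>Y x t - ys\<bar> \<le> 2 * \<epsilon>"
proof -
  have k: "0 < 1 - 1 / gm" "1 - 1 / gm < 1" using par by auto
  \<comment> \<open>Barrier \<open>\<eta> * (1 + t + lam2 - x)\<close>: growth in time gives the
    strict inequality, and the slope \<open>- \<eta>\<close> excludes a maximum at the centre, where
    \<open>Yx\<close> vanishes. Afterwards \<open>\<eta>\<close> is made arbitrarily small.\<close>
  have aux: "e * (Y x t - ys) - \<eta> * (1 + t + lam2 - x) \<le> 2 * \<epsilon>" if e: "e = 1 \<or> e = -1" and eta: "\<eta> > 0" for e \<eta>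
  proof (rule parabolic_comparison[where w="\<lambda>x t. e * (Y x t - ys)" and S="\<lambda>x t. \<eta> * (1 + t + lam2 - x)"
      and \<l>=Lam and ?T0.0=0 and ?T1.0=t
      and wx="\<lambda>x t. e * Yx x t" and wxx="\<lambda>x t. e * (YL x t - 2 * Yx x t / x)" and wt="\<lambda>x t. e * v x t"
      and Sx="\<lambda>x t. - \<eta>" and Sxx="\<lambda>x t. 0" and St="\<lambda>x t. \<eta>"])
    show "continuous_on {0..t} Lam" by (rule continuous_on_subset[OF contLam]) auto
    show "continuous_on {(x, t'). 0 \<le> t' \<and> t' \<le> t \<and> 0 \<le> x \<and> x \<le> Lam t'} (\<lambda>(x, t). e * (Y x t - ys) - \<eta> * (1 + t + lam2 - x))"
      unfolding split_beta by (intro continuous_intros contY) auto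
    fix x' t' assume xt: "0 < x'" "x' < Lam t'" "0 < t'" "t' \<le> t"
    then have t': "t' \<ge> 0" by simp
    show "((\<lambda>x. e * (Y x t' - ys)) has_real_derivative e * Yx x' t') (at x')"
      using xt t' by (auto intro!: derivative_eq_intros dYx)
    show "((\<lambda>x. e * Yx x t') has_real_derivative e * (YL x' t' - 2 * Yx x' t' / x')) (at x')"
      using xt t' by (auto intro!: derivative_eq_intros dYxx)
    have "(Y x' has_real_derivative v x' t') (at t')"
      using dYt[OF t', of x'] xt at_within_half_line[OF xt(3)] by simp
    then show "((\<lambda>t. e * (Y x' t - ys)) has_real_derivative e * v x' t') (at t')"
      by (auto intro!: derivative_eq_intros)
    assume h: "e * Yx x' t' = - \<eta>" "e * (YL x' t' - 2 * Yx x' t' / x') \<le> 0"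
    have "e * v x' t' = A x' t' * (e * (YL x' t' - 2 * Yx x' t' / x') + 2 * (e * Yx x' t') / x')"
      using xt by (simp add: v_def field_simps)
    also have "\<dots> \<le> A x' t' * (2 * (- \<eta>) / x')" using h A_pos[of x' t'] by (intro mult_left_mono) auto
    also have "\<dots> < \<eta>" using eta xt A_pos[of x' t'] by (smt (verit) divide_neg_pos mult_pos_neg)
    finally show "e * v x' t' < \<eta>" .
  next
    fix t' assume t': "0 < t'" "t' \<le> t"
    have "continuous_on {0..Lam t'} (\<lambda>x. Yx x t')" by (intro contY continuous_intros) (use t' in auto)
    then have "((\<lambda>x. Yx x t') \<longlongrightarrow> Yx 0 t') (at 0 within {0..Lam t'})"
      using Lam_pos[of t'] t' by (auto simp: continuous_on_def)
    moreover have "Yx 0 t' = 0" using Ls0[of t'] t' by (simp add: Yx_def)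
    ultimately have "\<forall>\<^sub>F x in at 0 within {0..Lam t'}. \<bar>Yx x t'\<bar> < \<eta>"
      using tendstoD[of "\<lambda>x. Yx x t'" 0 "at 0 within {0..Lam t'}" \<eta>] eta by simp
    then obtain d where d: "d > 0" "\<And>x. x \<in> {0..Lam t'} \<Longrightarrow> x \<noteq> 0 \<Longrightarrow> dist x 0 < d \<Longrightarrow> \<bar>Yx x t'\<bar> < \<eta>"
      by (auto simp: eventually_at)
    show "\<exists>\<epsilon>>0. \<forall>x. 0 < x \<and> x < \<epsilon> \<longrightarrow> - \<eta> < e * Yx x t'"
    proof (intro exI[of _ "min d (Lam t')"] conjI allI impI)
      fix x assume "0 < x \<and> x < min d (Lam t')"
      then have "\<bar>Yx x t'\<bar> < \<eta>" by (intro d(2)) (auto simp: dist_real_def)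
      then show "- \<eta> < e * Yx x t'" using e by auto
    qed (use d Lam_pos[of t'] t' in auto)
  next
    fix t' assume t': "0 \<le> t'" "t' \<le> t"
    have "e * (Y (Lam t') t' - ys) = (1 - 1 / gm) * (e * (L 1 t' - ln rs))"
      by (simp add: Y_at_wall[OF t'(1)] ys_def algebra_simps)
    also have "\<dots> \<le> (1 - 1 / gm) * \<epsilon>" using near(3)[OF t'(1)] k e by (intro mult_left_mono) auto
    also have "\<dots> \<le> 1 * \<epsilon>" using k eps by (intro mult_right_mono) auto
    finally have "e * (Y (Lam t') t' - ys) \<le> 2 * \<epsilon>" using eps by simp
    moreover have "\<eta> * (1 + t' + lam2 - Lam t') \<ge> 0" using eta t' Lam_bounds[OF t'(1)] by simp
    ultimately show "e * (Y (Lam t') t' - ys) - \<eta> * (1 + t' + lam2 - Lam t') \<le> 2 * \<epsilon>" by simp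
  next
    fix x' assume x': "0 \<le> x'" "x' \<le> Lam 0"
    have i: "0 \<le> x' / Lam 0" "x' / Lam 0 \<le> 1" using frac_in[of 0 x'] x' by auto
    have "\<bar>L 1 0 - ln rs\<bar> / gm \<le> \<epsilon> / 1" using near(3)[of 0] par eps by (intro frac_le) auto
    then have "\<bar>(L 1 0 - ln rs) / gm\<bar> \<le> \<epsilon>" using par by simp
    moreover have "\<bar>L (x' / Lam 0) 0 - ln rs\<bar> \<le> \<epsilon>" by (rule near0[OF i])
    moreover have "Y x' 0 - ys = (L (x' / Lam 0) 0 - ln rs) - (L 1 0 - ln rs) / gm"
      by (simp add: Y_def ys_def algebra_simps diff_divide_distrib)
    ultimately have "\<bar>Y x' 0 - ys\<bar> \<le> 2 * \<epsilon>" unfolding abs_le_iff by linarith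
    then have "e * (Y x' 0 - ys) \<le> 2 * \<epsilon>" using e by auto
    moreover have "\<eta> * (1 + 0 + lam2 - x') \<ge> 0" using eta x' Lam_bounds[of 0] by simp
    ultimately show "e * (Y x' 0 - ys) - \<eta> * (1 + 0 + lam2 - x') \<le> 2 * \<epsilon>" by simp
  qed (use assms Lam_pos in \<open>auto intro!: derivative_eq_intros\<close>)
  have "e * (Y x t - ys) \<le> 2 * \<epsilon>" if e: "e = 1 \<or> e = -1" for e
  proof (rule field_le_epsilon)
    fix d :: real assume d: "d > 0"
    let ?c = "1 + t + lam2 - x"
    have c: "?c > 0" using assms Lam_bounds[of t] by simp
    then show "e * (Y x t - ys) \<le> 2 * \<epsilon> + d" using aux[OF e, of "d / ?c"] d by simp
  qed
  from this[of 1] this[of "-1"] show ?thesis by (simp add: abs_le_iff)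
qed

lemma A_bounds: assumes "t \<ge> 0" "0 \<le> x" "x \<le> Lam t" shows "amin \<le> A x t" "A x t \<le> amax"
proof -
  have 1: "(ln rs - 1) / (3 * gm) \<le> L 1 t / (3 * gm)" "L 1 t / (3 * gm) \<le> (ln rs + 1) / (3 * gm)"
    using L1_bounds[OF assms(1)] par by (auto intro: divide_right_mono)
  have 2: "ys - 2 \<le> Y x t" "Y x t \<le> ys + 2" using Y_near[OF assms] eps unfolding abs_le_iff by linarith+
  show "amin \<le> A x t" "A x t \<le> amax"
    unfolding amin_def amax_def A_def using 1 2 par by (intro mult_mono; simp)+
qed

end

lemma abs_exp_minus_one_le: "\<bar>z\<bar> \<le> 1 \<Longrightarrow> \<bar>exp z - 1\<bar> \<le> 2 * \<bar>z\<bar>" for z :: real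
proof -
  assume z: "\<bar>z\<bar> \<le> 1"
  have l: "exp z \<ge> 1 + z" by (rule exp_ge_add_one_self)
  show ?thesis
  proof (cases "z \<ge> 0")
    case True
    then have "exp z \<le> 1 + z + z\<^sup>2" using z by (intro exp_bound) auto
    moreover have "z\<^sup>2 \<le> z" using True z mult_left_le[of z z] by (simp add: power2_eq_square)
    ultimately show ?thesis using l True by simp
  next
    case False
    then have "\<bar>exp z - 1\<bar> = 1 - exp z" "\<bar>z\<bar> = - z" by auto
    then show ?thesis using l False by linarith
  qed
qed

section \<open>Difference quotients in time\<close>

context bubble_flow
begin

definition "dq h x t = (Y x (t + h) - Y x t) / h"
definition "dqx h x t = (Yx x (t + h) - Yx x t) / h"
definition "dqxx h x t = ((YL x (t + h) - 2 * Yx x (t + h) / x) - (YL x t - 2 * Yx x t / x)) / h"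
text \<open>Source in the equation of the quotient, caused by the change of the coefficient: the
  increment of \<open>A * \<Delta>Y\<close> is split with \<open>A\<close> taken at
  \<open>t + h\<close>, and the remainder involves the Laplacian only through
  \<open>v x t\<close>.\<close>

definition "dqF h x t = (A x (t + h) / A x t - 1) * v x t / h"

lemma dq_derivs:
  assumes "t > 0" "h > 0" "0 < x" "x < Lam t" "x < Lam (t + h)"
  shows "((\<lambda>x. dq h x t) has_real_derivative dqx h x t) (at x)"
    "((\<lambda>x. dqx h x t) has_real_derivative dqxx h x t) (at x)"
    "(dq h x has_real_derivative A x (t + h) * (dqxx h x t + 2 * dqx h x t / x) + dqF h x t) (at t)"
proof -
  have t: "t \<ge> 0" "t + h \<ge> 0" using assms by auto
  show "((\<lambda>x. dq h x t) has_real_derivative dqx h x t) (at x)"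
    unfolding dq_def dqx_def using assms t by (intro DERIV_cdivide DERIV_diff dYx) auto
  show "((\<lambda>x. dqx h x t) has_real_derivative dqxx h x t) (at x)"
    unfolding dqx_def dqxx_def using assms t by (intro DERIV_cdivide DERIV_diff dYxx) auto
  have a: "(Y x has_real_derivative v x t) (at t)"
    using dYt[of t x] at_within_half_line[of t] assms by simp
  have b: "(Y x has_real_derivative v x (t + h)) (at (t + h))"
    using dYt[of "t + h" x] at_within_half_line[of "t + h"] assms by simp
  then have "((\<lambda>t. Y x (t + h)) has_real_derivative v x (t + h)) (at t)" by (simp only: DERIV_shift)
  then have "(dq h x has_real_derivative (v x (t + h) - v x t) / h) (at t)"
    unfolding dq_def using a by (intro DERIV_cdivide DERIV_diff)
  moreover have "A x (t + h) * (dqxx h x t + 2 * dqx h x t / x) = (A x (t + h) * YL x (t + h) - A x (t + h) * YL x t) / h"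
    unfolding dqxx_def dqx_def by (simp add: diff_divide_distrib right_diff_distrib add_divide_distrib)
  then have "A x (t + h) * (dqxx h x t + 2 * dqx h x t / x) + dqF h x t = (v x (t + h) - v x t) / h"
    unfolding dqF_def v_def using A_pos[of x t]
    by (simp add: diff_divide_distrib algebra_simps)
  ultimately show "(dq h x has_real_derivative A x (t + h) * (dqxx h x t + 2 * dqx h x t / x) + dqF h x t) (at t)" by simp
qed

lemma Y_mvt:
  assumes "t \<ge> 0" "h > 0" "0 \<le> x" "\<And>\<tau>. t \<le> \<tau> \<Longrightarrow> \<tau> \<le> t + h \<Longrightarrow> x < Lam \<tau>"
  shows "\<exists>z. t < z \<and> z < t + h \<and> Y x (t + h) - Y x t = h * v x z"
proof -
  have "continuous_on {t..t + h} (Y x)"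
    by (intro contY continuous_intros) (use assms in \<open>auto intro: less_imp_le\<close>)
  moreover have "(Y x has_derivative (\<lambda>y. v x z * y)) (at z)" if "t < z" "z < t + h" for z
    using dYt[of z x] at_within_half_line[of z] assms that by (simp add: has_field_derivative_def)
  ultimately obtain z where "t < z" "z < t + h" "Y x (t + h) - Y x t = v x z * (t + h - t)"
    using mvt[of t "t + h" "Y x" "\<lambda>z y. v x z * y"] assms by auto
  then show ?thesis by (intro exI[of _ z]) (simp add: mult.commute)
qed

text \<open>The ratio of the coefficients is \<open>exp z\<close>, where \<open>z\<close> is
  \<open>- h\<close> times the sum of \<open>q / (3 * gm)\<close> and \<open>v\<close> at
  intermediate times; this cancels the division by \<open>h\<close>. The resulting bound is
  quadratic in the sizes of \<open>q\<close> and \<open>v\<close>. The factor 2 is that of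
  \<open>abs_exp_minus_one_le\<close>, which needs \<open>\<bar>z\<bar> \<le> 1\<close>.\<close>

lemma dqF_bound:
  assumes t: "t \<ge> 0" "h > 0" "0 \<le> x" "\<And>\<tau>. t \<le> \<tau> \<Longrightarrow> \<tau> \<le> t + h \<Longrightarrow> x < Lam \<tau>"
    and mu: "\<And>\<tau>. t \<le> \<tau> \<Longrightarrow> \<tau> \<le> t + h \<Longrightarrow> \<bar>v x \<tau>\<bar> \<le> \<mu>"
    and qb: "\<And>\<tau>. t \<le> \<tau> \<Longrightarrow> \<tau> \<le> t + h \<Longrightarrow> \<bar>q \<tau>\<bar> \<le> qb"
    and h: "h * (qb / (3 * gm) + \<mu>) \<le> 1"
  shows "\<bar>dqF h x t\<bar> \<le> 2 * (qb / (3 * gm) + \<mu>) * \<mu>"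
proof -
  have g: "gm > 0" using par by simp
  obtain z1 where z1: "t < z1" "z1 < t + h" "Y x (t + h) - Y x t = h * v x z1" using Y_mvt[OF t] by auto
  have "\<And>t. t \<ge> 0 \<Longrightarrow> (L 1 has_real_derivative q t) (at t within {0..})" using dLt by (simp add: q_def)
  from mvt_half_line[OF t(1) _ this, of "t + h"] t(2)
  obtain z2 where z2: "t < z2" "z2 < t + h" "L 1 (t + h) - L 1 t = h * q z2" by auto
  define z where "z = - (h * q z2 / (3 * gm)) - h * v x z1"
  have "A x (t + h) / A x t = exp (- (L 1 (t + h) / (3 * gm)) - Y x (t + h) - (- (L 1 t / (3 * gm)) - Y x t))"
  proof -
    have "kap * exp a * exp (- b) / (kap * exp c * exp (- d)) = exp (a - b - (c - d))" for a b c d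
      using par by (simp add: exp_diff exp_minus exp_add field_simps)
    then show ?thesis unfolding A_def .
  qed
  also have "- (L 1 (t + h) / (3 * gm)) - Y x (t + h) - (- (L 1 t / (3 * gm)) - Y x t)
     = - ((L 1 (t + h) - L 1 t) / (3 * gm)) - (Y x (t + h) - Y x t)"
    by (simp add: diff_divide_distrib)
  finally have Az: "A x (t + h) / A x t = exp z" unfolding z1(3) z2(3) z_def .
  have "\<bar>z\<bar> \<le> \<bar>h * q z2 / (3 * gm)\<bar> + \<bar>h * v x z1\<bar>" unfolding z_def using abs_triangle_ineq4[of "- (h * q z2 / (3 * gm))" "h * v x z1"] unfolding abs_minus_cancel .
  also have "\<dots> = h * (\<bar>q z2\<bar> / (3 * gm) + \<bar>v x z1\<bar>)" using t g by (simp add: abs_mult algebra_simps)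
  also have "\<dots> \<le> h * (qb / (3 * gm) + \<mu>)"
    using t g z1 z2 by (intro mult_left_mono add_mono divide_right_mono qb mu) auto
  finally have zb: "\<bar>z\<bar> \<le> h * (qb / (3 * gm) + \<mu>)" .
  then have "\<bar>exp z - 1\<bar> \<le> 2 * \<bar>z\<bar>" using h by (intro abs_exp_minus_one_le) simp
  also have "\<dots> \<le> 2 * (h * (qb / (3 * gm) + \<mu>))" using zb by simp
  finally have 1: "\<bar>exp z - 1\<bar> \<le> 2 * (h * (qb / (3 * gm) + \<mu>))" .
  have "\<bar>(exp z - 1) * v x t\<bar> \<le> 2 * (h * (qb / (3 * gm) + \<mu>)) * \<mu>"
    unfolding abs_mult using 1 mu[of t] t(2) by (intro mult_mono) auto
  then have "\<bar>(exp z - 1) * v x t\<bar> / h \<le> 2 * (h * (qb / (3 * gm) + \<mu>)) * \<mu> / h" using t by (intro divide_right_mono) auto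
  then show ?thesis unfolding dqF_def Az using t by (simp add: mult.assoc del: distrib_left_numeral)
qed

lemma compact_dom: "0 \<le> T0 \<Longrightarrow> compact {(x, t). T0 \<le> t \<and> t \<le> T1 \<and> 0 \<le> x \<and> x \<le> Lam t}"
  by (rule compact_moving_interval) (auto intro: Lam_pos continuous_on_subset[OF contLam])

text \<open>The quotient equals \<open>v\<close> at an intermediate time, so uniform continuity on a
  compact region suffices. The margin \<open>\<delta>\<close> keeps \<open>x\<close> inside the
  moving domain during the whole interval from \<open>t\<close> to \<open>t + h\<close>.\<close>

lemma dq_uniform:
  assumes d: "\<delta> > 0" and e: "\<eta> > 0"
  shows "\<exists>h0>0. h0 \<le> 1 \<and> (\<forall>h t x. 0 < h \<and> h < h0 \<and> 0 \<le> t \<and> t \<le> T \<and> 0 \<le> x \<and> x \<le> Lam t - \<delta> \<longrightarrow>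
      (\<forall>\<tau>. t \<le> \<tau> \<and> \<tau> \<le> t + h \<longrightarrow> x < Lam \<tau>) \<and> \<bar>dq h x t - v x t\<bar> \<le> \<eta>)"
proof -
  define Q where "Q = {(x, t). 0 \<le> t \<and> t \<le> T + 1 \<and> 0 \<le> x \<and> x \<le> Lam t}"
  have "continuous_on Q (\<lambda>z. v (fst z) (snd z))"
    by (intro contY continuous_intros) (auto simp: Q_def)
  then have "uniformly_continuous_on Q (\<lambda>z. v (fst z) (snd z))"
    using compact_dom[of 0 "T + 1"] by (intro compact_uniformly_continuous) (auto simp: Q_def)
  then obtain d1 where d1: "d1 > 0" "\<And>z z'. z \<in> Q \<Longrightarrow> z' \<in> Q \<Longrightarrow> dist z' z < d1 \<Longrightarrow>
      dist (v (fst z') (snd z')) (v (fst z) (snd z)) < \<eta>"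
    using e unfolding uniformly_continuous_on_def by metis
  have "uniformly_continuous_on {0..T + 1} Lam"
    by (intro compact_uniformly_continuous continuous_on_subset[OF contLam]) auto
  then obtain d2 where d2: "d2 > 0" "\<And>z z'. z \<in> {0..T + 1} \<Longrightarrow> z' \<in> {0..T + 1} \<Longrightarrow> dist z' z < d2 \<Longrightarrow>
      dist (Lam z') (Lam z) < \<delta>"
    using d unfolding uniformly_continuous_on_def by metis
  define h0 where "h0 = min 1 (min d1 d2)"
  have h0: "h0 > 0" "h0 \<le> 1" "h0 \<le> d1" "h0 \<le> d2" using d1 d2 by (auto simp: h0_def)
  show ?thesis
  proof (intro exI[of _ h0] conjI h0(1,2) allI impI, goal_cases)
    case (1 h t x \<tau>)
    then have "dist (Lam \<tau>) (Lam t) < \<delta>" using h0 by (intro d2) (auto simp: dist_real_def)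
    then show ?case using 1 unfolding dist_real_def by linarith
  next
    case (2 h t x)
    have in1: "x < Lam \<tau>" if "t \<le> \<tau>" "\<tau> \<le> t + h" for \<tau>
    proof -
      have "dist (Lam \<tau>) (Lam t) < \<delta>" using h0 2 that by (intro d2) (auto simp: dist_real_def)
      then show ?thesis using 2 unfolding dist_real_def by linarith
    qed
    obtain z where z: "t < z" "z < t + h" "Y x (t + h) - Y x t = h * v x z"
      using Y_mvt[of t h x] 2 in1 by auto
    have zt: "(x, z) \<in> Q" "(x, t) \<in> Q" using z 2 in1[of z] in1[of t] h0 by (auto simp: Q_def)
    have "dist (x, z) (x, t) < d1" using z 2 h0 by (simp add: dist_Pair_Pair dist_real_def)
    then have "\<bar>v x z - v x t\<bar> < \<eta>" using d1(2)[OF zt(2) zt(1)] by (simp add: dist_real_def)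
    moreover have "dq h x t = v x z" unfolding dq_def z(3) using 2 by simp
    ultimately show ?case by simp
  qed
qed

lemma Yx_tendsto_0: "t \<ge> 0 \<Longrightarrow> \<kappa> > 0 \<Longrightarrow> \<exists>d>0. \<forall>x. 0 < x \<and> x < d \<longrightarrow> \<bar>Yx x t\<bar> < \<kappa>"
proof -
  assume t: "t \<ge> 0" and k: "\<kappa> > 0"
  have "continuous_on {0..Lam t} (\<lambda>x. Yx x t)" by (intro contY continuous_intros) (use t in auto)
  then have "((\<lambda>x. Yx x t) \<longlongrightarrow> Yx 0 t) (at 0 within {0..Lam t})"
    using Lam_pos[of t] t by (auto simp: continuous_on_def)
  moreover have "Yx 0 t = 0" using Ls0[of t] t by (simp add: Yx_def)
  ultimately have "\<forall>\<^sub>F x in at 0 within {0..Lam t}. \<bar>Yx x t\<bar> < \<kappa>"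
    using tendstoD[of "\<lambda>x. Yx x t" 0 "at 0 within {0..Lam t}" \<kappa>] k by simp
  then obtain d where d: "d > 0" "\<And>x. x \<in> {0..Lam t} \<Longrightarrow> x \<noteq> 0 \<Longrightarrow> dist x 0 < d \<Longrightarrow> \<bar>Yx x t\<bar> < \<kappa>"
    by (auto simp: eventually_at)
  show ?thesis
  proof (intro exI[of _ "min d (Lam t)"] conjI allI impI)
    fix x assume "0 < x \<and> x < min d (Lam t)"
    then show "\<bar>Yx x t\<bar> < \<kappa>" by (intro d(2)) (auto simp: dist_real_def)
  qed (use d Lam_pos[of t] t in auto)
qed

lemma dqx_tendsto_0: "t \<ge> 0 \<Longrightarrow> h > 0 \<Longrightarrow> \<kappa> > 0 \<Longrightarrow> \<exists>d>0. \<forall>x. 0 < x \<and> x < d \<longrightarrow> \<bar>dqx h x t\<bar> < \<kappa>"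
proof -
  assume t: "t \<ge> 0" "h > 0" and k: "\<kappa> > 0"
  obtain d1 where d1: "d1 > 0" "\<And>x. 0 < x \<Longrightarrow> x < d1 \<Longrightarrow> \<bar>Yx x t\<bar> < \<kappa> * h / 2"
    using Yx_tendsto_0[of t "\<kappa> * h / 2"] t k by auto
  obtain d2 where d2: "d2 > 0" "\<And>x. 0 < x \<Longrightarrow> x < d2 \<Longrightarrow> \<bar>Yx x (t + h)\<bar> < \<kappa> * h / 2"
    using Yx_tendsto_0[of "t + h" "\<kappa> * h / 2"] t k by auto
  show ?thesis
  proof (intro exI[of _ "min d1 d2"] conjI allI impI)
    fix x assume "0 < x \<and> x < min d1 d2"
    then have "\<bar>Yx x (t + h) - Yx x t\<bar> < \<kappa> * h" using d1(2)[of x] d2(2)[of x] unfolding abs_less_iff by simp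
    then show "\<bar>dqx h x t\<bar> < \<kappa>" unfolding dqx_def using t by (simp add: field_simps)
  qed (use d1 d2 in auto)
qed

end

context bubble_near
begin

text \<open>Comparison for \<open>v = Y\<^sub>t\<close>. Since \<open>v\<close> is not known to be differentiable, the maximum principle is applied to the
  difference quotients \<open>dq h\<close> on slightly smaller domains. The barrier is a supersolution for every
  coefficient in \<open>[amin, amax]\<close>.\<close>

lemma v_comparison:
  assumes e: "e = 1 \<or> e = -1" and T: "0 \<le> T0" "T0 \<le> T1" "T1 < T2"
    and mu: "\<And>x t. T0 \<le> t \<Longrightarrow> t < T2 \<Longrightarrow> 0 \<le> x \<Longrightarrow> x \<le> Lam t \<Longrightarrow> \<bar>v x t\<bar> \<le> \<mu>"
    and qb: "\<And>t. T0 \<le> t \<Longrightarrow> t < T2 \<Longrightarrow> \<bar>q t\<bar> \<le> qb"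
    and dS: "\<And>x t. 0 < x \<Longrightarrow> x < Lam t \<Longrightarrow> T0 < t \<Longrightarrow> t \<le> T1 \<Longrightarrow> ((\<lambda>x. S x t) has_real_derivative Sx x t) (at x)"
      "\<And>x t. 0 < x \<Longrightarrow> x < Lam t \<Longrightarrow> T0 < t \<Longrightarrow> t \<le> T1 \<Longrightarrow> ((\<lambda>x. Sx x t) has_real_derivative Sxx x t) (at x)"
      "\<And>x t. 0 < x \<Longrightarrow> x < Lam t \<Longrightarrow> T0 < t \<Longrightarrow> t \<le> T1 \<Longrightarrow> (S x has_real_derivative St x t) (at t)"
    and cS: "continuous_on {(x, t). T0 \<le> t \<and> t \<le> T1 \<and> 0 \<le> x \<and> x \<le> Lam t} (\<lambda>(x, t). S x t)"
    and super: "\<And>x t a. 0 < x \<Longrightarrow> x < Lam t \<Longrightarrow> T0 < t \<Longrightarrow> t \<le> T1 \<Longrightarrow> amin \<le> a \<Longrightarrow> a \<le> amax \<Longrightarrow>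
       a * (Sxx x t + 2 * Sx x t / x) + 2 * (qb / (3 * gm) + \<mu>) * \<mu> < St x t"
    and centre: "\<And>t. T0 < t \<Longrightarrow> t \<le> T1 \<Longrightarrow> \<exists>\<kappa>>0. \<exists>d>0. \<forall>x. 0 < x \<and> x < d \<longrightarrow> Sx x t \<le> - \<kappa>"
    and bdry: "\<And>t. T0 \<le> t \<Longrightarrow> t \<le> T1 \<Longrightarrow> e * v (Lam t) t \<le> S (Lam t) t"
    and init: "\<And>x. 0 \<le> x \<Longrightarrow> x \<le> Lam T0 \<Longrightarrow> e * v x T0 \<le> S x T0"
    and xt: "T0 \<le> t" "t \<le> T1" "0 \<le> x" "x \<le> Lam t"
  shows "e * v x t \<le> S x t"
proof (rule ccontr)
  assume "\<not> e * v x t \<le> S x t"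
  define M where "M = e * v x t - S x t"
  have M: "M > 0" using \<open>\<not> e * v x t \<le> S x t\<close> by (simp add: M_def)
  define Q where "Q = {(x, t). T0 \<le> t \<and> t \<le> T1 \<and> 0 \<le> x \<and> x \<le> Lam t}"
  have cv: "continuous_on Q (\<lambda>z. e * v (fst z) (snd z) - S (fst z) (snd z))"
    using cS T unfolding Q_def[symmetric] split_beta
    by (intro continuous_intros contY) (auto simp: Q_def)
  then have "uniformly_continuous_on Q (\<lambda>z. e * v (fst z) (snd z) - S (fst z) (snd z))"
    using compact_dom[OF T(1), of T1] by (intro compact_uniformly_continuous) (auto simp: Q_def)
  then obtain d1 where d1: "d1 > 0" "\<And>z z'. z \<in> Q \<Longrightarrow> z' \<in> Q \<Longrightarrow> dist z' z < d1 \<Longrightarrow>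
      dist (e * v (fst z') (snd z') - S (fst z') (snd z')) (e * v (fst z) (snd z) - S (fst z) (snd z)) < M / 4"
    unfolding uniformly_continuous_on_def using M by (metis zero_less_divide_iff zero_less_numeral)
  have xl: "x < Lam t" using M bdry[OF xt(1,2)] xt by (cases "x = Lam t") (auto simp: M_def)
  \<comment> \<open>Small enough that \<open>e * v - S\<close> at distance \<open>\<delta>\<close>
    from the wall exceeds its wall value by less than \<open>M / 4\<close>, and that the offending
    point \<open>x\<close> still lies in the reduced domain.\<close>
  define \<delta> where "\<delta> = min (d1 / 2) (min (lam1 / 2) (Lam t - x))"
  have dd: "\<delta> > 0" "\<delta> < d1" "\<delta> < lam1" "x \<le> Lam t - \<delta>" using d1 const_pos xl by (auto simp: \<delta>_def)
  have near_wall: "e * v (Lam s - \<delta>) s - S (Lam s - \<delta>) s \<le> M / 4" if s: "T0 \<le> s" "s \<le> T1" for s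
  proof -
    have s0: "s \<ge> 0" using s T by simp
    have "(Lam s, s) \<in> Q" "(Lam s - \<delta>, s) \<in> Q" using Lam_bounds[OF s0] dd s const_pos by (auto simp: Q_def)
    moreover have "dist (Lam s - \<delta>, s) (Lam s, s) < d1" using dd by (simp add: dist_Pair_Pair dist_real_def)
    ultimately have "\<bar>(e * v (Lam s - \<delta>) s - S (Lam s - \<delta>) s) - (e * v (Lam s) s - S (Lam s) s)\<bar> < M / 4"
      using d1(2) by (fastforce simp: dist_real_def)
    then show ?thesis using bdry[OF s] unfolding abs_less_iff by linarith
  qed
  obtain h0 where h0: "h0 > 0" "h0 \<le> 1" "\<And>h t x. 0 < h \<Longrightarrow> h < h0 \<Longrightarrow> 0 \<le> t \<Longrightarrow> t \<le> T1 \<Longrightarrow> 0 \<le> x \<Longrightarrow> x \<le> Lam t - \<delta> \<Longrightarrow>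
      (\<forall>\<tau>. t \<le> \<tau> \<and> \<tau> \<le> t + h \<longrightarrow> x < Lam \<tau>) \<and> \<bar>dq h x t - v x t\<bar> \<le> M / 8"
    using dq_uniform[OF dd(1), of "M / 8" T1] M by auto
  have q0: "qb \<ge> 0" "\<mu> \<ge> 0" using qb[of T0] mu[of T0 0] T Lam_pos[of T0] by auto
  \<comment> \<open>The three entries ensure closeness of the quotient to \<open>v\<close>, room for
    \<open>t + h\<close> before \<open>T2\<close>, and the smallness required by
    \<open>dqF_bound\<close>.\<close>
  define h where "h = min (h0 / 2) (min ((T2 - T1) / 2) (1 / (qb / (3 * gm) + \<mu> + 1)))"
  have cpos: "qb / (3 * gm) + \<mu> \<ge> 0" using q0 par by simp
  have h: "0 < h" "h < h0" "h < T2 - T1" "h \<le> 1 / (qb / (3 * gm) + \<mu> + 1)"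
    using h0 T cpos by (auto simp: h_def min_def)
  have "h * (qb / (3 * gm) + \<mu>) \<le> 1 / (qb / (3 * gm) + \<mu> + 1) * (qb / (3 * gm) + \<mu>)" using h(4) cpos by (intro mult_right_mono)
  also have "\<dots> \<le> 1" using cpos by simp
  finally have h1: "h * (qb / (3 * gm) + \<mu>) \<le> 1" .
  have inn: "x < Lam \<tau>" if "T0 \<le> t" "t \<le> T1" "0 \<le> x" "x \<le> Lam t - \<delta>" "t \<le> \<tau>" "\<tau> \<le> t + h" for x t \<tau>
    using h0(3)[of h t x] h that T by auto
  have close: "\<bar>dq h x t - v x t\<bar> \<le> M / 8" if "T0 \<le> t" "t \<le> T1" "0 \<le> x" "x \<le> Lam t - \<delta>" for x t
    using h0(3)[of h t x] h that T by auto
  have close': "e * dq h x t \<le> e * v x t + M / 8" "e * v x t \<le> e * dq h x t + M / 8"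
    if "T0 \<le> t" "t \<le> T1" "0 \<le> x" "x \<le> Lam t - \<delta>" for x t
    using close[OF that] e unfolding abs_le_iff by auto
  \<comment> \<open>On the parabolic boundary the quotient exceeds \<open>S\<close> by at most
    \<open>M / 4 + M / 8\<close>, whereas at the offending point it would exceed it by at least
    \<open>M - M / 8\<close>; the threshold \<open>M / 2\<close> lies between.\<close>
  have "e * dq h x t - S x t \<le> M / 2"
  proof (rule parabolic_comparison[where w="\<lambda>x t. e * dq h x t" and S=S
      and \<l>="\<lambda>t. Lam t - \<delta>" and ?T0.0=T0 and ?T1.0=T1
      and wx="\<lambda>x t. e * dqx h x t" and wxx="\<lambda>x t. e * dqxx h x t"
      and wt="\<lambda>x t. e * (A x (t + h) * (dqxx h x t + 2 * dqx h x t / x) + dqF h x t)"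
      and Sx=Sx and Sxx=Sxx and St=St])
    show "continuous_on {T0..T1} (\<lambda>t. Lam t - \<delta>)"
      by (intro continuous_intros continuous_on_subset[OF contLam]) (use T in auto)
    show "0 < Lam s - \<delta>" if "T0 \<le> s" "s \<le> T1" for s using Lam_bounds[of s] dd that T by simp
    have "continuous_on {(x, t). T0 \<le> t \<and> t \<le> T1 \<and> 0 \<le> x \<and> x \<le> Lam t - \<delta>} (\<lambda>z. S (fst z) (snd z))"
      by (rule continuous_on_subset[OF cS[unfolded split_beta]]) (use dd in auto)
    then show "continuous_on {(x, t). T0 \<le> t \<and> t \<le> T1 \<and> 0 \<le> x \<and> x \<le> Lam t - \<delta>} (\<lambda>(x, t). e * dq h x t - S x t)"
      unfolding split_beta dq_def using h T dd
      by (intro continuous_intros contY) (auto intro: less_imp_le[OF inn])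
    fix x' t' assume xt': "0 < x'" "x' < Lam t' - \<delta>" "T0 < t'" "t' \<le> T1"
    then have t'0: "t' > 0" using T by simp
    have lx: "x' < Lam t'" "x' < Lam (t' + h)" using inn[of t' x'] xt' h by auto
    note dd' = dq_derivs[OF t'0 h(1) xt'(1) lx]
    show "((\<lambda>x. e * dq h x t') has_real_derivative e * dqx h x' t') (at x')"
      "((\<lambda>x. e * dqx h x t') has_real_derivative e * dqxx h x' t') (at x')"
      "((\<lambda>t. e * dq h x' t) has_real_derivative e * (A x' (t' + h) * (dqxx h x' t' + 2 * dqx h x' t' / x') + dqF h x' t')) (at t')"
      by (intro DERIV_cmult dd')+
    show "((\<lambda>x. S x t') has_real_derivative Sx x' t') (at x')" "((\<lambda>x. Sx x t') has_real_derivative Sxx x' t') (at x')"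
      "(S x' has_real_derivative St x' t') (at t')" by (intro dS xt' lx)+
    assume m: "e * dqx h x' t' = Sx x' t'" "e * dqxx h x' t' \<le> Sxx x' t'"
    have ab: "amin \<le> A x' (t' + h)" "A x' (t' + h) \<le> amax" using A_bounds[of "t' + h" x'] t'0 h xt' lx by auto
    have F: "\<bar>dqF h x' t'\<bar> \<le> 2 * (qb / (3 * gm) + \<mu>) * \<mu>"
    proof (rule dqF_bound[OF _ h(1) _ _ _ _ h1])
      fix \<tau> assume tau: "t' \<le> \<tau>" "\<tau> \<le> t' + h"
      show "x' < Lam \<tau>" using inn[of t' x' \<tau>] tau xt' by auto
      then show "\<bar>v x' \<tau>\<bar> \<le> \<mu>" using mu[of \<tau> x'] tau xt' h by auto
      show "\<bar>q \<tau>\<bar> \<le> qb" using qb[of \<tau>] tau xt' h by auto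
    qed (use t'0 xt' in auto)
    have "e * (A x' (t' + h) * (dqxx h x' t' + 2 * dqx h x' t' / x') + dqF h x' t')
       = A x' (t' + h) * (e * dqxx h x' t' + 2 * (e * dqx h x' t') / x') + e * dqF h x' t'"
      by (simp add: algebra_simps)
    also have "\<dots> \<le> A x' (t' + h) * (Sxx x' t' + 2 * Sx x' t' / x') + 2 * (qb / (3 * gm) + \<mu>) * \<mu>"
      unfolding m(1) using m(2) A_pos[of x' "t' + h"] F e by (intro add_mono mult_left_mono) auto
    also have "\<dots> < St x' t'" by (rule super[OF xt'(1) lx(1) xt'(3,4) ab])
    finally show "e * (A x' (t' + h) * (dqxx h x' t' + 2 * dqx h x' t' / x') + dqF h x' t') < St x' t'" .
  next
    fix s assume s: "T0 < s" "s \<le> T1"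
    obtain \<kappa> d where kd: "\<kappa> > 0" "d > 0" "\<And>x. 0 < x \<Longrightarrow> x < d \<Longrightarrow> Sx x s \<le> - \<kappa>" using centre[OF s] by auto
    obtain d' where d': "d' > 0" "\<And>x. 0 < x \<Longrightarrow> x < d' \<Longrightarrow> \<bar>dqx h x s\<bar> < \<kappa>"
      using dqx_tendsto_0[of s h \<kappa>] kd h s T by auto
    show "\<exists>\<epsilon>>0. \<forall>x. 0 < x \<and> x < \<epsilon> \<longrightarrow> Sx x s < e * dqx h x s"
    proof (intro exI[of _ "min d d'"] conjI allI impI)
      fix x assume "0 < x \<and> x < min d d'"
      then have "\<bar>dqx h x s\<bar> < \<kappa>" "Sx x s \<le> - \<kappa>" using kd d' by auto
      then show "Sx x s < e * dqx h x s" using e by auto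
    qed (use kd d' in auto)
  next
    fix s assume s: "T0 \<le> s" "s \<le> T1"
    have "0 \<le> Lam s - \<delta>" using Lam_bounds[of s] dd s T by simp
    then show "e * dq h (Lam s - \<delta>) s - S (Lam s - \<delta>) s \<le> M / 2"
      using close'(1)[OF s, of "Lam s - \<delta>"] near_wall[OF s] M by simp
  next
    fix x' assume x': "0 \<le> x'" "x' \<le> Lam T0 - \<delta>"
    then show "e * dq h x' T0 - S x' T0 \<le> M / 2"
      using close'(1)[of T0 x'] init[of x'] T dd M by simp
  qed (use T xt dd in auto)
  moreover have "M \<le> e * dq h x t - S x t + M / 8" using close'(2)[OF xt(1,2,3) dd(4)] by (simp add: M_def)
  ultimately show False using M by simp
qed

end

section \<open>Bootstrap for the size of the time derivative\<close>

context bubble_par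
begin

text \<open>\<open>kw\<close> converts the wall gradient into the flux term of the velocity law.
  \<open>K1\<close> collects the coefficients in the bounds for \<open>Lam1\<close>,
  \<open>q\<close> and the wall value of \<open>v\<close>; \<open>K2\<close> is the height of the
  linear barrier per unit of source; \<open>K3\<close> converts the initial Laplacian into
  \<open>v\<close>.\<close>

definition "kw = 4 * kap * lam2 * exp (1 - ln rs) / Rs\<^sup>2"
definition "K1 = 1 + 6 * gm / Rs + 3 * gm * kw + kw * lam2"
definition "K2 = lam2 * (lam2 + 1) / (2 * amin)"
definition "K3 = amax / lam1\<^sup>2"

lemma K_pos: "kw > 0" "K1 \<ge> 1" "K2 > 0" "K3 > 0"
  using par Rs const_pos by (auto simp: kw_def K1_def K2_def K3_def intro!: add_nonneg_nonneg mult_nonneg_nonneg)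

text \<open>Bound for the wall gradient by interpolation at length \<open>\<delta>\<close>: an
  oscillation \<open>4 * \<epsilon>\<close> of \<open>Y\<close> gives the first term, a bound
  \<open>2 * (\<mu> / amin)\<close> for \<open>Y_xx\<close> the second.\<close>

definition "wall_grad \<epsilon> \<delta> \<mu> = 4 * \<epsilon> / \<delta> + 2 * (\<mu> / amin) * \<delta>"

text \<open>The clauses on \<open>wall_grad\<close> yield, in this order, a small speed of the end
  point, the bound \<open>\<bar>q\<bar> \<le> \<mu>\<close>, and the improvement of the bound on
  \<open>v\<close> from \<open>\<mu>\<close> to \<open>\<mu> / 2\<close>.\<close>

definition "admissible_size \<mu> \<epsilon> \<longleftrightarrow> (\<exists>\<delta>. 0 < \<delta> \<and> \<delta> \<le> lam1 / 2 \<and> wall_grad \<epsilon> \<delta> \<mu> \<le> \<mu> / (8 * K1) \<and>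
   K1 * (\<epsilon> + wall_grad \<epsilon> \<delta> \<mu>) \<le> \<mu> \<and> K3 * \<epsilon> + K1 * (\<epsilon> + wall_grad \<epsilon> \<delta> \<mu> + (wall_grad \<epsilon> \<delta> \<mu>)\<^sup>2) + K2 * (4 * \<mu>\<^sup>2 + \<epsilon>) \<le> \<mu> / 2)"

text \<open>Order of choice: \<open>\<mu>\<close> small enough that the quadratic source is a
  fraction of \<open>\<mu>\<close>, a length \<open>\<delta>\<close> that depends on the parameters
  only, and last \<open>\<epsilon>\<close> small against \<open>\<mu> * \<delta>\<close>.\<close>

lemma admissible_size_ex: "\<exists>\<mu>0>0. \<forall>\<mu>. 0 < \<mu> \<and> \<mu> \<le> \<mu>0 \<longrightarrow> (\<exists>\<epsilon>0>0. \<forall>\<epsilon>. 0 < \<epsilon> \<and> \<epsilon> \<le> \<epsilon>0 \<longrightarrow> admissible_size \<mu> \<epsilon>)"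
proof (rule exI[of _ "min 1 (1 / (64 * K2))"], intro conjI allI impI)
  show "min 1 (1 / (64 * K2)) > 0" using K_pos by simp
  fix \<mu> assume "0 < \<mu> \<and> \<mu> \<le> min 1 (1 / (64 * K2))"
  then have mu: "0 < \<mu>" "\<mu> \<le> 1" "\<mu> \<le> 1 / (64 * K2)" by auto
  \<comment> \<open>Makes the part \<open>2 * (\<mu> / amin) * \<delta>\<close> of
    \<open>wall_grad\<close> at most \<open>\<mu> / (16 * K1)\<close>, leaving an equal share for
    \<open>4 * \<epsilon> / \<delta>\<close>.\<close>
  define \<delta> where "\<delta> = min (lam1 / 2) (amin / (32 * K1))"
  have d: "\<delta> > 0" "\<delta> \<le> lam1 / 2" "\<delta> \<le> amin / (32 * K1)" using const_pos K_pos by (auto simp: \<delta>_def)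
  define e0 where "e0 = min (\<mu> * \<delta> / (64 * K1)) (min (\<mu> / (16 * K1)) (min (\<mu> / (16 * K2)) (\<mu> / (16 * K3))))"
  have e0: "e0 > 0" using mu d K_pos by (auto simp: e0_def)
  show "\<exists>\<epsilon>0>0. \<forall>\<epsilon>. 0 < \<epsilon> \<and> \<epsilon> \<le> \<epsilon>0 \<longrightarrow> admissible_size \<mu> \<epsilon>"
  proof (intro exI[of _ e0] conjI allI impI e0)
    fix \<epsilon> assume "0 < \<epsilon> \<and> \<epsilon> \<le> e0"
    then have e: "0 < \<epsilon>" "\<epsilon> \<le> \<mu> * \<delta> / (64 * K1)" "\<epsilon> \<le> \<mu> / (16 * K1)" "\<epsilon> \<le> \<mu> / (16 * K2)" "\<epsilon> \<le> \<mu> / (16 * K3)"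
      by (auto simp: e0_def)
    have K: "K1 > 0" "K2 > 0" "K3 > 0" using K_pos by auto
    let ?G = "wall_grad \<epsilon> \<delta> \<mu>"
    have "4 * \<epsilon> / \<delta> \<le> 4 * (\<mu> * \<delta> / (64 * K1)) / \<delta>" using e(2) d by (intro divide_right_mono mult_left_mono) auto
    also have "\<dots> = \<mu> / (16 * K1)" using d by simp
    finally have 1: "4 * \<epsilon> / \<delta> \<le> \<mu> / (16 * K1)" .
    have "2 * (\<mu> / amin) * \<delta> \<le> 2 * (\<mu> / amin) * (amin / (32 * K1))" using d mu const_pos by (intro mult_left_mono) auto
    also have "\<dots> = \<mu> / (16 * K1)" using const_pos by simp
    finally have 2: "2 * (\<mu> / amin) * \<delta> \<le> \<mu> / (16 * K1)" .
    have G: "?G \<le> \<mu> / (8 * K1)" using 1 2 unfolding wall_grad_def by simp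
    have G0: "?G \<ge> 0" unfolding wall_grad_def using e d mu const_pos by simp
    have KG: "K1 * ?G \<le> \<mu> / 8" using G K by (simp add: field_simps)
    have Ke: "K1 * \<epsilon> \<le> \<mu> / 16" "K2 * \<epsilon> \<le> \<mu> / 16" "K3 * \<epsilon> \<le> \<mu> / 16" using e(3,4,5) K by (simp_all add: field_simps)
    have "?G \<le> \<mu> / 8" using KG mult_right_mono[OF K_pos(2) G0] by simp
    then have G1: "?G \<le> 1 / 8" using mu by simp
    have "K1 * ?G\<^sup>2 = (K1 * ?G) * ?G" by (simp add: power2_eq_square)
    also have "\<dots> \<le> (\<mu> / 8) * (1 / 8)" using KG G1 G0 K mu by (intro mult_mono) auto
    finally have KG2: "K1 * ?G\<^sup>2 \<le> \<mu> / 64" by simp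
    have "K2 * (4 * \<mu>\<^sup>2) = 4 * (K2 * \<mu>) * \<mu>" by (simp add: power2_eq_square)
    also have "\<dots> \<le> 4 * (1 / 64) * \<mu>" using mu K by (intro mult_right_mono mult_left_mono) (auto simp: field_simps)
    finally have K2m: "K2 * (4 * \<mu>\<^sup>2) \<le> \<mu> / 16" by simp
    show "admissible_size \<mu> \<epsilon>" unfolding admissible_size_def
    proof (rule exI[of _ \<delta>], intro conjI d(1,2) G)
      show "K1 * (\<epsilon> + ?G) \<le> \<mu>" using Ke KG mu by (simp add: distrib_left)
      show "K3 * \<epsilon> + K1 * (\<epsilon> + ?G + ?G\<^sup>2) + K2 * (4 * \<mu>\<^sup>2 + \<epsilon>) \<le> \<mu> / 2"
        using Ke KG KG2 K2m mu by (simp add: distrib_left)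
    qed
  qed
qed

end

context bubble_near
begin

lemma exp_L1: "t \<ge> 0 \<Longrightarrow> exp (- L 1 t) \<le> exp (1 - ln rs)" using L1_bounds[of t] by simp

lemma kap_gf_bound: assumes "t \<ge> 0" shows "\<bar>kap * gf t / (R t)\<^sup>2\<bar> \<le> kw * \<bar>Yx (Lam t) t\<bar>"
proof -
  have R: "R t > 0" by (rule Rpos[OF assms])
  have "\<bar>gf t\<bar> = Lam t * \<bar>Yx (Lam t) t\<bar> * exp (- L 1 t)"
    unfolding gf_def Ls_wall[OF assms] using Lam_pos[OF assms] by (simp add: abs_mult exp_minus field_simps)
  also have "\<dots> \<le> lam2 * \<bar>Yx (Lam t) t\<bar> * exp (1 - ln rs)"
    using Lam_bounds[OF assms] exp_L1[OF assms] const_pos by (intro mult_mono) auto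
  finally have g: "\<bar>gf t\<bar> \<le> lam2 * \<bar>Yx (Lam t) t\<bar> * exp (1 - ln rs)" .
  have "\<bar>kap * gf t / (R t)\<^sup>2\<bar> = kap * \<bar>gf t\<bar> / (R t)\<^sup>2" using par by (simp add: abs_mult)
  also have "\<dots> \<le> kap * (lam2 * \<bar>Yx (Lam t) t\<bar> * exp (1 - ln rs)) / (Rs / 2)\<^sup>2"
    using g R_bounds[OF assms] R Rs par const_pos by (intro frac_le mult_left_mono power_mono mult_nonneg_nonneg) (auto intro: order.trans[OF abs_ge_zero g])
  also have "\<dots> = kw * \<bar>Yx (Lam t) t\<bar>" by (simp add: kw_def power_divide)
  finally show ?thesis .
qed

lemma Lam1_bound: assumes "t \<ge> 0" shows "\<bar>Lam1 t\<bar> \<le> K1 * \<bar>Yx (Lam t) t\<bar>"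
proof -
  have "\<bar>Lam1 t\<bar> = \<bar>kap * gf t / (R t)\<^sup>2\<bar> * Lam t" unfolding Lam1_def using Lam_pos[OF assms] by (simp add: abs_mult)
  also have "\<dots> \<le> kw * \<bar>Yx (Lam t) t\<bar> * lam2" using kap_gf_bound[OF assms] Lam_bounds[OF assms] Lam_pos[OF assms] K_pos by (intro mult_mono) auto
  also have "\<dots> = (kw * lam2) * \<bar>Yx (Lam t) t\<bar>" by simp
  also have "\<dots> \<le> K1 * \<bar>Yx (Lam t) t\<bar>" using K_pos par Rs const_pos by (intro mult_right_mono) (auto simp: K1_def)
  finally show ?thesis .
qed

lemma q_bound: assumes "t \<ge> 0" shows "\<bar>q t\<bar> \<le> K1 * (\<epsilon> + \<bar>Yx (Lam t) t\<bar>)"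
proof -
  have R: "R t > 0" by (rule Rpos[OF assms])
  have "q t = gm * (- 3 * (R1 t / R t) - 3 * (kap * gf t / (R t)\<^sup>2))" using wallv'[OF assms] par by (simp add: field_simps)
  then have "\<bar>q t\<bar> = gm * \<bar>- 3 * (R1 t / R t) - 3 * (kap * gf t / (R t)\<^sup>2)\<bar>" using par by (simp add: abs_mult)
  also have "\<dots> \<le> gm * (3 * \<bar>R1 t / R t\<bar> + 3 * \<bar>kap * gf t / (R t)\<^sup>2\<bar>)"
    using par abs_triangle_ineq4[of "- 3 * (R1 t / R t)" "3 * (kap * gf t / (R t)\<^sup>2)"] by (intro mult_left_mono) (auto simp: abs_mult)
  also have "\<dots> \<le> gm * (3 * (\<epsilon> / (Rs / 2)) + 3 * (kw * \<bar>Yx (Lam t) t\<bar>))"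
  proof -
    have "\<bar>R1 t / R t\<bar> = \<bar>R1 t\<bar> / R t" using R by simp
    also have "\<dots> \<le> \<epsilon> / (Rs / 2)" using near(2)[OF assms] R_bounds[OF assms] R Rs by (intro frac_le) auto
    finally show ?thesis using kap_gf_bound[OF assms] par by (intro mult_left_mono add_mono) auto
  qed
  also have "\<dots> = (6 * gm / Rs) * \<epsilon> + (3 * gm * kw) * \<bar>Yx (Lam t) t\<bar>" by (simp add: algebra_simps)
  also have "\<dots> \<le> K1 * \<epsilon> + K1 * \<bar>Yx (Lam t) t\<bar>" using K_pos par Rs const_pos eps by (intro add_mono mult_right_mono) (auto simp: K1_def)
  finally show ?thesis by (simp add: distrib_left)
qed

lemma v_wall_bound: assumes "t \<ge> 0" shows "\<bar>v (Lam t) t\<bar> \<le> K1 * (\<epsilon> + \<bar>Yx (Lam t) t\<bar> + (Yx (Lam t) t)\<^sup>2)"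
proof -
  let ?G = "\<bar>Yx (Lam t) t\<bar>"
  have "\<bar>v (Lam t) t\<bar> = \<bar>(1 - 1 / gm) * q t + (kap * gf t / (R t)\<^sup>2) * (Lam t * Yx (Lam t) t)\<bar>"
    unfolding v_at_wall[OF assms] Ls_wall[OF assms] by simp
  also have "\<dots> \<le> \<bar>(1 - 1 / gm) * q t\<bar> + \<bar>(kap * gf t / (R t)\<^sup>2) * (Lam t * Yx (Lam t) t)\<bar>" by (rule abs_triangle_ineq)
  also have "\<dots> = (1 - 1 / gm) * \<bar>q t\<bar> + \<bar>kap * gf t / (R t)\<^sup>2\<bar> * (Lam t * ?G)"
    using par Lam_pos[OF assms] by (simp add: abs_mult)
  also have "\<dots> \<le> 1 * (K1 * (\<epsilon> + ?G)) + kw * ?G * (lam2 * ?G)"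
    using q_bound[OF assms] kap_gf_bound[OF assms] Lam_bounds[OF assms] Lam_pos[OF assms] par K_pos by (intro add_mono mult_mono) auto
  also have "kw * ?G * (lam2 * ?G) = (kw * lam2) * ?G\<^sup>2" by (simp add: power2_eq_square)
  also have "\<dots> \<le> K1 * ?G\<^sup>2" using K_pos par Rs const_pos by (intro mult_right_mono) (auto simp: K1_def)
  finally show ?thesis by (simp add: algebra_simps)
qed

lemma YL_bound: "t \<ge> 0 \<Longrightarrow> 0 \<le> x \<Longrightarrow> x \<le> Lam t \<Longrightarrow> \<bar>v x t\<bar> \<le> \<mu> \<Longrightarrow> \<bar>YL x t\<bar> \<le> \<mu> / amin"
  unfolding YL_v abs_divide using A_bounds[of t x] A_pos[of x t] const_pos by (intro frac_le) (auto intro: order.trans[OF abs_ge_zero])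

lemma Yxx_bound:
  assumes t: "t \<ge> 0" and x: "0 < x" "x < Lam t" and c: "\<And>y. 0 < y \<Longrightarrow> y < Lam t \<Longrightarrow> \<bar>YL y t\<bar> \<le> c"
  shows "\<bar>YL x t - 2 * Yx x t / x\<bar> \<le> 2 * c"
proof -
  have "\<bar>Yx x t\<bar> \<le> c * x / 3" by (rule Yx_bound[OF t]) (use x c in auto)
  then have "\<bar>Yx x t / x\<bar> \<le> c / 3" using x by (simp add: field_simps)
  moreover have "\<bar>YL x t\<bar> \<le> c" using c x by auto
  moreover have "\<bar>YL x t - 2 * Yx x t / x\<bar> \<le> \<bar>YL x t\<bar> + 2 * \<bar>Yx x t / x\<bar>"
    using abs_triangle_ineq4[of "YL x t" "2 * Yx x t / x"] by (simp add: abs_mult)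
  moreover have "c \<ge> 0" using c[OF x] by simp
  ultimately show ?thesis by linarith
qed

text \<open>Two mean value steps: some point within \<open>\<delta>\<close> of the wall has gradient
  at most \<open>4 * \<epsilon> / \<delta>\<close>, and from there to the wall the gradient changes
  by at most \<open>\<delta>\<close> times the bound for the second derivative.\<close>

lemma wall_gradient:
  assumes t: "t \<ge> 0" and mu: "\<And>x. 0 < x \<Longrightarrow> x < Lam t \<Longrightarrow> \<bar>v x t\<bar> \<le> \<mu>" and d: "0 < \<delta>" "\<delta> \<le> lam1 / 2"
  shows "\<bar>Yx (Lam t) t\<bar> \<le> wall_grad \<epsilon> \<delta> \<mu>"
proof -
  let ?c = "\<mu> / amin"
  have l: "Lam t > \<delta>" using Lam_bounds[OF t] d const_pos by simp
  have c: "\<bar>YL y t\<bar> \<le> ?c" if "0 < y" "y < Lam t" for y using YL_bound[OF t, of y \<mu>] mu[OF that] that by simp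
  have "\<exists>l z. Lam t - \<delta> < z \<and> z < Lam t \<and> ((\<lambda>x. Y x t) has_real_derivative l) (at z) \<and>
      Y (Lam t) t - Y (Lam t - \<delta>) t = (Lam t - (Lam t - \<delta>)) * l"
  proof (rule MVT)
    show "continuous_on {Lam t - \<delta>..Lam t} (\<lambda>x. Y x t)" by (intro contY continuous_intros) (use t l in auto)
    show "(\<lambda>x. Y x t) differentiable at x" if "Lam t - \<delta> < x" "x < Lam t" for x
      using dYx[OF t, of x] that l real_differentiable_def by auto
  qed (use d in auto)
  then obtain l' z where z: "Lam t - \<delta> < z" "z < Lam t" "((\<lambda>x. Y x t) has_real_derivative l') (at z)"
      "Y (Lam t) t - Y (Lam t - \<delta>) t = \<delta> * l'" by auto
  have l': "l' = Yx z t" using DERIV_unique[OF z(3)] dYx[OF t, of z] z l by auto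
  have "\<delta> * \<bar>Yx z t\<bar> \<le> 4 * \<epsilon>"
  proof -
    have "\<delta> * \<bar>Yx z t\<bar> = \<bar>Y (Lam t) t - Y (Lam t - \<delta>) t\<bar>" unfolding z(4) l' using d by (simp add: abs_mult)
    moreover have "\<bar>Y (Lam t) t - ys\<bar> \<le> 2 * \<epsilon>" "\<bar>Y (Lam t - \<delta>) t - ys\<bar> \<le> 2 * \<epsilon>" using Y_near[OF t] l d by auto
    ultimately show ?thesis unfolding abs_le_iff by linarith
  qed
  then have 1: "\<bar>Yx z t\<bar> \<le> 4 * \<epsilon> / \<delta>" using d by (simp add: field_simps)
  have "\<exists>l w. z < w \<and> w < Lam t \<and> ((\<lambda>x. Yx x t) has_real_derivative l) (at w) \<and>
      Yx (Lam t) t - Yx z t = (Lam t - z) * l"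
  proof (rule MVT)
    show "continuous_on {z..Lam t} (\<lambda>x. Yx x t)" by (intro contY continuous_intros) (use t z l in auto)
    show "(\<lambda>x. Yx x t) differentiable at x" if "z < x" "x < Lam t" for x
      using dYxx[OF t, of x] that z l real_differentiable_def by auto
  qed (use z in auto)
  then obtain l2 w where w: "z < w" "w < Lam t" "((\<lambda>x. Yx x t) has_real_derivative l2) (at w)"
      "Yx (Lam t) t - Yx z t = (Lam t - z) * l2" by auto
  have w0: "w > 0" using w z l by simp
  have l2: "l2 = YL w t - 2 * Yx w t / w" using DERIV_unique[OF w(3)] dYxx[OF t w0 w(2)] by auto
  have "\<bar>l2\<bar> \<le> 2 * ?c" unfolding l2 using Yxx_bound[OF t w0 w(2) c] .
  then have "\<bar>(Lam t - z) * l2\<bar> \<le> \<delta> * (2 * ?c)" unfolding abs_mult using z by (intro mult_mono) auto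
  then have "\<bar>Yx (Lam t) t\<bar> \<le> \<bar>Yx z t\<bar> + 2 * ?c * \<delta>" using w(4) by (simp add: mult_ac)
  with 1 show ?thesis unfolding wall_grad_def by linarith
qed

text \<open>The barrier \<open>b + \<kappa> * (lam2 + 1 - x)\<close> is stationary and linear, so
  that the term \<open>2 * Sx / x\<close> of the radial Laplacian alone must beat the source; on a
  bounded domain it does. The constant \<open>b\<close> covers the wall and initial values.\<close>

lemma bootstrap_step:
  assumes mu: "\<And>x t. 0 \<le> t \<Longrightarrow> t < Tb \<Longrightarrow> 0 \<le> x \<Longrightarrow> x \<le> Lam t \<Longrightarrow> \<bar>v x t\<bar> \<le> \<mu>"
    and init: "\<And>x. 0 \<le> x \<Longrightarrow> x \<le> Lam 0 \<Longrightarrow> \<bar>v x 0\<bar> \<le> K3 * \<epsilon>"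
    and adm: "admissible_size \<mu> \<epsilon>"
    and xt: "0 \<le> t" "t < Tb" "0 \<le> x" "x \<le> Lam t"
  shows "\<bar>v x t\<bar> \<le> \<mu> / 2"
proof -
  from adm obtain \<delta> where d: "0 < \<delta>" "\<delta> \<le> lam1 / 2" and G1: "K1 * (\<epsilon> + wall_grad \<epsilon> \<delta> \<mu>) \<le> \<mu>"
    and tot: "K3 * \<epsilon> + K1 * (\<epsilon> + wall_grad \<epsilon> \<delta> \<mu> + (wall_grad \<epsilon> \<delta> \<mu>)\<^sup>2) + K2 * (4 * \<mu>\<^sup>2 + \<epsilon>) \<le> \<mu> / 2"
    unfolding admissible_size_def by blast
  let ?G = "wall_grad \<epsilon> \<delta> \<mu>"
  have mu0: "\<mu> \<ge> 0" using mu[OF xt] by simp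
  have G: "\<bar>Yx (Lam s) s\<bar> \<le> ?G" if "0 \<le> s" "s < Tb" for s
    by (rule wall_gradient[OF that(1) mu[OF that] d]) auto
  have q: "\<bar>q s\<bar> \<le> \<mu>" if "0 \<le> s" "s < Tb" for s
  proof -
    have "\<bar>q s\<bar> \<le> K1 * (\<epsilon> + \<bar>Yx (Lam s) s\<bar>)" by (rule q_bound[OF that(1)])
    also have "\<dots> \<le> K1 * (\<epsilon> + ?G)" using G[OF that] K_pos by (intro mult_left_mono) auto
    finally show ?thesis using G1 by simp
  qed
  define b where "b = K3 * \<epsilon> + K1 * (\<epsilon> + ?G + ?G\<^sup>2)"
  \<comment> \<open>Solves
    \<open>2 * amin * \<kappa> / lam2 = 4 * \<mu>\<^sup>2 + \<epsilon>\<close>, where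
    \<open>4 * \<mu>\<^sup>2\<close> bounds the source with \<open>q\<close> and \<open>v\<close> of
    size \<open>\<mu>\<close>, and \<open>\<epsilon>\<close> makes the inequality strict.\<close>
  define \<kappa> where "\<kappa> = lam2 * (4 * \<mu>\<^sup>2 + \<epsilon>) / (2 * amin)"
  have k: "\<kappa> > 0" unfolding \<kappa>_def using const_pos eps by (auto intro!: divide_pos_pos mult_pos_pos add_nonneg_pos)
  have G0: "?G \<ge> 0" using G[OF xt(1,2)] by linarith
  have b0: "K3 * \<epsilon> \<le> b" unfolding b_def using K_pos eps G0 by simp
  have "e * v x t \<le> b + \<kappa> * (lam2 + 1 - x)" if e: "e = 1 \<or> e = -1" for e
  proof (rule v_comparison[where S="\<lambda>x t. b + \<kappa> * (lam2 + 1 - x)" and Sx="\<lambda>x t. - \<kappa>" and Sxx="\<lambda>x t. 0" and St="\<lambda>x t. 0"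
      and ?T0.0=0 and ?T1.0=t and ?T2.0=Tb and \<mu>=\<mu> and qb=\<mu>, OF e])
    show "continuous_on {(x, t'). 0 \<le> t' \<and> t' \<le> t \<and> 0 \<le> x \<and> x \<le> Lam t'} (\<lambda>(x, t). b + \<kappa> * (lam2 + 1 - x))"
      unfolding split_beta by (intro continuous_intros)
    fix x s a assume h: "0 < x" "x < Lam s" "0 < s" "s \<le> t" "amin \<le> a" "a \<le> amax"
    have "2 * (\<mu> / (3 * gm) + \<mu>) * \<mu> \<le> 2 * (\<mu> + \<mu>) * \<mu>"
    proof -
      have "\<mu> / (3 * gm) \<le> \<mu> / 1" using mu0 par by (intro frac_le) auto
      then show ?thesis using mu0 by (intro mult_right_mono) auto
    qed
    also have "\<dots> < 4 * \<mu>\<^sup>2 + \<epsilon>" using eps by (simp add: power2_eq_square)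
    also have "\<dots> = 2 * amin * \<kappa> / lam2" using const_pos by (simp add: \<kappa>_def)
    also have "\<dots> \<le> 2 * a * \<kappa> / x" using h k const_pos Lam_bounds[of s] by (intro frac_le mult_mono mult_nonneg_nonneg) auto
    finally show "a * (0 + 2 * - \<kappa> / x) + 2 * (\<mu> / (3 * gm) + \<mu>) * \<mu> < 0" by (simp add: mult_ac)
  next
    fix s assume s: "0 \<le> s" "s \<le> t"
    have "e * v (Lam s) s \<le> \<bar>v (Lam s) s\<bar>" using e by auto
    also have "\<dots> \<le> K1 * (\<epsilon> + \<bar>Yx (Lam s) s\<bar> + (Yx (Lam s) s)\<^sup>2)" by (rule v_wall_bound[OF s(1)])
    also have "(Yx (Lam s) s)\<^sup>2 = \<bar>Yx (Lam s) s\<bar>\<^sup>2" by simp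
    also have "K1 * (\<epsilon> + \<bar>Yx (Lam s) s\<bar> + \<bar>Yx (Lam s) s\<bar>\<^sup>2) \<le> K1 * (\<epsilon> + ?G + ?G\<^sup>2)"
      using G[of s] s xt K_pos by (intro mult_left_mono add_mono power_mono) auto
    also have "\<dots> \<le> b" unfolding b_def using K_pos eps by simp
    finally show "e * v (Lam s) s \<le> b + \<kappa> * (lam2 + 1 - Lam s)" using k Lam_bounds[OF s(1)] by (smt (verit) mult_nonneg_nonneg)
  next
    fix x assume x: "0 \<le> x" "x \<le> Lam 0"
    have "e * v x 0 \<le> \<bar>v x 0\<bar>" using e by auto
    also have "\<dots> \<le> b" using init[OF x] b0 by simp
    finally show "e * v x 0 \<le> b + \<kappa> * (lam2 + 1 - x)" using k x Lam_bounds[of 0] by (smt (verit) mult_nonneg_nonneg)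
  next
    show "\<exists>\<kappa>'>0. \<exists>d>0. \<forall>x::real. 0 < x \<and> x < d \<longrightarrow> - \<kappa> \<le> - \<kappa>'" by (rule exI[of _ \<kappa>], intro conjI k) (auto intro!: exI[of _ "1::real"])
  qed (use xt mu q in \<open>auto intro!: derivative_eq_intros\<close>)
  from this[of 1] this[of "-1"] have "\<bar>v x t\<bar> \<le> b + \<kappa> * (lam2 + 1 - x)" by (auto simp: abs_le_iff)
  also have "\<dots> \<le> b + \<kappa> * (lam2 + 1)" using k xt by simp
  also have "\<kappa> * (lam2 + 1) = K2 * (4 * \<mu>\<^sup>2 + \<epsilon>)" by (simp add: \<kappa>_def K2_def)
  finally show ?thesis using tot unfolding b_def by simp
qed

text \<open>Continuity argument at the first time \<open>T\<close> at which \<open>\<mu>\<close> is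
  attained, which exists by compactness: before \<open>T\<close> the bootstrap gives
  \<open>\<mu> / 2\<close>, and this bound survives the limit.\<close>

lemma v_small:
  assumes init: "\<And>x. 0 \<le> x \<Longrightarrow> x \<le> Lam 0 \<Longrightarrow> \<bar>v x 0\<bar> \<le> K3 * \<epsilon>"
    and adm: "admissible_size \<mu> \<epsilon>" and mu: "\<mu> > 0"
    and xt: "0 \<le> t" "0 \<le> x" "x \<le> Lam t"
  shows "\<bar>v x t\<bar> \<le> \<mu>"
proof (rule ccontr)
  assume neg: "\<not> \<bar>v x t\<bar> \<le> \<mu>"
  define Q where "Q = {(x, s). 0 \<le> s \<and> s \<le> t \<and> 0 \<le> x \<and> x \<le> Lam s}"
  have cv: "continuous_on Q (\<lambda>z. \<bar>v (fst z) (snd z)\<bar>)"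
    by (intro continuous_intros contY) (auto simp: Q_def)
  have Qc: "compact Q" unfolding Q_def by (rule compact_dom) simp
  have "closed (Q \<inter> (\<lambda>z. \<bar>v (fst z) (snd z)\<bar>) -` {\<mu>..})"
    by (rule continuous_closed_preimage[OF cv compact_imp_closed[OF Qc]]) simp
  then have "compact (Q \<inter> (Q \<inter> (\<lambda>z. \<bar>v (fst z) (snd z)\<bar>) -` {\<mu>..}))" by (rule compact_Int_closed[OF Qc])
  then have "compact (snd ` (Q \<inter> (Q \<inter> (\<lambda>z. \<bar>v (fst z) (snd z)\<bar>) -` {\<mu>..})))" (is "compact ?B")
    by (intro compact_continuous_image continuous_intros)
  moreover have "t \<in> ?B" using neg xt by (intro image_eqI[of _ _ "(x, t)"]) (auto simp: Q_def)
  ultimately obtain T where T: "T \<in> ?B" "\<And>s. s \<in> ?B \<Longrightarrow> T \<le> s"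
    using compact_attains_inf[of ?B] by blast
  then obtain y where y: "0 \<le> T" "T \<le> t" "0 \<le> y" "y \<le> Lam T" "\<mu> \<le> \<bar>v y T\<bar>" by (auto simp: Q_def)
  have below: "\<bar>v x s\<bar> \<le> \<mu>" if "0 \<le> s" "s < T" "0 \<le> x" "x \<le> Lam s" for x s
  proof (rule ccontr)
    assume "\<not> \<bar>v x s\<bar> \<le> \<mu>"
    then have "s \<in> ?B" using that y by (intro image_eqI[of _ _ "(x, s)"]) (auto simp: Q_def)
    then show False using T(2) that by fastforce
  qed
  have half: "K3 * \<epsilon> \<le> \<mu> / 2"
  proof -
    obtain \<delta> where "K3 * \<epsilon> + K1 * (\<epsilon> + wall_grad \<epsilon> \<delta> \<mu> + (wall_grad \<epsilon> \<delta> \<mu>)\<^sup>2) + K2 * (4 * \<mu>\<^sup>2 + \<epsilon>) \<le> \<mu> / 2" "0 < \<delta>"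
      using adm unfolding admissible_size_def by blast
    moreover have "wall_grad \<epsilon> \<delta> \<mu> \<ge> 0" using \<open>0 < \<delta>\<close> eps mu const_pos by (simp add: wall_grad_def)
    then have "K1 * (\<epsilon> + wall_grad \<epsilon> \<delta> \<mu> + (wall_grad \<epsilon> \<delta> \<mu>)\<^sup>2) \<ge> 0" using K_pos eps by (intro mult_nonneg_nonneg add_nonneg_nonneg) auto
    moreover have "K2 * (4 * \<mu>\<^sup>2 + \<epsilon>) \<ge> 0" using K_pos eps by (intro mult_nonneg_nonneg add_nonneg_nonneg) auto
    ultimately show ?thesis by linarith
  qed
  have Tpos: "T > 0"
  proof (rule ccontr)
    assume "\<not> T > 0"
    then have "T = 0" using y by simp
    then show False using init[of y] y half mu by simp
  qed
  \<comment> \<open>Approach along a fixed scaled radius, which stays in the moving domain at all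
    times.\<close>
  define s where "s = y / Lam T"
  have s: "0 \<le> s" "s \<le> 1" "s * Lam T = y" using frac_in[OF y(1,3,4)] Lam_pos[OF y(1)] by (auto simp: s_def)
  have sl: "0 \<le> s * Lam \<tau> \<and> s * Lam \<tau> \<le> Lam \<tau>" if "\<tau> \<ge> 0" for \<tau>
    using s Lam_pos[OF that] mult_right_mono[of s 1 "Lam \<tau>"] by auto
  have "continuous_on {0..T} (\<lambda>\<tau>. \<bar>v (s * Lam \<tau>) \<tau>\<bar>)"
    by (intro continuous_intros contY continuous_on_subset[OF contLam]) (use sl in auto)
  then have "((\<lambda>\<tau>. \<bar>v (s * Lam \<tau>) \<tau>\<bar>) \<longlongrightarrow> \<bar>v (s * Lam T) T\<bar>) (at T within {0..T})"
    using y by (auto simp: continuous_on_def)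
  moreover have "at T within {0..T} = at_left T" using Tpos by (simp add: at_within_Icc_at_left)
  ultimately have lim: "((\<lambda>\<tau>. \<bar>v (s * Lam \<tau>) \<tau>\<bar>) \<longlongrightarrow> \<bar>v (s * Lam T) T\<bar>) (at_left T)" by simp
  have "\<forall>\<^sub>F \<tau> in at_left T. \<bar>v (s * Lam \<tau>) \<tau>\<bar> \<le> \<mu> / 2"
    using eventually_at_left_real[OF Tpos]
  proof eventually_elim
    case (elim \<tau>)
    then show ?case using sl[of \<tau>] by (intro bootstrap_step[OF below init adm]) auto
  qed
  then have "\<bar>v (s * Lam T) T\<bar> \<le> \<mu> / 2"
    by (rule tendsto_upperbound[OF lim]) simp
  then show False using y s mu by simp
qed

end

section \<open>Uniform Hoelder estimates\<close>

text \<open>The value and the increments share one constant on the whole half-line, which makes the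
  class closed under products. The exponent 1/2 is the one that interpolation yields for the wall
  gradient.\<close>

definition half_holder :: "(real \<Rightarrow> real) \<Rightarrow> bool" where
  "half_holder f \<longleftrightarrow> (\<exists>C\<ge>0. \<forall>t\<ge>0. \<bar>f t\<bar> \<le> C \<and> (\<forall>t'\<ge>0. \<bar>f t - f t'\<bar> \<le> C * sqrt \<bar>t - t'\<bar>))"

lemma half_holderI:
  assumes B: "\<And>t. t \<ge> 0 \<Longrightarrow> \<bar>f t\<bar> \<le> B"
    and C: "\<And>t t'. t \<ge> 0 \<Longrightarrow> t' \<ge> 0 \<Longrightarrow> \<bar>f t - f t'\<bar> \<le> C * sqrt \<bar>t - t'\<bar>"
  shows "half_holder f"
  unfolding half_holder_def
proof (intro exI[of _ "max 0 (max B C)"] conjI allI impI)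
  fix t :: real assume t: "t \<ge> 0"
  show "\<bar>f t\<bar> \<le> max 0 (max B C)" using B[OF t] by linarith
  fix t' :: real assume t': "t' \<ge> 0"
  have "C * sqrt \<bar>t - t'\<bar> \<le> max 0 (max B C) * sqrt \<bar>t - t'\<bar>" by (intro mult_right_mono) auto
  with C[OF t t'] show "\<bar>f t - f t'\<bar> \<le> max 0 (max B C) * sqrt \<bar>t - t'\<bar>" by linarith
qed simp

lemma half_holderE:
  assumes "half_holder f"
  obtains C where "C \<ge> 0" "\<And>t. t \<ge> 0 \<Longrightarrow> \<bar>f t\<bar> \<le> C" "\<And>t t'. t \<ge> 0 \<Longrightarrow> t' \<ge> 0 \<Longrightarrow> \<bar>f t - f t'\<bar> \<le> C * sqrt \<bar>t - t'\<bar>"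
  using assms unfolding half_holder_def by auto

lemma half_holder_const: "half_holder (\<lambda>t. c)"
  by (rule half_holderI[where B="\<bar>c\<bar>" and C=0]) auto

lemma half_holder_add: "half_holder f \<Longrightarrow> half_holder g \<Longrightarrow> half_holder (\<lambda>t. f t + g t)"
proof -
  assume f: "half_holder f" and g: "half_holder g"
  obtain C where C: "C \<ge> 0" "\<And>t. t \<ge> 0 \<Longrightarrow> \<bar>f t\<bar> \<le> C" "\<And>t t'. t \<ge> 0 \<Longrightarrow> t' \<ge> 0 \<Longrightarrow> \<bar>f t - f t'\<bar> \<le> C * sqrt \<bar>t - t'\<bar>"
    by (rule half_holderE[OF f]) blast
  obtain D where D: "D \<ge> 0" "\<And>t. t \<ge> 0 \<Longrightarrow> \<bar>g t\<bar> \<le> D" "\<And>t t'. t \<ge> 0 \<Longrightarrow> t' \<ge> 0 \<Longrightarrow> \<bar>g t - g t'\<bar> \<le> D * sqrt \<bar>t - t'\<bar>"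
    by (rule half_holderE[OF g]) blast
  show ?thesis
  proof (rule half_holderI[where B="C + D" and C="C + D"])
    fix t :: real assume "t \<ge> 0" then show "\<bar>f t + g t\<bar> \<le> C + D" using C(2)[of t] D(2)[of t] by linarith
    fix t' :: real assume "t' \<ge> 0" "t \<ge> 0"
    have "\<bar>f t + g t - (f t' + g t')\<bar> \<le> \<bar>f t - f t'\<bar> + \<bar>g t - g t'\<bar>" by linarith
    then show "\<bar>f t + g t - (f t' + g t')\<bar> \<le> (C + D) * sqrt \<bar>t - t'\<bar>"
      using C(3)[of t t'] D(3)[of t t'] \<open>t \<ge> 0\<close> \<open>t' \<ge> 0\<close> by (simp add: distrib_right)
  qed
qed

lemma half_holder_mult: "half_holder f \<Longrightarrow> half_holder g \<Longrightarrow> half_holder (\<lambda>t. f t * g t)"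
proof -
  assume f: "half_holder f" and g: "half_holder g"
  obtain C where C: "C \<ge> 0" "\<And>t. t \<ge> 0 \<Longrightarrow> \<bar>f t\<bar> \<le> C" "\<And>t t'. t \<ge> 0 \<Longrightarrow> t' \<ge> 0 \<Longrightarrow> \<bar>f t - f t'\<bar> \<le> C * sqrt \<bar>t - t'\<bar>"
    by (rule half_holderE[OF f]) blast
  obtain D where D: "D \<ge> 0" "\<And>t. t \<ge> 0 \<Longrightarrow> \<bar>g t\<bar> \<le> D" "\<And>t t'. t \<ge> 0 \<Longrightarrow> t' \<ge> 0 \<Longrightarrow> \<bar>g t - g t'\<bar> \<le> D * sqrt \<bar>t - t'\<bar>"
    by (rule half_holderE[OF g]) blast
  show ?thesis
  proof (rule half_holderI[where B="C * D" and C="2 * C * D"])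
    fix t :: real assume t: "t \<ge> 0" show "\<bar>f t * g t\<bar> \<le> C * D" unfolding abs_mult using C D t by (intro mult_mono) auto
    fix t' :: real assume t': "t' \<ge> 0" and t: "t \<ge> 0"
    have "f t * g t - f t' * g t' = (f t - f t') * g t + f t' * (g t - g t')" by (simp add: algebra_simps)
    then have "\<bar>f t * g t - f t' * g t'\<bar> \<le> \<bar>f t - f t'\<bar> * \<bar>g t\<bar> + \<bar>f t'\<bar> * \<bar>g t - g t'\<bar>"
      using abs_triangle_ineq[of "(f t - f t') * g t" "f t' * (g t - g t')"] by (simp add: abs_mult)
    also have "\<dots> \<le> (C * sqrt \<bar>t - t'\<bar>) * D + C * (D * sqrt \<bar>t - t'\<bar>)"
      using C D t t' by (intro add_mono mult_mono) auto
    finally show "\<bar>f t * g t - f t' * g t'\<bar> \<le> 2 * C * D * sqrt \<bar>t - t'\<bar>" by (simp add: algebra_simps)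
  qed
qed

lemma half_holder_deriv:
  assumes "\<And>t. t \<ge> 0 \<Longrightarrow> \<bar>f t\<bar> \<le> B" "\<And>t. t \<ge> 0 \<Longrightarrow> (f has_real_derivative f' t) (at t within {0..})" "\<And>t. t \<ge> 0 \<Longrightarrow> \<bar>f' t\<bar> \<le> B'"
  shows "half_holder f"
proof (rule half_holderI[where B=B and C="2 * B + B'"])
  fix t t' :: real assume t: "t \<ge> 0" "t' \<ge> 0"
  have B: "0 \<le> B" "0 \<le> B'" using assms(1)[OF t(1)] assms(3)[OF t(1)] by linarith+
  have aux: "\<bar>f b - f a\<bar> \<le> B' * \<bar>b - a\<bar>" if ab: "0 \<le> a" "a < b" for a b
  proof -
    obtain z where z: "a < z" "z < b" "f b - f a = (b - a) * f' z"
      using mvt_half_line[OF ab assms(2)] by blast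
    then show ?thesis using assms(3)[of z] ab by (simp add: abs_mult mult.commute mult_left_mono)
  qed
  have lip: "\<bar>f t - f t'\<bar> \<le> B' * \<bar>t - t'\<bar>"
    using aux[of t t'] aux[of t' t] t by (cases t t' rule: linorder_cases) (auto simp: abs_minus_commute)
  show "\<bar>f t - f t'\<bar> \<le> (2 * B + B') * sqrt \<bar>t - t'\<bar>"
  proof (cases "\<bar>t - t'\<bar> \<le> 1")
    case True
    have "\<bar>t - t'\<bar> = sqrt \<bar>t - t'\<bar> * sqrt \<bar>t - t'\<bar>" by simp
    also have "\<dots> \<le> sqrt \<bar>t - t'\<bar> * 1" using True by (intro mult_left_mono) (auto simp: real_sqrt_le_1_iff)
    finally have "B' * \<bar>t - t'\<bar> \<le> B' * sqrt \<bar>t - t'\<bar>" using B by (intro mult_left_mono) auto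
    also have "\<dots> \<le> (2 * B + B') * sqrt \<bar>t - t'\<bar>" using B by (intro mult_right_mono) auto
    finally show ?thesis using lip by simp
  next
    case False
    have "\<bar>f t - f t'\<bar> \<le> 2 * B" using assms(1)[OF t(1)] assms(1)[OF t(2)] by linarith
    also have "\<dots> \<le> (2 * B + B') * 1" using B by simp
    also have "\<dots> \<le> (2 * B + B') * sqrt \<bar>t - t'\<bar>" using False B by (intro mult_left_mono) auto
    finally show ?thesis .
  qed
qed (use assms in auto)

text \<open>The barrier \<open>N\<^sup>\<beta>\<close> for \<open>N = \<sigma> + \<nu> (\<tau> + \<sigma>\<^sup>2)\<^bsup>1/2\<^esup>\<close>: for small \<open>\<nu>\<close> the concavity of the power in \<open>\<sigma>\<close> dominates
  the time derivative, and \<open>N\<close> is comparable to \<open>\<sigma>\<close> at \<open>\<tau> = 0\<close> and to \<open>\<tau>\<^bsup>1/2\<^esup>\<close> at \<open>\<sigma> = 0\<close>.\<close>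

definition "bN \<nu> \<sigma> \<tau> = \<sigma> + \<nu> * sqrt (\<tau> + \<sigma>\<^sup>2)"
definition "bNs \<nu> \<sigma> \<tau> = 1 + \<nu> * (\<sigma> / sqrt (\<tau> + \<sigma>\<^sup>2))"
definition "bNss \<nu> \<sigma> \<tau> = \<nu> * (\<tau> / (sqrt (\<tau> + \<sigma>\<^sup>2)) ^ 3)"

lemma bN_derivs:
  assumes "\<sigma> > 0" "\<tau> \<ge> 0"
  shows "((\<lambda>\<sigma>. bN \<nu> \<sigma> \<tau>) has_real_derivative bNs \<nu> \<sigma> \<tau>) (at \<sigma>)"
    "((\<lambda>\<sigma>. bNs \<nu> \<sigma> \<tau>) has_real_derivative bNss \<nu> \<sigma> \<tau>) (at \<sigma>)"
proof -
  have p: "\<tau> + \<sigma>\<^sup>2 > 0" using assms by (simp add: add_nonneg_pos)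
  have "((\<lambda>\<sigma>. sqrt (\<tau> + \<sigma>\<^sup>2)) has_real_derivative inverse (sqrt (\<tau> + \<sigma>\<^sup>2)) / 2 * (2 * \<sigma>)) (at \<sigma>)"
    by (rule DERIV_chain2[where f=sqrt and g="\<lambda>\<sigma>. \<tau> + \<sigma>\<^sup>2", OF DERIV_real_sqrt[OF p]]) (auto intro!: derivative_eq_intros)
  moreover have "inverse (sqrt (\<tau> + \<sigma>\<^sup>2)) / 2 * (2 * \<sigma>) = \<sigma> / sqrt (\<tau> + \<sigma>\<^sup>2)" by (simp add: field_simps)
  ultimately have d: "((\<lambda>\<sigma>. sqrt (\<tau> + \<sigma>\<^sup>2)) has_real_derivative \<sigma> / sqrt (\<tau> + \<sigma>\<^sup>2)) (at \<sigma>)" by simp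
  show "((\<lambda>\<sigma>. bN \<nu> \<sigma> \<tau>) has_real_derivative bNs \<nu> \<sigma> \<tau>) (at \<sigma>)"
    unfolding bN_def bNs_def by (intro DERIV_add DERIV_cmult DERIV_ident d)
  have s: "sqrt (\<tau> + \<sigma>\<^sup>2) > 0" using p by simp
  have sq: "sqrt (\<tau> + \<sigma>\<^sup>2) * sqrt (\<tau> + \<sigma>\<^sup>2) = \<tau> + \<sigma>\<^sup>2" using p by simp
  have "((\<lambda>\<sigma>. \<sigma> / sqrt (\<tau> + \<sigma>\<^sup>2)) has_real_derivative (1 * sqrt (\<tau> + \<sigma>\<^sup>2) - \<sigma> * (\<sigma> / sqrt (\<tau> + \<sigma>\<^sup>2))) / (sqrt (\<tau> + \<sigma>\<^sup>2) * sqrt (\<tau> + \<sigma>\<^sup>2))) (at \<sigma>)"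
    by (rule DERIV_divide[OF DERIV_ident d]) (use s in simp)
  moreover have "(1 * sqrt (\<tau> + \<sigma>\<^sup>2) - \<sigma> * (\<sigma> / sqrt (\<tau> + \<sigma>\<^sup>2))) / (sqrt (\<tau> + \<sigma>\<^sup>2) * sqrt (\<tau> + \<sigma>\<^sup>2)) = \<tau> / (sqrt (\<tau> + \<sigma>\<^sup>2)) ^ 3"
  proof -
    have "1 * sqrt (\<tau> + \<sigma>\<^sup>2) - \<sigma> * (\<sigma> / sqrt (\<tau> + \<sigma>\<^sup>2)) = (sqrt (\<tau> + \<sigma>\<^sup>2) * sqrt (\<tau> + \<sigma>\<^sup>2) - \<sigma>\<^sup>2) / sqrt (\<tau> + \<sigma>\<^sup>2)"
      using s by (simp add: field_simps power2_eq_square)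
    also have "\<dots> = \<tau> / sqrt (\<tau> + \<sigma>\<^sup>2)" unfolding sq by simp
    finally show ?thesis using s by (simp add: power3_eq_cube)
  qed
  ultimately have "((\<lambda>\<sigma>. \<sigma> / sqrt (\<tau> + \<sigma>\<^sup>2)) has_real_derivative \<tau> / (sqrt (\<tau> + \<sigma>\<^sup>2)) ^ 3) (at \<sigma>)" by simp
  from DERIV_add[OF DERIV_const[of 1] DERIV_cmult[OF this, of \<nu>]]
  show "((\<lambda>\<sigma>. bNs \<nu> \<sigma> \<tau>) has_real_derivative bNss \<nu> \<sigma> \<tau>) (at \<sigma>)"
    unfolding bNs_def bNss_def by simp
qed

text \<open>Everything rests on \<open>bN \<nu> \<sigma> \<tau> \<le> 2 * sqrt (\<tau> +
  \<sigma>\<^sup>2)\<close>, valid for \<open>\<nu> \<le> 1\<close>: multiplied by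
  \<open>bN\<close>, the second derivative and the time derivative of the root term are of order
  \<open>\<nu>\<close>, hence small against the concavity.\<close>

lemma bN_bounds:
  assumes "\<sigma> > 0" "\<tau> \<ge> 0" "0 < \<nu>" "\<nu> \<le> 1"
  shows "bN \<nu> \<sigma> \<tau> > 0" "1 \<le> bNs \<nu> \<sigma> \<tau>" "bN \<nu> \<sigma> \<tau> * bNss \<nu> \<sigma> \<tau> \<le> 2 * \<nu>"
    "bN \<nu> \<sigma> \<tau> * (\<nu> / (2 * sqrt (\<tau> + \<sigma>\<^sup>2))) \<le> \<nu>"
proof -
  let ?D = "sqrt (\<tau> + \<sigma>\<^sup>2)"
  have p: "\<tau> + \<sigma>\<^sup>2 > 0" using assms by (simp add: add_nonneg_pos)
  then have D: "?D > 0" by simp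
  show N: "bN \<nu> \<sigma> \<tau> > 0" unfolding bN_def using assms D by (intro add_pos_pos mult_pos_pos) auto
  show "1 \<le> bNs \<nu> \<sigma> \<tau>" unfolding bNs_def using assms D by simp
  have "\<sigma> \<le> ?D" using assms by (intro real_le_rsqrt) simp
  moreover have "\<nu> * ?D \<le> 1 * ?D" using assms D by (intro mult_right_mono) auto
  ultimately have ND: "bN \<nu> \<sigma> \<tau> \<le> 2 * ?D" unfolding bN_def by linarith
  have "\<tau> \<le> ?D\<^sup>2" using p by simp
  then have "\<tau> / ?D ^ 3 \<le> ?D\<^sup>2 / ?D ^ 3" using D by (intro divide_right_mono) auto
  also have "\<dots> = 1 / ?D" using D by (simp add: power2_eq_square power3_eq_cube)
  finally have "bNss \<nu> \<sigma> \<tau> \<le> \<nu> * (1 / ?D)" unfolding bNss_def using assms by (intro mult_left_mono) auto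
  moreover have "bNss \<nu> \<sigma> \<tau> \<ge> 0" unfolding bNss_def using assms D by simp
  ultimately have "bN \<nu> \<sigma> \<tau> * bNss \<nu> \<sigma> \<tau> \<le> (2 * ?D) * (\<nu> * (1 / ?D))" using ND N D by (intro mult_mono) auto
  then show "bN \<nu> \<sigma> \<tau> * bNss \<nu> \<sigma> \<tau> \<le> 2 * \<nu>" using D by simp
  have "bN \<nu> \<sigma> \<tau> * (\<nu> / (2 * ?D)) \<le> (2 * ?D) * (\<nu> / (2 * ?D))" using ND D assms by (intro mult_right_mono) auto
  then show "bN \<nu> \<sigma> \<tau> * (\<nu> / (2 * ?D)) \<le> \<nu>" using D by simp
qed

section \<open>Regularity in time of the wall value of the time derivative\<close>

lemma abs_diff4_le: "\<bar>a - b - c - d - e\<bar> \<le> \<bar>a\<bar> + \<bar>b\<bar> + \<bar>c\<bar> + \<bar>d\<bar> + \<bar>e\<bar>" for a b c d e :: real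
  by (smt (verit))

text \<open>The first condition in \<open>mu_small\<close> lets the curvature term dominate the
  motion of the end point in the wall barrier; the second keeps the spatial variation of
  \<open>A\<close> below the concavity gained from the exponent \<open>\<beta> < 1\<close> when the
  variable is doubled. The bounds by \<open>\<mu>\<close> record the outcome of the
  bootstrap.\<close>

locale bubble_smooth = bubble_near +
  fixes \<mu> \<beta> :: real
  assumes mu_pos: "\<mu> > 0" and be: "0 < \<beta>" "\<beta> < 1"
    and mu_small: "\<mu> * lam2 \<le> 2 * amin" "\<mu> * (2 * amax * lam2\<^sup>2) \<le> 3 * amin\<^sup>2 * (1 - \<beta>)"
    and v_le: "\<And>x t. t \<ge> 0 \<Longrightarrow> 0 \<le> x \<Longrightarrow> x \<le> Lam t \<Longrightarrow> \<bar>v x t\<bar> \<le> \<mu>"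
    and q_le: "\<And>t. t \<ge> 0 \<Longrightarrow> \<bar>q t\<bar> \<le> \<mu>"
    and Lam1_le: "\<And>t. t \<ge> 0 \<Longrightarrow> \<bar>Lam1 t\<bar> \<le> \<mu>"
begin

lemma YL_le: "t \<ge> 0 \<Longrightarrow> 0 \<le> x \<Longrightarrow> x \<le> Lam t \<Longrightarrow> \<bar>YL x t\<bar> \<le> \<mu> / amin"
  using YL_bound v_le by blast

lemma Yx_le: "t \<ge> 0 \<Longrightarrow> 0 \<le> x \<Longrightarrow> x \<le> Lam t \<Longrightarrow> \<bar>Yx x t\<bar> \<le> \<mu> / amin * x / 3"
proof (cases "x = 0")
  case True
  assume "t \<ge> 0"
  then show ?thesis using True Ls0[of t] by (simp add: Yx_def)
next
  case False
  assume "t \<ge> 0" "0 \<le> x" "x \<le> Lam t"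
  then show ?thesis using False by (intro Yx_bound YL_le) auto
qed

definition "CL = \<mu> / amin * lam2\<^sup>2"

lemma CL_pos: "CL > 0" using mu_pos const_pos by (simp add: CL_def)

lemma s_in: "t \<ge> 0 \<Longrightarrow> 0 \<le> s \<Longrightarrow> s \<le> 1 \<Longrightarrow> 0 \<le> s * Lam t \<and> s * Lam t \<le> Lam t"
  using Lam_pos[of t] mult_right_mono[of s 1 "Lam t"] by auto

lemma LL_le: assumes "t \<ge> 0" "0 \<le> s" "s \<le> 1" shows "\<bar>LL s t\<bar> \<le> CL"
proof -
  have l: "Lam t > 0" by (rule Lam_pos[OF assms(1)])
  have "LL s t = YL (s * Lam t) t * (Lam t)\<^sup>2" using l by (simp add: YL_def)
  then have "\<bar>LL s t\<bar> = \<bar>YL (s * Lam t) t\<bar> * (Lam t)\<^sup>2" by (simp add: abs_mult)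
  also have "\<dots> \<le> \<mu> / amin * lam2\<^sup>2"
    using YL_le[OF assms(1)] s_in[OF assms] Lam_bounds[OF assms(1)] l mu_pos const_pos by (intro mult_mono power_mono) auto
  finally show ?thesis by (simp add: CL_def)
qed

lemma Ls_le: assumes "t \<ge> 0" "0 \<le> s" "s \<le> 1" shows "\<bar>Ls s t\<bar> \<le> CL * s"
proof -
  have l: "Lam t > 0" by (rule Lam_pos[OF assms(1)])
  have "Ls s t = Yx (s * Lam t) t * Lam t" using l by (simp add: Yx_def)
  then have "\<bar>Ls s t\<bar> = \<bar>Yx (s * Lam t) t\<bar> * Lam t" using l by (simp add: abs_mult)
  also have "\<dots> \<le> (\<mu> / amin * (s * Lam t) / 3) * Lam t"
    using Yx_le[OF assms(1)] s_in[OF assms] l by (intro mult_right_mono) auto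
  also have "\<dots> = (\<mu> / amin * s / 3) * (Lam t)\<^sup>2" by (simp add: power2_eq_square)
  also have "\<dots> \<le> (\<mu> / amin * s) * lam2\<^sup>2"
  proof (intro mult_mono power_mono)
    have "\<mu> / amin * s \<ge> 0" using mu_pos const_pos assms by simp
    then show "\<mu> / amin * s / 3 \<le> \<mu> / amin * s" "0 \<le> \<mu> / amin * s" by auto
  qed (use Lam_bounds[OF assms(1)] l in auto)
  finally show ?thesis by (simp add: CL_def mult_ac)
qed

lemma Ls_le': assumes "t \<ge> 0" "0 \<le> s" "s \<le> 1" shows "\<bar>Ls s t\<bar> \<le> CL"
proof -
  have "CL * s \<le> CL" using assms CL_pos by simp
  with Ls_le[OF assms] show ?thesis by linarith
qed

lemma Lss_le: assumes "t \<ge> 0" "0 < s" "s < 1" shows "\<bar>LL s t - 2 * Ls s t / s\<bar> \<le> 3 * CL"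
proof -
  have "\<bar>Ls s t / s\<bar> \<le> CL" using Ls_le[of t s] assms by (simp add: field_simps)
  moreover have "\<bar>LL s t\<bar> \<le> CL" using LL_le[of t s] assms by simp
  moreover have "\<bar>LL s t - 2 * Ls s t / s\<bar> \<le> \<bar>LL s t\<bar> + 2 * \<bar>Ls s t / s\<bar>"
    using abs_triangle_ineq4[of "LL s t" "2 * Ls s t / s"] by (simp add: abs_mult)
  ultimately show ?thesis by linarith
qed

definition "CT = \<mu> + kw * (\<mu> / amin * lam2) * CL + \<mu>"

lemma gf_le: assumes "t \<ge> 0" shows "\<bar>kap * gf t / (R t)\<^sup>2\<bar> \<le> kw * (\<mu> / amin * lam2)"
proof -
  have "\<bar>Yx (Lam t) t\<bar> \<le> \<mu> / amin * Lam t / 3" using Yx_le[OF assms, of "Lam t"] Lam_pos[OF assms] by simp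
  also have "\<dots> \<le> \<mu> / amin * Lam t"
  proof -
    have "\<mu> / amin * Lam t \<ge> 0" using mu_pos const_pos Lam_pos[OF assms] by simp
    then show ?thesis by simp
  qed
  also have "\<dots> \<le> \<mu> / amin * lam2" using Lam_bounds[OF assms] mu_pos const_pos by (intro mult_left_mono) auto
  finally have "kw * \<bar>Yx (Lam t) t\<bar> \<le> kw * (\<mu> / amin * lam2)" using K_pos by (intro mult_left_mono) auto
  with kap_gf_bound[OF assms] show ?thesis by simp
qed

lemma Lt_eq: assumes "t \<ge> 0" "0 \<le> s" "s \<le> 1"
  shows "Lt s t = v (s * Lam t) t - kap * gf t / (R t)\<^sup>2 * (s * Ls s t) + q t / gm"
  using pde'[OF assms(2,3,1)] v_eq[OF assms(1), of "s * Lam t"] Lam_pos[OF assms(1)] by (simp add: algebra_simps)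

lemma Lt_le: assumes "t \<ge> 0" "0 \<le> s" "s \<le> 1" shows "\<bar>Lt s t\<bar> \<le> CT"
proof -
  have "\<bar>kap * gf t / (R t)\<^sup>2 * (s * Ls s t)\<bar> \<le> kw * (\<mu> / amin * lam2) * CL"
  proof -
    have "\<bar>s * Ls s t\<bar> \<le> 1 * CL" unfolding abs_mult using Ls_le'[OF assms] assms by (intro mult_mono) auto
    then show ?thesis unfolding abs_mult[of "kap * gf t / (R t)\<^sup>2"]
      using gf_le[OF assms(1)] K_pos mu_pos const_pos by (intro mult_mono) auto
  qed
  moreover have "\<bar>v (s * Lam t) t\<bar> \<le> \<mu>" using v_le s_in[OF assms] assms by auto
  moreover have "\<bar>q t / gm\<bar> \<le> \<mu>"
  proof -
    have "\<bar>q t\<bar> / gm \<le> \<mu> / 1" using q_le[OF assms(1)] par mu_pos by (intro frac_le) auto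
    then show ?thesis using par by simp
  qed
  ultimately show ?thesis unfolding Lt_eq[OF assms] CT_def abs_le_iff by linarith
qed

lemma L_lipschitz_time: assumes "t \<ge> 0" "t' \<ge> 0" "0 \<le> s" "s \<le> 1" shows "\<bar>L s t - L s t'\<bar> \<le> CT * \<bar>t - t'\<bar>"
proof -
  have aux: "\<bar>L s b - L s a\<bar> \<le> CT * \<bar>b - a\<bar>" if ab: "0 \<le> a" "a < b" for a b
  proof -
    have "\<And>t. t \<ge> 0 \<Longrightarrow> (L s has_real_derivative Lt s t) (at t within {0..})" using dLt assms by auto
    from mvt_half_line[OF ab this] obtain z where z: "a < z" "z < b" "L s b - L s a = (b - a) * Lt s z" by blast
    then show ?thesis using Lt_le[of z s] ab assms by (simp add: abs_mult mult.commute mult_left_mono)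
  qed
  show ?thesis
    using aux[of t t'] aux[of t' t] assms by (cases t t' rule: linorder_cases) (auto simp: abs_minus_commute)
qed

lemma Ls_mvt: assumes "t \<ge> 0" "0 \<le> a" "a < b" "b \<le> 1" shows "\<exists>z. a < z \<and> z < b \<and> L b t - L a t = (b - a) * Ls z t"
proof -
  have "\<exists>l z. a < z \<and> z < b \<and> ((\<lambda>s. L s t) has_real_derivative l) (at z) \<and> L b t - L a t = (b - a) * l"
  proof (rule MVT)
    show "continuous_on {a..b} (\<lambda>s. L s t)" by (intro cont_comp continuous_intros) (use assms in auto)
    show "(\<lambda>s. L s t) differentiable at x" if "a < x" "x < b" for x
      using dL[of x t] that assms real_differentiable_def by auto
  qed (use assms in auto)
  then obtain l z where z: "a < z" "z < b" "((\<lambda>s. L s t) has_real_derivative l) (at z)" "L b t - L a t = (b - a) * l" by auto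
  have "l = Ls z t" using DERIV_unique[OF z(3)] dL[of z t] z assms by auto
  with z show ?thesis by auto
qed

lemma Ls_lipschitz: assumes "t \<ge> 0" "0 \<le> a" "a \<le> 1" "0 \<le> b" "b \<le> 1" shows "\<bar>Ls a t - Ls b t\<bar> \<le> 3 * CL * \<bar>a - b\<bar>"
proof -
  have aux: "\<bar>Ls b t - Ls a t\<bar> \<le> 3 * CL * \<bar>b - a\<bar>" if ab: "0 \<le> a" "a < b" "b \<le> 1" for a b
  proof -
    have "\<exists>l z. a < z \<and> z < b \<and> ((\<lambda>s. Ls s t) has_real_derivative l) (at z) \<and> Ls b t - Ls a t = (b - a) * l"
    proof (rule MVT)
      show "continuous_on {a..b} (\<lambda>s. Ls s t)" by (intro cont_comp continuous_intros) (use assms ab in auto)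
      show "(\<lambda>s. Ls s t) differentiable at x" if "a < x" "x < b" for x
        using dLs[of x t] that ab assms real_differentiable_def by auto
    qed (use ab in auto)
    then obtain l z where z: "a < z" "z < b" "((\<lambda>s. Ls s t) has_real_derivative l) (at z)" "Ls b t - Ls a t = (b - a) * l" by auto
    have "l = LL z t - 2 * Ls z t / z" using DERIV_unique[OF z(3)] dLs[of z t] z ab assms by auto
    then have "\<bar>l\<bar> \<le> 3 * CL" using Lss_le[of t z] z ab assms by simp
    then show ?thesis using z ab by (simp add: abs_mult mult.commute mult_left_mono)
  qed
  show ?thesis
    using aux[of a b] aux[of b a] assms by (cases a b rule: linorder_cases) (auto simp: abs_minus_commute)
qed

text \<open>Since \<open>L\<close> is Lipschitz in time and \<open>Ls\<close> Lipschitz in space,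
  the wall gradient is compared with the difference quotient of \<open>L\<close> over a length
  \<open>\<delta>\<close>. The errors, of order \<open>CL * \<delta>\<close> and
  \<open>CT * \<bar>t - t'\<bar> / \<delta>\<close>, balance for
  \<open>\<delta> = sqrt \<bar>t - t'\<bar>\<close>.\<close>

lemma Ls_wall_half_holder: "half_holder (Ls 1)"
proof (rule half_holderI[where B=CL and C="6 * CL + 2 * CT"])
  have CT0: "CT \<ge> 0" using Lt_le[of 0 0] by simp
  show "\<bar>Ls 1 t\<bar> \<le> CL" if "t \<ge> 0" for t using Ls_le'[OF that, of 1] by simp
  fix t t' :: real assume t: "t \<ge> 0" "t' \<ge> 0"
  show "\<bar>Ls 1 t - Ls 1 t'\<bar> \<le> (6 * CL + 2 * CT) * sqrt \<bar>t - t'\<bar>"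
  proof (cases "\<bar>t - t'\<bar> < 1")
    case False
    have "\<bar>Ls 1 t - Ls 1 t'\<bar> \<le> 2 * CL" using Ls_le'[OF t(1), of 1] Ls_le'[OF t(2), of 1] by simp
    also have "\<dots> \<le> (6 * CL + 2 * CT) * 1" using CL_pos CT0 by simp
    also have "\<dots> \<le> (6 * CL + 2 * CT) * sqrt \<bar>t - t'\<bar>" using False CL_pos CT0 by (intro mult_left_mono) auto
    finally show ?thesis .
  next
    case True
    show ?thesis
    proof (cases "t = t'")
      case False
      define \<delta> where "\<delta> = sqrt \<bar>t - t'\<bar>"
      have d: "0 < \<delta>" "\<delta> < 1" "\<bar>t - t'\<bar> = \<delta> * \<delta>" using True False by (auto simp: \<delta>_def)
      have step: "\<bar>\<delta> * Ls 1 u - (L 1 u - L (1 - \<delta>) u)\<bar> \<le> \<delta> * (3 * CL * \<delta>)" if u: "u \<ge> 0" for u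
      proof -
        obtain z where z: "1 - \<delta> < z" "z < 1" "L 1 u - L (1 - \<delta>) u = (1 - (1 - \<delta>)) * Ls z u"
          using Ls_mvt[OF u, of "1 - \<delta>" 1] d by auto
        have "\<delta> * Ls 1 u - (L 1 u - L (1 - \<delta>) u) = \<delta> * (Ls 1 u - Ls z u)" unfolding z(3) by (simp add: algebra_simps)
        moreover have "\<bar>Ls 1 u - Ls z u\<bar> \<le> 3 * CL * \<delta>"
        proof -
          have "\<bar>Ls 1 u - Ls z u\<bar> \<le> 3 * CL * \<bar>1 - z\<bar>" using z d by (intro Ls_lipschitz u) auto
          also have "\<dots> \<le> 3 * CL * \<delta>" using z d CL_pos by (intro mult_left_mono) auto
          finally show ?thesis .
        qed
        ultimately show ?thesis using d by (simp add: abs_mult mult_left_mono)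
      qed
      have "\<bar>L 1 t - L 1 t'\<bar> \<le> CT * (\<delta> * \<delta>)" "\<bar>L (1 - \<delta>) t - L (1 - \<delta>) t'\<bar> \<le> CT * (\<delta> * \<delta>)"
        using L_lipschitz_time[OF t] d by auto
      with step[OF t(1)] step[OF t(2)]
      have "\<bar>\<delta> * Ls 1 t - \<delta> * Ls 1 t'\<bar> \<le> 2 * (\<delta> * (3 * CL * \<delta>)) + 2 * (CT * (\<delta> * \<delta>))"
        unfolding abs_le_iff by linarith
      moreover have "\<delta> * \<bar>Ls 1 t - Ls 1 t'\<bar> = \<bar>\<delta> * Ls 1 t - \<delta> * Ls 1 t'\<bar>"
        unfolding right_diff_distrib[symmetric] abs_mult using d by simp
      moreover have "2 * (\<delta> * (3 * CL * \<delta>)) + 2 * (CT * (\<delta> * \<delta>)) = \<delta> * ((6 * CL + 2 * CT) * \<delta>)"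
        by (simp add: algebra_simps)
      ultimately have "\<delta> * \<bar>Ls 1 t - Ls 1 t'\<bar> \<le> \<delta> * ((6 * CL + 2 * CT) * \<delta>)" by linarith
      then show ?thesis using d by (simp add: \<delta>_def[symmetric])
    qed simp
  qed
qed

lemma R2_bounded: "\<exists>B. \<forall>t\<ge>0. \<bar>R2 t\<bar> \<le> B"
proof -
  define B where "B = (c0 * exp (ln rs + 1) + pin + 2 * sg / (Rs / 2) + 4 * mu * \<epsilon> / (Rs / 2) + rl * (3 / 2 * \<epsilon>\<^sup>2)) / (rl * (Rs / 2))"
  have "\<bar>R2 t\<bar> \<le> B" if t: "t \<ge> 0" for t
  proof -
    have R: "R t > 0" "R t \<ge> Rs / 2" using Rpos[OF t] R_bounds[OF t] by auto
    have "rl * R t * R2 t = c0 * exp (L 1 t) - pin - 2 * sg / R t - 4 * mu * R1 t / R t - rl * (3 / 2 * (R1 t)\<^sup>2)"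
      using wallp[OF t] by (simp add: algebra_simps)
    then have "\<bar>rl * R t * R2 t\<bar> \<le> \<bar>c0 * exp (L 1 t)\<bar> + \<bar>pin\<bar> + \<bar>2 * sg / R t\<bar> + \<bar>4 * mu * R1 t / R t\<bar> + \<bar>rl * (3 / 2 * (R1 t)\<^sup>2)\<bar>"
      using abs_diff4_le by metis
    also have "\<dots> \<le> c0 * exp (ln rs + 1) + pin + 2 * sg / (Rs / 2) + 4 * mu * \<epsilon> / (Rs / 2) + rl * (3 / 2 * \<epsilon>\<^sup>2)"
    proof (intro add_mono)
      show "\<bar>c0 * exp (L 1 t)\<bar> \<le> c0 * exp (ln rs + 1)" using par L1_bounds[OF t] by (simp add: abs_mult)
      have "2 * sg / R t \<le> 2 * sg / (Rs / 2)" by (rule frac_le) (use par R Rs in auto)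
      then show "\<bar>2 * sg / R t\<bar> \<le> 2 * sg / (Rs / 2)" using par R by simp
      show "\<bar>4 * mu * R1 t / R t\<bar> \<le> 4 * mu * \<epsilon> / (Rs / 2)"
        unfolding abs_divide abs_mult using par R Rs near(2)[OF t] by (intro frac_le mult_mono) auto
      have "(R1 t)\<^sup>2 \<le> \<epsilon>\<^sup>2" using power_mono[OF near(2)[OF t], of 2] by simp
      then show "\<bar>rl * (3 / 2 * (R1 t)\<^sup>2)\<bar> \<le> rl * (3 / 2 * \<epsilon>\<^sup>2)" using par by (simp add: abs_mult)
    qed (use par in auto)
    finally have 1: "\<bar>rl * R t * R2 t\<bar> \<le> B * (rl * (Rs / 2))" unfolding B_def using par Rs by simp
    have "rl * (Rs / 2) * \<bar>R2 t\<bar> \<le> \<bar>rl * R t * R2 t\<bar>"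
      unfolding abs_mult using par R Rs by (intro mult_mono) auto
    also note 1
    finally have "(rl * (Rs / 2)) * \<bar>R2 t\<bar> \<le> (rl * (Rs / 2)) * B" by (simp add: mult.commute)
    moreover have "rl * (Rs / 2) > 0" using par Rs by simp
    ultimately show ?thesis using mult_le_cancel_left_pos by blast
  qed
  then show ?thesis by blast
qed

text \<open>By the velocity law and the equation at the wall, this value is a polynomial in
  \<open>R1\<close>, \<open>1 / R\<close>, \<open>exp (- L 1)\<close> and \<open>Ls 1\<close>. The
  first three have bounded derivatives, so only the wall gradient limits the exponent.\<close>

lemma wall_value_half_holder: "half_holder (\<lambda>t. v (Lam t) t)"
proof -
  obtain B2 where B2: "\<And>t. t \<ge> 0 \<Longrightarrow> \<bar>R2 t\<bar> \<le> B2" using R2_bounded by auto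
  have h1: "half_holder R1" by (rule half_holder_deriv[OF near(2) dR1 B2])
  have h2: "half_holder (\<lambda>t. 1 / R t)"
  proof (rule half_holder_deriv[where f'="\<lambda>t. - (R1 t / (R t)\<^sup>2)" and B="1 / (Rs / 2)" and B'="\<epsilon> / (Rs / 2)\<^sup>2"])
    fix t :: real assume t: "t \<ge> 0"
    have R: "R t > 0" "R t \<ge> Rs / 2" using Rpos[OF t] R_bounds[OF t] by auto
    have "1 / R t \<le> 1 / (Rs / 2)" by (rule frac_le) (use R Rs in auto)
    then show "\<bar>1 / R t\<bar> \<le> 1 / (Rs / 2)" using R by simp
    show "((\<lambda>t. 1 / R t) has_real_derivative - (R1 t / (R t)\<^sup>2)) (at t within {0..})"
      using R by (auto intro!: derivative_eq_intros dR t simp: power2_eq_square)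
    show "\<bar>- (R1 t / (R t)\<^sup>2)\<bar> \<le> \<epsilon> / (Rs / 2)\<^sup>2"
      unfolding abs_minus_cancel abs_divide using R Rs near(2)[OF t] eps by (intro frac_le) (auto intro!: power_mono)
  qed
  have h3: "half_holder (\<lambda>t. exp (- L 1 t))"
  proof (rule half_holder_deriv[where f'="\<lambda>t. exp (- L 1 t) * (- q t)" and B="exp (1 - ln rs)" and B'="exp (1 - ln rs) * \<mu>"])
    fix t :: real assume t: "t \<ge> 0"
    show "\<bar>exp (- L 1 t)\<bar> \<le> exp (1 - ln rs)" using exp_L1[OF t] by simp
    show "((\<lambda>t. exp (- L 1 t)) has_real_derivative exp (- L 1 t) * (- q t)) (at t within {0..})"
      unfolding q_def by (auto intro!: derivative_eq_intros dLt t)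
    show "\<bar>exp (- L 1 t) * (- q t)\<bar> \<le> exp (1 - ln rs) * \<mu>"
      unfolding abs_mult using exp_L1[OF t] q_le[OF t] by (intro mult_mono) auto
  qed
  let ?g = "\<lambda>t. kap * ((1 / R t) * ((1 / R t) * (Ls 1 t * exp (- L 1 t))))"
  have h4: "half_holder ?g"
    by (intro half_holder_mult half_holder_const h2 h3 Ls_wall_half_holder)
  have g: "?g t = kap * gf t / (R t)\<^sup>2" for t
    unfolding gf_def by (simp add: exp_minus divide_inverse power2_eq_square mult_ac)
  have "half_holder (\<lambda>t. (1 - 1 / gm) * (gm * (- 3 * (R1 t * (1 / R t)) + (- 3) * ?g t)) + ?g t * Ls 1 t)"
    by (intro half_holder_mult half_holder_const h1 h2 h4 half_holder_add Ls_wall_half_holder)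
  then have "\<exists>C\<ge>0. \<forall>t\<ge>0. \<bar>v (Lam t) t\<bar> \<le> C \<and> (\<forall>t'\<ge>0. \<bar>v (Lam t) t - v (Lam t') t'\<bar> \<le> C * sqrt \<bar>t - t'\<bar>)"
  proof -
    have eq: "v (Lam t) t = (1 - 1 / gm) * (gm * (- 3 * (R1 t * (1 / R t)) + (- 3) * ?g t)) + ?g t * Ls 1 t" if t: "t \<ge> 0" for t
    proof -
      have "q t = gm * (- 3 * (R1 t * (1 / R t)) + (- 3) * ?g t)" unfolding g using wallv'[OF t] par by (simp add: field_simps)
      then show ?thesis unfolding v_at_wall[OF t] g by simp
    qed
    assume "half_holder (\<lambda>t. (1 - 1 / gm) * (gm * (- 3 * (R1 t * (1 / R t)) + (- 3) * ?g t)) + ?g t * Ls 1 t)"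
    then show ?thesis unfolding half_holder_def using eq by auto
  qed
  then show ?thesis unfolding half_holder_def .
qed

end

section \<open>Barrier at the wall\<close>

context bubble_smooth
begin

definition "CF = 2 * (\<mu> / (3 * gm) + \<mu>) * \<mu>"

lemma CF_nonneg: "CF \<ge> 0" using mu_pos par by (simp add: CF_def)

text \<open>For fixed \<open>t0\<close>, and up to the sign \<open>e\<close>, the barrier
  \<open>v (Lam t0) t0 + K * N powr \<beta>\<close> is used between \<open>t0 - 1\<close> and
  \<open>t0\<close>, with \<open>N\<close> evaluated at wall distance \<open>Lam t - x\<close> and
  remaining time \<open>t0 - t\<close>. On the wall \<open>N\<close> is
  \<open>\<nu> * sqrt (t0 - t)\<close> and dominates the Hoelder variation of the wall value; at
  time \<open>t0 - 1\<close> it is at least \<open>\<nu>\<close> and dominates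
  \<open>2 * \<mu>\<close>; at \<open>t0\<close> it is comparable to the distance.\<close>

lemma wall_barrier: "\<exists>C>0. \<forall>t x. 1 \<le> t \<and> 0 \<le> x \<and> x \<le> Lam t \<longrightarrow> \<bar>v x t - v (Lam t) t\<bar> \<le> C * (Lam t - x) powr \<beta>"
proof -
  obtain H where H: "H \<ge> 0" "\<And>t t'. t \<ge> 0 \<Longrightarrow> t' \<ge> 0 \<Longrightarrow> \<bar>v (Lam t) t - v (Lam t') t'\<bar> \<le> H * sqrt \<bar>t - t'\<bar>"
    using half_holderE[OF wall_value_half_holder] by metis
  \<comment> \<open>A quarter of the concavity \<open>amin * (1 - \<beta>)\<close> is allotted to
    the second derivative of \<open>N\<close> and a quarter to its time derivative; half is left
    against the source.\<close>
  define \<nu> where "\<nu> = min 1 (min ((1 - \<beta>) / 8) (amin * (1 - \<beta>) / 4))"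
  have "0 < \<nu>" "\<nu> \<le> 1" unfolding \<nu>_def using be const_pos by auto
  moreover have "\<nu> \<le> (1 - \<beta>) / 8" "\<nu> \<le> amin * (1 - \<beta>) / 4" unfolding \<nu>_def by linarith+
  ultimately have nu: "0 < \<nu>" "\<nu> \<le> 1" "2 * \<nu> \<le> (1 - \<beta>) / 4" "\<nu> \<le> amin * (1 - \<beta>) / 4" by linarith+
  define Nm where "Nm = 2 * lam2 + 1"
  have Nm: "Nm > 0" using const_pos by (simp add: Nm_def)
  define k0 where "k0 = \<beta> * (amin * (1 - \<beta>) / 2) * Nm powr (\<beta> - 2)"
  have k0: "k0 > 0" using be const_pos Nm by (auto simp: k0_def)
  have nb: "\<nu> powr \<beta> > 0" using nu by simp
  \<comment> \<open>One summand for each place of comparison: the wall, the initial time, and the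
    source \<open>CF\<close> in the interior.\<close>
  define K where "K = H / \<nu> powr \<beta> + 2 * \<mu> / \<nu> powr \<beta> + (CF + 1) / k0"
  have pieces: "H / \<nu> powr \<beta> \<ge> 0" "2 * \<mu> / \<nu> powr \<beta> > 0" "(CF + 1) / k0 > 0"
    using H mu_pos CF_nonneg k0 nb by (auto intro: divide_pos_pos)
  have Kpos: "K > 0" using pieces unfolding K_def by linarith
  have KH: "H \<le> K * \<nu> powr \<beta>"
  proof -
    have "H = (H / \<nu> powr \<beta>) * \<nu> powr \<beta>" using nb by simp
    also have "\<dots> \<le> K * \<nu> powr \<beta>" using pieces nb by (intro mult_right_mono) (auto simp: K_def)
    finally show ?thesis .
  qed
  have Kmu: "2 * \<mu> \<le> K * \<nu> powr \<beta>"
  proof -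
    have "2 * \<mu> = (2 * \<mu> / \<nu> powr \<beta>) * \<nu> powr \<beta>" using nb by simp
    also have "\<dots> \<le> K * \<nu> powr \<beta>" using pieces nb by (intro mult_right_mono) (auto simp: K_def)
    finally show ?thesis .
  qed
  have KCF: "CF < K * k0"
  proof -
    have "CF + 1 = ((CF + 1) / k0) * k0" using k0 by simp
    also have "\<dots> \<le> K * k0" using pieces k0 by (intro mult_right_mono) (auto simp: K_def)
    finally show ?thesis by simp
  qed
  have main: "e * v x0 t0 \<le> e * v (Lam t0) t0 + K * (bN \<nu> (Lam t0 - x0) 0) powr \<beta>"
    if e: "e = 1 \<or> e = -1" and t0: "1 \<le> t0" and x0: "0 \<le> x0" "x0 \<le> Lam t0" for e x0 t0
  proof -
    define N where "N x t = bN \<nu> (Lam t - x) (t0 - t)" for x t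
    define Ns where "Ns x t = bNs \<nu> (Lam t - x) (t0 - t)" for x t
    define Nss where "Nss x t = bNss \<nu> (Lam t - x) (t0 - t)" for x t
    define D where "D x t = sqrt ((t0 - t) + (Lam t - x)\<^sup>2)" for x t
    have Npos: "N x t > 0" if "x < Lam t" "t \<le> t0" for x t
      using bN_bounds(1)[of "Lam t - x" "t0 - t" \<nu>] that nu by (simp add: N_def)
    have Nx: "((\<lambda>x. N x t) has_real_derivative - Ns x t) (at x)" if "x < Lam t" "t \<le> t0" for x t
    proof -
      have "((\<lambda>x. bN \<nu> (Lam t - x) (t0 - t)) has_real_derivative bNs \<nu> (Lam t - x) (t0 - t) * (-1)) (at x)"
        by (rule DERIV_chain2[OF bN_derivs(1)]) (use that in \<open>auto intro!: derivative_eq_intros\<close>)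
      then show ?thesis by (simp add: N_def Ns_def)
    qed
    have Nsx: "((\<lambda>x. Ns x t) has_real_derivative - Nss x t) (at x)" if "x < Lam t" "t \<le> t0" for x t
    proof -
      have "((\<lambda>x. bNs \<nu> (Lam t - x) (t0 - t)) has_real_derivative bNss \<nu> (Lam t - x) (t0 - t) * (-1)) (at x)"
        by (rule DERIV_chain2[OF bN_derivs(2)]) (use that in \<open>auto intro!: derivative_eq_intros\<close>)
      then show ?thesis by (simp add: Ns_def Nss_def)
    qed
    have Nt: "(N x has_real_derivative Ns x t * Lam1 t - \<nu> / (2 * D x t)) (at t)" if "x < Lam t" "t \<le> t0" "t > 0" for x t
    proof -
      have dl: "(Lam has_real_derivative Lam1 t) (at t)" using dLam[of t] at_within_half_line[of t] that by simp
      have p: "(t0 - t) + (Lam t - x)\<^sup>2 > 0" using that by (simp add: add_nonneg_pos)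
      have s: "D x t > 0" using p by (simp add: D_def)
      have "((\<lambda>t. sqrt ((t0 - t) + (Lam t - x)\<^sup>2)) has_real_derivative
         inverse (sqrt ((t0 - t) + (Lam t - x)\<^sup>2)) / 2 * (- 1 + 2 * (Lam t - x) * Lam1 t)) (at t)"
        by (rule DERIV_chain2[where f=sqrt and g="\<lambda>t. (t0 - t) + (Lam t - x)\<^sup>2", OF DERIV_real_sqrt[OF p]])
          (auto intro!: derivative_eq_intros dl)
      moreover have "((\<lambda>t. Lam t - x) has_real_derivative Lam1 t) (at t)" by (auto intro!: derivative_eq_intros dl)
      ultimately have "(N x has_real_derivative Lam1 t + \<nu> * (inverse (D x t) / 2 * (- 1 + 2 * (Lam t - x) * Lam1 t))) (at t)"
        unfolding N_def bN_def D_def by (intro DERIV_add DERIV_cmult)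
      moreover have "Lam1 t + \<nu> * (inverse (D x t) / 2 * (- 1 + 2 * (Lam t - x) * Lam1 t)) = Ns x t * Lam1 t - \<nu> / (2 * D x t)"
        unfolding Ns_def bNs_def D_def[symmetric] using s by (simp add: field_simps)
      ultimately show ?thesis by simp
    qed
    have powr_d: "((\<lambda>z. z powr r) has_real_derivative r * z powr (r - 1)) (at z)" if "z > 0" for z r :: real
      using has_real_derivative_powr[OF that] .
    have "e * v x0 t0 \<le> e * v (Lam t0) t0 + K * (N x0 t0) powr \<beta>"
    proof (rule v_comparison[where S="\<lambda>x t. e * v (Lam t0) t0 + K * (N x t) powr \<beta>"
        and Sx="\<lambda>x t. - (K * (\<beta> * (N x t powr (\<beta> - 1) * Ns x t)))"
        and Sxx="\<lambda>x t. K * (\<beta> * ((\<beta> - 1) * N x t powr (\<beta> - 2) * Ns x t * Ns x t + N x t powr (\<beta> - 1) * Nss x t))"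
        and St="\<lambda>x t. K * (\<beta> * (N x t powr (\<beta> - 1) * (Ns x t * Lam1 t - \<nu> / (2 * D x t))))"
        and ?T0.0="t0 - 1" and ?T1.0=t0 and ?T2.0="t0 + 1" and \<mu>=\<mu> and qb=\<mu>, OF e])
      fix x t assume xt: "0 < x" "x < Lam t" "t0 - 1 < t" "t \<le> t0"
      have t': "t > 0" using xt t0 by simp
      note n = Npos[OF xt(2,4)]
      have d1: "((\<lambda>x. N x t powr r) has_real_derivative r * N x t powr (r - 1) * (- Ns x t)) (at x)" for r
        by (rule DERIV_chain2[where f="\<lambda>z. z powr r", OF powr_d[OF n] Nx[OF xt(2,4)]])
      show "((\<lambda>x. e * v (Lam t0) t0 + K * (N x t) powr \<beta>) has_real_derivative - (K * (\<beta> * (N x t powr (\<beta> - 1) * Ns x t)))) (at x)"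
        by (rule DERIV_cong[OF DERIV_add[OF DERIV_const DERIV_cmult[OF d1]]]) simp
      have d2: "((\<lambda>x. N x t powr (\<beta> - 1) * Ns x t) has_real_derivative
          ((\<beta> - 1) * N x t powr (\<beta> - 1 - 1) * (- Ns x t)) * Ns x t + (- Nss x t) * N x t powr (\<beta> - 1)) (at x)"
        by (rule DERIV_mult[OF d1 Nsx[OF xt(2,4)]])
      show "((\<lambda>x. - (K * (\<beta> * (N x t powr (\<beta> - 1) * Ns x t)))) has_real_derivative
          K * (\<beta> * ((\<beta> - 1) * N x t powr (\<beta> - 2) * Ns x t * Ns x t + N x t powr (\<beta> - 1) * Nss x t))) (at x)"
        by (rule DERIV_cong[OF DERIV_minus[OF DERIV_cmult[OF DERIV_cmult[OF d2]]]]) (simp add: algebra_simps)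
      have d3: "((\<lambda>t. N x t powr \<beta>) has_real_derivative \<beta> * N x t powr (\<beta> - 1) * (Ns x t * Lam1 t - \<nu> / (2 * D x t))) (at t)"
        by (rule DERIV_chain2[where f="\<lambda>z. z powr \<beta>", OF powr_d[OF n] Nt[OF xt(2,4) t']])
      show "((\<lambda>t. e * v (Lam t0) t0 + K * (N x t) powr \<beta>) has_real_derivative
          K * (\<beta> * (N x t powr (\<beta> - 1) * (Ns x t * Lam1 t - \<nu> / (2 * D x t))))) (at t)"
        by (rule DERIV_cong[OF DERIV_add[OF DERIV_const DERIV_cmult[OF d3]]]) (simp add: algebra_simps)
      fix a assume a: "amin \<le> a" "a \<le> amax"
      have a0: "a > 0" using a const_pos by simp
      have bb: "Ns x t \<ge> 1" "N x t * Nss x t \<le> 2 * \<nu>" "N x t * (\<nu> / (2 * D x t)) \<le> \<nu>"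
        using bN_bounds(2-4)[of "Lam t - x" "t0 - t" \<nu>] xt nu by (auto simp: N_def Ns_def Nss_def D_def)
      define p where "p = N x t powr (\<beta> - 2)"
      have p1: "N x t powr (\<beta> - 1) = p * N x t"
      proof -
        have "N x t powr (\<beta> - 1) = N x t powr ((\<beta> - 2) + 1)" by simp
        also have "\<dots> = p * N x t powr 1" unfolding p_def by (rule powr_add)
        finally show ?thesis using n by simp
      qed
      have NNm: "N x t \<le> Nm"
      proof -
        have s: "0 \<le> Lam t - x" "Lam t - x \<le> lam2" using xt Lam_bounds[of t] t' by auto
        have "sqrt ((t0 - t) + (Lam t - x)\<^sup>2) \<le> 1 + lam2"
        proof (rule real_le_lsqrt)
          have "(t0 - t) + (Lam t - x)\<^sup>2 \<le> 1 + lam2\<^sup>2" using s xt by (intro add_mono power_mono) auto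
          also have "\<dots> \<le> (1 + lam2)\<^sup>2" using const_pos by (simp add: power2_eq_square algebra_simps)
          finally show "(t0 - t) + (Lam t - x)\<^sup>2 \<le> (1 + lam2)\<^sup>2" .
        qed (use const_pos xt in auto)
        then have "\<nu> * sqrt ((t0 - t) + (Lam t - x)\<^sup>2) \<le> 1 * (1 + lam2)" using nu xt by (intro mult_mono) auto
        then show ?thesis unfolding N_def bN_def Nm_def using s by simp
      qed
      have pge: "p \<ge> Nm powr (\<beta> - 2)" unfolding p_def using NNm n be by (intro powr_mono2') auto
      \<comment> \<open>The common factor \<open>K * \<beta> * p\<close> is removed. The motion of
        the wall is absorbed by the curvature term, as
        \<open>- Lam1 t \<le> \<mu> \<le> 2 * a / x\<close>.\<close>
      have br: "a * (- (1 - \<beta>) * (Ns x t * Ns x t) + N x t * Nss x t) - 2 * a * (N x t * Ns x t) / x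
          - N x t * Ns x t * Lam1 t + N x t * (\<nu> / (2 * D x t)) \<le> - (amin * (1 - \<beta>) / 2)"
      proof -
        have NN: "N x t * Ns x t \<ge> 0" using n bb by simp
        have "\<mu> \<le> 2 * a / x"
        proof -
          have "\<mu> * x \<le> \<mu> * lam2" using xt Lam_bounds[of t] t' mu_pos by (intro mult_left_mono) auto
          also have "\<dots> \<le> 2 * a" using mu_small a by simp
          finally show ?thesis using xt by (simp add: field_simps)
        qed
        then have "- Lam1 t \<le> 2 * a / x" using Lam1_le[of t] t' by (simp add: abs_le_iff)
        then have "(N x t * Ns x t) * (- Lam1 t) \<le> (N x t * Ns x t) * (2 * a / x)" using NN by (intro mult_left_mono) auto
        then have 1: "- 2 * a * (N x t * Ns x t) / x - N x t * Ns x t * Lam1 t \<le> 0" by (simp add: mult_ac)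
        have "1 \<le> Ns x t * Ns x t" using bb(1) mult_mono[of 1 "Ns x t" 1 "Ns x t"] by simp
        then have "(1 - \<beta>) * 1 \<le> (1 - \<beta>) * (Ns x t * Ns x t)" using be by (intro mult_left_mono) auto
        then have "- ((1 - \<beta>) * (Ns x t * Ns x t)) + N x t * Nss x t \<le> - (3 / 4 * (1 - \<beta>))" using bb(2) nu(3) by linarith
        then have "- (1 - \<beta>) * (Ns x t * Ns x t) + N x t * Nss x t \<le> - (3 / 4 * (1 - \<beta>))" by (simp only: mult_minus_left)
        then have "a * (- (1 - \<beta>) * (Ns x t * Ns x t) + N x t * Nss x t) \<le> a * (- (3 / 4 * (1 - \<beta>)))"
          using a0 by (intro mult_left_mono) auto
        also have "\<dots> \<le> amin * (- (3 / 4 * (1 - \<beta>)))" using a be by (intro mult_right_mono_neg) auto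
        also have "\<dots> = - (3 / 4 * (amin * (1 - \<beta>)))" by (simp only: mult_minus_right mult_ac)
        finally have 2: "a * (- (1 - \<beta>) * (Ns x t * Ns x t) + N x t * Nss x t) \<le> - (3 / 4 * (amin * (1 - \<beta>)))" .
        from 1 2 bb(3) nu(4) show ?thesis by simp
      qed
      have "CF < K * k0" by (rule KCF)
      also have "\<dots> = (K * \<beta> * Nm powr (\<beta> - 2)) * (amin * (1 - \<beta>) / 2)" by (simp add: k0_def)
      also have "\<dots> \<le> (K * \<beta> * p) * (amin * (1 - \<beta>) / 2)"
        using Kpos be pge const_pos by (intro mult_right_mono mult_left_mono) auto
      also have "\<dots> \<le> (K * \<beta> * p) * - (a * (- (1 - \<beta>) * (Ns x t * Ns x t) + N x t * Nss x t) - 2 * a * (N x t * Ns x t) / x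
          - N x t * Ns x t * Lam1 t + N x t * (\<nu> / (2 * D x t)))"
        using br Kpos be n by (intro mult_left_mono) (auto simp: p_def)
      finally show "a * (K * (\<beta> * ((\<beta> - 1) * N x t powr (\<beta> - 2) * Ns x t * Ns x t + N x t powr (\<beta> - 1) * Nss x t)) +
          2 * - (K * (\<beta> * (N x t powr (\<beta> - 1) * Ns x t))) / x) + 2 * (\<mu> / (3 * gm) + \<mu>) * \<mu>
          < K * (\<beta> * (N x t powr (\<beta> - 1) * (Ns x t * Lam1 t - \<nu> / (2 * D x t))))"
        unfolding p1 p_def[symmetric] CF_def[symmetric] by (simp add: algebra_simps)
    next
      let ?Q = "{(x, t). t0 - 1 \<le> t \<and> t \<le> t0 \<and> 0 \<le> x \<and> x \<le> Lam t}"
      have "continuous_on ?Q (\<lambda>z. e * v (Lam t0) t0 + K * (N (fst z) (snd z)) powr \<beta>)"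
      proof (intro continuous_on_add continuous_on_mult continuous_on_const continuous_on_powr')
        show "continuous_on ?Q (\<lambda>z. N (fst z) (snd z))"
          unfolding N_def bN_def using t0
          by (intro continuous_intros continuous_on_compose2[OF contLam]) auto
        show "\<forall>z\<in>?Q. 0 \<le> N (fst z) (snd z) \<and> (N (fst z) (snd z) = 0 \<longrightarrow> 0 < \<beta>)"
          using nu be by (auto simp: N_def bN_def)
      qed
      then show "continuous_on ?Q (\<lambda>(x, t). e * v (Lam t0) t0 + K * (N x t) powr \<beta>)" by (simp add: split_beta)
    next
      fix t assume t: "t0 - 1 < t" "t \<le> t0"
      have l: "Lam t > lam1 / 2" using Lam_bounds[of t] const_pos t t0 by simp
      have "- (K * (\<beta> * (N x t powr (\<beta> - 1) * Ns x t))) \<le> - (K * (\<beta> * (Nm powr (\<beta> - 1) * 1)))"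
        if x: "0 < x" "x < lam1 / 2" for x
      proof -
        have xl: "x < Lam t" using x l by simp
        have n: "N x t > 0" using Npos xl t by simp
        have NNm: "N x t \<le> Nm"
        proof -
          have s: "0 \<le> Lam t - x" "Lam t - x \<le> lam2" using x xl Lam_bounds[of t] t t0 by auto
          have "sqrt ((t0 - t) + (Lam t - x)\<^sup>2) \<le> 1 + lam2"
          proof (rule real_le_lsqrt)
            have "(t0 - t) + (Lam t - x)\<^sup>2 \<le> 1 + lam2\<^sup>2" using s t by (intro add_mono power_mono) auto
            also have "\<dots> \<le> (1 + lam2)\<^sup>2" using const_pos by (simp add: power2_eq_square algebra_simps)
            finally show "(t0 - t) + (Lam t - x)\<^sup>2 \<le> (1 + lam2)\<^sup>2" .
          qed (use const_pos t in auto)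
          then have "\<nu> * sqrt ((t0 - t) + (Lam t - x)\<^sup>2) \<le> 1 * (1 + lam2)" using nu t by (intro mult_mono) auto
          then show ?thesis unfolding N_def bN_def Nm_def using s by simp
        qed
        have "Ns x t \<ge> 1" using bN_bounds(2)[of "Lam t - x" "t0 - t" \<nu>] xl t nu by (auto simp: Ns_def)
        moreover have "Nm powr (\<beta> - 1) \<le> N x t powr (\<beta> - 1)" using NNm n be by (intro powr_mono2') auto
        ultimately have "Nm powr (\<beta> - 1) * 1 \<le> N x t powr (\<beta> - 1) * Ns x t" using Nm by (intro mult_mono) auto
        then show ?thesis using Kpos be by simp
      qed
      moreover have "K * (\<beta> * (Nm powr (\<beta> - 1) * 1)) > 0" using Kpos be Nm by simp
      moreover have "lam1 / 2 > 0" using const_pos by simp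
      ultimately show "\<exists>\<kappa>>0. \<exists>d>0. \<forall>x. 0 < x \<and> x < d \<longrightarrow> - (K * (\<beta> * (N x t powr (\<beta> - 1) * Ns x t))) \<le> - \<kappa>" by blast
    next
      fix t assume t: "t0 - 1 \<le> t" "t \<le> t0"
      let ?\<tau> = "t0 - t"
      have "e * v (Lam t) t - e * v (Lam t0) t0 \<le> \<bar>v (Lam t) t - v (Lam t0) t0\<bar>" using e by auto
      also have "\<dots> \<le> H * sqrt \<bar>t - t0\<bar>" using H(2)[of t t0] t t0 by simp
      also have "\<dots> = H * ?\<tau> powr (1 / 2)" using t by (simp add: powr_half_sqrt)
      \<comment> \<open>Passing from exponent \<open>1 / 2\<close> to \<open>\<beta> / 2\<close>
        uses \<open>?\<tau> \<le> 1\<close>, hence a time interval of length 1.\<close>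
      also have "\<dots> \<le> H * ?\<tau> powr (\<beta> / 2)"
        using H t be by (intro mult_left_mono powr_mono') auto
      also have "\<dots> \<le> (K * \<nu> powr \<beta>) * ?\<tau> powr (\<beta> / 2)" using KH by (intro mult_right_mono) auto
      also have "\<dots> = K * (\<nu> powr \<beta> * (sqrt ?\<tau>) powr \<beta>)" using t by (simp add: powr_half_sqrt[symmetric] powr_powr)
      also have "\<dots> = K * (N (Lam t) t) powr \<beta>" using t nu by (simp add: N_def bN_def powr_mult)
      finally show "e * v (Lam t) t \<le> e * v (Lam t0) t0 + K * (N (Lam t) t) powr \<beta>" by simp
    next
      fix x assume x: "0 \<le> x" "x \<le> Lam (t0 - 1)"
      have "e * v x (t0 - 1) - e * v (Lam t0) t0 \<le> \<bar>v x (t0 - 1)\<bar> + \<bar>v (Lam t0) t0\<bar>" using e by auto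
      also have "\<dots> \<le> 2 * \<mu>" using v_le[of "t0 - 1" x] v_le[of t0 "Lam t0"] Lam_pos[of t0] x t0 by simp
      also have "\<dots> \<le> K * \<nu> powr \<beta>" by (rule Kmu)
      also have "\<dots> \<le> K * (N x (t0 - 1)) powr \<beta>"
      proof (intro mult_left_mono powr_mono2)
        have "1 \<le> sqrt (1 + (Lam (t0 - 1) - x)\<^sup>2)" by simp
        then have "\<nu> * 1 \<le> \<nu> * sqrt (1 + (Lam (t0 - 1) - x)\<^sup>2)" using nu by (intro mult_left_mono) auto
        then show "\<nu> \<le> N x (t0 - 1)" using x by (simp add: N_def bN_def)
      qed (use nu be Kpos in auto)
      finally show "e * v x (t0 - 1) \<le> e * v (Lam t0) t0 + K * (N x (t0 - 1)) powr \<beta>" by simp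
    qed (use t0 x0 v_le q_le in auto)
    then show ?thesis by (simp add: N_def)
  qed
  show ?thesis
  proof (intro exI[of _ "2 * K"] conjI allI impI)
    fix t x assume "1 \<le> t \<and> 0 \<le> x \<and> x \<le> Lam t"
    then have tx: "1 \<le> t" "0 \<le> x" "x \<le> Lam t" by auto
    have "bN \<nu> (Lam t - x) 0 \<le> 2 * (Lam t - x)" unfolding bN_def using tx nu mult_right_mono[of \<nu> 1 "Lam t - x"] by simp
    moreover have "bN \<nu> (Lam t - x) 0 \<ge> 0" unfolding bN_def using tx nu by simp
    ultimately have "(bN \<nu> (Lam t - x) 0) powr \<beta> \<le> (2 * (Lam t - x)) powr \<beta>" using be by (intro powr_mono2) auto
    also have "\<dots> = 2 powr \<beta> * (Lam t - x) powr \<beta>" by (rule powr_mult)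
    also have "\<dots> \<le> 2 powr 1 * (Lam t - x) powr \<beta>" using be by (intro mult_right_mono powr_mono) auto
    finally have "K * (bN \<nu> (Lam t - x) 0) powr \<beta> \<le> 2 * K * (Lam t - x) powr \<beta>" using Kpos by (simp add: mult_ac)
    then show "\<bar>v x t - v (Lam t) t\<bar> \<le> 2 * K * (Lam t - x) powr \<beta>"
      using main[of 1 t x] main[of "-1" t x] tx by (simp add: abs_le_iff)
  qed (use Kpos in simp)
qed

end

section \<open>Spatial Hoelder estimate by doubling the variable\<close>

lemma compact_moving_triangle:
  fixes \<l> :: "real \<Rightarrow> real"
  assumes "continuous_on {T0..T1} \<l>" "\<And>t. T0 \<le> t \<Longrightarrow> t \<le> T1 \<Longrightarrow> \<l> t > 0"
  shows "compact {(x, y, t). T0 \<le> t \<and> t \<le> T1 \<and> 0 \<le> y \<and> y \<le> x \<and> x \<le> \<l> t}"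
proof -
  have "{(x, y, t). T0 \<le> t \<and> t \<le> T1 \<and> 0 \<le> y \<and> y \<le> x \<and> x \<le> \<l> t} =
     (\<lambda>(s, s', t). (s * \<l> t, s' * (s * \<l> t), t)) ` ({0..1} \<times> {0..1} \<times> {T0..T1})" (is "?A = ?B")
  proof (intro equalityI subsetI)
    fix z assume "z \<in> ?A"
    then obtain x y t where z: "z = (x, y, t)" "T0 \<le> t" "t \<le> T1" "0 \<le> y" "y \<le> x" "x \<le> \<l> t" by auto
    have l: "\<l> t > 0" by (rule assms(2)) (use z in auto)
    define s' where "s' = (if x = 0 then 0 else y / x)"
    have s': "0 \<le> s'" "s' \<le> 1" "s' * x = y" using z by (auto simp: s'_def)
    have "z = (\<lambda>(s, s', t). (s * \<l> t, s' * (s * \<l> t), t)) (x / \<l> t, s', t)" using z l s' by auto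
    moreover have "(x / \<l> t, s', t) \<in> {0..1} \<times> {0..1} \<times> {T0..T1}" using z l s' by auto
    ultimately show "z \<in> ?B" by blast
  next
    fix z assume "z \<in> ?B"
    then obtain w where w: "w \<in> {0..1} \<times> {0..1} \<times> {T0..T1}" "z = (\<lambda>(s, s', t). (s * \<l> t, s' * (s * \<l> t), t)) w" by blast
    obtain s s' t where "w = (s, s', t)" by (cases w)
    with w have z: "z = (s * \<l> t, s' * (s * \<l> t), t)" "0 \<le> s" "s \<le> 1" "0 \<le> s'" "s' \<le> 1" "T0 \<le> t" "t \<le> T1" by auto
    have "\<l> t > 0" by (rule assms(2)) (use z in auto)
    then have a: "s * \<l> t \<le> 1 * \<l> t" "0 \<le> s * \<l> t" using z by (auto intro: mult_right_mono)
    then have "s' * (s * \<l> t) \<le> 1 * (s * \<l> t)" using z by (intro mult_right_mono)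
    moreover have "0 \<le> s' * (s * \<l> t)" using a z by simp
    ultimately have "s' * (s * \<l> t) \<le> 1 * (s * \<l> t)" "0 \<le> s' * (s * \<l> t)" by auto
    with a z show "z \<in> ?A" by auto
  qed
  moreover have "continuous_on ({0..1} \<times> {0..1} \<times> {T0..T1}) (\<lambda>(s, s', t). (s * \<l> t, s' * (s * \<l> t), t))"
  proof -
    have "continuous_on ({0..1} \<times> {0..1} \<times> {T0..T1}) (\<lambda>z::real \<times> real \<times> real. \<l> (snd (snd z)))"
      by (rule continuous_on_compose2[OF assms(1)]) (auto intro!: continuous_intros)
    then show ?thesis unfolding split_beta by (intro continuous_intros) auto
  qed
  ultimately show ?thesis by (simp only: compact_continuous_image compact_Times compact_Icc)
qed

context bubble_smooth
begin

text \<open>Bound for \<open>\<bar>A_x\<bar> / x\<close>: the derivative of \<open>A\<close> is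
  \<open>- A * Yx\<close>, and \<open>\<bar>Yx\<bar>\<close> is at most
  \<open>\<mu> / amin * x / 3\<close>.\<close>

definition "C7 = amax * (\<mu> / amin) / 3"

lemma C7: "C7 \<ge> 0" "2 * lam2\<^sup>2 * C7 \<le> amin * (1 - \<beta>)"
proof -
  show "C7 \<ge> 0" using const_pos mu_pos by (simp add: C7_def)
  have "2 * lam2\<^sup>2 * C7 = \<mu> * (2 * amax * lam2\<^sup>2) / (3 * amin)" by (simp add: C7_def mult_ac)
  also have "\<dots> \<le> 3 * amin\<^sup>2 * (1 - \<beta>) / (3 * amin)" using mu_small(2) const_pos by (intro divide_right_mono) auto
  also have "\<dots> = amin * (1 - \<beta>)" using const_pos by (simp add: power2_eq_square)
  finally show "2 * lam2\<^sup>2 * C7 \<le> amin * (1 - \<beta>)" .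
qed

text \<open>The factor \<open>y1\<close> reflects the vanishing gradient at the centre; in the
  doubling argument it cancels the singular \<open>1 / y1\<close> of the curvature term.\<close>

lemma A_difference:
  assumes t: "t \<ge> 0" and y: "0 \<le> y2" "y2 < y1" "y1 \<le> Lam t"
  shows "\<bar>A y1 t - A y2 t\<bar> \<le> C7 * y1 * (y1 - y2)"
proof -
  have dA: "((\<lambda>x. A x t) has_real_derivative - (A z t * Yx z t)) (at z)" if "y2 < z" "z < y1" for z
    unfolding A_def using dYx[OF t, of z] that y by (auto intro!: derivative_eq_intros)
  have "\<exists>l z. y2 < z \<and> z < y1 \<and> ((\<lambda>x. A x t) has_real_derivative l) (at z) \<and> A y1 t - A y2 t = (y1 - y2) * l"
  proof (rule MVT[OF y(2)])
    show "continuous_on {y2..y1} (\<lambda>x. A x t)" unfolding A_def by (intro continuous_intros contY) (use t y in auto)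
    show "(\<lambda>x. A x t) differentiable at x" if "y2 < x" "x < y1" for x using dA[OF that] real_differentiable_def by auto
  qed
  then obtain l z where z: "y2 < z" "z < y1" "((\<lambda>x. A x t) has_real_derivative l) (at z)" "A y1 t - A y2 t = (y1 - y2) * l" by auto
  have l: "l = - (A z t * Yx z t)" using DERIV_unique[OF z(3) dA[OF z(1,2)]] .
  have "\<bar>l\<bar> = A z t * \<bar>Yx z t\<bar>" unfolding l using A_pos[of z t] by (simp add: abs_mult)
  also have "\<dots> \<le> amax * (\<mu> / amin * z / 3)" using A_bounds[OF t, of z] Yx_le[OF t, of z] z y const_pos by (intro mult_mono) auto
  also have "\<dots> = C7 * z" by (simp add: C7_def)
  also have "\<dots> \<le> C7 * y1" using C7 z by (intro mult_left_mono) auto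
  finally show ?thesis unfolding z(4) abs_mult using z y by (simp add: mult.commute mult_left_mono)
qed

text \<open>Doubling of the spatial variable; the factor \<open>t - t0\<close> removes the dependence on the values at time \<open>t0\<close>.\<close>

lemma v_holder: "\<exists>K>0. \<forall>t x1 x2. 2 \<le> t \<and> 0 \<le> x2 \<and> x2 \<le> x1 \<and> x1 \<le> Lam t \<longrightarrow> \<bar>v x1 t - v x2 t\<bar> \<le> K * (x1 - x2) powr \<beta>"
proof -
  obtain C6 where C6: "C6 > 0" "\<And>t x. 1 \<le> t \<Longrightarrow> 0 \<le> x \<Longrightarrow> x \<le> Lam t \<Longrightarrow> \<bar>v x t - v (Lam t) t\<bar> \<le> C6 * (Lam t - x) powr \<beta>"
    using wall_barrier by blast
  define k0 where "k0 = \<beta> * lam2 powr (\<beta> - 2) * (amin * (1 - \<beta>))"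
  have k0: "k0 > 0" using be const_pos by (auto simp: k0_def)
  \<comment> \<open>\<open>C6\<close> settles pairs with one point on the wall. The other summand
    makes the concavity \<open>K * k0\<close> exceed the remaining terms at an interior maximum:
    \<open>4 * \<mu>\<close> from the time weight and \<open>2 * CF\<close> from the two
    sources.\<close>
  define K where "K = C6 + (4 * \<mu> + 2 * CF + 1) / k0"
  have p0: "(4 * \<mu> + 2 * CF + 1) / k0 > 0" using k0 mu_pos CF_nonneg by (intro divide_pos_pos) auto
  have Kpos: "K > 0" "C6 \<le> K" using C6 p0 by (auto simp: K_def)
  have Kk: "4 * \<mu> + 2 * CF < K * k0"
  proof -
    have "4 * \<mu> + 2 * CF + 1 = ((4 * \<mu> + 2 * CF + 1) / k0) * k0" using k0 by simp
    also have "\<dots> \<le> K * k0" using k0 C6 by (intro mult_right_mono) (auto simp: K_def)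
    finally show ?thesis by simp
  qed
  have main: "(t - t0) * (e * v x1 t - e * v x2 t) - K * (x1 - x2) powr \<beta> \<le> 0"
    if e: "e = 1 \<or> e = -1" and t0: "1 \<le> t0" and tx: "t0 \<le> t" "t \<le> t0 + 1" "0 \<le> x2" "x2 \<le> x1" "x1 \<le> Lam t" for e t0 t x1 x2
  proof (rule ccontr)
    assume neg: "\<not> (t - t0) * (e * v x1 t - e * v x2 t) - K * (x1 - x2) powr \<beta> \<le> 0"
    define f where "f x y t = (t - t0) * (e * v x t - e * v y t) - K * (x - y) powr \<beta>" for x y t
    define M where "M = f x1 x2 t"
    have M: "M > 0" using neg by (simp add: M_def f_def)
    have vb: "\<bar>v x s\<bar> \<le> \<mu>" if "t0 \<le> s" "0 \<le> x" "x \<le> Lam s" for x s using v_le[of s x] that t0 by simp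
    have M2: "M \<le> 2 * \<mu>"
    proof -
      have a: "e * v x1 t - e * v x2 t \<le> 2 * \<mu>" using vb[of t x1] vb[of t x2] tx e unfolding abs_le_iff by auto
      have "M \<le> (t - t0) * (e * v x1 t - e * v x2 t)" unfolding M_def f_def using Kpos by simp
      also have "\<dots> \<le> (t - t0) * (2 * \<mu>)" using a tx by (intro mult_left_mono) auto
      also have "\<dots> \<le> 1 * (2 * \<mu>)" using tx mu_pos by (intro mult_right_mono) auto
      finally show ?thesis by simp
    qed
    define \<Omega> where "\<Omega> = {(x, y, t). t0 \<le> t \<and> t \<le> t0 + 1 \<and> 0 \<le> y \<and> y \<le> x \<and> x \<le> Lam t}"
    have cLam: "continuous_on {t0..t0 + 1} Lam" by (rule continuous_on_subset[OF contLam]) (use t0 in auto)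
    have Oc: "compact \<Omega>" unfolding \<Omega>_def
      by (rule compact_moving_triangle[OF cLam]) (use Lam_pos t0 in auto)
    have cp: "continuous_on B (\<lambda>z. (fst z - fst (snd z)) powr \<beta>)" if "\<And>z. z \<in> B \<Longrightarrow> fst (snd z) \<le> fst z" for B :: "(real \<times> real \<times> real) set"
      by (rule continuous_on_powr') (use that be in \<open>auto intro!: continuous_intros\<close>)
    have cf: "continuous_on \<Omega> (\<lambda>z. f (fst z) (fst (snd z)) (snd (snd z)))"
      unfolding f_def by (intro continuous_on_diff continuous_on_mult continuous_on_const contY cp continuous_intros)
        (use t0 in \<open>auto simp: \<Omega>_def\<close>)
    then have "uniformly_continuous_on \<Omega> (\<lambda>z. f (fst z) (fst (snd z)) (snd (snd z)))"
      using Oc by (intro compact_uniformly_continuous)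
    then obtain d1 where d1: "d1 > 0" "\<And>z z'. z \<in> \<Omega> \<Longrightarrow> z' \<in> \<Omega> \<Longrightarrow> dist z' z < d1 \<Longrightarrow>
        dist (f (fst z') (fst (snd z')) (snd (snd z'))) (f (fst z) (fst (snd z)) (snd (snd z))) < M / 4"
      unfolding uniformly_continuous_on_def using M by (metis zero_less_divide_iff zero_less_numeral)
    have wall: "f (Lam s) y s \<le> 0" if s: "t0 \<le> s" "s \<le> t0 + 1" "0 \<le> y" "y \<le> Lam s" for s y
    proof -
      have "e * v (Lam s) s - e * v y s \<le> C6 * (Lam s - y) powr \<beta>" using C6(2)[of s y] s t0 e unfolding abs_le_iff by auto
      then have "(s - t0) * (e * v (Lam s) s - e * v y s) \<le> (s - t0) * (C6 * (Lam s - y) powr \<beta>)" using s by (intro mult_left_mono) auto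
      also have "\<dots> \<le> 1 * (K * (Lam s - y) powr \<beta>)" using s Kpos C6 by (intro mult_mono) auto
      finally show ?thesis by (simp add: f_def)
    qed
    have x1l: "x1 < Lam t" using wall[of t x2] tx M by (cases "x1 = Lam t") (auto simp: M_def)
    define \<delta> where "\<delta> = min (d1 / 2) (min (lam1 / 2) (Lam t - x1))"
    have dd: "\<delta> > 0" "\<delta> < d1" "\<delta> < lam1" "x1 \<le> Lam t - \<delta>" using d1 const_pos x1l by (auto simp: \<delta>_def)
    have near_wall: "f (Lam s - \<delta>) y s < M / 4" if s: "t0 \<le> s" "s \<le> t0 + 1" "0 \<le> y" "y \<le> Lam s - \<delta>" for s y
    proof -
      have "(Lam s, y, s) \<in> \<Omega>" "(Lam s - \<delta>, y, s) \<in> \<Omega>" using dd s by (auto simp: \<Omega>_def)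
      moreover have "dist (Lam s - \<delta>, y, s) (Lam s, y, s) < d1" using dd by (simp add: dist_Pair_Pair dist_real_def)
      ultimately have "\<bar>f (Lam s - \<delta>) y s - f (Lam s) y s\<bar> < M / 4"
        using d1(2)[of "(Lam s, y, s)" "(Lam s - \<delta>, y, s)"] by (simp add: dist_real_def)
      then show ?thesis using wall[of s y] s dd unfolding abs_less_iff by linarith
    qed
    obtain h0 where h0: "h0 > 0" "h0 \<le> 1" "\<And>h t x. 0 < h \<Longrightarrow> h < h0 \<Longrightarrow> 0 \<le> t \<Longrightarrow> t \<le> t0 + 1 \<Longrightarrow> 0 \<le> x \<Longrightarrow> x \<le> Lam t - \<delta> \<Longrightarrow>
        (\<forall>\<tau>. t \<le> \<tau> \<and> \<tau> \<le> t + h \<longrightarrow> x < Lam \<tau>) \<and> \<bar>dq h x t - v x t\<bar> \<le> M / 16"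
      using dq_uniform[OF dd(1), of "M / 16" "t0 + 1"] M by auto
    have cpos: "\<mu> / (3 * gm) + \<mu> \<ge> 0" using mu_pos par by simp
    define h where "h = min (h0 / 2) (1 / (\<mu> / (3 * gm) + \<mu> + 1))"
    have h: "0 < h" "h < h0" "h \<le> 1 / (\<mu> / (3 * gm) + \<mu> + 1)" using h0 cpos by (auto simp: h_def min_def)
    have "h * (\<mu> / (3 * gm) + \<mu>) \<le> 1 / (\<mu> / (3 * gm) + \<mu> + 1) * (\<mu> / (3 * gm) + \<mu>)" using h(3) cpos by (intro mult_right_mono)
    also have "\<dots> \<le> 1" using cpos by simp
    finally have h1: "h * (\<mu> / (3 * gm) + \<mu>) \<le> 1" .
    have inn: "x < Lam \<tau>" if "t0 \<le> s" "s \<le> t0 + 1" "0 \<le> x" "x \<le> Lam s - \<delta>" "s \<le> \<tau>" "\<tau> \<le> s + h" for x s \<tau>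
      using h0(3)[of h s x] h that t0 by auto
    have close: "\<bar>dq h x s - v x s\<bar> \<le> M / 16" if "t0 \<le> s" "s \<le> t0 + 1" "0 \<le> x" "x \<le> Lam s - \<delta>" for x s
      using h0(3)[of h s x] h that t0 by auto
    \<comment> \<open>The functional with \<open>v\<close> replaced by difference quotients, which
      can be differentiated in time and twice in space; it differs from \<open>f\<close> by at most
      \<open>M / 8\<close>.\<close>
    define fh where "fh x y t = (t - t0) * (e * dq h x t - e * dq h y t) - K * (x - y) powr \<beta>" for x y t
    have fclose: "\<bar>fh x y s - f x y s\<bar> \<le> M / 8" if s: "t0 \<le> s" "s \<le> t0 + 1" "0 \<le> y" "y \<le> x" "x \<le> Lam s - \<delta>" for x y s
    proof -
      have c1: "\<bar>dq h x s - v x s\<bar> \<le> M / 16" "\<bar>dq h y s - v y s\<bar> \<le> M / 16" by (rule close; use s in linarith)+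
      have "fh x y s - f x y s = (s - t0) * (e * (dq h x s - v x s) - e * (dq h y s - v y s))"
        unfolding fh_def f_def by (simp add: algebra_simps)
      moreover have "\<bar>e * (dq h x s - v x s) - e * (dq h y s - v y s)\<bar> \<le> M / 8"
        using c1 e unfolding abs_le_iff by auto
      then have "\<bar>s - t0\<bar> * \<bar>e * (dq h x s - v x s) - e * (dq h y s - v y s)\<bar> \<le> \<bar>s - t0\<bar> * (M / 8)" by (intro mult_left_mono) auto
      ultimately have "\<bar>fh x y s - f x y s\<bar> \<le> (s - t0) * (M / 8)" using s by (simp add: abs_mult)
      also have "\<dots> \<le> 1 * (M / 8)" using s M by (intro mult_right_mono) auto
      finally show ?thesis by simp
    qed
    define \<Omega>' where "\<Omega>' = {(x, y, t). t0 \<le> t \<and> t \<le> t0 + 1 \<and> 0 \<le> y \<and> y \<le> x \<and> x \<le> Lam t - \<delta>}"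
    have cO': "compact \<Omega>'" unfolding \<Omega>'_def
    proof (rule compact_moving_triangle)
      show "continuous_on {t0..t0 + 1} (\<lambda>t. Lam t - \<delta>)" by (intro continuous_intros cLam)
      show "0 < Lam s - \<delta>" if "t0 \<le> s" "s \<le> t0 + 1" for s using Lam_bounds[of s] dd that t0 by simp
    qed
    have cfh: "continuous_on \<Omega>' (\<lambda>z. fh (fst z) (fst (snd z)) (snd (snd z)))"
    proof -
      have m: "0 \<le> snd (snd z) + h \<and> 0 \<le> snd (snd z) \<and> (0 \<le> fst z \<and> fst z \<le> Lam (snd (snd z))) \<and> fst z \<le> Lam (snd (snd z) + h)
          \<and> (0 \<le> fst (snd z) \<and> fst (snd z) \<le> Lam (snd (snd z))) \<and> fst (snd z) \<le> Lam (snd (snd z) + h) \<and> fst (snd z) \<le> fst z"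
        if "z \<in> \<Omega>'" for z
      proof -
        obtain x y s where z: "z = (x, y, s)" by (cases z)
        have s: "t0 \<le> s" "s \<le> t0 + 1" "0 \<le> y" "y \<le> x" "x \<le> Lam s - \<delta>" using that by (auto simp: z \<Omega>'_def)
        have "x < Lam (s + h)" "y < Lam (s + h)" by (rule inn[of s]; use s h in simp)+
        then show ?thesis using s t0 h dd by (simp add: z)
      qed
      have mm: "\<And>z. z \<in> \<Omega>' \<Longrightarrow> 0 \<le> snd (snd z)" "\<And>z. z \<in> \<Omega>' \<Longrightarrow> 0 \<le> snd (snd z) + h"
        "\<And>z. z \<in> \<Omega>' \<Longrightarrow> 0 \<le> fst z \<and> fst z \<le> Lam (snd (snd z))"
        "\<And>z. z \<in> \<Omega>' \<Longrightarrow> 0 \<le> fst z \<and> fst z \<le> Lam (snd (snd z) + h)"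
        "\<And>z. z \<in> \<Omega>' \<Longrightarrow> 0 \<le> fst (snd z) \<and> fst (snd z) \<le> Lam (snd (snd z))"
        "\<And>z. z \<in> \<Omega>' \<Longrightarrow> 0 \<le> fst (snd z) \<and> fst (snd z) \<le> Lam (snd (snd z) + h)"
        "\<And>z. z \<in> \<Omega>' \<Longrightarrow> fst (snd z) \<le> fst z"
        by (blast dest: m)+
      have cc: "continuous_on \<Omega>' (\<lambda>z. fst z)" "continuous_on \<Omega>' (\<lambda>z. fst (snd z))" "continuous_on \<Omega>' (\<lambda>z. snd (snd z))"
        "continuous_on \<Omega>' (\<lambda>z. snd (snd z) + h)"
        by (intro continuous_intros)+
      note 1 = contY(1)[OF cc(1,3) mm(1,3)] contY(1)[OF cc(1,4) mm(2,4)] contY(1)[OF cc(2,3) mm(1,5)] contY(1)[OF cc(2,4) mm(2,6)]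
      show ?thesis unfolding fh_def dq_def
        by (intro continuous_on_diff continuous_on_mult continuous_on_const continuous_on_divide 1 cp[OF mm(7)] cc) (use h in simp)+
    qed
    have z0: "(x1, x2, t) \<in> \<Omega>'" using tx dd by (auto simp: \<Omega>'_def)
    have "\<exists>z\<in>\<Omega>'. \<forall>w\<in>\<Omega>'. fh (fst w) (fst (snd w)) (snd (snd w)) \<le> fh (fst z) (fst (snd z)) (snd (snd z))"
      by (rule continuous_attains_sup[OF cO' _ cfh]) (use z0 in auto)
    then obtain y1 y2 s where z: "(y1, y2, s) \<in> \<Omega>'" and max: "\<And>x y r. (x, y, r) \<in> \<Omega>' \<Longrightarrow> fh x y r \<le> fh y1 y2 s"
      by fastforce
    have z': "t0 \<le> s" "s \<le> t0 + 1" "0 \<le> y2" "y2 \<le> y1" "y1 \<le> Lam s - \<delta>" using z by (auto simp: \<Omega>'_def)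
    have big: "fh y1 y2 s \<ge> 7 / 8 * M" using max[OF z0] fclose[of t x2 x1] tx dd unfolding M_def[symmetric] abs_le_iff by simp
    have bigp: "fh y1 y2 s > 0" using big M by linarith
    have y12: "y2 < y1" using bigp z' by (cases "y1 = y2") (auto simp: fh_def)
    have "K * (y1 - y2) powr \<beta> \<ge> 0" using Kpos by simp
    then have st0: "t0 < s" using bigp z'(1) by (cases "s = t0") (auto simp: fh_def)
    have y1l: "y1 < Lam s - \<delta>"
    proof (rule ccontr)
      assume "\<not> y1 < Lam s - \<delta>"
      then have "y1 = Lam s - \<delta>" using z' by simp
      then show False using near_wall[of s y2] z' fclose[of s y2 y1] big M unfolding abs_le_iff by auto
    qed
    define c where "c = s - t0"
    have c: "0 < c" "c \<le> 1" using st0 z' by (auto simp: c_def)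
    have s0: "s > 0" using z' t0 by simp
    have lx: "x < Lam s" "x < Lam (s + h)" if "0 \<le> x" "x \<le> Lam s - \<delta>" for x
      using inn[of s x] z' h that by auto
    have dqx1: "((\<lambda>x. dq h x s) has_real_derivative dqx h x s) (at x)" if "0 < x" "x < Lam s - \<delta>" for x
      using dq_derivs(1)[OF s0 h(1) that(1) lx] that by simp
    have dqx2: "((\<lambda>x. dqx h x s) has_real_derivative dqxx h x s) (at x)" if "0 < x" "x < Lam s - \<delta>" for x
      using dq_derivs(2)[OF s0 h(1) that(1) lx] that by simp
    have pw1: "((\<lambda>x. (x - y) powr r) has_real_derivative r * (x - y) powr (r - 1)) (at x)" if "y < x" for x y r :: real
    proof -
      have "((\<lambda>x. (x - y) powr r) has_real_derivative r * (x - y) powr (r - 1) * 1) (at x)"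
        by (rule DERIV_chain2[where f="\<lambda>z. z powr r", OF has_real_derivative_powr]) (use that in \<open>auto intro!: derivative_eq_intros\<close>)
      then show ?thesis by simp
    qed
    have pw2: "((\<lambda>y. (x - y) powr r) has_real_derivative - (r * (x - y) powr (r - 1))) (at y)" if "y < x" for x y r :: real
    proof -
      have "((\<lambda>y. (x - y) powr r) has_real_derivative r * (x - y) powr (r - 1) * (- 1)) (at y)"
        by (rule DERIV_chain2[where f="\<lambda>z. z powr r", OF has_real_derivative_powr]) (use that in \<open>auto intro!: derivative_eq_intros\<close>)
      then show ?thesis by simp
    qed
    have g2d: "((\<lambda>y. fh y1 y s) has_real_derivative - (c * (e * dqx h y s)) + K * (\<beta> * (y1 - y) powr (\<beta> - 1))) (at y)"
      if "0 < y" "y < y1" for y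
    proof -
      have "((\<lambda>y. c * (e * dq h y1 s - e * dq h y s) - K * (y1 - y) powr \<beta>) has_real_derivative
          c * (0 - e * dqx h y s) - K * (- (\<beta> * (y1 - y) powr (\<beta> - 1)))) (at y)"
        by (intro DERIV_diff DERIV_cmult DERIV_const dqx1 pw2) (use that y1l in auto)
      then show ?thesis unfolding fh_def c_def[symmetric] by simp
    qed
    \<comment> \<open>At the centre the gradient of the quotient tends to zero, while
      \<open>- K * (y1 - y) powr \<beta>\<close> has a positive slope in \<open>y\<close>; hence
      moving the inner point outward would increase \<open>fh\<close>.\<close>
    have y2p: "y2 > 0"
    proof (rule ccontr)
      assume "\<not> y2 > 0"
      then have y20: "y2 = 0" using z' by simp
      define \<kappa> where "\<kappa> = K * (\<beta> * y1 powr (\<beta> - 1))"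
      have y1p: "y1 > 0" using y12 y20 by simp
      have k: "\<kappa> > 0" using Kpos be y1p by (simp add: \<kappa>_def)
      obtain d where d: "d > 0" "\<And>x. 0 < x \<Longrightarrow> x < d \<Longrightarrow> \<bar>dqx h x s\<bar> < \<kappa>" using dqx_tendsto_0[of s h \<kappa>] s0 h k by auto
      define b where "b = min d y1 / 2"
      have b: "b > 0" "b < d" "b < y1" using d y1p by (auto simp: b_def min_def)
      have sub: "(y1, y, s) \<in> \<Omega>'" if "0 \<le> y" "y \<le> b" for y using that b z' by (auto simp: \<Omega>'_def)
      have "continuous_on {0..b} ((\<lambda>z. fh (fst z) (fst (snd z)) (snd (snd z))) \<circ> (\<lambda>y. (y1, y, s)))"
        by (rule continuous_on_compose) (auto intro!: continuous_intros continuous_on_subset[OF cfh] sub)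
      then have cb: "continuous_on {0..b} (\<lambda>y. fh y1 y s)" by (simp add: o_def)
      have "\<exists>l z. 0 < z \<and> z < b \<and> ((\<lambda>y. fh y1 y s) has_real_derivative l) (at z) \<and> fh y1 b s - fh y1 0 s = (b - 0) * l"
        by (rule MVT[OF b(1) cb]) (use g2d b real_differentiable_def in fastforce)
      then obtain l w where w: "0 < w" "w < b" "((\<lambda>y. fh y1 y s) has_real_derivative l) (at w)" "fh y1 b s - fh y1 0 s = b * l" by auto
      have "l = - (c * (e * dqx h w s)) + K * (\<beta> * (y1 - w) powr (\<beta> - 1))" using DERIV_unique[OF w(3) g2d[of w]] w b by simp
      moreover have "c * (e * dqx h w s) < \<kappa>"
      proof -
        have "e * dqx h w s \<le> \<bar>dqx h w s\<bar>" using e by auto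
        then have "c * (e * dqx h w s) \<le> c * \<bar>dqx h w s\<bar>" using c by (intro mult_left_mono) auto
        also have "\<dots> \<le> 1 * \<bar>dqx h w s\<bar>" using c by (intro mult_right_mono) auto
        also have "\<dots> < \<kappa>" using d(2)[of w] w b by simp
        finally show ?thesis .
      qed
      moreover have "\<kappa> \<le> K * (\<beta> * (y1 - w) powr (\<beta> - 1))"
        unfolding \<kappa>_def using Kpos be w b by (intro mult_left_mono powr_mono2') auto
      ultimately have "l > 0" by linarith
      then have "b * l > 0" using b by simp
      then show False using max[OF sub[of b]] w(4) b y20 by simp
    qed
    define \<sigma> where "\<sigma> = y1 - y2"
    have sp: "\<sigma> > 0" "\<sigma> \<le> lam2" using y12 y2p y1l Lam_bounds[of s] s0 dd by (auto simp: \<sigma>_def)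
    \<comment> \<open>The second-derivative tests in \<open>y1\<close> and in \<open>y2\<close> are
      applied separately; each yields the concavity
      \<open>\<beta> * (\<beta> - 1) * \<sigma> powr (\<beta> - 2)\<close>, and the first-order
      conditions give both gradients the same value.\<close>
    have m1: "c * (e * dqx h y1 s) = K * (\<beta> * \<sigma> powr (\<beta> - 1))" "c * (e * dqxx h y1 s) \<le> K * (\<beta> * ((\<beta> - 1) * \<sigma> powr (\<beta> - 2)))"
    proof -
      have mm: "fh y y2 s \<le> fh y1 y2 s" if "y2 < y" "y < Lam s - \<delta>" for y
        by (rule max) (use that z' in \<open>auto simp: \<Omega>'_def\<close>)
      have g1d: "((\<lambda>y. fh y y2 s) has_real_derivative c * (e * dqx h y s - 0) - K * (\<beta> * (y - y2) powr (\<beta> - 1))) (at y)"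
        if "y2 < y" "y < Lam s - \<delta>" for y
        unfolding fh_def c_def[symmetric]
        by (intro DERIV_diff DERIV_cmult DERIV_const dqx1 pw1) (use that y2p in auto)
      have g1dd: "((\<lambda>y. c * (e * dqx h y s - 0) - K * (\<beta> * (y - y2) powr (\<beta> - 1))) has_real_derivative
          c * (e * dqxx h y1 s - 0) - K * (\<beta> * ((\<beta> - 1) * (y1 - y2) powr (\<beta> - 1 - 1)))) (at y1)"
        by (intro DERIV_diff DERIV_cmult DERIV_const dqx2 pw1) (use y12 y1l y2p in auto)
      note im = interior_max_derivs[OF y12 y1l mm g1d g1dd]
      from im show "c * (e * dqx h y1 s) = K * (\<beta> * \<sigma> powr (\<beta> - 1))" "c * (e * dqxx h y1 s) \<le> K * (\<beta> * ((\<beta> - 1) * \<sigma> powr (\<beta> - 2)))"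
        by (auto simp: \<sigma>_def)
    qed
    have m2: "c * (e * dqx h y2 s) = K * (\<beta> * \<sigma> powr (\<beta> - 1))" "- (c * (e * dqxx h y2 s)) \<le> K * (\<beta> * ((\<beta> - 1) * \<sigma> powr (\<beta> - 2)))"
    proof -
      have mm: "fh y1 y s \<le> fh y1 y2 s" if "0 < y" "y < y1" for y
        by (rule max) (use that z' in \<open>auto simp: \<Omega>'_def\<close>)
      have g2dd: "((\<lambda>y. - (c * (e * dqx h y s)) + K * (\<beta> * (y1 - y) powr (\<beta> - 1))) has_real_derivative
          - (c * (e * dqxx h y2 s)) + K * (\<beta> * - ((\<beta> - 1) * (y1 - y2) powr (\<beta> - 1 - 1)))) (at y2)"
        by (intro DERIV_add DERIV_minus DERIV_cmult dqx2 pw2) (use y12 y1l y2p in auto)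
      note im = interior_max_derivs[OF y2p y12 mm g2d g2dd]
      from im show "c * (e * dqx h y2 s) = K * (\<beta> * \<sigma> powr (\<beta> - 1))" "- (c * (e * dqxx h y2 s)) \<le> K * (\<beta> * ((\<beta> - 1) * \<sigma> powr (\<beta> - 2)))"
        by (auto simp: \<sigma>_def)
    qed
    define A1 where "A1 = A y1 (s + h)"
    define A2 where "A2 = A y2 (s + h)"
    define F1 where "F1 = dqF h y1 s"
    define F2 where "F2 = dqF h y2 s"
    have y1b: "0 < y1" "y1 < Lam s" "y1 < Lam (s + h)" using lx[of y1] y12 y2p z' by auto
    have y2b: "0 < y2" "y2 < Lam s" "y2 < Lam (s + h)" using lx[of y2] y12 y2p z' by auto
    have F: "\<bar>dqF h y s\<bar> \<le> CF" if y: "0 \<le> y" "y \<le> Lam s - \<delta>" for y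
      unfolding CF_def
    proof (rule dqF_bound[OF _ h(1) y(1) _ _ _ h1])
      fix \<tau> assume tau: "s \<le> \<tau>" "\<tau> \<le> s + h"
      show "y < Lam \<tau>" using inn[of s y \<tau>] tau y z' by auto
      then show "\<bar>v y \<tau>\<bar> \<le> \<mu>" using v_le[of \<tau> y] tau y s0 by auto
      show "\<bar>q \<tau>\<bar> \<le> \<mu>" using q_le[of \<tau>] tau s0 by auto
    qed (use s0 in auto)
    have Fb: "c * (e * F1) \<le> CF" "- (c * (e * F2)) \<le> CF"
    proof -
      have "\<bar>F1\<bar> \<le> CF" "\<bar>F2\<bar> \<le> CF" unfolding F1_def F2_def by (rule F; use z' y12 y2p in simp)+
      then have "c * \<bar>F1\<bar> \<le> 1 * CF" "c * \<bar>F2\<bar> \<le> 1 * CF" using c by (intro mult_mono; simp)+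
      moreover have "c * (e * F1) \<le> c * \<bar>F1\<bar>" "c * (- (e * F2)) \<le> c * \<bar>F2\<bar>" using c e by (intro mult_left_mono; auto)+
      ultimately show "c * (e * F1) \<le> CF" "- (c * (e * F2)) \<le> CF" by auto
    qed
    have Ab: "amin \<le> A1" "amin \<le> A2" using A_bounds[of "s + h" y1] A_bounds[of "s + h" y2] y1b y2b s0 h by (auto simp: A1_def A2_def)
    have A12: "A1 - A2 \<le> C7 * y1 * \<sigma>" using A_difference[of "s + h" y2 y1] y1b y2b y12 s0 h
      unfolding A1_def A2_def \<sigma>_def abs_le_iff by auto
    let ?T1 = "A1 * (dqxx h y1 s + 2 * dqx h y1 s / y1) + F1"
    let ?T2 = "A2 * (dqxx h y2 s + 2 * dqx h y2 s / y2) + F2"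
    \<comment> \<open>Differentiating the weight \<open>t - t0\<close> produces the undifferentiated
      difference of the quotients, which is bounded by \<open>4 * \<mu>\<close> next.\<close>
    have time: "0 \<le> (e * dq h y1 s - e * dq h y2 s) + c * (e * ?T1 - e * ?T2)"
    proof -
      have "eventually (\<lambda>r. Lam r - \<delta> > y1) (at s within {t0..t0 + 1})"
      proof (rule order_tendstoD(1)[where y="Lam s - \<delta>"])
        show "((\<lambda>r. Lam r - \<delta>) \<longlongrightarrow> Lam s - \<delta>) (at s within {t0..t0 + 1})"
          using cLam z' by (intro tendsto_intros) (auto simp: continuous_on_def)
      qed (use y1l in auto)
      then obtain d where d: "d > 0" "\<And>r. r \<in> {t0..t0 + 1} \<Longrightarrow> r \<noteq> s \<Longrightarrow> dist r s < d \<Longrightarrow> Lam r - \<delta> > y1"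
        by (auto simp: eventually_at)
      define r0 where "r0 = max t0 (s - d)"
      have r0: "r0 < s" using d st0 by (auto simp: r0_def)
      show ?thesis
      proof (rule left_max_deriv_nonneg[OF r0, where f="\<lambda>r. fh y1 y2 r"])
        fix r assume r: "r0 < r" "r < s"
        then have "y1 < Lam r - \<delta>" using d(2)[of r] z' by (auto simp: r0_def dist_real_def)
        then show "fh y1 y2 r \<le> fh y1 y2 s" by (intro max) (use r z' in \<open>auto simp: \<Omega>'_def r0_def\<close>)
      next
        have d1: "(dq h y1 has_real_derivative ?T1) (at s)" using dq_derivs(3)[OF s0 h(1) y1b] by (simp add: A1_def F1_def)
        have d2: "(dq h y2 has_real_derivative ?T2) (at s)" using dq_derivs(3)[OF s0 h(1) y2b] by (simp add: A2_def F2_def)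
        have "((\<lambda>r. (r - t0) * (e * dq h y1 r - e * dq h y2 r) - K * (y1 - y2) powr \<beta>) has_real_derivative
            ((1 - 0) * (e * dq h y1 s - e * dq h y2 s) + (e * ?T1 - e * ?T2) * (s - t0)) - 0) (at s)"
          by (intro DERIV_diff DERIV_mult DERIV_cmult DERIV_ident DERIV_const d1 d2)
        then show "((\<lambda>r. fh y1 y2 r) has_real_derivative (e * dq h y1 s - e * dq h y2 s) + c * (e * ?T1 - e * ?T2)) (at s)"
          unfolding fh_def by (rule DERIV_cong) (simp add: c_def mult.commute)
      qed
    qed
    have dqb: "e * dq h y1 s - e * dq h y2 s \<le> 4 * \<mu>"
    proof -
      have "\<bar>dq h y1 s - v y1 s\<bar> \<le> M / 16" "\<bar>dq h y2 s - v y2 s\<bar> \<le> M / 16" by (rule close; use z' y12 y2p in simp)+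
      moreover have "\<bar>v y1 s\<bar> \<le> \<mu>" "\<bar>v y2 s\<bar> \<le> \<mu>" using vb z' y1b y2b by auto
      ultimately show ?thesis using M2 mu_pos e unfolding abs_le_iff by auto
    qed
    define P where "P = \<sigma> powr (\<beta> - 2)"
    have Pp: "P > 0" using sp by (simp add: P_def)
    have QP: "\<sigma> powr (\<beta> - 1) = \<sigma> * P"
    proof -
      have "\<sigma> powr (\<beta> - 1) = \<sigma> powr (1 + (\<beta> - 2))" by simp
      also have "\<dots> = \<sigma> powr 1 * P" unfolding P_def by (rule powr_add)
      finally show ?thesis using sp by simp
    qed
    have t1: "c * (e * ?T1) \<le> A1 * (K * (\<beta> * ((\<beta> - 1) * P)) + 2 * (K * (\<beta> * (\<sigma> * P))) / y1) + CF"
    proof -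
      have "c * (e * ?T1) = A1 * (c * (e * dqxx h y1 s) + 2 * (c * (e * dqx h y1 s)) / y1) + c * (e * F1)" by (simp add: algebra_simps)
      also have "\<dots> \<le> A1 * (K * (\<beta> * ((\<beta> - 1) * P)) + 2 * (K * (\<beta> * (\<sigma> * P))) / y1) + CF"
        unfolding m1(1) QP using m1(2)[folded P_def] Fb(1) Ab const_pos by (intro add_mono mult_left_mono) auto
      finally show ?thesis .
    qed
    have t2: "- (c * (e * ?T2)) \<le> A2 * (K * (\<beta> * ((\<beta> - 1) * P)) - 2 * (K * (\<beta> * (\<sigma> * P))) / y2) + CF"
    proof -
      have "- (c * (e * ?T2)) = A2 * (- (c * (e * dqxx h y2 s)) - 2 * (c * (e * dqx h y2 s)) / y2) + - (c * (e * F2))" by (simp add: algebra_simps)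
      also have "\<dots> \<le> A2 * (K * (\<beta> * ((\<beta> - 1) * P)) - 2 * (K * (\<beta> * (\<sigma> * P))) / y2) + CF"
        unfolding m2(1) QP using m2(2)[folded P_def] Fb(2) Ab const_pos by (intro add_mono mult_left_mono diff_mono) auto
      finally show ?thesis .
    qed
    \<comment> \<open>Both points carry the same gradient, so the curvature terms combine to
      \<open>A1 / y1 - A2 / y2\<close>. As \<open>y2 < y1\<close>, only the difference of the
      coefficients can make this positive, and by the smallness of \<open>C7\<close> its
      contribution is at most half the concavity.\<close>
    have br: "(A1 + A2) * (\<beta> - 1) + 2 * \<sigma> * (A1 / y1 - A2 / y2) \<le> - (amin * (1 - \<beta>))"
    proof -
      have "A2 / y1 \<le> A2 / y2" using Ab const_pos y2b y12 by (intro divide_left_mono) auto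
      then have "A1 / y1 - A2 / y2 \<le> (A1 - A2) / y1" by (simp add: diff_divide_distrib)
      also have "\<dots> \<le> C7 * y1 * \<sigma> / y1" using A12 y1b by (intro divide_right_mono) auto
      also have "\<dots> = C7 * \<sigma>" using y1b by simp
      finally have "2 * \<sigma> * (A1 / y1 - A2 / y2) \<le> 2 * \<sigma> * (C7 * \<sigma>)" using sp by (intro mult_left_mono) auto
      also have "\<dots> = 2 * \<sigma>\<^sup>2 * C7" by (simp add: power2_eq_square)
      also have "\<dots> \<le> 2 * lam2\<^sup>2 * C7" using sp C7 by (intro mult_right_mono mult_left_mono power_mono) auto
      also note C7(2)
      finally have 1: "2 * \<sigma> * (A1 / y1 - A2 / y2) \<le> amin * (1 - \<beta>)" .
      have "(A1 + A2) * (1 - \<beta>) \<ge> (2 * amin) * (1 - \<beta>)" using Ab be by (intro mult_right_mono) auto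
      then have "(A1 + A2) * (\<beta> - 1) \<le> - (2 * (amin * (1 - \<beta>)))" by (simp add: algebra_simps)
      with 1 show ?thesis by linarith
    qed
    have "0 \<le> 4 * \<mu> + 2 * CF + (K * \<beta> * P) * ((A1 + A2) * (\<beta> - 1) + 2 * \<sigma> * (A1 / y1 - A2 / y2))"
      using time dqb t1 t2 by (simp add: algebra_simps)
    also have "\<dots> \<le> 4 * \<mu> + 2 * CF + (K * \<beta> * P) * - (amin * (1 - \<beta>))"
      using br Kpos be Pp by (intro add_left_mono mult_left_mono) auto
    also have "(K * \<beta> * P) * - (amin * (1 - \<beta>)) \<le> - (K * k0)"
    proof -
      have "lam2 powr (\<beta> - 2) \<le> P" unfolding P_def using sp be by (intro powr_mono2') auto
      then have "(K * \<beta> * lam2 powr (\<beta> - 2)) * (amin * (1 - \<beta>)) \<le> (K * \<beta> * P) * (amin * (1 - \<beta>))"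
        using Kpos be const_pos by (intro mult_right_mono mult_left_mono) auto
      moreover have "(K * \<beta> * lam2 powr (\<beta> - 2)) * (amin * (1 - \<beta>)) = K * k0" by (simp add: k0_def)
      ultimately show ?thesis by simp
    qed
    finally show False using Kk by linarith
  qed
  show ?thesis
  proof (intro exI[of _ K] conjI allI impI)
    fix t x1 x2 assume "2 \<le> t \<and> 0 \<le> x2 \<and> x2 \<le> x1 \<and> x1 \<le> Lam t"
    then have a: "2 \<le> t" "0 \<le> x2" "x2 \<le> x1" "x1 \<le> Lam t" by auto
    \<comment> \<open>Started at \<open>t - 1\<close>, the argument has weight 1 at time
      \<open>t\<close>; the wall barrier holds from time 1 on, whence
      \<open>t \<ge> 2\<close>.\<close>
    show "\<bar>v x1 t - v x2 t\<bar> \<le> K * (x1 - x2) powr \<beta>"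
      using main[of 1 "t - 1" t x2 x1] main[of "-1" "t - 1" t x2 x1] a by (simp add: abs_le_iff)
  qed (rule Kpos)
qed

end

section \<open>Convergence\<close>

definition unif_0 :: "(real \<Rightarrow> real \<Rightarrow> real) \<Rightarrow> bool" where
  "unif_0 f \<longleftrightarrow> (\<forall>\<epsilon>>0. \<exists>T\<ge>0. \<forall>t\<ge>T. \<forall>s. 0 \<le> s \<and> s \<le> 1 \<longrightarrow> \<bar>f s t\<bar> \<le> \<epsilon>)"

lemma unif_0D: "unif_0 f \<Longrightarrow> \<epsilon> > 0 \<Longrightarrow> \<exists>T\<ge>0. \<forall>t\<ge>T. \<forall>s. 0 \<le> s \<and> s \<le> 1 \<longrightarrow> \<bar>f s t\<bar> \<le> \<epsilon>"
  by (simp add: unif_0_def)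

lemma unif_0_tendsto: assumes "unif_0 f" "0 \<le> s" "s \<le> 1" shows "(f s \<longlongrightarrow> 0) at_top"
proof (rule tendstoI)
  fix e :: real assume e: "e > 0"
  then obtain T where "\<And>t s. t \<ge> T \<Longrightarrow> 0 \<le> s \<Longrightarrow> s \<le> 1 \<Longrightarrow> \<bar>f s t\<bar> \<le> e / 2"
    using unif_0D[OF assms(1), of "e / 2"] by auto
  then have "\<bar>f s t\<bar> < e" if "t \<ge> T" for t using that assms e by fastforce
  then show "\<forall>\<^sub>F t in at_top. dist (f s t) 0 < e" by (auto simp: eventually_at_top_linorder)
qed

lemma cancel_one_plus: "b \<ge> 0 \<Longrightarrow> (b + 1) * (x / (b + 1)) = x" for b x :: real
  by simp

text \<open>Landau interpolation: the mean slope of \<open>f\<close> over a length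
  \<open>\<delta>\<close> tends to zero, and the bound on \<open>f''\<close> lets \<open>f'\<close>
  deviate from it by at most \<open>B * \<delta>\<close>.\<close>

lemma deriv_tendsto_0:
  fixes f f' f'' :: "real \<Rightarrow> real"
  assumes d1: "\<And>t. t \<ge> 0 \<Longrightarrow> (f has_real_derivative f' t) (at t within {0..})"
    and d2: "\<And>t. t \<ge> 0 \<Longrightarrow> (f' has_real_derivative f'' t) (at t within {0..})"
    and B: "\<And>t. t > 0 \<Longrightarrow> \<bar>f'' t\<bar> \<le> B" and lim: "(f \<longlongrightarrow> 0) at_top"
  shows "(f' \<longlongrightarrow> 0) at_top"
proof (rule tendstoI)
  fix e :: real assume e: "e > 0"
  have B0: "B \<ge> 0" using B[of 1] by simp
  define \<delta> where "\<delta> = e / 2 / (B + 1)"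
  have d: "\<delta> > 0" "B * \<delta> \<le> e / 2"
  proof -
    show "\<delta> > 0" using e B0 by (simp add: \<delta>_def)
    have "B * \<delta> \<le> (B + 1) * \<delta>" using \<open>\<delta> > 0\<close> by (intro mult_right_mono) auto
    also have "\<dots> = e / 2" unfolding \<delta>_def by (rule cancel_one_plus[OF B0])
    finally show "B * \<delta> \<le> e / 2" .
  qed
  have "\<forall>\<^sub>F t in at_top. \<bar>f t\<bar> < e * \<delta> / 8" using tendstoD[OF lim, of "e * \<delta> / 8"] e d by simp
  then obtain T where T: "\<And>t. t \<ge> T \<Longrightarrow> \<bar>f t\<bar> < e * \<delta> / 8" by (auto simp: eventually_at_top_linorder)
  have "\<bar>f' t\<bar> < e" if t: "t \<ge> max T 0" for t
  proof -
    have t0: "0 \<le> t" "t < t + \<delta>" "t \<ge> T" using t d by auto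
    from mvt_half_line[OF t0(1,2) d1] obtain z where z: "t < z" "z < t + \<delta>" "f (t + \<delta>) - f t = \<delta> * f' z" by auto
    from mvt_half_line[OF t0(1) z(1) d2] obtain w where w: "t < w" "w < z" "f' z - f' t = (z - t) * f'' w" by auto
    have "\<delta> * \<bar>f' z\<bar> = \<bar>f (t + \<delta>) - f t\<bar>" unfolding z(3) abs_mult using d by simp
    also have "\<dots> < \<delta> * (e / 4)" using T[of t] T[of "t + \<delta>"] t0 unfolding abs_less_iff by (simp add: algebra_simps)
    finally have 1: "\<bar>f' z\<bar> < e / 4" using d by simp
    have "\<bar>f' z - f' t\<bar> \<le> \<delta> * B" unfolding w(3) abs_mult using z w B[of w] t0 B0 by (intro mult_mono) auto
    then show ?thesis using 1 d e unfolding abs_less_iff abs_le_iff by (simp add: mult.commute)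
  qed
  then show "\<forall>\<^sub>F t in at_top. dist (f' t) 0 < e"
    using eventually_mono[OF eventually_ge_at_top[of "max T 0"], of "\<lambda>t. dist (f' t) 0 < e"] by simp
qed

context bubble_smooth
begin

text \<open>\<open>LL\<close> is \<open>Lam^2 * v / A\<close>, and \<open>A\<close> is Lipschitz
  with values above \<open>amin\<close>; on the unit interval a Lipschitz bound implies exponent
  \<open>\<beta>\<close>.\<close>

lemma LL_holder: "\<exists>C>0. \<forall>t\<ge>2. \<forall>s1 s2. 0 \<le> s1 \<and> s1 \<le> 1 \<and> 0 \<le> s2 \<and> s2 \<le> 1 \<longrightarrow> \<bar>LL s1 t - LL s2 t\<bar> \<le> C * \<bar>s1 - s2\<bar> powr \<beta>"
proof -
  obtain K where K: "K > 0" "\<And>t x1 x2. 2 \<le> t \<Longrightarrow> 0 \<le> x2 \<Longrightarrow> x2 \<le> x1 \<Longrightarrow> x1 \<le> Lam t \<Longrightarrow> \<bar>v x1 t - v x2 t\<bar> \<le> K * (x1 - x2) powr \<beta>"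
    using v_holder by blast
  define C where "C = lam2\<^sup>2 * (K * lam2 powr \<beta> / amin + \<mu> * (C7 * lam2 * lam2) / amin\<^sup>2)"
  have C: "C > 0" unfolding C_def using const_pos K mu_pos C7 by (intro mult_pos_pos add_pos_nonneg divide_pos_pos divide_nonneg_pos mult_nonneg_nonneg) auto
  have aux: "\<bar>LL s1 t - LL s2 t\<bar> \<le> C * (s1 - s2) powr \<beta>" if t: "t \<ge> 2" and s: "0 \<le> s2" "s2 < s1" "s1 \<le> 1" for t s1 s2
  proof -
    have t0: "t \<ge> 0" using t by simp
    have l: "Lam t > 0" "Lam t \<le> lam2" using Lam_pos[OF t0] Lam_bounds[OF t0] by auto
    let ?x1 = "s1 * Lam t" and ?x2 = "s2 * Lam t"
    have x: "0 \<le> ?x2" "?x2 < ?x1" "?x1 \<le> Lam t" using s_in[OF t0, of s1] s_in[OF t0, of s2] s l by auto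
    have e1: "LL s1 t = (Lam t)\<^sup>2 * (v ?x1 t / A ?x1 t)" "LL s2 t = (Lam t)\<^sup>2 * (v ?x2 t / A ?x2 t)"
      using YL_v[of ?x1 t] YL_v[of ?x2 t] l by (simp_all add: YL_def field_simps)
    define a1 where "a1 = A ?x1 t"
    define a2 where "a2 = A ?x2 t"
    have a: "amin \<le> a1" "amin \<le> a2" using A_bounds(1)[OF t0, of ?x1] A_bounds(1)[OF t0, of ?x2] x s by (auto simp: a1_def a2_def)
    have a0: "a1 > 0" "a2 > 0" using a const_pos by auto
    have sp: "0 < s1 - s2" "s1 - s2 \<le> 1" using s by auto
    have "(s1 - s2) powr 1 \<le> (s1 - s2) powr \<beta>" using sp be by (intro powr_mono') auto
    then have sb: "s1 - s2 \<le> (s1 - s2) powr \<beta>" using sp by simp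
    have "v ?x1 t / a1 - v ?x2 t / a2 = (v ?x1 t - v ?x2 t) / a1 + v ?x2 t * (a2 - a1) / (a1 * a2)"
      using a0 by (simp add: field_simps)
    then have "\<bar>v ?x1 t / a1 - v ?x2 t / a2\<bar> \<le> \<bar>(v ?x1 t - v ?x2 t) / a1\<bar> + \<bar>v ?x2 t * (a2 - a1) / (a1 * a2)\<bar>"
      by (simp only: abs_triangle_ineq)
    also have "\<dots> \<le> K * lam2 powr \<beta> / amin * (s1 - s2) powr \<beta> + \<mu> * (C7 * lam2 * lam2) / amin\<^sup>2 * (s1 - s2) powr \<beta>"
    proof (rule add_mono)
      have "\<bar>v ?x1 t - v ?x2 t\<bar> \<le> K * (?x1 - ?x2) powr \<beta>" using K(2)[OF t x(1) less_imp_le[OF x(2)] x(3)] .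
      also have "?x1 - ?x2 = Lam t * (s1 - s2)" by (simp add: algebra_simps)
      also have "K * (Lam t * (s1 - s2)) powr \<beta> = K * (Lam t powr \<beta> * (s1 - s2) powr \<beta>)" by (simp add: powr_mult)
      also have "\<dots> \<le> K * (lam2 powr \<beta> * (s1 - s2) powr \<beta>)"
        using K l be by (intro mult_left_mono mult_right_mono powr_mono2) auto
      finally have "\<bar>v ?x1 t - v ?x2 t\<bar> / a1 \<le> K * (lam2 powr \<beta> * (s1 - s2) powr \<beta>) / amin"
        using a const_pos K by (intro frac_le) auto
      then show "\<bar>(v ?x1 t - v ?x2 t) / a1\<bar> \<le> K * lam2 powr \<beta> / amin * (s1 - s2) powr \<beta>" using a0 by (simp add: mult_ac)
      have "\<bar>a2 - a1\<bar> \<le> C7 * ?x1 * (?x1 - ?x2)"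
        using A_difference[OF t0 x] unfolding a1_def a2_def by (simp add: abs_minus_commute)
      also have "\<dots> = (C7 * ?x1 * Lam t) * (s1 - s2)" by (simp add: algebra_simps)
      also have "\<dots> \<le> (C7 * lam2 * lam2) * (s1 - s2) powr \<beta>"
      proof (rule mult_mono[OF _ sb])
        have xx: "?x1 \<le> lam2" using x l by linarith
        show "C7 * ?x1 * Lam t \<le> C7 * lam2 * lam2"
          by (rule mult_mono[OF mult_left_mono[OF xx C7(1)] l(2)]) (use C7 l const_pos in auto)
      qed (use C7 const_pos sp in auto)
      finally have "\<bar>v ?x2 t\<bar> * \<bar>a2 - a1\<bar> / (a1 * a2) \<le> \<mu> * ((C7 * lam2 * lam2) * (s1 - s2) powr \<beta>) / (amin * amin)"
        using v_le[OF t0, of ?x2] s x a a0 const_pos mu_pos C7 by (intro frac_le mult_mono mult_nonneg_nonneg) auto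
      then show "\<bar>v ?x2 t * (a2 - a1) / (a1 * a2)\<bar> \<le> \<mu> * (C7 * lam2 * lam2) / amin\<^sup>2 * (s1 - s2) powr \<beta>"
        using a0 by (simp add: abs_mult power2_eq_square mult_ac)
    qed
    finally have d: "\<bar>v ?x1 t / a1 - v ?x2 t / a2\<bar> \<le> (K * lam2 powr \<beta> / amin + \<mu> * (C7 * lam2 * lam2) / amin\<^sup>2) * (s1 - s2) powr \<beta>"
      by (simp add: distrib_right)
    have "\<bar>LL s1 t - LL s2 t\<bar> = (Lam t)\<^sup>2 * \<bar>v ?x1 t / a1 - v ?x2 t / a2\<bar>"
      unfolding e1 a1_def[symmetric] a2_def[symmetric] right_diff_distrib[symmetric] abs_mult by simp
    also have "\<dots> \<le> lam2\<^sup>2 * ((K * lam2 powr \<beta> / amin + \<mu> * (C7 * lam2 * lam2) / amin\<^sup>2) * (s1 - s2) powr \<beta>)"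
      using d l by (intro mult_mono power_mono) auto
    finally show ?thesis by (simp add: C_def mult.assoc)
  qed
  show ?thesis
  proof (intro exI[of _ C] conjI C allI impI)
    fix t s1 s2 :: real assume t: "2 \<le> t" and s: "0 \<le> s1 \<and> s1 \<le> 1 \<and> 0 \<le> s2 \<and> s2 \<le> 1"
    show "\<bar>LL s1 t - LL s2 t\<bar> \<le> C * \<bar>s1 - s2\<bar> powr \<beta>"
      using aux[OF t, of s1 s2] aux[OF t, of s2 s1] s C
      by (cases s1 s2 rule: linorder_cases) (auto simp: abs_minus_commute)
  qed
qed

lemma E_bounded_below: "t \<ge> 0 \<Longrightarrow> W Rs + cT * m + c0 * m * ln (3 * m) \<le> E t"
proof -
  assume t: "t \<ge> 0"
  have 1: "W Rs \<le> W (R t)" using well_of_sign_change(1)[OF Rs(1) W_deriv W_sign, of "R t"] Rpos[OF t] by auto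
  have "ln (Th t) \<le> Th t - 1" using ln_le_minus_one[OF Th_pos[OF t]] .
  then have "cT * m * 1 \<le> cT * m * (Th t - ln (Th t))" using cT par by (intro mult_left_mono) auto
  moreover have "rl * (R t) ^ 3 * (R1 t)\<^sup>2 / 2 \<ge> 0" using par Rpos[OF t] by simp
  ultimately show ?thesis using E_lower[OF t] 1 by simp
qed

text \<open>A deviation \<open>\<epsilon>'\<close> from the wall value forces a point
  \<open>\<xi>\<close> with gradient at least \<open>\<epsilon>'\<close>. The bound
  \<open>\<bar>Ls s t\<bar> \<le> CL * s\<close> keeps \<open>\<xi>\<close> away from the centre,
  where the weight \<open>s^2\<close> degenerates, and the Lipschitz bound keeps the gradient above
  \<open>\<epsilon>' / 2\<close> on an interval of length \<open>l\<close>.\<close>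

lemma D_lower:
  assumes t: "t \<ge> 0" and e: "\<epsilon>' > 0" and s: "0 \<le> s" "s \<le> 1" and X: "\<bar>L 1 t - L s t\<bar> \<ge> \<epsilon>'"
  shows "D t \<ge> (\<epsilon>' / (6 * CL)) ^ 3 * (\<epsilon>' / 2)\<^sup>2"
proof -
  define l where "l = \<epsilon>' / (6 * CL)"
  have l: "l > 0" "3 * CL * l = \<epsilon>' / 2" "CL * (6 * l) = \<epsilon>'" using e CL_pos by (auto simp: l_def)
  have s1: "s < 1" using X e s by (cases "s = 1") auto
  obtain \<xi> where xi: "s < \<xi>" "\<xi> < 1" "L 1 t - L s t = (1 - s) * Ls \<xi> t" using Ls_mvt[OF t s(1) s1] by auto
  have xi0: "0 \<le> \<xi>" "\<xi> \<le> 1" using xi s by auto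
  have "\<epsilon>' \<le> (1 - s) * \<bar>Ls \<xi> t\<bar>" using X s unfolding xi(3) abs_mult by simp
  also have "\<dots> \<le> 1 * \<bar>Ls \<xi> t\<bar>" using s by (intro mult_right_mono) auto
  finally have big: "\<epsilon>' \<le> \<bar>Ls \<xi> t\<bar>" by simp
  have "CL * (6 * l) \<le> CL * \<xi>" using big Ls_le[OF t xi0] l(3) by linarith
  then have xl: "6 * l \<le> \<xi>" using CL_pos by simp
  have pw: "l\<^sup>2 * (\<epsilon>' / 2)\<^sup>2 \<le> y\<^sup>2 * (Ls y t)\<^sup>2" if y: "y \<in> {\<xi> - l..\<xi>}" for y
  proof -
    have y0: "0 \<le> y" "y \<le> 1" "l \<le> y" using y xl l xi0 by auto
    have "\<bar>Ls \<xi> t - Ls y t\<bar> \<le> 3 * CL * \<bar>\<xi> - y\<bar>" by (rule Ls_lipschitz[OF t xi0 y0(1,2)])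
    also have "\<dots> \<le> 3 * CL * l" using y CL_pos by (intro mult_left_mono) auto
    finally have "\<epsilon>' / 2 \<le> \<bar>Ls y t\<bar>" using big l(2) by linarith
    then have 1: "(\<epsilon>' / 2)\<^sup>2 \<le> \<bar>Ls y t\<bar>\<^sup>2" using e by (intro power_mono) auto
    have 2: "l\<^sup>2 \<le> y\<^sup>2" using y0 l by (intro power_mono) auto
    show ?thesis using mult_mono[OF 2 1] by simp
  qed
  have ii: "(\<lambda>y. y\<^sup>2 * (Ls y t)\<^sup>2) integrable_on {0..1}" "(\<lambda>y. y\<^sup>2 * (Ls y t)\<^sup>2) integrable_on {\<xi> - l..\<xi>}"
    by (intro integrable_continuous_real continuous_intros cont_comp; use t xi0 xl l in auto)+
  have "l * (l\<^sup>2 * (\<epsilon>' / 2)\<^sup>2) = integral {\<xi> - l..\<xi>} (\<lambda>y. l\<^sup>2 * (\<epsilon>' / 2)\<^sup>2)" using l by simp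
  also have "\<dots> \<le> integral {\<xi> - l..\<xi>} (\<lambda>y. y\<^sup>2 * (Ls y t)\<^sup>2)" by (intro integral_le ii pw) auto
  also have "\<dots> \<le> D t" unfolding D_def by (intro integral_subset_le ii) (use xi0 xl l in auto)
  finally show ?thesis by (simp add: l_def[symmetric] power2_eq_square power3_eq_cube mult_ac)
qed

text \<open>As \<open>L\<close> is Lipschitz in time, a deviation larger than
  \<open>\<epsilon>'\<close> stays above half that size for a fixed time \<open>\<tau>\<close> and
  costs a fixed amount \<open>c\<close> of energy; once the energy is within \<open>c\<close> of its
  infimum, none can occur.\<close>

lemma X_unif: "unif_0 (\<lambda>s t. L 1 t - L s t)"
  unfolding unif_0_def
proof (intro allI impI)
  fix \<epsilon>' :: real assume e: "\<epsilon>' > 0"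
  have CT0: "CT \<ge> 0" using Lt_le[of 0 0] by simp
  define \<tau> where "\<tau> = \<epsilon>' / 4 / (CT + 1)"
  have tau: "\<tau> > 0" "2 * (CT * \<tau>) \<le> \<epsilon>' / 2"
  proof -
    show "\<tau> > 0" using e CT0 by (simp add: \<tau>_def)
    have "CT * \<tau> \<le> (CT + 1) * \<tau>" using \<open>\<tau> > 0\<close> by (intro mult_right_mono) auto
    also have "\<dots> = \<epsilon>' / 4" unfolding \<tau>_def by (rule cancel_one_plus[OF CT0])
    finally show "2 * (CT * \<tau>) \<le> \<epsilon>' / 2" by simp
  qed
  define d0 where "d0 = (\<epsilon>' / 2 / (6 * CL)) ^ 3 * (\<epsilon>' / 2 / 2)\<^sup>2"
  have d0: "d0 > 0" using e CL_pos by (simp add: d0_def)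
  define c where "c = \<tau> * (cT * gm * kap * (Rs / 2) * d0)"
  have c: "c > 0" using tau cT par Rs d0 by (simp add: c_def)
  have drop: "E (t + \<tau>) \<le> E t - c" if t: "t \<ge> 0" and s: "0 \<le> s" "s \<le> 1" and X: "\<bar>L 1 t - L s t\<bar> > \<epsilon>'" for t s
  proof -
    have t2: "t < t + \<tau>" using tau by simp
    from mvt_half_line[OF t t2 energy_deriv] obtain z where z: "t < z" "z < t + \<tau>"
      "E (t + \<tau>) - E t = \<tau> * (- 4 * mu * R z * (R1 z)\<^sup>2 - cT * gm * kap * R z * D z)" by auto
    have z0: "z \<ge> 0" using z t by simp
    have "\<bar>L 1 t - L 1 z\<bar> \<le> CT * \<tau>" "\<bar>L s t - L s z\<bar> \<le> CT * \<tau>"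
    proof -
      have "CT * \<bar>t - z\<bar> \<le> CT * \<tau>" using z CT0 by (intro mult_left_mono) auto
      then show "\<bar>L 1 t - L 1 z\<bar> \<le> CT * \<tau>" "\<bar>L s t - L s z\<bar> \<le> CT * \<tau>"
        using L_lipschitz_time[OF t z0, of 1] L_lipschitz_time[OF t z0 s] by auto
    qed
    then have "\<bar>L 1 z - L s z\<bar> \<ge> \<epsilon>' / 2" using X tau(2) by linarith
    then have Dz: "D z \<ge> d0" using D_lower[OF z0 _ s, of "\<epsilon>' / 2"] e by (simp add: d0_def)
    have "cT * gm * kap * (Rs / 2) * d0 \<le> cT * gm * kap * R z * D z"
      using R_bounds[OF z0] Dz d0 cT par Rs by (intro mult_mono mult_left_mono mult_nonneg_nonneg) auto
    moreover have "4 * mu * R z * (R1 z)\<^sup>2 \<ge> 0" using par Rpos[OF z0] by simp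
    ultimately have "- 4 * mu * R z * (R1 z)\<^sup>2 - cT * gm * kap * R z * D z \<le> - (cT * gm * kap * (Rs / 2) * d0)" by simp
    then have "\<tau> * (- 4 * mu * R z * (R1 z)\<^sup>2 - cT * gm * kap * R z * D z) \<le> \<tau> * - (cT * gm * kap * (Rs / 2) * d0)"
      using tau by (intro mult_left_mono) auto
    then show ?thesis using z(3) by (simp add: c_def)
  qed
  have bb: "bdd_below (E ` {0..})" by (rule bdd_belowI2[OF E_bounded_below]) simp
  have "Inf (E ` {0..}) < Inf (E ` {0..}) + c" using c by simp
  then obtain T where T: "T \<ge> 0" "E T < Inf (E ` {0..}) + c"
    using cInf_lessD[of "E ` {0..}" "Inf (E ` {0..}) + c"] c by auto
  show "\<exists>T\<ge>0. \<forall>t\<ge>T. \<forall>s. 0 \<le> s \<and> s \<le> 1 \<longrightarrow> \<bar>L 1 t - L s t\<bar> \<le> \<epsilon>'"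
  proof (intro exI[of _ T] conjI T allI impI)
    fix t s :: real assume t: "T \<le> t" and s: "0 \<le> s \<and> s \<le> 1"
    show "\<bar>L 1 t - L s t\<bar> \<le> \<epsilon>'"
    proof (rule ccontr)
      assume "\<not> \<bar>L 1 t - L s t\<bar> \<le> \<epsilon>'"
      then have "E (t + \<tau>) \<le> E t - c" using drop[of t s] s t T by auto
      also have "E t \<le> E T" by (rule E_antimono) (use t T in auto)
      finally have "E (t + \<tau>) < Inf (E ` {0..})" using T by simp
      moreover have "Inf (E ` {0..}) \<le> E (t + \<tau>)" by (rule cInf_lower[OF _ bb]) (use t T tau in auto)
      ultimately show False by simp
    qed
  qed
qed

text \<open>Landau interpolation in \<open>s\<close> between the small oscillation of
  \<open>L\<close> and the Lipschitz bound for \<open>Ls\<close>; the interval lies to the right or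
  to the left of \<open>s\<close> so as to stay in the unit interval.\<close>

lemma Ls_unif: "unif_0 Ls"
  unfolding unif_0_def
proof (intro allI impI)
  fix \<epsilon>' :: real assume e: "\<epsilon>' > 0"
  define \<delta> where "\<delta> = min (1 / 2) (\<epsilon>' / (6 * CL))"
  have d: "\<delta> > 0" "\<delta> \<le> 1 / 2" using e CL_pos by (auto simp: \<delta>_def)
  have "\<delta> \<le> \<epsilon>' / (6 * CL)" by (simp add: \<delta>_def)
  then have d3: "3 * CL * \<delta> \<le> \<epsilon>' / 2" using CL_pos by (simp add: field_simps)
  obtain T where T: "T \<ge> 0" "\<And>t s. t \<ge> T \<Longrightarrow> 0 \<le> s \<Longrightarrow> s \<le> 1 \<Longrightarrow> \<bar>L 1 t - L s t\<bar> \<le> \<epsilon>' * \<delta> / 4"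
    using unif_0D[OF X_unif, of "\<epsilon>' * \<delta> / 4"] e d by auto
  show "\<exists>T\<ge>0. \<forall>t\<ge>T. \<forall>s. 0 \<le> s \<and> s \<le> 1 \<longrightarrow> \<bar>Ls s t\<bar> \<le> \<epsilon>'"
  proof (intro exI[of _ T] conjI T allI impI)
    fix t s :: real assume t: "T \<le> t" and s: "0 \<le> s \<and> s \<le> 1"
    have t0: "t \<ge> 0" using t T by simp
    define a where "a = (if s \<le> 1 / 2 then s else s - \<delta>)"
    have a: "0 \<le> a" "a + \<delta> \<le> 1" "\<bar>s - a\<bar> \<le> \<delta>" "a \<le> s" "s \<le> a + \<delta>" using s d by (auto simp: a_def)
    obtain \<xi> where xi: "a < \<xi>" "\<xi> < a + \<delta>" "L (a + \<delta>) t - L a t = \<delta> * Ls \<xi> t"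
      using Ls_mvt[OF t0 a(1), of "a + \<delta>"] a d by auto
    have "\<delta> * \<bar>Ls \<xi> t\<bar> = \<bar>L (a + \<delta>) t - L a t\<bar>" unfolding xi(3) abs_mult using d by simp
    also have "\<dots> \<le> \<delta> * (\<epsilon>' / 2)" using T(2)[OF t, of a] T(2)[OF t, of "a + \<delta>"] a d unfolding abs_le_iff by (simp add: algebra_simps)
    finally have 1: "\<bar>Ls \<xi> t\<bar> \<le> \<epsilon>' / 2" using d by simp
    have "\<bar>Ls s t - Ls \<xi> t\<bar> \<le> 3 * CL * \<bar>s - \<xi>\<bar>" by (rule Ls_lipschitz[OF t0]) (use s xi a in auto)
    also have "\<dots> \<le> 3 * CL * \<delta>" using xi a CL_pos by (intro mult_left_mono) auto
    finally show "\<bar>Ls s t\<bar> \<le> \<epsilon>'" using 1 d3 by linarith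
  qed
qed

text \<open>The same interpolation for \<open>s^2 * Ls\<close>, whose derivative
  \<open>s^2 * LL\<close> determines \<open>LL\<close> only away from the centre; for
  \<open>s < \<delta>\<close> the Hoelder bound transfers the value at
  \<open>\<delta>\<close>.\<close>

lemma LL_unif: "unif_0 LL"
  unfolding unif_0_def
proof (intro allI impI)
  fix \<epsilon>' :: real assume e: "\<epsilon>' > 0"
  obtain C where C: "C > 0" "\<And>t s1 s2. t \<ge> 2 \<Longrightarrow> 0 \<le> s1 \<Longrightarrow> s1 \<le> 1 \<Longrightarrow> 0 \<le> s2 \<Longrightarrow> s2 \<le> 1 \<Longrightarrow> \<bar>LL s1 t - LL s2 t\<bar> \<le> C * \<bar>s1 - s2\<bar> powr \<beta>"
    using LL_holder by blast
  define \<delta> where "\<delta> = min (1 / 2) ((\<epsilon>' / (4 * C)) powr (1 / \<beta>))"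
  have d: "\<delta> > 0" "\<delta> \<le> 1 / 2" using e C by (auto simp: \<delta>_def)
  have "\<delta> powr \<beta> \<le> ((\<epsilon>' / (4 * C)) powr (1 / \<beta>)) powr \<beta>" using d be by (intro powr_mono2) (auto simp: \<delta>_def)
  also have "\<dots> = \<epsilon>' / (4 * C)" using e C be by (simp add: powr_powr)
  finally have Cd: "C * \<delta> powr \<beta> \<le> \<epsilon>' / 4" using C by (simp add: field_simps)
  define lm where "lm = \<epsilon>' * \<delta> ^ 3 / 32"
  have lam: "lm > 0" using e d by (simp add: lm_def)
  obtain T where T: "T \<ge> 0" "\<And>t s. t \<ge> T \<Longrightarrow> 0 \<le> s \<Longrightarrow> s \<le> 1 \<Longrightarrow> \<bar>Ls s t\<bar> \<le> lm"
    using unif_0D[OF Ls_unif lam] by auto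
  have big: "\<bar>LL s t\<bar> \<le> 3 * \<epsilon>' / 4" if t: "t \<ge> max T 2" and s: "\<delta> \<le> s" "s \<le> 1" for t s
  proof -
    have t0: "t \<ge> 0" "t \<ge> T" "t \<ge> 2" using t T by auto
    define a where "a = s - \<delta> / 2"
    have a: "\<delta> / 2 \<le> a" "a < s" using s d by (auto simp: a_def)
    let ?f = "\<lambda>y. y\<^sup>2 * Ls y t"
    have df: "(?f has_real_derivative y\<^sup>2 * LL y t) (at y)" if "0 < y" "y < 1" for y
      using that t0 by (auto intro!: derivative_eq_intros dLs simp: field_simps power2_eq_square)
    have "\<exists>l z. a < z \<and> z < s \<and> (?f has_real_derivative l) (at z) \<and> ?f s - ?f a = (s - a) * l"
    proof (rule MVT[OF a(2)])
      show "continuous_on {a..s} ?f" by (intro continuous_intros cont_comp) (use t0 a d s in auto)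
      show "?f differentiable at x" if "a < x" "x < s" for x using df[of x] that a d s real_differentiable_def by auto
    qed
    then obtain l z where z: "a < z" "z < s" "(?f has_real_derivative l) (at z)" "?f s - ?f a = (s - a) * l" by auto
    have z0: "0 < z" "z < 1" "\<delta> / 2 \<le> z" using z a d s by auto
    have l: "l = z\<^sup>2 * LL z t" using DERIV_unique[OF z(3) df[OF z0(1,2)]] .
    have "\<bar>?f s\<bar> \<le> 1 * lm" "\<bar>?f a\<bar> \<le> 1 * lm"
      unfolding abs_mult using T(2)[OF t0(2)] s a d by (intro mult_mono; simp add: power_le_one)+
    then have "\<bar>(s - a) * l\<bar> \<le> 2 * lm" using z(4) by linarith
    then have "(\<delta> / 2) * (z\<^sup>2 * \<bar>LL z t\<bar>) \<le> 2 * lm" unfolding l abs_mult using d by (simp add: a_def)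
    moreover have "(\<delta> / 2) * ((\<delta> / 2)\<^sup>2 * \<bar>LL z t\<bar>) \<le> (\<delta> / 2) * (z\<^sup>2 * \<bar>LL z t\<bar>)"
      using z0 d by (intro mult_left_mono mult_right_mono power_mono) auto
    ultimately have "\<delta> ^ 3 * \<bar>LL z t\<bar> \<le> \<delta> ^ 3 * (\<epsilon>' / 2)"
      by (simp add: lm_def power2_eq_square power3_eq_cube)
    then have 1: "\<bar>LL z t\<bar> \<le> \<epsilon>' / 2" using d by simp
    have "\<bar>LL s t - LL z t\<bar> \<le> C * \<bar>s - z\<bar> powr \<beta>" by (rule C(2)[OF t0(3)]) (use s d z0 in auto)
    also have "\<dots> \<le> C * \<delta> powr \<beta>" using z d C be by (intro mult_left_mono powr_mono2) (auto simp: a_def)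
    finally show ?thesis using 1 Cd by linarith
  qed
  show "\<exists>T\<ge>0. \<forall>t\<ge>T. \<forall>s. 0 \<le> s \<and> s \<le> 1 \<longrightarrow> \<bar>LL s t\<bar> \<le> \<epsilon>'"
  proof (intro exI[of _ "max T 2"] conjI allI impI)
    fix t s :: real assume t: "max T 2 \<le> t" and s: "0 \<le> s \<and> s \<le> 1"
    show "\<bar>LL s t\<bar> \<le> \<epsilon>'"
    proof (cases "\<delta> \<le> s")
      case True then show ?thesis using big[OF t] s e by fastforce
    next
      case False
      have "\<bar>LL s t - LL \<delta> t\<bar> \<le> C * \<bar>s - \<delta>\<bar> powr \<beta>" by (rule C(2)) (use s d t in auto)
      also have "\<dots> \<le> C * \<delta> powr \<beta>" using s d C be False by (intro mult_left_mono powr_mono2) auto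
      finally show ?thesis using big[OF t, of \<delta>] d Cd by linarith
    qed
  qed (use T in auto)
qed

text \<open>The equation at the wall is solved for \<open>q\<close>, which is possible because
  \<open>1 - 1 / gm\<close> is positive; the velocity law then gives \<open>R1\<close>. Bounds on
  \<open>R\<close> and the wall density suffice here, their limits being obtained only
  later.\<close>

lemma q_tendsto_0: "(q \<longlongrightarrow> 0) at_top" and R1_tendsto_0: "(R1 \<longlongrightarrow> 0) at_top"
proof -
  have Ls1: "(Ls 1 \<longlongrightarrow> 0) at_top" by (rule unif_0_tendsto[OF Ls_unif]) auto
  have LL1: "(LL 1 \<longlongrightarrow> 0) at_top" by (rule unif_0_tendsto[OF LL_unif]) auto
  have nn: "\<forall>\<^sub>F t in at_top. (t::real) \<ge> 0" by (rule eventually_ge_at_top)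
  have g: "((\<lambda>t. kap * gf t / (R t)\<^sup>2) \<longlongrightarrow> 0) at_top"
  proof (rule Lim_null_comparison)
    show "\<forall>\<^sub>F t in at_top. norm (kap * gf t / (R t)\<^sup>2) \<le> (kw / lam1) * \<bar>Ls 1 t\<bar>"
      using nn
    proof eventually_elim
      case (elim t)
      have "\<bar>Yx (Lam t) t\<bar> = \<bar>Ls 1 t\<bar> / Lam t" using Ls_wall[OF elim] Lam_pos[OF elim] by (simp add: abs_mult)
      also have "\<dots> \<le> \<bar>Ls 1 t\<bar> / lam1" using Lam_bounds[OF elim] const_pos Lam_pos[OF elim] by (intro frac_le) auto
      finally have "kw * \<bar>Yx (Lam t) t\<bar> \<le> kw * (\<bar>Ls 1 t\<bar> / lam1)" using K_pos by (intro mult_left_mono) auto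
      then show ?case using kap_gf_bound[OF elim] by simp
    qed
    show "((\<lambda>t. (kw / lam1) * \<bar>Ls 1 t\<bar>) \<longlongrightarrow> 0) at_top"
      using tendsto_mult_right_zero[OF tendsto_rabs_zero[OF Ls1]] .
  qed
  have vw: "((\<lambda>t. v (Lam t) t) \<longlongrightarrow> 0) at_top"
  proof (rule Lim_null_comparison)
    show "\<forall>\<^sub>F t in at_top. norm (v (Lam t) t) \<le> (amax / lam1\<^sup>2) * \<bar>LL 1 t\<bar>"
      using nn
    proof eventually_elim
      case (elim t)
      have l: "Lam t > 0" by (rule Lam_pos[OF elim])
      have "\<bar>v (Lam t) t\<bar> = A (Lam t) t * (\<bar>LL 1 t\<bar> / (Lam t)\<^sup>2)" unfolding v_def YL_def using l A_pos[of "Lam t" t] by (simp add: abs_mult)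
      also have "\<dots> \<le> amax * (\<bar>LL 1 t\<bar> / lam1\<^sup>2)"
        using A_bounds[OF elim, of "Lam t"] Lam_bounds[OF elim] l const_pos by (intro mult_mono frac_le power_mono) auto
      finally show ?case by simp
    qed
    show "((\<lambda>t. (amax / lam1\<^sup>2) * \<bar>LL 1 t\<bar>) \<longlongrightarrow> 0) at_top"
      using tendsto_mult_right_zero[OF tendsto_rabs_zero[OF LL1]] .
  qed
  define kk where "kk = 1 - 1 / gm"
  have k: "kk > 0" using par by (simp add: kk_def)
  have "((\<lambda>t. (v (Lam t) t - kap * gf t / (R t)\<^sup>2 * Ls 1 t) / kk) \<longlongrightarrow> (0 - 0 * 0) / kk) at_top"
    by (intro tendsto_intros vw g Ls1) (use k in auto)
  then have q1: "((\<lambda>t. (v (Lam t) t - kap * gf t / (R t)\<^sup>2 * Ls 1 t) / kk) \<longlongrightarrow> 0) at_top" by simp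
  have "\<forall>\<^sub>F t in at_top. (v (Lam t) t - kap * gf t / (R t)\<^sup>2 * Ls 1 t) / kk = q t"
    using nn
  proof eventually_elim
    case (elim t)
    show ?case unfolding v_at_wall[OF elim] kk_def[symmetric] using k by simp
  qed
  from Lim_transform_eventually[OF q1 this] show q: "(q \<longlongrightarrow> 0) at_top" .
  have "((\<lambda>t. - (q t / gm + 3 * (kap * gf t / (R t)\<^sup>2)) / 3) \<longlongrightarrow> - (0 / gm + 3 * 0) / 3) at_top"
    by (intro tendsto_intros q g) (use par in auto)
  then have r1: "((\<lambda>t. - (q t / gm + 3 * (kap * gf t / (R t)\<^sup>2)) / 3) \<longlongrightarrow> 0) at_top" by simp
  show "(R1 \<longlongrightarrow> 0) at_top"
  proof (rule Lim_null_comparison)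
    show "\<forall>\<^sub>F t in at_top. norm (R1 t) \<le> (2 * Rs) * \<bar>- (q t / gm + 3 * (kap * gf t / (R t)\<^sup>2)) / 3\<bar>"
      using nn
    proof eventually_elim
      case (elim t)
      have R: "R t > 0" by (rule Rpos[OF elim])
      have "- (q t / gm + 3 * (kap * gf t / (R t)\<^sup>2)) / 3 = R1 t / R t" using wallv'[OF elim] by simp
      then have "R1 t = R t * (- (q t / gm + 3 * (kap * gf t / (R t)\<^sup>2)) / 3)" using R by simp
      then have "\<bar>R1 t\<bar> = \<bar>R t * (- (q t / gm + 3 * (kap * gf t / (R t)\<^sup>2)) / 3)\<bar>" by (rule arg_cong)
      also have "\<dots> = R t * \<bar>- (q t / gm + 3 * (kap * gf t / (R t)\<^sup>2)) / 3\<bar>" unfolding abs_mult[of "R t"] using R by simp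
      also have "\<dots> \<le> (2 * Rs) * \<bar>- (q t / gm + 3 * (kap * gf t / (R t)\<^sup>2)) / 3\<bar>" using R_bounds[OF elim] by (intro mult_right_mono) auto
      finally show ?case by simp
    qed
    show "((\<lambda>t. (2 * Rs) * \<bar>- (q t / gm + 3 * (kap * gf t / (R t)\<^sup>2)) / 3\<bar>) \<longlongrightarrow> 0) at_top"
      using tendsto_mult_right_zero[OF tendsto_rabs_zero[OF r1]] .
  qed
qed

lemma R3_eq: assumes "t > 0"
  shows "R3 t = (c0 * exp (L 1 t) * q t + 2 * sg * R1 t / (R t)\<^sup>2 - 4 * mu * (R2 t / R t - (R1 t)\<^sup>2 / (R t)\<^sup>2) - 4 * rl * R1 t * R2 t) / (rl * R t)"
proof -
  have t: "t \<ge> 0" using assms by simp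
  have R: "R t > 0" by (rule Rpos[OF t])
  have a: "((\<lambda>t. c0 * exp (L 1 t)) has_real_derivative c0 * (exp (L 1 t) * q t)) (at t within {0..})"
    unfolding q_def using t by (auto intro!: derivative_eq_intros dLt)
  have b: "((\<lambda>t. pin + 2 * sg / R t + 4 * mu * R1 t / R t + rl * (R t * R2 t + 3 / 2 * (R1 t)\<^sup>2)) has_real_derivative
     - (2 * sg * R1 t / (R t)\<^sup>2) + 4 * mu * (R2 t / R t - (R1 t)\<^sup>2 / (R t)\<^sup>2) + rl * (R1 t * R2 t + R t * R3 t + 3 * R1 t * R2 t)) (at t within {0..})"
    using R by (auto intro!: derivative_eq_intros dR dR1 dR2 t simp: field_simps power2_eq_square)
  have "((\<lambda>t. pin + 2 * sg / R t + 4 * mu * R1 t / R t + rl * (R t * R2 t + 3 / 2 * (R1 t)\<^sup>2)) has_real_derivative c0 * (exp (L 1 t) * q t)) (at t within {0..})"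
    by (rule has_field_derivative_transform_within[OF a zero_less_one]) (use t wallp in auto)
  then have "c0 * (exp (L 1 t) * q t) = - (2 * sg * R1 t / (R t)\<^sup>2) + 4 * mu * (R2 t / R t - (R1 t)\<^sup>2 / (R t)\<^sup>2) + rl * (R1 t * R2 t + R t * R3 t + 3 * R1 t * R2 t)"
    using b DERIV_unique unfolding at_within_half_line[OF assms] by blast
  then have "rl * R t * R3 t = c0 * exp (L 1 t) * q t + 2 * sg * R1 t / (R t)\<^sup>2 - 4 * mu * (R2 t / R t - (R1 t)\<^sup>2 / (R t)\<^sup>2) - 4 * rl * R1 t * R2 t"
    by (simp add: algebra_simps)
  then show ?thesis using R par by (simp add: field_simps)
qed

lemma R_low: "t \<ge> 0 \<Longrightarrow> \<bar>1 / R t\<bar> \<le> 2 / Rs"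
proof -
  assume t: "t \<ge> 0"
  have "1 / R t \<le> 1 / (Rs / 2)" by (rule frac_le) (use R_bounds[OF t] Rs in auto)
  then show ?thesis using Rpos[OF t] by simp
qed

lemma R3_bounded: "\<exists>B. \<forall>t>0. \<bar>R3 t\<bar> \<le> B"
proof -
  obtain B2 where B2: "\<And>t. t \<ge> 0 \<Longrightarrow> \<bar>R2 t\<bar> \<le> B2" using R2_bounded by auto
  define i where "i = 2 / Rs"
  define B where "B = (c0 * exp (ln rs + 1) * \<mu> + 2 * sg * \<epsilon> * (i * i) + 4 * mu * (B2 * i + (\<epsilon> * \<epsilon>) * (i * i)) + 4 * rl * \<epsilon> * B2) * (i / rl)"
  have "\<bar>R3 t\<bar> \<le> B" if t0: "t > 0" for t
  proof -
    have t: "t \<ge> 0" using t0 by simp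
    define j where "j = 1 / R t"
    have j: "\<bar>j\<bar> \<le> i" using R_low[OF t] by (simp add: j_def i_def)
    have i0: "i \<ge> 0" using j by linarith
    have e1: "R3 t = (c0 * exp (L 1 t) * q t + 2 * sg * R1 t * (j * j) - 4 * mu * (R2 t * j - (R1 t * R1 t) * (j * j)) - 4 * rl * R1 t * R2 t) * (j / rl)"
      unfolding R3_eq[OF t0] j_def by (simp add: power2_eq_square)
    have b1: "\<bar>c0 * exp (L 1 t) * q t\<bar> \<le> c0 * exp (ln rs + 1) * \<mu>"
      unfolding abs_mult using par L1_bounds[OF t] q_le[OF t] by (intro mult_mono) auto
    have b2: "\<bar>2 * sg * R1 t * (j * j)\<bar> \<le> 2 * sg * \<epsilon> * (i * i)"
      unfolding abs_mult using par near(2)[OF t] j i0 eps by (intro mult_mono) auto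
    have "\<bar>R2 t * j\<bar> \<le> B2 * i" "\<bar>(R1 t * R1 t) * (j * j)\<bar> \<le> (\<epsilon> * \<epsilon>) * (i * i)"
      unfolding abs_mult using B2[OF t] near(2)[OF t] j i0 eps by (intro mult_mono; linarith?)+ (auto intro: order.trans[OF abs_ge_zero B2[OF t]])
    then have "\<bar>R2 t * j - (R1 t * R1 t) * (j * j)\<bar> \<le> B2 * i + (\<epsilon> * \<epsilon>) * (i * i)" by linarith
    then have b3: "\<bar>4 * mu * (R2 t * j - (R1 t * R1 t) * (j * j))\<bar> \<le> 4 * mu * (B2 * i + (\<epsilon> * \<epsilon>) * (i * i))"
      unfolding abs_mult[of "4 * mu"] using par by (intro mult_mono) auto
    have b4: "\<bar>4 * rl * R1 t * R2 t\<bar> \<le> 4 * rl * \<epsilon> * B2"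
      unfolding abs_mult using par near(2)[OF t] B2[OF t] eps by (intro mult_mono) auto
    have "\<bar>c0 * exp (L 1 t) * q t + 2 * sg * R1 t * (j * j) - 4 * mu * (R2 t * j - (R1 t * R1 t) * (j * j)) - 4 * rl * R1 t * R2 t\<bar>
      \<le> c0 * exp (ln rs + 1) * \<mu> + 2 * sg * \<epsilon> * (i * i) + 4 * mu * (B2 * i + (\<epsilon> * \<epsilon>) * (i * i)) + 4 * rl * \<epsilon> * B2"
      using b1 b2 b3 b4 unfolding abs_le_iff by linarith
    moreover have "\<bar>j / rl\<bar> \<le> i / rl" using j par by (simp add: divide_right_mono)
    ultimately show ?thesis unfolding e1 B_def abs_mult[of _ "j / rl"] by (intro mult_mono) auto
  qed
  then show ?thesis by blast
qed

text \<open>The wall pressure law would give \<open>R2\<close> only through the still unknown limits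
  of \<open>R\<close> and \<open>L 1\<close>; interpolation between the decay of \<open>R1\<close>
  and the bound for \<open>R3\<close> avoids them.\<close>

lemma R2_tendsto_0: "(R2 \<longlongrightarrow> 0) at_top"
proof -
  obtain B where "\<And>t. t > 0 \<Longrightarrow> \<bar>R3 t\<bar> \<le> B" using R3_bounded by auto
  from deriv_tendsto_0[OF dR1 dR2 this R1_tendsto_0] show ?thesis .
qed

lemma mass_approx:
  assumes t: "t \<ge> 0" and x: "\<And>s. 0 \<le> s \<Longrightarrow> s \<le> 1 \<Longrightarrow> \<bar>L 1 t - L s t\<bar> \<le> x" and x1: "x \<le> 1"
  shows "\<bar>3 * m - exp (L 1 t) * R t ^ 3\<bar> \<le> 6 * (exp (L 1 t) * R t ^ 3) * x"
proof -
  have R: "R t > 0" by (rule Rpos[OF t])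
  have hm: "((\<lambda>s. R t ^ 3 * (s\<^sup>2 * exp (L s t))) has_integral m) {0..1}"
    using mass[OF t] integrable_L(2)[OF t] by (metis integrable_integral)
  have hp: "((\<lambda>s. exp (L 1 t) * R t ^ 3 * s\<^sup>2) has_integral exp (L 1 t) * R t ^ 3 * (1 / 3)) {0..1}"
    by (intro has_integral_mult_right int_sq)
  have h: "((\<lambda>s. R t ^ 3 * (s\<^sup>2 * exp (L s t)) - exp (L 1 t) * R t ^ 3 * s\<^sup>2) has_integral m - exp (L 1 t) * R t ^ 3 * (1 / 3)) {0..1}"
    by (rule has_integral_diff[OF hm hp])
  have "norm (integral {0..1} (\<lambda>s. R t ^ 3 * (s\<^sup>2 * exp (L s t)) - exp (L 1 t) * R t ^ 3 * s\<^sup>2)) \<le> (exp (L 1 t) * R t ^ 3 * (2 * x)) * (1 - 0)"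
  proof (rule integral_bound)
    show "continuous_on {0..1} (\<lambda>s. R t ^ 3 * (s\<^sup>2 * exp (L s t)) - exp (L 1 t) * R t ^ 3 * s\<^sup>2)"
      by (intro continuous_intros cont_comp) (use t in auto)
    fix s :: real assume s: "s \<in> {0..1}"
    have xs: "\<bar>L 1 t - L s t\<bar> \<le> x" using x s by simp
    have "\<bar>exp (L s t - L 1 t) - 1\<bar> \<le> 2 * \<bar>L s t - L 1 t\<bar>" using xs x1 by (intro abs_exp_minus_one_le) (simp add: abs_minus_commute)
    then have e: "\<bar>exp (L s t - L 1 t) - 1\<bar> \<le> 2 * x" using xs by (simp add: abs_minus_commute)
    have "R t ^ 3 * (s\<^sup>2 * exp (L s t)) - exp (L 1 t) * R t ^ 3 * s\<^sup>2 = exp (L 1 t) * R t ^ 3 * (s\<^sup>2 * (exp (L s t - L 1 t) - 1))"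
      by (simp add: exp_diff algebra_simps)
    then have "\<bar>R t ^ 3 * (s\<^sup>2 * exp (L s t)) - exp (L 1 t) * R t ^ 3 * s\<^sup>2\<bar> = exp (L 1 t) * R t ^ 3 * (s\<^sup>2 * \<bar>exp (L s t - L 1 t) - 1\<bar>)"
      using R by (simp add: abs_mult)
    also have "\<dots> \<le> exp (L 1 t) * R t ^ 3 * (1 * (2 * x))"
      using e s R by (intro mult_left_mono mult_mono power_le_one) auto
    finally show "norm (R t ^ 3 * (s\<^sup>2 * exp (L s t)) - exp (L 1 t) * R t ^ 3 * s\<^sup>2) \<le> exp (L 1 t) * R t ^ 3 * (2 * x)" by simp
  qed simp
  then have 1: "\<bar>m - exp (L 1 t) * R t ^ 3 * (1 / 3)\<bar> \<le> exp (L 1 t) * R t ^ 3 * (2 * x)" unfolding integral_unique[OF h] by simp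
  have "\<bar>3 * m - exp (L 1 t) * R t ^ 3\<bar> = 3 * \<bar>m - exp (L 1 t) * R t ^ 3 * (1 / 3)\<bar>" by (simp add: abs_if)
  also have "\<dots> \<le> 3 * (exp (L 1 t) * R t ^ 3 * (2 * x))" by (rule mult_left_mono[OF 1]) simp
  finally show ?thesis by simp
qed

text \<open>The pressure law with vanishing dynamic part \<open>w\<close>, multiplied by
  \<open>R t ^ 3\<close> and combined with the asymptotically uniform density, says that the
  equilibrium cubic at \<open>R t\<close> tends to its value at \<open>Rs\<close>. Its difference
  quotient is at least \<open>pin * Rs\<^sup>2\<close>, so \<open>R\<close> converges, and the
  pressure law then gives the wall density.\<close>

lemma R_tendsto: "(R \<longlongrightarrow> Rs) at_top" and L1_tendsto: "(L 1 \<longlongrightarrow> ln rs) at_top"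
proof -
  have nn: "\<forall>\<^sub>F t in at_top. (t::real) \<ge> 0" by (rule eventually_ge_at_top)
  define w where "w t = 4 * mu * R1 t / R t + rl * (R t * R2 t + 3 / 2 * (R1 t)\<^sup>2)" for t
  have bmul: "((\<lambda>t. f t * g t) \<longlongrightarrow> 0) at_top" if f: "\<And>t. t \<ge> 0 \<Longrightarrow> \<bar>f t\<bar> \<le> B" and g: "(g \<longlongrightarrow> 0) at_top" for f g :: "real \<Rightarrow> real" and B
  proof (rule Lim_null_comparison)
    show "\<forall>\<^sub>F t in at_top. norm (f t * g t) \<le> B * \<bar>g t\<bar>"
      using nn by eventually_elim (use f in \<open>auto simp: abs_mult intro!: mult_right_mono\<close>)
    show "((\<lambda>t. B * \<bar>g t\<bar>) \<longlongrightarrow> 0) at_top" using tendsto_mult_right_zero[OF tendsto_rabs_zero[OF g]] .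
  qed
  have R2b: "\<bar>R t\<bar> \<le> 2 * Rs" if "t \<ge> 0" for t using R_bounds[OF that] Rpos[OF that] by simp
  have "((\<lambda>t. 4 * mu * ((1 / R t) * R1 t) + rl * (R t * R2 t + 3 / 2 * (R1 t)\<^sup>2)) \<longlongrightarrow> 4 * mu * 0 + rl * (0 + 3 / 2 * 0\<^sup>2)) at_top"
    by (intro tendsto_intros bmul[OF R_low R1_tendsto_0] bmul[OF R2b R2_tendsto_0] R1_tendsto_0)
  then have w0: "(w \<longlongrightarrow> 0) at_top" unfolding w_def by simp
  have P: "c0 * exp (L 1 t) = pin + 2 * sg / R t + w t" if "t \<ge> 0" for t using wallp[OF that] by (simp add: w_def)
  define g where "g r = pin * r ^ 3 + 2 * sg * r\<^sup>2" for r
  have PRb: "exp (L 1 t) * R t ^ 3 \<le> exp (ln rs + 1) * (2 * Rs) ^ 3" if "t \<ge> 0" for t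
    using L1_bounds[OF that] R_bounds[OF that] Rpos[OF that] by (intro mult_mono power_mono) auto
  define BB where "BB = exp (ln rs + 1) * (2 * Rs) ^ 3"
  have BB: "BB > 0" using Rs by (simp add: BB_def)
  have mR: "((\<lambda>t. 3 * m - exp (L 1 t) * R t ^ 3) \<longlongrightarrow> 0) at_top"
  proof (rule tendstoI)
    fix e :: real assume e: "e > 0"
    define x where "x = min 1 (e / (12 * BB))"
    have x: "x > 0" "x \<le> 1" "x \<le> e / (12 * BB)" using e BB by (auto simp: x_def)
    obtain T where T: "T \<ge> 0" "\<And>t s. t \<ge> T \<Longrightarrow> 0 \<le> s \<Longrightarrow> s \<le> 1 \<Longrightarrow> \<bar>L 1 t - L s t\<bar> \<le> x"
      using unif_0D[OF X_unif x(1)] by auto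
    have "\<bar>3 * m - exp (L 1 t) * R t ^ 3\<bar> < e" if t: "t \<ge> T" for t
    proof -
      have t0: "t \<ge> 0" using t T by simp
      have "\<bar>3 * m - exp (L 1 t) * R t ^ 3\<bar> \<le> 6 * (exp (L 1 t) * R t ^ 3) * x" by (rule mass_approx[OF t0 T(2)[OF t] x(2)])
      also have "\<dots> \<le> 6 * BB * (e / (12 * BB))" using PRb[OF t0] x BB Rpos[OF t0] by (intro mult_mono) (auto simp: BB_def)
      also have "\<dots> < e" using BB e by simp
      finally show ?thesis .
    qed
    then show "\<forall>\<^sub>F t in at_top. dist (3 * m - exp (L 1 t) * R t ^ 3) 0 < e" by (auto simp: eventually_at_top_linorder)
  qed
  have R3b: "\<bar>R t ^ 3\<bar> \<le> (2 * Rs) ^ 3" if "t \<ge> 0" for t using R2b[OF that] unfolding power_abs by (intro power_mono) auto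
  have "((\<lambda>t. R t ^ 3 * w t - c0 * (exp (L 1 t) * R t ^ 3 - 3 * m) ) \<longlongrightarrow> 0 - c0 * 0) at_top"
  proof (intro tendsto_diff tendsto_mult tendsto_const bmul[OF R3b w0])
    show "((\<lambda>t. exp (L 1 t) * R t ^ 3 - 3 * m) \<longlongrightarrow> 0) at_top" using tendsto_minus[OF mR] by simp
  qed
  then have gl: "((\<lambda>t. R t ^ 3 * w t - c0 * (exp (L 1 t) * R t ^ 3 - 3 * m)) \<longlongrightarrow> 0) at_top" by simp
  have kp: "pin * Rs\<^sup>2 > 0" using par Rs by simp
  have "((\<lambda>t. R t - Rs) \<longlongrightarrow> 0) at_top"
  proof (rule Lim_null_comparison)
    show "\<forall>\<^sub>F t in at_top. norm (R t - Rs) \<le> (1 / (pin * Rs\<^sup>2)) * \<bar>R t ^ 3 * w t - c0 * (exp (L 1 t) * R t ^ 3 - 3 * m)\<bar>"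
      using nn
    proof eventually_elim
      case (elim t)
      have R: "R t > 0" by (rule Rpos[OF elim])
      have "R t ^ 3 * (c0 * exp (L 1 t)) = g (R t) + R t ^ 3 * w t"
        unfolding P[OF elim] g_def using R by (simp add: field_simps power2_eq_square power3_eq_cube)
      moreover have "3 * c0 * m = g Rs" using Rs by (simp add: g_def)
      ultimately have "R t ^ 3 * w t - c0 * (exp (L 1 t) * R t ^ 3 - 3 * m) = g Rs - g (R t)" by (simp add: algebra_simps)
      also have "\<dots> = (Rs - R t) * (pin * (Rs\<^sup>2 + Rs * R t + (R t)\<^sup>2) + 2 * sg * (Rs + R t))"
        unfolding g_def by (simp add: algebra_simps power2_eq_square power3_eq_cube)
      finally have "\<bar>R t ^ 3 * w t - c0 * (exp (L 1 t) * R t ^ 3 - 3 * m)\<bar> = \<bar>R t - Rs\<bar> * (pin * (Rs\<^sup>2 + Rs * R t + (R t)\<^sup>2) + 2 * sg * (Rs + R t))"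
        using par Rs R by (simp add: abs_mult abs_minus_commute)
      also have "\<dots> \<ge> \<bar>R t - Rs\<bar> * (pin * Rs\<^sup>2)"
      proof (rule mult_left_mono)
        have "pin * Rs\<^sup>2 \<le> pin * (Rs\<^sup>2 + Rs * R t + (R t)\<^sup>2)" using par Rs R by (intro mult_left_mono) auto
        moreover have "2 * sg * (Rs + R t) \<ge> 0" using par Rs R by simp
        ultimately show "pin * Rs\<^sup>2 \<le> pin * (Rs\<^sup>2 + Rs * R t + (R t)\<^sup>2) + 2 * sg * (Rs + R t)" by simp
      qed simp
      finally show ?case using kp by (simp add: field_simps)
    qed
    show "((\<lambda>t. (1 / (pin * Rs\<^sup>2)) * \<bar>R t ^ 3 * w t - c0 * (exp (L 1 t) * R t ^ 3 - 3 * m)\<bar>) \<longlongrightarrow> 0) at_top"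
      using tendsto_mult_right_zero[OF tendsto_rabs_zero[OF gl]] .
  qed
  then show Rl: "(R \<longlongrightarrow> Rs) at_top" by (simp add: LIM_zero_iff)
  have "((\<lambda>t. (pin + 2 * sg / R t + w t) / c0) \<longlongrightarrow> (pin + 2 * sg / Rs + 0) / c0) at_top"
    by (intro tendsto_intros Rl w0) (use Rs par in auto)
  then have "((\<lambda>t. (pin + 2 * sg / R t + w t) / c0) \<longlongrightarrow> rs) at_top" by (simp add: rs_def)
  moreover have "\<forall>\<^sub>F t in at_top. (pin + 2 * sg / R t + w t) / c0 = exp (L 1 t)"
    using nn by eventually_elim (use P par in \<open>simp add: field_simps\<close>)
  ultimately have "((\<lambda>t. exp (L 1 t)) \<longlongrightarrow> rs) at_top" by (rule Lim_transform_eventually)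
  from tendsto_ln[OF this] rs show "(L 1 \<longlongrightarrow> ln rs) at_top" by simp
qed

lemma R3_tendsto_0: "(R3 \<longlongrightarrow> 0) at_top"
proof -
  have "((\<lambda>t. (c0 * exp (L 1 t) * q t + 2 * sg * R1 t / (R t)\<^sup>2 - 4 * mu * (R2 t / R t - (R1 t)\<^sup>2 / (R t)\<^sup>2) - 4 * rl * R1 t * R2 t) / (rl * R t))
     \<longlongrightarrow> (c0 * exp (ln rs) * 0 + 2 * sg * 0 / Rs\<^sup>2 - 4 * mu * (0 / Rs - 0\<^sup>2 / Rs\<^sup>2) - 4 * rl * 0 * 0) / (rl * Rs)) at_top"
    by (intro tendsto_intros q_tendsto_0 R1_tendsto_0 R2_tendsto_0 R_tendsto L1_tendsto) (use Rs par in auto)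
  then have l: "((\<lambda>t. (c0 * exp (L 1 t) * q t + 2 * sg * R1 t / (R t)\<^sup>2 - 4 * mu * (R2 t / R t - (R1 t)\<^sup>2 / (R t)\<^sup>2) - 4 * rl * R1 t * R2 t) / (rl * R t))
     \<longlongrightarrow> 0) at_top" by simp
  show ?thesis
  proof (rule Lim_transform_eventually[OF l])
    show "\<forall>\<^sub>F t in at_top. (c0 * exp (L 1 t) * q t + 2 * sg * R1 t / (R t)\<^sup>2 - 4 * mu * (R2 t / R t - (R1 t)\<^sup>2 / (R t)\<^sup>2) - 4 * rl * R1 t * R2 t) / (rl * R t) = R3 t"
      using eventually_gt_at_top[of 0] by eventually_elim (simp only: R3_eq)
  qed
qed

lemma L_unif: "unif_0 (\<lambda>s t. L s t - ln rs)"
  unfolding unif_0_def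
proof (intro allI impI)
  fix \<epsilon>' :: real assume e: "\<epsilon>' > 0"
  obtain T where T: "T \<ge> 0" "\<And>t s. t \<ge> T \<Longrightarrow> 0 \<le> s \<Longrightarrow> s \<le> 1 \<Longrightarrow> \<bar>L 1 t - L s t\<bar> \<le> \<epsilon>' / 2"
    using unif_0D[OF X_unif, of "\<epsilon>' / 2"] e by auto
  have "\<forall>\<^sub>F t in at_top. dist (L 1 t) (ln rs) < \<epsilon>' / 2" by (rule tendstoD[OF L1_tendsto]) (use e in simp)
  then obtain T2 where T2: "\<And>t. t \<ge> T2 \<Longrightarrow> \<bar>L 1 t - ln rs\<bar> < \<epsilon>' / 2" by (auto simp: eventually_at_top_linorder dist_real_def)
  show "\<exists>T\<ge>0. \<forall>t\<ge>T. \<forall>s. 0 \<le> s \<and> s \<le> 1 \<longrightarrow> \<bar>L s t - ln rs\<bar> \<le> \<epsilon>'"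
  proof (intro exI[of _ "max T T2"] conjI allI impI)
    fix t s :: real assume "max T T2 \<le> t" "0 \<le> s \<and> s \<le> 1"
    then show "\<bar>L s t - ln rs\<bar> \<le> \<epsilon>'" using T(2)[of t s] T2[of t] by (simp add: abs_if split: if_splits)
  qed (use T in auto)
qed

end

section \<open>Nonlinear stability of the scaled flow\<close>

context bubble_par
begin

text \<open>Constants are fixed in the order \<open>\<mu>\<close>, \<open>\<epsilon>\<close>,
  \<open>\<delta>\<close>: \<open>\<mu>\<close> meets the bootstrap and the two smallness conditions
  for the exponent \<open>\<beta>\<close>, \<open>\<epsilon>\<close> is admissible for
  \<open>\<mu>\<close>, and \<open>\<delta>\<close> is an initial size for which the energy keeps
  the wall data within \<open>\<epsilon>\<close>. The initial bound on \<open>LL\<close> starts the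
  bootstrap for \<open>v\<close>.\<close>

theorem flow_stability:
  assumes be: "0 < \<beta>" "\<beta> < 1"
  obtains \<delta> where "\<delta> > 0" and "\<And>L Ls LL Lt R R1 R2 R3. bubble_flow kap gm c0 sg pin rl mu m Rs L Ls LL Lt R R1 R2 R3 \<Longrightarrow>
     (\<forall>s. 0 \<le> s \<and> s \<le> 1 \<longrightarrow> \<bar>L s 0 - ln rs\<bar> \<le> \<delta> \<and> \<bar>LL s 0\<bar> \<le> \<delta>) \<Longrightarrow> \<bar>R 0 - Rs\<bar> \<le> \<delta> \<Longrightarrow> \<bar>R1 0\<bar> \<le> \<delta> \<Longrightarrow>
     unif_0 (\<lambda>s t. L s t - ln rs) \<and> unif_0 LL \<and>
     (R \<longlongrightarrow> Rs) at_top \<and> (R1 \<longlongrightarrow> 0) at_top \<and> (R2 \<longlongrightarrow> 0) at_top \<and> (R3 \<longlongrightarrow> 0) at_top \<and>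
     (\<exists>C>0. \<forall>t\<ge>2. \<forall>s1 s2. 0 \<le> s1 \<and> s1 \<le> 1 \<and> 0 \<le> s2 \<and> s2 \<le> 1 \<longrightarrow> \<bar>LL s1 t - LL s2 t\<bar> \<le> C * \<bar>s1 - s2\<bar> powr \<beta>)"
proof -
  obtain \<mu>0 where mu0: "\<mu>0 > 0" "\<And>\<mu>. 0 < \<mu> \<Longrightarrow> \<mu> \<le> \<mu>0 \<Longrightarrow> \<exists>\<epsilon>0>0. \<forall>\<epsilon>. 0 < \<epsilon> \<and> \<epsilon> \<le> \<epsilon>0 \<longrightarrow> admissible_size \<mu> \<epsilon>"
    using admissible_size_ex by auto
  \<comment> \<open>\<open>a\<close> and \<open>b\<close> are the largest values of
    \<open>\<mu>\<close> permitted by the two clauses of \<open>mu_small\<close>.\<close>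
  define a where "a = 2 * amin / lam2"
  define b where "b = 3 * amin\<^sup>2 * (1 - \<beta>) / (2 * amax * lam2\<^sup>2)"
  have ab: "a > 0" "b > 0" using const_pos be by (auto simp: a_def b_def)
  define \<mu> where "\<mu> = min \<mu>0 (min a b)"
  have mu: "\<mu> > 0" "\<mu> \<le> \<mu>0" "\<mu> \<le> a" "\<mu> \<le> b" using mu0 ab by (auto simp: \<mu>_def)
  have mua: "\<mu> * lam2 \<le> 2 * amin" using mu(3) const_pos by (simp add: a_def field_simps)
  have mub: "\<mu> * (2 * amax * lam2\<^sup>2) \<le> 3 * amin\<^sup>2 * (1 - \<beta>)"
  proof -
    define p where "p = 2 * amax * lam2\<^sup>2"
    have p: "p > 0" using const_pos by (simp add: p_def)
    have "\<mu> * p \<le> b * p" using mu(4) p by (intro mult_right_mono) auto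
    also have "\<dots> = 3 * amin\<^sup>2 * (1 - \<beta>)" unfolding b_def p_def[symmetric] using p by simp
    finally show ?thesis by (simp add: p_def)
  qed
  obtain \<epsilon>0 where e0: "\<epsilon>0 > 0" "\<And>\<epsilon>. 0 < \<epsilon> \<Longrightarrow> \<epsilon> \<le> \<epsilon>0 \<Longrightarrow> admissible_size \<mu> \<epsilon>" using mu0(2)[OF mu(1,2)] by auto
  define \<epsilon> where "\<epsilon> = min \<epsilon>0 (min 1 (Rs / 2))"
  have eps: "\<epsilon> > 0" "\<epsilon> \<le> \<epsilon>0" "\<epsilon> \<le> 1" "\<epsilon> \<le> Rs / 2" using e0 Rs unfolding \<epsilon>_def by auto
  have adm: "admissible_size \<mu> \<epsilon>" by (rule e0(2)) (use eps in auto)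
  obtain \<delta>1 where d1: "\<delta>1 > 0" and d2: "\<forall>L Ls LL Lt R R1 R2 R3. bubble_flow kap gm c0 sg pin rl mu m Rs L Ls LL Lt R R1 R2 R3 \<and>
     (\<forall>s. 0 \<le> s \<and> s \<le> 1 \<longrightarrow> \<bar>L s 0 - ln rs\<bar> \<le> \<delta>1) \<and> \<bar>R 0 - Rs\<bar> \<le> \<delta>1 \<and> \<bar>R1 0\<bar> \<le> \<delta>1 \<longrightarrow>
     (\<forall>t\<ge>0. \<bar>R t - Rs\<bar> < \<epsilon> \<and> \<bar>R1 t\<bar> < \<epsilon> \<and> \<bar>L 1 t - ln rs\<bar> < \<epsilon>)"
    using low_norm_stability[OF eps(1)] by blast
  define \<delta> where "\<delta> = min \<delta>1 \<epsilon>"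
  have d: "\<delta> > 0" "\<delta> \<le> \<delta>1" "\<delta> \<le> \<epsilon>" using d1 eps by (auto simp: \<delta>_def)
  show ?thesis
  proof (rule that[OF d(1)])
    fix L Ls LL Lt R R1 R2 R3
    assume fl: "bubble_flow kap gm c0 sg pin rl mu m Rs L Ls LL Lt R R1 R2 R3"
      and i: "\<forall>s. 0 \<le> s \<and> s \<le> 1 \<longrightarrow> \<bar>L s 0 - ln rs\<bar> \<le> \<delta> \<and> \<bar>LL s 0\<bar> \<le> \<delta>" and i2: "\<bar>R 0 - Rs\<bar> \<le> \<delta>" "\<bar>R1 0\<bar> \<le> \<delta>"
    interpret bubble_flow kap gm c0 sg pin rl mu m Rs L Ls LL Lt R R1 R2 R3 by (rule fl)
    have n: "\<bar>R t - Rs\<bar> < \<epsilon> \<and> \<bar>R1 t\<bar> < \<epsilon> \<and> \<bar>L 1 t - ln rs\<bar> < \<epsilon>" if "t \<ge> 0" for t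
    proof -
      have "\<bar>L s 0 - ln rs\<bar> \<le> \<delta>1" if "0 \<le> s \<and> s \<le> 1" for s using i[rule_format, OF that] d by linarith
      then have "\<forall>t\<ge>0. \<bar>R t - Rs\<bar> < \<epsilon> \<and> \<bar>R1 t\<bar> < \<epsilon> \<and> \<bar>L 1 t - ln rs\<bar> < \<epsilon>"
        using d2[rule_format, of L Ls LL Lt R R1 R2 R3] fl i2 d by auto
      then show ?thesis using that by simp
    qed
    interpret bubble_near kap gm c0 sg pin rl mu m Rs L Ls LL Lt R R1 R2 R3 \<epsilon>
    proof
      show "\<bar>R t - Rs\<bar> \<le> \<epsilon>" "\<bar>R1 t\<bar> \<le> \<epsilon>" "\<bar>L 1 t - ln rs\<bar> \<le> \<epsilon>" if "t \<ge> 0" for t using n[OF that] by auto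
      show "\<bar>L s 0 - ln rs\<bar> \<le> \<epsilon>" if "0 \<le> s" "s \<le> 1" for s using i[rule_format, of s] that d by auto
    qed (use eps in auto)
    have v0: "\<bar>v x 0\<bar> \<le> K3 * \<epsilon>" if x: "0 \<le> x" "x \<le> Lam 0" for x
    proof -
      have l: "Lam 0 > 0" "lam1 \<le> Lam 0" using Lam_pos[of 0] Lam_bounds[of 0] by auto
      have "\<bar>v x 0\<bar> = A x 0 * (\<bar>LL (x / Lam 0) 0\<bar> / (Lam 0)\<^sup>2)" unfolding v_def YL_def using l A_pos[of x 0] by (simp add: abs_mult)
      also have "\<dots> \<le> amax * (\<epsilon> / lam1\<^sup>2)"
      proof (intro mult_mono frac_le power_mono)
        show "\<bar>LL (x / Lam 0) 0\<bar> \<le> \<epsilon>" using i[rule_format, of "x / Lam 0"] frac_in[of 0 x] x d by auto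
      qed (use A_bounds[of 0 x] x l const_pos eps in auto)
      finally show ?thesis by (simp add: K3_def mult_ac)
    qed
    have vs: "\<bar>v x t\<bar> \<le> \<mu>" if "t \<ge> 0" "0 \<le> x" "x \<le> Lam t" for x t by (rule v_small[OF v0 adm mu(1) that])
    obtain \<delta>' where d': "0 < \<delta>'" "\<delta>' \<le> lam1 / 2" "wall_grad \<epsilon> \<delta>' \<mu> \<le> \<mu> / (8 * K1)" "K1 * (\<epsilon> + wall_grad \<epsilon> \<delta>' \<mu>) \<le> \<mu>"
      using adm unfolding admissible_size_def by blast
    have G: "\<bar>Yx (Lam t) t\<bar> \<le> wall_grad \<epsilon> \<delta>' \<mu>" if "t \<ge> 0" for t
      by (rule wall_gradient[OF that vs d'(1,2)]) (use that in auto)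
    interpret bubble_smooth kap gm c0 sg pin rl mu m Rs L Ls LL Lt R R1 R2 R3 \<epsilon> \<mu> \<beta>
    proof
      show "\<bar>q t\<bar> \<le> \<mu>" if t: "t \<ge> 0" for t
      proof -
        have "K1 * (\<epsilon> + \<bar>Yx (Lam t) t\<bar>) \<le> K1 * (\<epsilon> + wall_grad \<epsilon> \<delta>' \<mu>)" using G[OF t] K_pos by (intro mult_left_mono) auto
        then show ?thesis using q_bound[OF t] d'(4) by linarith
      qed
      show "\<bar>Lam1 t\<bar> \<le> \<mu>" if t: "t \<ge> 0" for t
      proof -
        have "K1 * \<bar>Yx (Lam t) t\<bar> \<le> K1 * (\<mu> / (8 * K1))" using G[OF t] d'(3) K_pos by (intro mult_left_mono) auto
        also have "\<dots> = \<mu> / 8" using K_pos by simp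
        also have "\<dots> \<le> \<mu>" using mu by simp
        finally show ?thesis using Lam1_bound[OF t] by linarith
      qed
    qed (use mu be mua mub vs in auto)
    show "unif_0 (\<lambda>s t. L s t - ln rs) \<and> unif_0 LL \<and>
      (R \<longlongrightarrow> Rs) at_top \<and> (R1 \<longlongrightarrow> 0) at_top \<and> (R2 \<longlongrightarrow> 0) at_top \<and> (R3 \<longlongrightarrow> 0) at_top \<and>
      (\<exists>C>0. \<forall>t\<ge>2. \<forall>s1 s2. 0 \<le> s1 \<and> s1 \<le> 1 \<and> 0 \<le> s2 \<and> s2 \<le> 1 \<longrightarrow> \<bar>LL s1 t - LL s2 t\<bar> \<le> C * \<bar>s1 - s2\<bar> powr \<beta>)"
      by (intro conjI L_unif LL_unif R_tendsto R1_tendsto_0 R2_tendsto_0 R3_tendsto_0 LL_holder)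
  qed
qed

end

section \<open>Integration of radial functions over balls\<close>

lemma absolutely_integrable_continuous_compact:
  fixes f :: "'a::euclidean_space \<Rightarrow> real"
  assumes "compact S" "continuous_on S f"
  shows "f absolutely_integrable_on S"
proof -
  have i: "integrable lborel (\<lambda>x. indicator S x *\<^sub>R f x)" by (rule borel_integrable_compact[OF assms])
  then show ?thesis unfolding set_integrable_def
    using integrable_completion[OF borel_measurable_integrable[OF i]] by simp
qed

text \<open>The integral over the closed ball of radius \<open>r\<close> is differentiated in
  \<open>r\<close>: over a thin shell it equals an intermediate value of \<open>f\<close> times the
  shell volume, and the difference of cubes factors. The fundamental theorem then gives the
  one-dimensional integral.\<close>

lemma integral_radial:
  fixes f :: "real \<Rightarrow> real"
  assumes b: "b > 0" and f: "continuous_on {0..b} f"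
  shows "integral (ball 0 b) (\<lambda>x::real^3. f (norm x)) = 4 * pi * integral {0..b} (\<lambda>r. r\<^sup>2 * f r)"
proof -
  let ?g = "\<lambda>x::real^3. f (norm x)"
  define F where "F r = integral (cball 0 r) ?g" for r
  have cg: "continuous_on (cball 0 r) ?g" if "r \<le> b" for r
    by (rule continuous_on_compose2[OF f]) (use that in \<open>auto intro!: continuous_intros\<close>)
  have ig: "?g integrable_on cball 0 r" if "r \<le> b" for r
  proof -
    have "?g absolutely_integrable_on cball 0 r"
      by (rule absolutely_integrable_continuous_compact) (use cg[OF that] in auto)
    then show ?thesis by (rule set_lebesgue_integral_eq_integral(1))
  qed
  have vol: "measure lebesgue (cball (0::real^3) r) = 4 / 3 * pi * r ^ 3" if "r \<ge> 0" for r
    using content_cball[of r "0::real^3"] that by (simp add: unit_ball_vol_3)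
  have shell: "\<exists>\<xi>. x \<le> \<xi> \<and> \<xi> \<le> y \<and> F y - F x = f \<xi> * (4 / 3 * pi * (y ^ 3 - x ^ 3))" if xy: "0 \<le> x" "x < y" "y \<le> b" for x y
  proof -
    define S where "S = cball (0::real^3) y - cball 0 x"
    have sub: "cball (0::real^3) x \<subseteq> cball 0 y" using xy by auto
    have mS: "S \<in> lmeasurable" unfolding S_def by (intro fmeasurable.Diff) auto
    have volS: "measure lebesgue S = 4 / 3 * pi * (y ^ 3 - x ^ 3)"
      unfolding S_def using measurable_measure_Diff[where M=lebesgue, OF _ _ sub] vol[of x] vol[of y] xy by (simp add: algebra_simps)
    have vpos: "4 / 3 * pi * (y ^ 3 - x ^ 3) > 0" using xy by (simp add: power_strict_mono)
    have iS: "?g integrable_on S" and FS: "F y - F x = integral S ?g"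
    proof -
      have ax: "?g absolutely_integrable_on cball 0 x" "?g absolutely_integrable_on cball 0 y"
        by (rule absolutely_integrable_continuous_compact; use cg xy in auto)+
      have aS: "?g absolutely_integrable_on S" unfolding S_def
        by (rule set_integrable_subset[OF ax(2)]) auto
      then show iS: "?g integrable_on S" by (rule set_lebesgue_integral_eq_integral(1))
      have "integral (S \<union> cball 0 x) ?g = integral S ?g + integral (cball 0 x) ?g"
      proof (rule integral_Un[OF iS ig])
        have "S \<inter> cball 0 x = {}" by (auto simp: S_def)
        then show "negligible (S \<inter> cball 0 x)" by simp
      qed (use xy in auto)
      moreover have "S \<union> cball 0 x = cball 0 y" using sub by (auto simp: S_def)
      ultimately show "F y - F x = integral S ?g" by (simp add: F_def)
    qed
    have cxy: "continuous_on {x..y} f" by (rule continuous_on_subset[OF f]) (use xy in auto)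
    obtain p where p: "p \<in> {x..y}" "\<And>z. z \<in> {x..y} \<Longrightarrow> f p \<le> f z" using continuous_attains_inf[OF compact_Icc _ cxy] xy by auto
    obtain P where P: "P \<in> {x..y}" "\<And>z. z \<in> {x..y} \<Longrightarrow> f z \<le> f P" using continuous_attains_sup[OF compact_Icc _ cxy] xy by auto
    have cint: "((\<lambda>_. c) has_integral measure lebesgue S * c) S" for c :: real
    proof -
      have "((\<lambda>_. 1::real) has_integral measure lebesgue S) S"
        unfolding lmeasure_integral[OF mS] by (rule integrable_integral[OF integrable_on_const[OF mS]])
      from has_integral_mult_left[OF this, of c] show ?thesis by simp
    qed
    have lo: "measure lebesgue S * f p \<le> integral S ?g"
      by (rule has_integral_le[OF cint integrable_integral[OF iS]]) (use p(2) in \<open>auto simp: S_def\<close>)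
    have hi: "integral S ?g \<le> measure lebesgue S * f P"
      by (rule has_integral_le[OF integrable_integral[OF iS] cint]) (use P(2) in \<open>auto simp: S_def\<close>)
    \<comment> \<open>Mean of the integrand over the shell, lying between the extreme values of
      \<open>f\<close> on the corresponding interval.\<close>
    define w where "w = (F y - F x) / (4 / 3 * pi * (y ^ 3 - x ^ 3))"
    have "f p \<le> w" "w \<le> f P" using lo hi vpos unfolding FS[symmetric] volS w_def by (auto simp: field_simps)
    moreover have "connected (f ` {x..y})" by (intro connected_continuous_image cxy) auto
    ultimately have "w \<in> f ` {x..y}" using p(1) P(1) connectedD_interval[of "f ` {x..y}" "f p" "f P" w] by blast
    then obtain \<xi> where "\<xi> \<in> {x..y}" "w = f \<xi>" by blast
    moreover have "F y - F x = w * (4 / 3 * pi * (y ^ 3 - x ^ 3))"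
      unfolding w_def using vpos by (metis less_irrefl nonzero_eq_divide_eq)
    ultimately show ?thesis by auto
  qed
  have F0: "F 0 = 0" unfolding F_def by (simp add: integral_negligible)
  have dF: "(F has_real_derivative 4 * pi * (r\<^sup>2 * f r)) (at r)" if r: "0 < r" "r < b" for r
  proof -
    have ex: "\<exists>\<xi>. \<bar>\<xi> - r\<bar> \<le> \<bar>y - r\<bar> \<and> (F y - F r) / (y - r) = f \<xi> * (4 / 3 * pi * (y\<^sup>2 + y * r + r\<^sup>2))"
      if y: "0 < y" "y < b" "y \<noteq> r" for y
    proof -
      have fac: "y ^ 3 - r ^ 3 = (y - r) * (y\<^sup>2 + y * r + r\<^sup>2)" by (simp add: power2_eq_square power3_eq_cube algebra_simps)
      show ?thesis
      proof (cases "y < r")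
        case True
        obtain \<xi> where "y \<le> \<xi>" "\<xi> \<le> r" "F r - F y = f \<xi> * (4 / 3 * pi * (r ^ 3 - y ^ 3))" using shell[of y r] y r True by auto
        moreover from this have "F y - F r = f \<xi> * (4 / 3 * pi * (y ^ 3 - r ^ 3))"
          unfolding right_diff_distrib by linarith
        then have "F y - F r = (y - r) * (f \<xi> * (4 / 3 * pi * (y\<^sup>2 + y * r + r\<^sup>2)))"
          unfolding fac by (simp add: mult_ac)
        ultimately show ?thesis using y by (intro exI[of _ \<xi>]) auto
      next
        case False
        obtain \<xi> where "r \<le> \<xi>" "\<xi> \<le> y" "F y - F r = f \<xi> * (4 / 3 * pi * (y ^ 3 - r ^ 3))" using shell[of r y] y r False by auto
        moreover from this have "F y - F r = (y - r) * (f \<xi> * (4 / 3 * pi * (y\<^sup>2 + y * r + r\<^sup>2)))"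
          unfolding fac by (simp add: mult_ac)
        ultimately show ?thesis using y by (intro exI[of _ \<xi>]) auto
      qed
    qed
    define \<xi> where "\<xi> y = (SOME \<xi>. \<bar>\<xi> - r\<bar> \<le> \<bar>y - r\<bar> \<and> (F y - F r) / (y - r) = f \<xi> * (4 / 3 * pi * (y\<^sup>2 + y * r + r\<^sup>2)))" for y
    have xi: "\<bar>\<xi> y - r\<bar> \<le> \<bar>y - r\<bar>" "(F y - F r) / (y - r) = f (\<xi> y) * (4 / 3 * pi * (y\<^sup>2 + y * r + r\<^sup>2))"
      if "0 < y" "y < b" "y \<noteq> r" for y
      using someI_ex[OF ex[OF that], folded \<xi>_def] by blast+
    have ev: "\<forall>\<^sub>F y in at r. 0 < y \<and> y < b \<and> y \<noteq> r"
      using eventually_at_in_open[of "{0<..<b}" r] r by (auto elim: eventually_mono)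
    have xl: "(\<xi> \<longlongrightarrow> r) (at r)"
    proof (rule LIM_zero_cancel, rule Lim_null_comparison)
      show "\<forall>\<^sub>F y in at r. norm (\<xi> y - r) \<le> \<bar>y - r\<bar>" using ev by eventually_elim (use xi in auto)
      show "((\<lambda>y. \<bar>y - r\<bar>) \<longlongrightarrow> 0) (at r)" by (rule tendsto_eq_intros | simp)+
    qed
    have "isCont f r" using f r continuous_on_interior[of "{0..b}" f r] by simp
    then have "((\<lambda>y. f (\<xi> y)) \<longlongrightarrow> f r) (at r)" using xl by (rule isCont_tendsto_compose)
    then have "((\<lambda>y. f (\<xi> y) * (4 / 3 * pi * (y\<^sup>2 + y * r + r\<^sup>2))) \<longlongrightarrow> f r * (4 / 3 * pi * (r\<^sup>2 + r * r + r\<^sup>2))) (at r)"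
      by (intro tendsto_intros)
    then have "((\<lambda>y. (F y - F r) / (y - r)) \<longlongrightarrow> f r * (4 / 3 * pi * (r\<^sup>2 + r * r + r\<^sup>2))) (at r)"
      by (rule Lim_transform_eventually) (use ev in \<open>eventually_elim, auto simp: xi\<close>)
    then show ?thesis unfolding has_field_derivative_iff by (simp add: power2_eq_square mult_ac)
  qed
  obtain B where "\<forall>y\<in>f ` {0..b}. norm y \<le> B"
    using compact_imp_bounded[OF compact_continuous_image[OF f compact_Icc]] unfolding bounded_iff by blast
  then have B: "\<And>r. r \<in> {0..b} \<Longrightarrow> \<bar>f r\<bar> \<le> B" by simp
  \<comment> \<open>Continuity up to the end points, where the derivative has not been computed,
    comes from a Lipschitz bound based on the shell volume.\<close>
  have cF: "continuous_on {0..b} F"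
  proof (rule continuous_on_subset[of "{0..b}"])
    have B0: "B \<ge> 0" using B[of 0] b by simp
    have lip: "\<bar>F y - F x\<bar> \<le> B * (4 * pi * b\<^sup>2) * (y - x)" if xy: "0 \<le> x" "x < y" "y \<le> b" for x y
    proof -
      obtain \<xi> where x: "x \<le> \<xi>" "\<xi> \<le> y" "F y - F x = f \<xi> * (4 / 3 * pi * (y ^ 3 - x ^ 3))" using shell[OF xy] by auto
      have fac: "y ^ 3 - x ^ 3 = (y - x) * (y\<^sup>2 + y * x + x\<^sup>2)" by (simp add: power2_eq_square power3_eq_cube algebra_simps)
      have "y\<^sup>2 + y * x + x\<^sup>2 \<le> b\<^sup>2 + b * b + b\<^sup>2" using xy by (intro add_mono mult_mono power_mono) auto
      then have le: "y\<^sup>2 + y * x + x\<^sup>2 \<le> 3 * b\<^sup>2" by (simp add: power2_eq_square)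
      have nn: "y\<^sup>2 + y * x + x\<^sup>2 \<ge> 0" using xy by simp
      have "\<bar>F y - F x\<bar> = \<bar>f \<xi>\<bar> * (4 / 3 * pi * ((y\<^sup>2 + y * x + x\<^sup>2) * (y - x)))"
        unfolding x(3) fac using xy nn by (simp add: abs_mult mult_ac)
      also have "\<dots> \<le> B * (4 / 3 * pi * (3 * b\<^sup>2 * (y - x)))"
        using B[of \<xi>] x xy le nn B0 by (intro mult_mono mult_left_mono mult_right_mono mult_nonneg_nonneg) auto
      finally show ?thesis by (simp add: mult_ac)
    qed
    have lip2: "\<bar>F y - F x\<bar> \<le> B * (4 * pi * b\<^sup>2) * \<bar>y - x\<bar>" if "x \<in> {0..b}" "y \<in> {0..b}" for x y
      using lip[of x y] lip[of y x] that by (cases x y rule: linorder_cases) (auto simp: abs_minus_commute)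
    have "(B * (4 * pi * b\<^sup>2))-lipschitz_on {0..b} F"
      using lip2 B0 by (intro lipschitz_onI) (auto simp: dist_real_def abs_minus_commute)
    then show "continuous_on {0..b} F" by (rule lipschitz_on_continuous_on)
  qed simp
  have "((\<lambda>r. 4 * pi * (r\<^sup>2 * f r)) has_integral F b - F 0) {0..b}"
    by (rule fundamental_theorem_of_calculus_interior)
      (use b cF dF in \<open>auto simp: has_real_derivative_iff_has_vector_derivative\<close>)
  from integral_unique[OF this] have "integral {0..b} (\<lambda>r. 4 * pi * (r\<^sup>2 * f r)) = F b" unfolding F0 by (simp only: diff_zero)
  moreover have "integral {0..b} (\<lambda>r. 4 * pi * (r\<^sup>2 * f r)) = 4 * pi * integral {0..b} (\<lambda>r. r\<^sup>2 * f r)" by simp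
  moreover have "F b = integral (ball 0 b) ?g" unfolding F_def
  proof (rule integral_spike_set)
    show "negligible {x \<in> cball 0 b - ball 0 b. ?g x \<noteq> 0}"
      by (rule negligible_subset[OF negligible_sphere[of 0 b]]) auto
    show "negligible {x \<in> ball 0 b - cball 0 b. ?g x \<noteq> 0}"
      by (rule negligible_subset[OF negligible_sphere[of 0 b]]) auto
  qed
  ultimately show ?thesis by simp
qed

section \<open>Passage to logarithmic density and scaled radius\<close>

lemma continuous_on_half_line:
  fixes F :: "real \<times> real \<Rightarrow> real"
  assumes "\<And>T. T > 0 \<Longrightarrow> continuous_on ({0..1} \<times> {0..T}) F"
  shows "continuous_on ({0..1} \<times> {0..}) F"
  unfolding continuous_on_iff
proof (intro ballI allI impI)
  fix z :: "real \<times> real" and e :: real assume z: "z \<in> {0..1} \<times> {0..}" and e: "e > 0"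
  obtain s t where st: "z = (s, t)" by (cases z)
  have "continuous_on ({0..1} \<times> {0..t + 1}) F" by (rule assms) (use z st in auto)
  moreover have "z \<in> {0..1} \<times> {0..t + 1}" using z st by auto
  ultimately obtain d where d: "d > 0" "\<And>y. y \<in> {0..1} \<times> {0..t + 1} \<Longrightarrow> dist y z < d \<Longrightarrow> dist (F y) (F z) < e"
    using e unfolding continuous_on_iff by metis
  show "\<exists>d>0. \<forall>y\<in>{0..1} \<times> {0..}. dist y z < d \<longrightarrow> dist (F y) (F z) < e"
  proof (intro exI[of _ "min d 1"] conjI ballI impI)
    fix y assume y: "y \<in> {0..1} \<times> {0..}" "dist y z < min d 1"
    have "dist (snd y) (snd z) \<le> dist y z" by (rule dist_snd_le)
    then have "\<bar>snd y - t\<bar> < 1" using y(2) st by (simp add: dist_real_def)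
    then have "snd y \<le> t + 1" by linarith
    then have "y \<in> {0..1} \<times> {0..t + 1}" using y by (cases y) auto
    then show "dist (F y) (F z) < e" using d(2) y by simp
  qed (use d in simp)
qed

text \<open>The value at \<open>s = 1\<close> is a limit along one explicit sequence and thus does
  not depend on the time horizon; on each horizon it agrees with the extension by uniform
  continuity, and the pieces fit together.\<close>

lemma continuous_extension_half_open:
  fixes f :: "real \<Rightarrow> real \<Rightarrow> real"
  assumes uc: "\<And>T. T > 0 \<Longrightarrow> uniformly_continuous_on ({0..<1} \<times> {0..T}) (\<lambda>(s, t). f s t)"
  shows "\<exists>g. continuous_on ({0..1} \<times> {0..}) (\<lambda>(s, t). g s t) \<and> (\<forall>s t. 0 \<le> s \<and> s < 1 \<and> t \<ge> 0 \<longrightarrow> g s t = f s t)"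
proof -
  define g where "g s t = (if s < 1 then f s t else lim (\<lambda>n. f (1 - inverse (real (Suc n))) t))" for s t
  have "continuous_on ({0..1} \<times> {0..T}) (\<lambda>(s, t). g s t)" if T: "T > 0" for T
  proof -
    have cl: "closure ({0..<1::real} \<times> {0..T}) = {0..1} \<times> {0..T}" by (simp add: closure_Times)
    obtain G where G: "uniformly_continuous_on ({0..1} \<times> {0..T}) G" "\<And>z. z \<in> {0..<1} \<times> {0..T} \<Longrightarrow> (\<lambda>(s, t). f s t) z = G z"
      using uniformly_continuous_on_extension_on_closure[OF uc[OF T]] unfolding cl by metis
    have cG: "continuous_on ({0..1} \<times> {0..T}) G" by (rule uniformly_continuous_imp_continuous[OF G(1)])
    have "(\<lambda>(s, t). g s t) z = G z" if z: "z \<in> {0..1} \<times> {0..T}" for z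
    proof -
      obtain s t where st: "z = (s, t)" "0 \<le> s" "s \<le> 1" "0 \<le> t" "t \<le> T" using z by auto
      show ?thesis
      proof (cases "s < 1")
        case True then show ?thesis using G(2)[of z] st by (simp add: g_def)
      next
        case False
        then have s: "s = 1" using st by simp
        have "(\<lambda>n. (1 - inverse (real (Suc n)), t)) \<longlonglongrightarrow> (1 - 0, t)"
          by (intro tendsto_intros LIMSEQ_inverse_real_of_nat)
        then have l: "(\<lambda>n. (1 - inverse (real (Suc n)), t)) \<longlonglongrightarrow> (1, t)" by simp
        have inn: "(1 - inverse (real (Suc n)), t) \<in> {0..1} \<times> {0..T}" for n using st by (auto simp: field_simps)
        have "(\<lambda>n. G (1 - inverse (real (Suc n)), t)) \<longlonglongrightarrow> G (1, t)"
          by (rule continuous_on_tendsto_compose[OF cG l]) (use st inn in auto)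
        moreover have "G (1 - inverse (real (Suc n)), t) = f (1 - inverse (real (Suc n))) t" for n
          using G(2)[of "(1 - inverse (real (Suc n)), t)"] st by (simp add: field_simps)
        ultimately have "lim (\<lambda>n. f (1 - inverse (real (Suc n))) t) = G (1, t)" by (simp add: limI)
        then show ?thesis using st s by (simp add: g_def)
      qed
    qed
    then show ?thesis using cG continuous_on_cong by metis
  qed
  then have "continuous_on ({0..1} \<times> {0..}) (\<lambda>(s, t). g s t)" by (rule continuous_on_half_line)
  then show ?thesis by (intro exI[of _ g]) (auto simp: g_def)
qed

lemma parabolic_holder_ray:
  fixes F :: "'a::real_normed_vector \<Rightarrow> real \<Rightarrow> real"
  assumes h: "parabolic_holder_on \<alpha> (ball 0 1 \<times> {0..T}) (\<lambda>(x, t). F x t)" and e: "norm e = 1" and al: "\<alpha> > 0"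
  shows "uniformly_continuous_on ({0..<1} \<times> {0..T}) (\<lambda>(s, t). F (s *\<^sub>R e) t)"
  unfolding uniformly_continuous_on_def
proof (intro allI impI)
  fix \<epsilon> :: real assume eps: "\<epsilon> > 0"
  obtain C0 where C0: "\<And>z w. z \<in> ball 0 1 \<times> {0..T} \<Longrightarrow> w \<in> ball 0 1 \<times> {0..T} \<Longrightarrow>
      \<bar>F (fst z) (snd z) - F (fst w) (snd w)\<bar> \<le> C0 * (dist (fst z) (fst w) powr (2 * \<alpha>) + \<bar>snd z - snd w\<bar> powr \<alpha>)"
    using h unfolding parabolic_holder_on_def split_beta fst_conv snd_conv by blast
  \<comment> \<open>\<open>C0\<close> may fail to be positive, so it is enlarged before serving as a
    divisor.\<close>
  define C where "C = max C0 1"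
  have C: "C > 0" "C0 \<le> C" by (auto simp: C_def)
  define k where "k = \<epsilon> / (4 * C)"
  have k: "k > 0" using eps C by (simp add: k_def)
  define d where "d = min (k powr (1 / (2 * \<alpha>))) (k powr (1 / \<alpha>))"
  have d: "d > 0" "d \<le> k powr (1 / (2 * \<alpha>))" "d \<le> k powr (1 / \<alpha>)" using k by (auto simp: d_def)
  have p1: "x powr (2 * \<alpha>) \<le> k" if "0 \<le> x" "x \<le> d" for x
  proof -
    have "x powr (2 * \<alpha>) \<le> (k powr (1 / (2 * \<alpha>))) powr (2 * \<alpha>)" using that d al by (intro powr_mono2) auto
    also have "\<dots> = k" using k al by (simp add: powr_powr)
    finally show ?thesis .
  qed
  have p2: "x powr \<alpha> \<le> k" if "0 \<le> x" "x \<le> d" for x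
  proof -
    have "x powr \<alpha> \<le> (k powr (1 / \<alpha>)) powr \<alpha>" using that d al by (intro powr_mono2) auto
    also have "\<dots> = k" using k al by (simp add: powr_powr)
    finally show ?thesis .
  qed
  show "\<exists>d>0. \<forall>x\<in>{0..<1} \<times> {0..T}. \<forall>x'\<in>{0..<1} \<times> {0..T}. dist x' x < d \<longrightarrow>
      dist (case x' of (s, t) \<Rightarrow> F (s *\<^sub>R e) t) (case x of (s, t) \<Rightarrow> F (s *\<^sub>R e) t) < \<epsilon>"
  proof (intro exI[of _ d] conjI d(1) ballI impI)
    fix z z' :: "real \<times> real" assume z: "z \<in> {0..<1} \<times> {0..T}" "z' \<in> {0..<1} \<times> {0..T}" "dist z' z < d"
    obtain s t where st: "z = (s, t)" "0 \<le> s" "s < 1" "t \<in> {0..T}" using z by auto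
    obtain s' t' where st': "z' = (s', t')" "0 \<le> s'" "s' < 1" "t' \<in> {0..T}" using z by auto
    have ds: "\<bar>s' - s\<bar> \<le> d" "\<bar>t' - t\<bar> \<le> d"
      using dist_fst_le[of z' z] dist_snd_le[of z' z] z(3) st st' by (auto simp: dist_real_def)
    have "dist (s' *\<^sub>R e) (s *\<^sub>R e) = \<bar>s' - s\<bar>" using e by (simp add: dist_norm flip: scaleR_diff_left)
    moreover have "(s' *\<^sub>R e, t') \<in> ball 0 1 \<times> {0..T}" "(s *\<^sub>R e, t) \<in> ball 0 1 \<times> {0..T}" using st st' e by auto
    ultimately have "\<bar>F (s' *\<^sub>R e) t' - F (s *\<^sub>R e) t\<bar> \<le> C0 * (\<bar>s' - s\<bar> powr (2 * \<alpha>) + \<bar>t' - t\<bar> powr \<alpha>)"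
      using C0[of "(s' *\<^sub>R e, t')" "(s *\<^sub>R e, t)"] by (simp add: e)
    also have "\<dots> \<le> C * (\<bar>s' - s\<bar> powr (2 * \<alpha>) + \<bar>t' - t\<bar> powr \<alpha>)" using C by (intro mult_right_mono) auto
    also have "\<dots> \<le> C * (k + k)" using C p1[of "\<bar>s' - s\<bar>"] p2[of "\<bar>t' - t\<bar>"] ds by (intro mult_left_mono add_mono) auto
    also have "\<dots> < \<epsilon>" using C eps by (simp add: k_def)
    finally show "dist (case z' of (s, t) \<Rightarrow> F (s *\<^sub>R e) t) (case z of (s, t) \<Rightarrow> F (s *\<^sub>R e) t) < \<epsilon>"
      by (simp add: st st' dist_real_def)
  qed
qed

lemma line_deriv:
  fixes u :: "'a::euclidean_space \<Rightarrow> real"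
  assumes "u differentiable (at (s *\<^sub>R e))"
  shows "((\<lambda>s. u (s *\<^sub>R e)) has_real_derivative partial_deriv e u (s *\<^sub>R e)) (at s)"
proof -
  have "(u has_derivative frechet_derivative u (at (s *\<^sub>R e))) (at (s *\<^sub>R e))"
    using assms by (simp add: frechet_derivative_works)
  moreover have "((\<lambda>s. s *\<^sub>R e) has_derivative (\<lambda>h. h *\<^sub>R e)) (at s)" by (auto intro!: derivative_eq_intros)
  ultimately have "((\<lambda>s. u (s *\<^sub>R e)) has_derivative (\<lambda>h. frechet_derivative u (at (s *\<^sub>R e)) (h *\<^sub>R e))) (at s)"
    using diff_chain_at[of "\<lambda>s. s *\<^sub>R e" "\<lambda>h. h *\<^sub>R e" s u] by (simp add: o_def)
  moreover have "frechet_derivative u (at (s *\<^sub>R e)) (h *\<^sub>R e) = h * partial_deriv e u (s *\<^sub>R e)" for h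
    using linear_frechet_derivative[OF assms] by (simp add: linear_scale partial_deriv_def)
  ultimately show ?thesis by (simp add: has_field_derivative_def mult_commute_abs)
qed

text \<open>The function is the integral of its continuous derivative, a representation that is
  differentiable also at the end point.\<close>

lemma endpoint_derivative:
  fixes f f' :: "real \<Rightarrow> real"
  assumes "continuous_on {0..1} f" "continuous_on {0..1} f'" "\<And>s. 0 < s \<Longrightarrow> s < 1 \<Longrightarrow> (f has_real_derivative f' s) (at s)"
  shows "(f has_real_derivative f' 1) (at 1 within {0..1})"
proof -
  have eq: "f s = f 0 + integral {0..s} f'" if "s \<in> {0..1}" for s
  proof -
    have "(f' has_integral f s - f 0) {0..s}"
      by (rule fundamental_theorem_of_calculus_interior)
        (use that assms in \<open>auto simp: has_real_derivative_iff_has_vector_derivative intro: continuous_on_subset\<close>)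
    then show ?thesis by (simp add: integral_unique)
  qed
  have "((\<lambda>s. f 0 + integral {0..s} f') has_real_derivative 0 + f' 1) (at 1 within {0..1})"
    by (intro DERIV_add DERIV_const integral_has_real_derivative[OF assms(2)]) simp
  then have "((\<lambda>s. f 0 + integral {0..s} f') has_real_derivative f' 1) (at 1 within {0..1})" by simp
  then show ?thesis
  proof (rule has_field_derivative_transform_within[OF _ zero_less_one])
    show "f 0 + integral {0..s} f' = f s" if "s \<in> {0..1}" for s using eq[OF that] by (rule sym)
  qed simp
qed

text \<open>The wall is outside the open set on which time derivatives are given. The identity
  \<open>F s t = F s 0 + integral {0..t} (Ft s)\<close> passes to the limit \<open>s = 1\<close> and
  is differentiated there.\<close>

lemma limit_time_derivative:
  fixes F Ft :: "real \<Rightarrow> real \<Rightarrow> real"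
  assumes cF: "continuous_on ({0..1} \<times> {0..}) (\<lambda>(s, t). F s t)" and cFt: "continuous_on ({0..1} \<times> {0..}) (\<lambda>(s, t). Ft s t)"
    and d: "\<And>s t. 0 \<le> s \<Longrightarrow> s < 1 \<Longrightarrow> t \<ge> 0 \<Longrightarrow> (F s has_real_derivative Ft s t) (at t within {0..})" and t: "t \<ge> 0"
  shows "(F 1 has_real_derivative Ft 1 t) (at t within {0..})"
proof -
  have cFs: "continuous_on {0..1} (\<lambda>s. F s t)" if "t \<ge> 0" for t
  proof -
    have "continuous_on {0..1} (\<lambda>s. (\<lambda>(s, t). F s t) (s, t))"
      by (rule continuous_on_compose2[OF cF]) (use that in \<open>auto intro!: continuous_intros\<close>)
    then show ?thesis by simp
  qed
  have cFtt: "continuous_on {0..T} (Ft 1)" for T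
  proof -
    have "continuous_on {0..T} (\<lambda>t. (\<lambda>(s, t). Ft s t) (1, t))"
      by (rule continuous_on_compose2[OF cFt]) (auto intro!: continuous_intros)
    then show ?thesis by simp
  qed
  have eq1: "F 1 t = F 1 0 + integral {0..t} (Ft 1)" if t: "t \<ge> 0" for t
  proof -
    have sw: "continuous_on ({0..1} \<times> cbox 0 t) (\<lambda>(s, \<tau>). Ft s \<tau>)"
      by (rule continuous_on_subset[OF cFt]) auto
    have ci: "continuous_on {0..1} (\<lambda>s. integral {0..t} (Ft s))"
      using integral_continuous_on_param[OF sw] by simp
    have "F s t - F s 0 - integral {0..t} (Ft s) = 0" if "s \<in> {0..<1}" for s
    proof -
      have "(Ft s has_integral F s t - F s 0) {0..t}"
      proof (rule fundamental_theorem_of_calculus[OF t])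
        fix \<tau> assume "\<tau> \<in> {0..t}"
        then have "(F s has_real_derivative Ft s \<tau>) (at \<tau> within {0..t})" using that by (intro DERIV_subset[OF d]) auto
        then show "(F s has_vector_derivative Ft s \<tau>) (at \<tau> within {0..t})" by (simp add: has_real_derivative_iff_has_vector_derivative)
      qed
      then show ?thesis by (simp add: integral_unique)
    qed
    moreover have "continuous_on (closure {0..<1::real}) (\<lambda>s. F s t - F s 0 - integral {0..t} (Ft s))"
      using cFs[OF t] cFs[of 0] ci by (auto intro!: continuous_intros)
    ultimately have "F 1 t - F 1 0 - integral {0..t} (Ft 1) = 0"
      using continuous_constant_on_closure[of "{0..<1::real}" "\<lambda>s. F s t - F s 0 - integral {0..t} (Ft s)" 0 1] by simp
    then show ?thesis by simp
  qed
  have "((\<lambda>t. F 1 0 + integral {0..t} (Ft 1)) has_real_derivative 0 + Ft 1 t) (at t within {0..t + 1})"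
    by (intro DERIV_add DERIV_const integral_has_real_derivative[OF cFtt]) (use t in simp)
  moreover have "at t within {0..t + 1} = at t within {0..}"
    by (rule at_within_nhd[of t "{..<t + 1}"]) auto
  ultimately have "((\<lambda>t. F 1 0 + integral {0..t} (Ft 1)) has_real_derivative Ft 1 t) (at t within {0..})" by simp
  then show ?thesis
  proof (rule has_field_derivative_transform_within[OF _ zero_less_one])
    show "t \<in> {0..}" using t by simp
    show "F 1 0 + integral {0..x} (Ft 1) = F 1 x" if "x \<in> {0..}" for x using eq1[of x] that by (metis atLeast_iff)
  qed
qed

lemma time_deriv_eqI: "t \<ge> 0 \<Longrightarrow> (f has_real_derivative D) (at t within {0..}) \<Longrightarrow> time_deriv f t = D"
proof -
  assume t: "t \<ge> 0" and d: "(f has_real_derivative D) (at t within {0..})"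
  have "at_right t \<le> at t within {0..}" by (rule at_le) (use t in auto)
  then have "at t within {0..} \<noteq> bot" using trivial_limit_at_right_real[of t] by (metis bot.extremum_uniqueI)
  then show ?thesis unfolding time_deriv_def
    by (rule vector_derivative_within) (use d in \<open>simp add: has_real_derivative_iff_has_vector_derivative\<close>)
qed

lemma time_deriv_works: "f differentiable_on {0..} \<Longrightarrow> t \<ge> 0 \<Longrightarrow> (f has_real_derivative time_deriv f t) (at t within {0..})"
  unfolding time_deriv_def differentiable_on_def has_real_derivative_iff_has_vector_derivative
  by (simp add: vector_derivative_works)

text \<open>Serves to carry the equation from the open region to the centre, the wall and the
  initial time.\<close>

lemma continuous_on_quadrant_eq:
  fixes f g :: "real \<times> real \<Rightarrow> real"
  assumes "continuous_on ({0..1} \<times> {0..}) f" "continuous_on ({0..1} \<times> {0..}) g"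
    and eq: "\<And>s t. 0 < s \<Longrightarrow> s < 1 \<Longrightarrow> t > 0 \<Longrightarrow> f (s, t) = g (s, t)" and st: "0 \<le> s" "s \<le> 1" "t \<ge> 0"
  shows "f (s, t) = g (s, t)"
proof -
  have cl: "closure ({0<..<1} \<times> {0<..}) = ({0..1} \<times> {0..} :: (real \<times> real) set)" by (simp add: closure_Times)
  have "(\<lambda>z. f z - g z) (s, t) = 0"
    by (rule continuous_constant_on_closure[of "{0<..<1} \<times> {0<..}"])
      (unfold cl, use assms in \<open>auto intro!: continuous_intros\<close>)
  then show ?thesis by simp
qed

lemma continuous_on_Ici_eq:
  fixes f g :: "real \<Rightarrow> real"
  assumes "continuous_on {0..} f" "continuous_on {0..} g" "\<And>t. t > 0 \<Longrightarrow> f t = g t" "t \<ge> 0"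
  shows "f t = g t"
proof -
  have "(\<lambda>z. f z - g z) t = 0"
    by (rule continuous_constant_on_closure[of "{0<..}"]) (use assms in \<open>auto intro!: continuous_intros\<close>)
  then show ?thesis by simp
qed

lemma radial_deriv_eqI:
  assumes "0 < r" "r < b" "(f has_real_derivative D) (at r)"
  shows "radial_deriv b f r = D"
proof -
  have "at r within {0..b} = at r" by (rule at_within_interior) (use assms in auto)
  then show ?thesis unfolding radial_deriv_def
    using assms(3) by (simp add: has_real_derivative_iff_has_vector_derivative vector_derivative_at)
qed

lemma radial_deriv_endpoint:
  assumes "0 < b" "(f has_real_derivative D) (at b within {0..b})"
  shows "radial_deriv b f b = D"
  unfolding radial_deriv_def
  by (rule vector_derivative_within_cbox[of 0 b, unfolded cbox_interval])
    (use assms in \<open>auto simp: has_real_derivative_iff_has_vector_derivative\<close>)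

section \<open>Solutions on the fixed unit ball\<close>

locale bubble_solution =
  fixes P :: bubble_params and \<alpha> :: real and \<rho>0 :: "real \<Rightarrow> real" and R0 V0 :: real
    and \<rho> :: "real \<Rightarrow> real \<Rightarrow> real" and R :: "real \<Rightarrow> real"
  assumes adm: "admissible_params P" and al: "0 < \<alpha>"
    and sol: "RS_global_solution P \<alpha> (\<lambda>_. p_inf_star P) \<rho>0 R0 V0 \<rho> R"
begin

definition "u = (\<lambda>(x::real^3) t. \<rho> (R t * norm x) t)"
text \<open>A fixed coordinate direction: along its ray the three-dimensional derivatives become
  derivatives of the profile \<open>U\<close> in one variable.\<close>

definition "e1 = (axis 1 1 :: real^3)"
definition "U s t = \<rho> (R t * s) t"
definition "g1 s t = partial_deriv e1 (\<lambda>x. u x t) (s *\<^sub>R e1)"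
definition "g2 s t = partial_deriv e1 (partial_deriv e1 (\<lambda>x. u x t)) (s *\<^sub>R e1)"

lemma e1: "e1 \<in> Basis" "norm e1 = 1"
  by (auto simp: e1_def axis_in_Basis_iff)

lemma Rpos: "t \<ge> 0 \<Longrightarrow> R t > 0"
  and rho_pos: "t \<ge> 0 \<Longrightarrow> 0 \<le> r \<Longrightarrow> r \<le> R t \<Longrightarrow> \<rho> r t > 0"
  and pc: "parabolic_C2_holder \<alpha> (ball 0 1) u"
  and c3: "C3_holder_time \<alpha> R"
  and init: "\<And>r. r \<in> {0..R0} \<Longrightarrow> \<rho> r 0 = \<rho>0 r" "R 0 = R0" "time_deriv R 0 = V0"
  using sol unfolding RS_global_solution_def u_def by auto

lemma Upos: "t \<ge> 0 \<Longrightarrow> 0 \<le> s \<Longrightarrow> s \<le> 1 \<Longrightarrow> U s t > 0"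
  unfolding U_def using Rpos[of t] by (intro rho_pos) (auto intro: mult_left_le)

lemma u_diff: "t \<ge> 0 \<Longrightarrow> norm x < 1 \<Longrightarrow> (\<lambda>x. u x t) differentiable (at x)"
  and u_diff2: "t \<ge> 0 \<Longrightarrow> norm x < 1 \<Longrightarrow> i \<in> Basis \<Longrightarrow> partial_deriv i (\<lambda>x. u x t) differentiable (at x)"
proof -
  have "open (ball (0::real^3) 1)" by simp
  then show "t \<ge> 0 \<Longrightarrow> norm x < 1 \<Longrightarrow> (\<lambda>x. u x t) differentiable (at x)"
    "t \<ge> 0 \<Longrightarrow> norm x < 1 \<Longrightarrow> i \<in> Basis \<Longrightarrow> partial_deriv i (\<lambda>x. u x t) differentiable (at x)"
    using pc unfolding parabolic_C2_holder_def by (auto simp: differentiable_on_eq_differentiable_at)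
qed

lemma u_ray: "0 \<le> s \<Longrightarrow> u (s *\<^sub>R e1) t = U s t" using e1 by (simp add: u_def U_def)

lemma contU: "continuous_on ({0..1} \<times> {0..}) (\<lambda>(s, t). U s t)"
proof -
  have c: "continuous_on (cball 0 1 \<times> {0..}) (\<lambda>(x, t). u x t)"
    using pc unfolding parabolic_C2_holder_def by simp
  have "continuous_on ({0..1} \<times> {0..}) (\<lambda>z. (\<lambda>(x, t). u x t) (fst z *\<^sub>R e1, snd z))"
  proof (rule continuous_on_compose2[OF c])
    show "continuous_on ({0..1} \<times> {0..}) (\<lambda>z :: real \<times> real. (fst z *\<^sub>R e1, snd z))" by (intro continuous_intros)
    show "(\<lambda>z. (fst z *\<^sub>R e1, snd z)) ` ({0..1} \<times> {0..}) \<subseteq> cball 0 1 \<times> {0..}" using e1(2) by auto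
  qed
  then show ?thesis
    by (rule continuous_on_eq) (auto simp: u_ray)
qed

lemma g1_deriv: "t \<ge> 0 \<Longrightarrow> \<bar>s\<bar> < 1 \<Longrightarrow> ((\<lambda>s. u (s *\<^sub>R e1) t) has_real_derivative g1 s t) (at s)"
  unfolding g1_def using line_deriv[OF u_diff, of t s e1] e1 by simp

lemma g2_deriv: "t \<ge> 0 \<Longrightarrow> \<bar>s\<bar> < 1 \<Longrightarrow> ((\<lambda>s. g1 s t) has_real_derivative g2 s t) (at s)"
  unfolding g1_def g2_def using line_deriv[OF u_diff2, of t s e1 e1] e1 by simp

text \<open>Along every line through the origin \<open>u\<close> is even, so its derivative there
  equals its own negative.\<close>

lemma partial_deriv_0: assumes "t \<ge> 0" shows "partial_deriv e (\<lambda>x. u x t) 0 = 0"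
proof -
  let ?D = "partial_deriv e (\<lambda>x. u x t) 0"
  have d: "((\<lambda>s. u (s *\<^sub>R e) t) has_real_derivative ?D) (at 0)"
    using line_deriv[OF u_diff, of t 0 e] assms by simp
  have "((\<lambda>s. (\<lambda>s. u (s *\<^sub>R e) t) (- s)) has_real_derivative - ?D) (at 0)"
    using d DERIV_mirror[of "\<lambda>s. u (s *\<^sub>R e) t" ?D 0] by (metis minus_zero)
  moreover have "(\<lambda>s. (\<lambda>s. u (s *\<^sub>R e) t) (- s)) = (\<lambda>s. u (s *\<^sub>R e) t)" by (simp add: u_def)
  ultimately have "((\<lambda>s. u (s *\<^sub>R e) t) has_real_derivative - ?D) (at 0)" by metis
  from DERIV_unique[OF d this] show ?thesis by simp
qed

lemma ext_ex:
  "\<exists>g. continuous_on ({0..1} \<times> {0..}) (\<lambda>(s, t). g s t) \<and> (\<forall>s t. 0 \<le> s \<and> s < 1 \<and> t \<ge> 0 \<longrightarrow> g s t = g2 s t)"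
  "\<exists>g. continuous_on ({0..1} \<times> {0..}) (\<lambda>(s, t). g s t) \<and> (\<forall>s t. 0 \<le> s \<and> s < 1 \<and> t \<ge> 0 \<longrightarrow> g s t = time_deriv (u (s *\<^sub>R e1)) t)"
proof -
  have h: "parabolic_holder_on \<alpha> (ball 0 1 \<times> {0..T}) (\<lambda>(x, t). time_deriv (u x) t)"
    "parabolic_holder_on \<alpha> (ball 0 1 \<times> {0..T}) (\<lambda>(x, t). partial_deriv e1 (partial_deriv e1 (\<lambda>x. u x t)) x)"
    if "T > 0" for T using pc e1 that unfolding parabolic_C2_holder_def by auto
  show "\<exists>g. continuous_on ({0..1} \<times> {0..}) (\<lambda>(s, t). g s t) \<and> (\<forall>s t. 0 \<le> s \<and> s < 1 \<and> t \<ge> 0 \<longrightarrow> g s t = g2 s t)"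
    unfolding g2_def by (rule continuous_extension_half_open, rule parabolic_holder_ray[OF h(2) e1(2) al])
  show "\<exists>g. continuous_on ({0..1} \<times> {0..}) (\<lambda>(s, t). g s t) \<and> (\<forall>s t. 0 \<le> s \<and> s < 1 \<and> t \<ge> 0 \<longrightarrow> g s t = time_deriv (u (s *\<^sub>R e1)) t)"
    by (rule continuous_extension_half_open, rule parabolic_holder_ray[OF h(1) e1(2) al])
qed

text \<open>The solution class gives the second derivative and the time derivative only in the open
  ball; \<open>Uss\<close> and \<open>Ut\<close> are their continuous extensions, along the ray, to
  the wall.\<close>

definition "Uss = (SOME g. continuous_on ({0..1} \<times> {0..}) (\<lambda>(s, t). g s t) \<and> (\<forall>s t. 0 \<le> s \<and> s < 1 \<and> t \<ge> 0 \<longrightarrow> g s t = g2 s t))"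
definition "Ut = (SOME g. continuous_on ({0..1} \<times> {0..}) (\<lambda>(s, t). g s t) \<and> (\<forall>s t. 0 \<le> s \<and> s < 1 \<and> t \<ge> 0 \<longrightarrow> g s t = time_deriv (u (s *\<^sub>R e1)) t))"

lemma Uss: "continuous_on ({0..1} \<times> {0..}) (\<lambda>(s, t). Uss s t)" "0 \<le> s \<Longrightarrow> s < 1 \<Longrightarrow> t \<ge> 0 \<Longrightarrow> Uss s t = g2 s t"
  using someI_ex[OF ext_ex(1)] unfolding Uss_def[symmetric] by auto

lemma Ut: "continuous_on ({0..1} \<times> {0..}) (\<lambda>(s, t). Ut s t)" "0 \<le> s \<Longrightarrow> s < 1 \<Longrightarrow> t \<ge> 0 \<Longrightarrow> Ut s t = time_deriv (u (s *\<^sub>R e1)) t"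
  using someI_ex[OF ext_ex(2)] unfolding Ut_def[symmetric] by auto

text \<open>\<open>H = U\<^sub>s / s\<close>, extended continuously to \<open>s = 0\<close>.\<close>

definition "H s t = integral {0..1} (\<lambda>\<tau>. Uss (s * \<tau>) t)"
definition "Us s t = s * H s t"
definition "Ul s t = Uss s t + 2 * H s t"

lemma cont_pair:
  fixes F :: "real \<Rightarrow> real \<Rightarrow> real"
  assumes "continuous_on ({0..1} \<times> {0..}) (\<lambda>(s, t). F s t)" "continuous_on A f" "continuous_on A g"
    "\<And>z. z \<in> A \<Longrightarrow> 0 \<le> f z \<and> f z \<le> 1" "\<And>z. z \<in> A \<Longrightarrow> 0 \<le> g z"
  shows "continuous_on A (\<lambda>z. F (f z) (g z))"
proof -
  have "continuous_on A (\<lambda>z. (\<lambda>(s, t). F s t) (f z, g z))"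
    by (rule continuous_on_compose2[OF assms(1)]) (use assms in \<open>auto intro!: continuous_intros\<close>)
  then show ?thesis by simp
qed

lemma contH: "continuous_on ({0..1} \<times> {0..}) (\<lambda>(s, t). H s t)"
proof -
  have "continuous_on (({0..1} \<times> {0..}) \<times> cbox 0 1) (\<lambda>(z, \<tau>). Uss (fst z * \<tau>) (snd z))"
    unfolding split_beta by (rule cont_pair[OF Uss(1)]) (auto intro!: continuous_intros mult_le_one)
  from integral_continuous_on_param[OF this]
  have "continuous_on ({0..1} \<times> {0..}) (\<lambda>z. integral {0..1} (\<lambda>\<tau>. Uss (fst z * \<tau>) (snd z)))" by simp
  then show ?thesis unfolding H_def split_beta .
qed

lemma contUs: "continuous_on ({0..1} \<times> {0..}) (\<lambda>(s, t). Us s t)"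
  using contH unfolding Us_def split_beta by (intro continuous_intros)

lemma contUl: "continuous_on ({0..1} \<times> {0..}) (\<lambda>(s, t). Ul s t)"
  using contH Uss(1) unfolding Ul_def split_beta by (intro continuous_intros)

lemma g1_Us: assumes "t \<ge> 0" "0 \<le> s" "s < 1" shows "g1 s t = Us s t"
proof -
  have d: "((\<lambda>\<tau>. g1 (s * \<tau>) t) has_real_derivative s * Uss (s * \<tau>) t) (at \<tau>)" if "0 \<le> \<tau>" "\<tau> \<le> 1" for \<tau>
  proof -
    have st: "0 \<le> s * \<tau>" "s * \<tau> < 1" using assms that mult_left_le[of \<tau> s] by auto
    have "((\<lambda>\<tau>. g1 (s * \<tau>) t) has_real_derivative g2 (s * \<tau>) t * s) (at \<tau>)"
      by (rule DERIV_chain2[where f="\<lambda>s. g1 s t", OF g2_deriv]) (use assms st in \<open>auto intro!: derivative_eq_intros\<close>)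
    then show ?thesis using Uss(2)[OF st assms(1)] by (simp add: mult.commute)
  qed
  have "((\<lambda>\<tau>. s * Uss (s * \<tau>) t) has_integral g1 (s * 1) t - g1 (s * 0) t) {0..1}"
  proof (rule fundamental_theorem_of_calculus)
    fix \<tau> :: real assume "\<tau> \<in> {0..1}"
    then show "((\<lambda>\<tau>. g1 (s * \<tau>) t) has_vector_derivative s * Uss (s * \<tau>) t) (at \<tau> within {0..1})"
      using d[of \<tau>] by (simp add: has_real_derivative_iff_has_vector_derivative has_vector_derivative_at_within)
  qed simp
  from integral_unique[OF this] show ?thesis using partial_deriv_0[OF assms(1), of e1] by (simp add: Us_def H_def g1_def)
qed

lemma dU: assumes "t \<ge> 0" "0 < s" "s < 1" shows "((\<lambda>s. U s t) has_real_derivative Us s t) (at s)"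
proof -
  have "((\<lambda>s. u (s *\<^sub>R e1) t) has_real_derivative Us s t) (at s)"
    using g1_deriv[of t s] g1_Us[of t s] assms by simp
  then show ?thesis
    by (rule has_field_derivative_transform_within_open[of _ _ _ "{0<..}"]) (use assms u_ray in auto)
qed

lemma dUs: assumes "t \<ge> 0" "0 < s" "s < 1" shows "((\<lambda>s. Us s t) has_real_derivative (Ul s t - 2 * Us s t / s)) (at s)"
proof -
  have "((\<lambda>s. g1 s t) has_real_derivative Uss s t) (at s)"
    using g2_deriv[of t s] Uss(2)[of s t] assms by simp
  then have "((\<lambda>s. Us s t) has_real_derivative Uss s t) (at s)"
    by (rule has_field_derivative_transform_within_open[of _ _ _ "{0<..<1}"]) (use assms g1_Us in auto)
  moreover have "Uss s t = Ul s t - 2 * Us s t / s" using assms by (simp add: Ul_def Us_def)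
  ultimately show ?thesis by simp
qed

lemma dUt: assumes "t \<ge> 0" "0 \<le> s" "s \<le> 1" shows "(U s has_real_derivative Ut s t) (at t within {0..})"
proof -
  have d: "(U s has_real_derivative Ut s t) (at t within {0..})" if "0 \<le> s" "s < 1" "t \<ge> 0" for s t
  proof -
    have eq: "u (s *\<^sub>R e1) = U s" using u_ray[OF that(1)] by auto
    have "s *\<^sub>R e1 \<in> ball 0 1" using that e1 by simp
    then have "U s differentiable_on {0..}" using pc eq unfolding parabolic_C2_holder_def by metis
    from time_deriv_works[OF this that(3)] show ?thesis using Ut(2)[OF that] eq by simp
  qed
  show ?thesis
  proof (cases "s = 1")
    case True
    show ?thesis unfolding True by (rule limit_time_derivative[OF contU Ut(1) d assms(1)])
  qed (use d assms in auto)
qed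

definition "R1 = time_deriv R"
definition "R2 = (time_deriv ^^ 2) R"
definition "R3 = (time_deriv ^^ 3) R"

lemma dR: assumes "t \<ge> 0"
  shows "(R has_real_derivative R1 t) (at t within {0..})" "(R1 has_real_derivative R2 t) (at t within {0..})"
    "(R2 has_real_derivative R3 t) (at t within {0..})"
proof -
  have d: "(time_deriv ^^ k) R differentiable_on {0..}" if "k < 3" for k
    using c3 that unfolding C3_holder_time_def by blast
  show "(R has_real_derivative R1 t) (at t within {0..})"
    using time_deriv_works[OF d[of 0] assms] by (simp add: R1_def)
  show "(R1 has_real_derivative R2 t) (at t within {0..})"
    using time_deriv_works[OF d[of 1] assms] by (simp add: R1_def R2_def numeral_2_eq_2)
  show "(R2 has_real_derivative R3 t) (at t within {0..})"
    using time_deriv_works[OF d[of 2] assms] by (simp add: R2_def R3_def numeral_3_eq_3 numeral_2_eq_2)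
qed

lemma contR: "continuous_on {0..} R" "continuous_on {0..} R1" "continuous_on {0..} R2"
  by (rule DERIV_continuous_on; use dR in auto)+

definition "L s t = ln (U s t)"
definition "Ls s t = Us s t / U s t"
definition "LL s t = Ul s t / U s t - (Us s t / U s t)\<^sup>2"
definition "Lt s t = Ut s t / U s t"

abbreviation "kap \<equiv> kappa P / (gam P * cv P)"

lemma gam_pos: "gam P > 1" using adm by (simp add: admissible_params_def gam_def)

lemma params: "kap > 0" "Rg P * T_inf P > 0" "Rg P > 0" "T_inf P > 0"
  using adm gam_pos by (auto simp: admissible_params_def)

lemma U_radial: assumes "t \<ge> 0" shows "\<rho> r t = U (r / R t) t"
  unfolding U_def using Rpos[OF assms] by simp

lemma dLs': assumes "t \<ge> 0" "0 < s" "s < 1"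
  shows "((\<lambda>s. L s t) has_real_derivative Ls s t) (at s)" "((\<lambda>s. Ls s t) has_real_derivative (LL s t - 2 * Ls s t / s)) (at s)"
proof -
  have p: "U s t > 0" by (rule Upos) (use assms in auto)
  show "((\<lambda>s. L s t) has_real_derivative Ls s t) (at s)"
    unfolding L_def Ls_def using p by (auto intro!: derivative_eq_intros dU assms)
  have "((\<lambda>s. Us s t / U s t) has_real_derivative ((Ul s t - 2 * Us s t / s) * U s t - Us s t * Us s t) / (U s t * U s t)) (at s)"
    by (rule DERIV_divide[OF dUs[OF assms] dU[OF assms]]) (use p in simp)
  then show "((\<lambda>s. Ls s t) has_real_derivative (LL s t - 2 * Ls s t / s)) (at s)"
    unfolding Ls_def LL_def by (rule DERIV_cong) (use p assms in \<open>simp add: field_simps power2_eq_square\<close>)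
qed

lemma dLt': assumes "t \<ge> 0" "0 \<le> s" "s \<le> 1" shows "(L s has_real_derivative Lt s t) (at t within {0..})"
  unfolding L_def Lt_def using Upos[OF assms] by (auto intro!: derivative_eq_intros dUt assms)

text \<open>Passing from fixed \<open>r\<close> to fixed \<open>s = r / R t\<close> adds the
  transport term \<open>s * Us * R1 / R\<close>. When the wall velocity law is inserted, its
  pressure part cancels the term with \<open>r \<partial>_r \<rho>\<close> of the density equation,
  and its flux part becomes the transport term of the scaled equation.\<close>

lemma pde_interior:
  assumes t: "t > 0" and s: "0 < s" "s < 1"
  shows "Lt s t = kap / (R t)\<^sup>2 * (exp (- L s t) * LL s t - Ls 1 t / exp (L 1 t) * s * Ls s t) + Lt 1 t / gam P"
    and "R1 t = - kap * (Ls 1 t / exp (L 1 t)) / R t - R t * Lt 1 t / (3 * gam P)"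
proof -
  have t0: "t \<ge> 0" using t by simp
  let ?b = "R t" and ?f = "\<lambda>s. \<rho> s t"
  define q where "q = time_deriv (wall_pressure P \<rho> R) t / wall_pressure P \<rho> R t"
  have b: "?b > 0" by (rule Rpos[OF t0])
  define r where "r = s * ?b"
  have r: "0 < r" "r < ?b" "r / ?b = s" using s b by (auto simp: r_def)
  have eqs: "time_deriv (\<lambda>s. \<rho> r s) t = density_rhs P ?b ?f q r" "time_deriv R t = wall_velocity P ?b ?f q"
    using sol t r unfolding RS_global_solution_def q_def by (auto simp: Let_def)
  have U1: "U 1 t > 0" and Us': "U s t > 0" using Upos t0 s by auto
  have wp: "wall_pressure P \<rho> R = (\<lambda>t. Rg P * T_inf P * U 1 t)" by (auto simp: wall_pressure_def U_def)
  have "time_deriv (\<lambda>t. Rg P * T_inf P * U 1 t) t = Rg P * T_inf P * Ut 1 t"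
    by (rule time_deriv_eqI[OF t0]) (auto intro!: DERIV_cmult dUt t0)
  then have q: "q = Lt 1 t" unfolding q_def wp Lt_def using params by simp
  have ff: "?f = (\<lambda>x. U (x / ?b) t)" using U_radial[OF t0] by auto
  have df: "(?f has_real_derivative Us (x / ?b) t / ?b) (at x)" if "0 < x" "x < ?b" for x
  proof -
    have "((\<lambda>x. U (x / ?b) t) has_real_derivative Us (x / ?b) t * (1 / ?b)) (at x)"
      by (rule DERIV_chain2[where f="\<lambda>s. U s t", OF dU]) (use that b t0 in \<open>auto intro!: derivative_eq_intros\<close>)
    then show ?thesis unfolding ff by simp
  qed
  have rd: "radial_deriv ?b ?f r = Us s t / ?b" using radial_deriv_eqI[OF r(1,2) df[OF r(1,2)]] r by simp
  have dl: "((\<lambda>x. ln (?f x)) has_real_derivative Ls (x / ?b) t / ?b) (at x)" if "0 < x" "x < ?b" for x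
  proof -
    have "((\<lambda>x. L (x / ?b) t) has_real_derivative Ls (x / ?b) t * (1 / ?b)) (at x)"
      by (rule DERIV_chain2[where f="\<lambda>s. L s t", OF dLs'(1)]) (use that b t0 in \<open>auto intro!: derivative_eq_intros\<close>)
    then show ?thesis by (simp add: U_radial[OF t0] L_def)
  qed
  have rl: "radial_laplacian ?b (\<lambda>s. ln (?f s)) r = LL s t / ?b\<^sup>2"
  proof -
    have "((\<lambda>x. Ls (x / ?b) t) has_real_derivative (LL (r / ?b) t - 2 * Ls (r / ?b) t / (r / ?b)) * (1 / ?b)) (at r)"
      by (rule DERIV_chain2[where f="\<lambda>s. Ls s t", OF dLs'(2)]) (use r s b t0 in \<open>auto intro!: derivative_eq_intros\<close>)
    then have d0: "((\<lambda>x. Ls (x / ?b) t) has_real_derivative (LL s t - 2 * Ls s t / s) / ?b) (at r)" unfolding r(3) by simp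
    have "((\<lambda>x. x\<^sup>2 * (Ls (x / ?b) t / ?b)) has_real_derivative 2 * r * (Ls s t / ?b) + (LL s t - 2 * Ls s t / s) / ?b / ?b * r\<^sup>2) (at r)"
      by (rule DERIV_cong[OF DERIV_mult[OF DERIV_power[OF DERIV_ident, of 2] DERIV_cdivide[OF d0, of ?b]]]) (simp add: r(3))
    moreover have "2 * r * (Ls s t / ?b) + (LL s t - 2 * Ls s t / s) / ?b / ?b * r\<^sup>2 = r\<^sup>2 * (LL s t / ?b\<^sup>2)"
      unfolding r_def using s b by (simp add: field_simps power2_eq_square)
    ultimately have "((\<lambda>x. x\<^sup>2 * (Ls (x / ?b) t / ?b)) has_real_derivative r\<^sup>2 * (LL s t / ?b\<^sup>2)) (at r)" by simp
    then have "((\<lambda>x. x\<^sup>2 * radial_deriv ?b (\<lambda>s. ln (?f s)) x) has_real_derivative r\<^sup>2 * (LL s t / ?b\<^sup>2)) (at r)"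
    proof (rule has_field_derivative_transform_within_open[of _ _ _ "{0<..<?b}"])
      fix x assume "x \<in> {0<..<?b}"
      then show "x\<^sup>2 * (Ls (x / ?b) t / ?b) = x\<^sup>2 * radial_deriv ?b (\<lambda>s. ln (?f s)) x"
        using radial_deriv_eqI[OF _ _ dl, of x] by simp
    qed (use r in auto)
    from radial_deriv_eqI[OF r(1,2) this] show ?thesis unfolding radial_laplacian_def using r by simp
  qed
  have cont: "continuous_on ({0<..<1} \<times> {0..}) (\<lambda>(s, t). Us s t)"
    by (rule continuous_on_subset[OF contUs]) auto
  have da: "((\<lambda>\<tau>. r / R \<tau>) has_real_derivative - r * R1 t / ?b\<^sup>2) (at t within {0..})"
    using b by (auto intro!: derivative_eq_intros dR(1) t0 simp: power2_eq_square)
  have "((\<lambda>\<tau>. U (r / R \<tau>) \<tau>) has_real_derivative Ut (r / ?b) t + Us (r / ?b) t * (- r * R1 t / ?b\<^sup>2)) (at t within {0..})"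
    by (rule derivative_along_curve[where l=0 and u=1 and F=U and Fs=Us and a="\<lambda>\<tau>. r / R \<tau>", OF _ _ _ _ cont _ da])
      (use r s t0 in \<open>auto intro: dU dUt\<close>)
  then have "((\<lambda>\<tau>. \<rho> r \<tau>) has_real_derivative Ut s t + Us s t * (- r * R1 t / ?b\<^sup>2)) (at t within {0..})"
    unfolding r(3)
  proof (rule has_field_derivative_transform_within[OF _ zero_less_one])
    show "U (r / R x) x = \<rho> r x" if "x \<in> {0..}" for x using U_radial[of x r] that by simp
  qed (use t0 in simp)
  then have td: "time_deriv (\<lambda>s. \<rho> r s) t = Ut s t + Us s t * (- r * R1 t / ?b\<^sup>2)" by (rule time_deriv_eqI[OF t0])
  have fr: "\<rho> r t = U s t" using U_radial[OF t0, of r] r by simp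
  have fb: "\<rho> ?b t = U 1 t" by (simp add: U_def)
  \<comment> \<open>The one-sided derivative at the wall lies beyond differentiability in the open
    ball; it comes from the continuous extension of \<open>Us\<close>.\<close>
  have rb: "radial_deriv ?b ?f ?b = Us 1 t / ?b"
  proof (rule radial_deriv_endpoint[OF b])
    have "((\<lambda>s. U s t) has_real_derivative Us 1 t) (at 1 within {0..1})"
    proof (rule endpoint_derivative)
      show "continuous_on {0..1} (\<lambda>s. U s t)" by (rule cont_pair[OF contU]) (use t0 in \<open>auto intro!: continuous_intros\<close>)
      show "continuous_on {0..1} (\<lambda>s. Us s t)" by (rule cont_pair[OF contUs]) (use t0 in \<open>auto intro!: continuous_intros\<close>)
    qed (use dU t0 in auto)
    then have d1: "((\<lambda>s. U s t) has_real_derivative Us 1 t) (at 1 within {0..1})" .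
    have im: "(\<lambda>x. x / ?b) ` {0..?b} = {0..1}"
    proof (intro equalityI subsetI)
      fix y assume "y \<in> {0..1::real}"
      then have "y = (y * ?b) / ?b" "y * ?b \<in> {0..?b}" using b mult_right_mono[of y 1 ?b] by auto
      then show "y \<in> (\<lambda>x. x / ?b) ` {0..?b}" by blast
    qed (use b in auto)
    have bb: "?b / ?b = 1" using b by simp
    have "((\<lambda>s. U s t) has_real_derivative Us 1 t) (at (?b / ?b) within (\<lambda>x. x / ?b) ` {0..?b})"
      unfolding im bb by (rule d1)
    moreover have "((\<lambda>x. x / ?b) has_real_derivative 1 / ?b) (at ?b within {0..?b})" by (rule DERIV_cdivide[OF DERIV_ident])
    ultimately have "((\<lambda>s. U s t) \<circ> (\<lambda>x. x / ?b) has_real_derivative Us 1 t * (1 / ?b)) (at ?b within {0..?b})"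
      by (rule DERIV_image_chain)
    then show "(?f has_real_derivative Us 1 t / ?b) (at ?b within {0..?b})" unfolding ff by (simp add: o_def)
  qed
  define G where "G = Us 1 t / (U 1 t)\<^sup>2"
  have gG: "Ls 1 t / exp (L 1 t) = G" unfolding Ls_def L_def G_def using U1 by (simp add: power2_eq_square)
  have R1: "R1 t = - kap * G / ?b - ?b * q / (3 * gam P)"
    using eqs(2) unfolding wall_velocity_def rb fb R1_def G_def by simp
  then show "R1 t = - kap * (Ls 1 t / exp (L 1 t)) / R t - R t * Lt 1 t / (3 * gam P)" unfolding gG q by simp
  have e: "Ut s t + Us s t * (- r * R1 t / ?b\<^sup>2) = kap * (LL s t / ?b\<^sup>2) + 1 / gam P * q * (1 / 3 * r * (Us s t / ?b) + U s t)"
    using eqs(1) unfolding td density_rhs_def rl rd fr .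
  have "Ut s t = kap * (LL s t / ?b\<^sup>2) + 1 / gam P * q * (1 / 3 * s * Us s t + U s t) + s * Us s t * (R1 t / ?b)"
    using e b unfolding r_def by (simp add: field_simps power2_eq_square)
  also have "R1 t / ?b = - kap * G / ?b\<^sup>2 - q / (3 * gam P)"
    unfolding R1 using b by (simp add: field_simps power2_eq_square)
  also have "kap * (LL s t / ?b\<^sup>2) + 1 / gam P * q * (1 / 3 * s * Us s t + U s t) + s * Us s t * (- kap * G / ?b\<^sup>2 - q / (3 * gam P))
      = kap / ?b\<^sup>2 * (LL s t - G * s * Us s t) + q / gam P * U s t"
    by (simp add: algebra_simps diff_divide_distrib)
  finally have lt: "Lt s t = (kap / ?b\<^sup>2 * (LL s t - G * s * Us s t) + q / gam P * U s t) / U s t" by (simp add: Lt_def)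
  have ex: "exp (- L s t) = 1 / U s t" unfolding L_def using Us' by (simp add: exp_minus inverse_eq_divide)
  have "(k * (l - g * w) + c * U s t) / U s t = k * (1 / U s t * l - g * (w / U s t)) + c" for k l g w c :: real
    using Us' by (simp add: field_simps)
  from this[of "kap / ?b\<^sup>2" "LL s t" "G * s" "Us s t" "q / gam P"]
  show "Lt s t = kap / (R t)\<^sup>2 * (exp (- L s t) * LL s t - Ls 1 t / exp (L 1 t) * s * Ls s t) + Lt 1 t / gam P"
    unfolding gG ex Ls_def[of s t] q[symmetric] lt by simp
qed

lemma wallp_pos: "t > 0 \<Longrightarrow> Rg P * T_inf P * exp (L 1 t) = p_inf_star P + 2 * sigma P / R t + 4 * mu_l P * R1 t / R t +
    rho_l P * (R t * R2 t + 3 / 2 * (R1 t)\<^sup>2)"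
proof -
  assume t: "t > 0"
  have "\<rho> (R t) t = wall_density P (p_inf_star P) (R t) (time_deriv R t) ((time_deriv ^^ 2) R t)"
    using sol t unfolding RS_global_solution_def by (auto simp: Let_def)
  then have "U 1 t = wall_density P (p_inf_star P) (R t) (R1 t) (R2 t)" by (simp add: U_def R1_def R2_def)
  moreover have "exp (L 1 t) = U 1 t" unfolding L_def using Upos[of t 1] t by simp
  ultimately show ?thesis unfolding wall_density_def using params by simp
qed

lemma cont_time: "continuous_on {0..} (\<lambda>t. F 1 t)" if "continuous_on ({0..1} \<times> {0..}) (\<lambda>(s, t). F s t)"
  for F :: "real \<Rightarrow> real \<Rightarrow> real"
  by (rule cont_pair[OF that]) (auto intro!: continuous_intros)

lemma contL: "continuous_on ({0..1} \<times> {0..}) (\<lambda>(s, t). L s t)" "continuous_on ({0..1} \<times> {0..}) (\<lambda>(s, t). Ls s t)"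
  "continuous_on ({0..1} \<times> {0..}) (\<lambda>(s, t). LL s t)" "continuous_on ({0..1} \<times> {0..}) (\<lambda>(s, t). Lt s t)"
proof -
  have ne: "U (fst z) (snd z) \<noteq> 0" if "z \<in> {0..1} \<times> {0..}" for z
    using that Upos[of "snd z" "fst z"] by (cases z) auto
  note c = contU[unfolded split_beta] contUs[unfolded split_beta] contUl[unfolded split_beta] Ut(1)[unfolded split_beta]
  show "continuous_on ({0..1} \<times> {0..}) (\<lambda>(s, t). L s t)" unfolding L_def split_beta
    by (rule continuous_on_ln[OF c(1)]) (use ne in blast)
  have a: "continuous_on ({0..1} \<times> {0..}) (\<lambda>z. Us (fst z) (snd z) / U (fst z) (snd z))"
    "continuous_on ({0..1} \<times> {0..}) (\<lambda>z. Ul (fst z) (snd z) / U (fst z) (snd z))"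
    "continuous_on ({0..1} \<times> {0..}) (\<lambda>z. Ut (fst z) (snd z) / U (fst z) (snd z))"
    by (rule continuous_on_divide; use c ne in blast)+
  show "continuous_on ({0..1} \<times> {0..}) (\<lambda>(s, t). Ls s t)" "continuous_on ({0..1} \<times> {0..}) (\<lambda>(s, t). LL s t)"
    "continuous_on ({0..1} \<times> {0..}) (\<lambda>(s, t). Lt s t)"
    unfolding Ls_def LL_def Lt_def split_beta using a by (auto intro!: continuous_intros)
qed

lemma pde:
  assumes "0 \<le> s" "s \<le> 1" "t \<ge> 0"
  shows "Lt s t = kap / (R t)\<^sup>2 * (exp (- L s t) * LL s t - Ls 1 t / exp (L 1 t) * s * Ls s t) + Lt 1 t / gam P"
proof -
  have s1: "continuous_on ({0..1} \<times> {0..}) (\<lambda>z. f (snd z))" if "continuous_on {0..} f" for f :: "real \<Rightarrow> real"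
    by (rule continuous_on_compose2[OF that]) (auto intro!: continuous_intros)
  note c = contL[unfolded split_beta]
  have Rne: "\<forall>z\<in>{0..1} \<times> {0..}. (R (snd z))\<^sup>2 \<noteq> 0" using Rpos by fastforce
  have "(\<lambda>z. Lt (fst z) (snd z)) (s, t) = (\<lambda>z. kap / (R (snd z))\<^sup>2 * (exp (- L (fst z) (snd z)) * LL (fst z) (snd z)
      - Ls 1 (snd z) / exp (L 1 (snd z)) * fst z * Ls (fst z) (snd z)) + Lt 1 (snd z) / gam P) (s, t)"
  proof (rule continuous_on_quadrant_eq)
    show "continuous_on ({0..1} \<times> {0..}) (\<lambda>z. kap / (R (snd z))\<^sup>2 * (exp (- L (fst z) (snd z)) * LL (fst z) (snd z)
      - Ls 1 (snd z) / exp (L 1 (snd z)) * fst z * Ls (fst z) (snd z)) + Lt 1 (snd z) / gam P)"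
      using gam_pos Rne by (intro continuous_intros c s1[OF contR(1)] s1[OF cont_time[OF contL(1)]] s1[OF cont_time[OF contL(2)]] s1[OF cont_time[OF contL(4)]]) auto
    show "(\<lambda>z. Lt (fst z) (snd z)) (s, t) = (\<lambda>z. kap / (R (snd z))\<^sup>2 * (exp (- L (fst z) (snd z)) * LL (fst z) (snd z)
      - Ls 1 (snd z) / exp (L 1 (snd z)) * fst z * Ls (fst z) (snd z)) + Lt 1 (snd z) / gam P) (s, t)"
      if "0 < s" "s < 1" "t > 0" for s t unfolding fst_conv snd_conv by (rule pde_interior(1)[OF that(3,1,2)])
  qed (use c assms in auto)
  then show ?thesis unfolding fst_conv snd_conv .
qed

lemma wallv: assumes "t \<ge> 0" shows "R1 t = - kap * (Ls 1 t / exp (L 1 t)) / R t - R t * Lt 1 t / (3 * gam P)"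
proof (rule continuous_on_Ici_eq[where f=R1 and g="\<lambda>t. - kap * (Ls 1 t / exp (L 1 t)) / R t - R t * Lt 1 t / (3 * gam P)"])
  have Rne: "\<forall>t\<in>{0..}. R t \<noteq> 0" using Rpos by fastforce
  show "continuous_on {0..} (\<lambda>t. - kap * (Ls 1 t / exp (L 1 t)) / R t - R t * Lt 1 t / (3 * gam P))"
    using gam_pos Rne by (intro continuous_intros contR(1) cont_time[OF contL(1)] cont_time[OF contL(2)] cont_time[OF contL(4)]) auto
  show "R1 t = - kap * (Ls 1 t / exp (L 1 t)) / R t - R t * Lt 1 t / (3 * gam P)" if "t > 0" for t
    by (rule pde_interior(2)[OF that, of "1 / 2"]) auto
qed (use contR assms in auto)

lemma wallp: assumes "t \<ge> 0" shows "Rg P * T_inf P * exp (L 1 t) = p_inf_star P + 2 * sigma P / R t + 4 * mu_l P * R1 t / R t +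
    rho_l P * (R t * R2 t + 3 / 2 * (R1 t)\<^sup>2)"
proof (rule continuous_on_Ici_eq[where f="\<lambda>t. Rg P * T_inf P * exp (L 1 t)" and g="\<lambda>t. p_inf_star P + 2 * sigma P / R t + 4 * mu_l P * R1 t / R t +
    rho_l P * (R t * R2 t + 3 / 2 * (R1 t)\<^sup>2)"])
  have Rne: "\<forall>t\<in>{0..}. R t \<noteq> 0" using Rpos by fastforce
  show "continuous_on {0..} (\<lambda>t. p_inf_star P + 2 * sigma P / R t + 4 * mu_l P * R1 t / R t +
    rho_l P * (R t * R2 t + 3 / 2 * (R1 t)\<^sup>2))"
    using Rne by (intro continuous_intros contR) auto
  show "continuous_on {0..} (\<lambda>t. Rg P * T_inf P * exp (L 1 t))" by (intro continuous_intros cont_time[OF contL(1)])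
qed (use wallp_pos assms in auto)

lemma mass_substitution:
  "bubble_mass \<rho>0 R0 = 4 * pi * (R 0 ^ 3 * integral {0..1} (\<lambda>s. s\<^sup>2 * exp (L s 0)))"
proof -
  have b: "R 0 > 0" using Rpos[of 0] by simp
  have c: "continuous_on {0..1} (\<lambda>s. U s 0)" by (rule cont_pair[OF contU]) (auto intro!: continuous_intros)
  have eq: "\<rho>0 r = U (r / R 0) 0" if "r \<in> {0..R 0}" for r using init(1)[of r] that U_radial[of 0 r] init(2) by simp
  have "continuous_on {0..R 0} (\<lambda>r. U (r / R 0) 0)"
    by (rule continuous_on_compose2[OF c]) (use b in \<open>auto intro!: continuous_intros\<close>)
  then have "continuous_on {0..R 0} \<rho>0" by (rule continuous_on_eq) (simp add: eq)
  from integral_radial[OF b this]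
  have "bubble_mass \<rho>0 R0 = 4 * pi * integral {0..R 0} (\<lambda>r. r\<^sup>2 * \<rho>0 r)" unfolding bubble_mass_def init(2) .
  also have "integral {0..R 0} (\<lambda>r. r\<^sup>2 * \<rho>0 r) = R 0 ^ 3 * integral {0..1} (\<lambda>s. s\<^sup>2 * exp (L s 0))"
  proof -
    have "((\<lambda>s. s\<^sup>2 * U s 0) has_integral integral {0..1} (\<lambda>s. s\<^sup>2 * U s 0)) (cbox 0 1)"
      unfolding cbox_interval by (intro integrable_integral integrable_continuous_interval continuous_intros c)
    from has_integral_affinity[OF this, of "1 / R 0" 0]
    have "((\<lambda>r. (r / R 0)\<^sup>2 * U (r / R 0) 0) has_integral R 0 * integral {0..1} (\<lambda>s. s\<^sup>2 * U s 0)) ((\<lambda>x. R 0 * x) ` {0..1})"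
      using b by (simp add: mult.commute)
    moreover have "(\<lambda>x. R 0 * x) ` {0..1} = {0..R 0}" using b by simp
    ultimately have "((\<lambda>r. (R 0)\<^sup>2 * ((r / R 0)\<^sup>2 * U (r / R 0) 0)) has_integral (R 0)\<^sup>2 * (R 0 * integral {0..1} (\<lambda>s. s\<^sup>2 * U s 0))) {0..R 0}"
      by (intro has_integral_mult_right) simp
    then have "((\<lambda>r. r\<^sup>2 * \<rho>0 r) has_integral (R 0)\<^sup>2 * (R 0 * integral {0..1} (\<lambda>s. s\<^sup>2 * U s 0))) {0..R 0}"
      by (rule has_integral_eq[rotated]) (use b eq in \<open>auto simp: power_divide\<close>)
    moreover have "integral {0..1} (\<lambda>s. s\<^sup>2 * U s 0) = integral {0..1} (\<lambda>s. s\<^sup>2 * exp (L s 0))"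
      by (rule integral_cong) (use Upos in \<open>auto simp: L_def\<close>)
    ultimately show ?thesis by (simp add: integral_unique power2_eq_square power3_eq_cube)
  qed
  finally show ?thesis .
qed

lemma flow:
  assumes "bubble_par kap (gam P) (Rg P * T_inf P) (sigma P) (p_inf_star P) (rho_l P) (mu_l P) m Rs"
    and "bubble_mass \<rho>0 R0 = 4 * pi * m"
  shows "bubble_flow kap (gam P) (Rg P * T_inf P) (sigma P) (p_inf_star P) (rho_l P) (mu_l P) m Rs L Ls LL Lt R R1 R2 R3"
  unfolding bubble_flow_def bubble_flow_axioms_def
  by (intro conjI allI impI assms(1) contL dLs' dLt' dR pde wallv wallp Rpos)
    (use mass_substitution assms(2) in \<open>simp_all add: Ls_def Us_def\<close>)

end

section \<open>Norms of radial functions\<close>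

lemma partial_deriv_cong_open:
  assumes "open S" "\<And>x. x \<in> S \<Longrightarrow> f x = g x" "x \<in> S"
  shows "partial_deriv i f x = partial_deriv i g x"
proof -
  have "(f has_derivative D) (at x) \<longleftrightarrow> (g has_derivative D) (at x)" for D
    using has_derivative_transform_within_open[of f D x UNIV S g] has_derivative_transform_within_open[of g D x UNIV S f]
      assms by auto
  then show ?thesis unfolding partial_deriv_def frechet_derivative_def by simp
qed

lemma partial_deriv_diff_const: "partial_deriv i (\<lambda>x. f x - c) = partial_deriv i f"
proof -
  have "((\<lambda>x. f x - c) has_derivative D) (at x) \<longleftrightarrow> (f has_derivative D) (at x)" for D x
  proof
    assume "((\<lambda>x. f x - c) has_derivative D) (at x)"
    from has_derivative_add[OF this has_derivative_const[of c]] show "(f has_derivative D) (at x)" by simp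
  next
    assume "(f has_derivative D) (at x)"
    from has_derivative_diff[OF this has_derivative_const[of c]] show "((\<lambda>x. f x - c) has_derivative D) (at x)" by simp
  qed
  then show ?thesis unfolding partial_deriv_def frechet_derivative_def by simp
qed

lemma partial_deriv_eqI: "(f has_derivative D) (at x) \<Longrightarrow> partial_deriv i f x = D i"
  unfolding partial_deriv_def using frechet_derivative_at by metis

lemma C2_holder_norm_cong:
  assumes "open S" "\<And>x. x \<in> S \<Longrightarrow> f x = g x"
  shows "C2_holder_norm \<beta> S f = C2_holder_norm \<beta> S g"
proof -
  have 1: "partial_deriv i f x = partial_deriv i g x" if "x \<in> S" for i x
    using partial_deriv_cong_open[OF assms that] .
  have 2: "partial_deriv j (partial_deriv i f) x = partial_deriv j (partial_deriv i g) x" if "x \<in> S" for i j x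
    by (rule partial_deriv_cong_open[OF assms(1) 1 that])
  have s: "sup_norm S h = sup_norm S k" if "\<And>x. x \<in> S \<Longrightarrow> h x = k x" for h k
    unfolding sup_norm_def using that by (intro SUP_cong) auto
  have h: "holder_seminorm \<beta> S h = holder_seminorm \<beta> S k" if "\<And>x. x \<in> S \<Longrightarrow> h x = k x" for h k
    unfolding holder_seminorm_def using that by (intro SUP_cong) auto
  have "sup_norm S (partial_deriv i f) = sup_norm S (partial_deriv i g)"
    "sup_norm S (partial_deriv j (partial_deriv i f)) = sup_norm S (partial_deriv j (partial_deriv i g))"
    "holder_seminorm \<beta> S (partial_deriv j (partial_deriv i f)) = holder_seminorm \<beta> S (partial_deriv j (partial_deriv i g))" for i j
    by (intro s h 1 2; assumption)+
  then show ?thesis unfolding C2_holder_norm_def using s[of f g] assms(2) by simp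
qed

lemma sup_norm_bounds:
  assumes "\<And>x. x \<in> S \<Longrightarrow> \<bar>f x\<bar> \<le> a" "S \<noteq> {}"
  shows "sup_norm S f \<le> a" "0 \<le> sup_norm S f" "x \<in> S \<Longrightarrow> \<bar>f x\<bar> \<le> sup_norm S f"
proof -
  have b: "bdd_above ((\<lambda>x. \<bar>f x\<bar>) ` S)" using assms(1) by (intro bdd_aboveI) auto
  show "sup_norm S f \<le> a" unfolding sup_norm_def by (rule cSUP_least) (use assms in auto)
  have up: "\<bar>f x\<bar> \<le> sup_norm S f" if "x \<in> S" for x unfolding sup_norm_def by (rule cSUP_upper[OF that b])
  then show "x \<in> S \<Longrightarrow> \<bar>f x\<bar> \<le> sup_norm S f" .
  obtain y where "y \<in> S" using assms(2) by auto
  from up[OF this] show "0 \<le> sup_norm S f" by linarith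
qed

lemma holder_seminorm_bounds:
  assumes "\<And>x y. x \<in> S \<Longrightarrow> y \<in> S \<Longrightarrow> \<bar>f x - f y\<bar> \<le> a * dist x y powr \<beta>"
    "x0 \<in> S" "y0 \<in> S" "x0 \<noteq> y0"
  shows "holder_seminorm \<beta> S f \<le> a" "0 \<le> holder_seminorm \<beta> S f"
proof -
  let ?A = "{(x, y). x \<in> S \<and> y \<in> S \<and> x \<noteq> y}"
  let ?q = "\<lambda>(x, y). \<bar>f x - f y\<bar> / dist x y powr \<beta>"
  have le: "?q z \<le> a" if "z \<in> ?A" for z
  proof -
    obtain x y where z: "z = (x, y)" "x \<in> S" "y \<in> S" "x \<noteq> y" using \<open>z \<in> ?A\<close> by auto
    have "dist x y powr \<beta> > 0" using z by simp
    then show ?thesis using assms(1)[OF z(2,3)] by (simp add: z(1) pos_divide_le_eq)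
  qed
  have mem: "(x0, y0) \<in> ?A" using assms by auto
  show "holder_seminorm \<beta> S f \<le> a" unfolding holder_seminorm_def by (rule cSUP_least) (use mem le in blast)+
  have "?q (x0, y0) \<le> holder_seminorm \<beta> S f" unfolding holder_seminorm_def
    by (rule cSUP_upper[OF mem]) (use le in \<open>auto intro!: bdd_aboveI\<close>)
  moreover have "0 \<le> ?q (x0, y0)" by simp
  ultimately show "0 \<le> holder_seminorm \<beta> S f" by linarith
qed

text \<open>The suprema are taken in the reals and are informative only for bounded sets; the bounds
  \<open>a0\<close> to \<open>a3\<close> supply this, so that the norm dominates its constituents.
  The factors 3 and 9 count first and second partial derivatives.\<close>

lemma C2_holder_norm_bounds:
  fixes f :: "real ^ 3 \<Rightarrow> real"
  assumes f: "\<And>x. norm x < 1 \<Longrightarrow> \<bar>f x\<bar> \<le> a0"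
    and d: "\<And>x i. norm x < 1 \<Longrightarrow> i \<in> Basis \<Longrightarrow> \<bar>partial_deriv i f x\<bar> \<le> a1"
    and dd: "\<And>x i j. norm x < 1 \<Longrightarrow> i \<in> Basis \<Longrightarrow> j \<in> Basis \<Longrightarrow> \<bar>partial_deriv j (partial_deriv i f) x\<bar> \<le> a2"
    and h: "\<And>x y i j. norm x < 1 \<Longrightarrow> norm y < 1 \<Longrightarrow> i \<in> Basis \<Longrightarrow> j \<in> Basis \<Longrightarrow>
      \<bar>partial_deriv j (partial_deriv i f) x - partial_deriv j (partial_deriv i f) y\<bar> \<le> a3 * dist x y powr \<beta>"
  shows "C2_holder_norm \<beta> (ball 0 1) f \<le> a0 + 3 * a1 + 9 * (a2 + a3)" "0 \<le> C2_holder_norm \<beta> (ball 0 1) f"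
    "norm x < 1 \<Longrightarrow> \<bar>f x\<bar> \<le> C2_holder_norm \<beta> (ball 0 1) f"
    "norm x < 1 \<Longrightarrow> i \<in> Basis \<Longrightarrow> j \<in> Basis \<Longrightarrow> \<bar>partial_deriv j (partial_deriv i f) x\<bar> \<le> C2_holder_norm \<beta> (ball 0 1) f"
proof -
  let ?B = "ball (0::real^3) 1"
  have ne: "?B \<noteq> {}" by simp
  \<comment> \<open>Together with the origin a pair of distinct points, so that the seminorm is a
    supremum over a nonempty set.\<close>
  define x0 where "x0 = ((1/2) *\<^sub>R axis 1 1 :: real^3)"
  have x0: "x0 \<in> ?B" "0 \<in> ?B" "x0 \<noteq> 0" by (auto simp: x0_def)
  have s0: "sup_norm ?B f \<le> a0" "0 \<le> sup_norm ?B f" "\<And>x. norm x < 1 \<Longrightarrow> \<bar>f x\<bar> \<le> sup_norm ?B f"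
    using sup_norm_bounds[of ?B f a0] f ne by auto
  have s1: "sup_norm ?B (partial_deriv i f) \<le> a1" "0 \<le> sup_norm ?B (partial_deriv i f)" if "i \<in> Basis" for i
    using sup_norm_bounds[of ?B "partial_deriv i f" a1] d[OF _ that] ne by auto
  define s where "s i j = sup_norm ?B (partial_deriv j (partial_deriv i f))" for i j
  define k where "k i j = holder_seminorm \<beta> ?B (partial_deriv j (partial_deriv i f))" for i j
  have s2: "s i j \<le> a2" "0 \<le> s i j" "\<And>x. norm x < 1 \<Longrightarrow> \<bar>partial_deriv j (partial_deriv i f) x\<bar> \<le> s i j"
    if "i \<in> Basis" "j \<in> Basis" for i j
    using sup_norm_bounds[of ?B "partial_deriv j (partial_deriv i f)" a2] dd[OF _ that] ne by (auto simp: s_def)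
  have k2: "k i j \<le> a3" "0 \<le> k i j" if "i \<in> Basis" "j \<in> Basis" for i j
    using holder_seminorm_bounds[OF _ x0, of "partial_deriv j (partial_deriv i f)" a3 \<beta>] h[OF _ _ that] by (auto simp: k_def)
  define S1 where "S1 = (\<Sum>i\<in>Basis. sup_norm ?B (partial_deriv i f))"
  define S2 where "S2 = (\<Sum>i\<in>Basis. \<Sum>j\<in>Basis. s i j + k i j)"
  have N: "C2_holder_norm \<beta> ?B f = sup_norm ?B f + S1 + S2"
    unfolding C2_holder_norm_def S1_def S2_def s_def k_def ..
  have b1: "S1 \<le> 3 * a1" using sum_bounded_above[of Basis "\<lambda>i. sup_norm ?B (partial_deriv i f)" a1] s1 by (simp add: S1_def)
  have "(\<Sum>j\<in>Basis. s i j + k i j) \<le> 3 * (a2 + a3)" if "i \<in> Basis" for i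
    using sum_bounded_above[of "Basis :: (real^3) set" "\<lambda>j. s i j + k i j" "a2 + a3"] s2[OF that] k2[OF that] by (simp add: add_mono)
  then have b2: "S2 \<le> 9 * (a2 + a3)"
    using sum_bounded_above[of "Basis :: (real^3) set" "\<lambda>i. \<Sum>j\<in>Basis. s i j + k i j" "3 * (a2 + a3)"] by (simp add: S2_def)
  have p1: "S1 \<ge> 0" unfolding S1_def by (intro sum_nonneg s1)
  have p2': "0 \<le> (\<Sum>j\<in>Basis. s i j + k i j)" if "i \<in> Basis" for i by (intro sum_nonneg add_nonneg_nonneg s2 k2 that)
  have p2: "S2 \<ge> 0" unfolding S2_def by (intro sum_nonneg p2')
  have m2: "s i j \<le> S2" if "i \<in> Basis" "j \<in> Basis" for i j
  proof -
    have "s i j \<le> s i j + k i j" using k2 that by simp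
    also have "\<dots> \<le> (\<Sum>j\<in>Basis. s i j + k i j)"
      by (rule member_le_sum[of j Basis "\<lambda>j. s i j + k i j"]) (use that s2 k2 in \<open>auto intro!: add_nonneg_nonneg\<close>)
    also have "\<dots> \<le> S2" unfolding S2_def
      by (rule member_le_sum[of i Basis "\<lambda>i. \<Sum>j\<in>Basis. s i j + k i j"]) (use that p2' in auto)
    finally show ?thesis .
  qed
  show "C2_holder_norm \<beta> ?B f \<le> a0 + 3 * a1 + 9 * (a2 + a3)" "0 \<le> C2_holder_norm \<beta> ?B f"
    unfolding N using s0 b1 b2 p1 p2 by linarith+
  show "norm x < 1 \<Longrightarrow> \<bar>f x\<bar> \<le> C2_holder_norm \<beta> ?B f" unfolding N using s0(3)[of x] p1 p2 by linarith
  show "\<bar>partial_deriv j (partial_deriv i f) x\<bar> \<le> C2_holder_norm \<beta> ?B f" if "norm x < 1" "i \<in> Basis" "j \<in> Basis"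
    unfolding N using s2(3)[OF that(2,3,1)] m2[OF that(2,3)] s0(2) p1 by linarith
qed

definition holder_le :: "real \<Rightarrow> real \<Rightarrow> (real \<Rightarrow> real) \<Rightarrow> bool" where
  "holder_le \<gamma> a f \<longleftrightarrow> (\<forall>s\<in>{0..1}. \<bar>f s\<bar> \<le> a) \<and> (\<forall>s\<in>{0..1}. \<forall>s'\<in>{0..1}. \<bar>f s - f s'\<bar> \<le> a * \<bar>s - s'\<bar> powr \<gamma>)"

lemma holder_leD:
  assumes "holder_le \<gamma> a f" "0 \<le> s" "s \<le> 1"
  shows "\<bar>f s\<bar> \<le> a" "0 \<le> s' \<Longrightarrow> s' \<le> 1 \<Longrightarrow> \<bar>f s - f s'\<bar> \<le> a * \<bar>s - s'\<bar> powr \<gamma>"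
  using assms unfolding holder_le_def by auto

lemma holder_le_nonneg: "holder_le \<gamma> a f \<Longrightarrow> 0 \<le> a"
  using holder_leD(1)[of \<gamma> a f 0] by simp

lemma holder_le_mono: assumes "holder_le \<gamma> a f" "a \<le> b" shows "holder_le \<gamma> b f"
  unfolding holder_le_def
proof (intro conjI ballI)
  fix s s' :: real assume s: "s \<in> {0..1}" "s' \<in> {0..1}"
  have "\<bar>f s - f s'\<bar> \<le> a * \<bar>s - s'\<bar> powr \<gamma>" using holder_leD(2)[OF assms(1)] s by auto
  also have "\<dots> \<le> b * \<bar>s - s'\<bar> powr \<gamma>" using assms by (intro mult_right_mono) auto
  finally show "\<bar>f s - f s'\<bar> \<le> b * \<bar>s - s'\<bar> powr \<gamma>" .
next
  fix s :: real assume "s \<in> {0..1}"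
  then show "\<bar>f s\<bar> \<le> b" using holder_leD(1)[OF assms(1), of s] assms(2) by auto
qed

lemma holder_le_add: assumes "holder_le \<gamma> a f" "holder_le \<gamma> b g" shows "holder_le \<gamma> (a + b) (\<lambda>s. f s + g s)"
  unfolding holder_le_def
proof (intro conjI ballI)
  fix s s' :: real assume s: "s \<in> {0..1}" "s' \<in> {0..1}"
  have "\<bar>f s - f s'\<bar> \<le> a * \<bar>s - s'\<bar> powr \<gamma>" "\<bar>g s - g s'\<bar> \<le> b * \<bar>s - s'\<bar> powr \<gamma>"
    using holder_leD(2)[OF assms(1)] holder_leD(2)[OF assms(2)] s by auto
  then show "\<bar>f s + g s - (f s' + g s')\<bar> \<le> (a + b) * \<bar>s - s'\<bar> powr \<gamma>" by (simp add: distrib_right)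
next
  fix s :: real assume "s \<in> {0..1}"
  then show "\<bar>f s + g s\<bar> \<le> a + b"
    using holder_leD(1)[OF assms(1), of s] holder_leD(1)[OF assms(2), of s] by auto
qed

lemma holder_le_cmult: assumes "holder_le \<gamma> a f" shows "holder_le \<gamma> (\<bar>c\<bar> * a) (\<lambda>s. c * f s)"
  unfolding holder_le_def
proof (intro conjI ballI)
  fix s s' :: real assume s: "s \<in> {0..1}" "s' \<in> {0..1}"
  have "\<bar>f s - f s'\<bar> \<le> a * \<bar>s - s'\<bar> powr \<gamma>" using holder_leD(2)[OF assms(1)] s by auto
  from mult_left_mono[OF this, of "\<bar>c\<bar>"]
  show "\<bar>c * f s - c * f s'\<bar> \<le> \<bar>c\<bar> * a * \<bar>s - s'\<bar> powr \<gamma>" by (simp add: abs_mult[symmetric] right_diff_distrib)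
next
  fix s :: real assume "s \<in> {0..1}"
  then show "\<bar>c * f s\<bar> \<le> \<bar>c\<bar> * a" using holder_leD(1)[OF assms(1), of s] by (simp add: abs_mult mult_left_mono)
qed

lemma holder_le_mult: assumes "holder_le \<gamma> a f" "holder_le \<gamma> b g" shows "holder_le \<gamma> (2 * a * b) (\<lambda>s. f s * g s)"
  unfolding holder_le_def
proof (intro conjI ballI)
  note nn = holder_le_nonneg[OF assms(1)] holder_le_nonneg[OF assms(2)]
  fix s s' :: real assume s: "s \<in> {0..1}" "s' \<in> {0..1}"
  have "f s * g s - f s' * g s' = f s * (g s - g s') + (f s - f s') * g s'" by (simp add: algebra_simps)
  also have "\<bar>\<dots>\<bar> \<le> \<bar>f s\<bar> * \<bar>g s - g s'\<bar> + \<bar>f s - f s'\<bar> * \<bar>g s'\<bar>"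
    using abs_triangle_ineq[of "f s * (g s - g s')" "(f s - f s') * g s'"] by (simp add: abs_mult)
  also have "\<dots> \<le> a * (b * \<bar>s - s'\<bar> powr \<gamma>) + a * \<bar>s - s'\<bar> powr \<gamma> * b"
    using holder_leD[OF assms(1)] holder_leD[OF assms(2)] s nn by (intro add_mono mult_mono) auto
  finally show "\<bar>f s * g s - f s' * g s'\<bar> \<le> 2 * a * b * \<bar>s - s'\<bar> powr \<gamma>" by (simp add: algebra_simps)
next
  note nn = holder_le_nonneg[OF assms(1)] holder_le_nonneg[OF assms(2)]
  fix s :: real assume "s \<in> {0..1}"
  then have "\<bar>f s\<bar> * \<bar>g s\<bar> \<le> a * b" using holder_leD(1)[OF assms(1)] holder_leD(1)[OF assms(2)] nn by (intro mult_mono) auto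
  moreover have "a * b \<ge> 0" using nn by simp
  ultimately show "\<bar>f s * g s\<bar> \<le> 2 * a * b" by (simp add: abs_mult)
qed

lemma holder_le_C1:
  assumes c: "continuous_on {0..1} f" and d: "\<And>s. 0 < s \<Longrightarrow> s < 1 \<Longrightarrow> (f has_real_derivative f' s) (at s)"
    and b: "\<And>s. 0 \<le> s \<Longrightarrow> s \<le> 1 \<Longrightarrow> \<bar>f s\<bar> \<le> a" "\<And>s. 0 < s \<Longrightarrow> s < 1 \<Longrightarrow> \<bar>f' s\<bar> \<le> a" and g: "0 < \<gamma>" "\<gamma> \<le> 1"
  shows "holder_le \<gamma> a f"
proof -
  have a0: "a \<ge> 0" using b(1)[of 0] by simp
  have lip: "\<bar>f s - f s'\<bar> \<le> a * \<bar>s - s'\<bar> powr \<gamma>" if s: "0 \<le> s'" "s' < s" "s \<le> 1" for s s'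
  proof -
    have "continuous_on {s'..s} f" by (rule continuous_on_subset[OF c]) (use s in auto)
    moreover have "(f has_derivative (*) (f' x)) (at x)" if "s' < x" "x < s" for x
      using d[of x] that s by (simp add: has_field_derivative_def)
    ultimately obtain z where z: "z \<in> {s'<..<s}" "f s - f s' = f' z * (s - s')"
      using mvt[of s' s f "\<lambda>x. (*) (f' x)"] s by auto
    have "\<bar>f s - f s'\<bar> = \<bar>f' z\<bar> * \<bar>s - s'\<bar>" by (simp add: z abs_mult)
    also have "\<dots> \<le> a * \<bar>s - s'\<bar> powr \<gamma>"
      using b(2)[of z] z s a0 powr_mono'[of \<gamma> 1 "s - s'"] g by (intro mult_mono) auto
    finally show ?thesis .
  qed
  show ?thesis unfolding holder_le_def
  proof (intro conjI ballI)
    fix s s' :: real assume s: "s \<in> {0..1}" "s' \<in> {0..1}"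
    consider "s' < s" | "s < s'" | "s = s'" by linarith
    then show "\<bar>f s - f s'\<bar> \<le> a * \<bar>s - s'\<bar> powr \<gamma>"
    proof cases
      case 2
      then show ?thesis using lip[of s s'] s by (simp add: abs_minus_commute)
    qed (use lip s in auto)
  qed (use b in auto)
qed

text \<open>Distances below a threshold \<open>\<theta>\<close> use the stronger exponent, larger
  ones the supremum bound. The size \<open>\<epsilon>0\<close> is uniform over all \<open>f\<close>,
  so that it can be applied to the profiles at all late times.\<close>

lemma interpolation:
  assumes h: "0 < \<gamma>" "\<gamma> < \<beta>" "C > 0" and e: "\<epsilon> > 0"
  shows "\<exists>\<epsilon>0>0. \<forall>f. (\<forall>s. 0 \<le> s \<and> s \<le> 1 \<longrightarrow> \<bar>f s\<bar> \<le> \<epsilon>0) \<and>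
    (\<forall>s1 s2. 0 \<le> s1 \<and> s1 \<le> 1 \<and> 0 \<le> s2 \<and> s2 \<le> 1 \<longrightarrow> \<bar>f s1 - f s2\<bar> \<le> C * \<bar>s1 - s2\<bar> powr \<beta>) \<longrightarrow> holder_le \<gamma> \<epsilon> f"
proof -
  define \<theta> where "\<theta> = (\<epsilon> / C) powr (1 / (\<beta> - \<gamma>))"
  have th: "\<theta> > 0" "C * \<theta> powr (\<beta> - \<gamma>) = \<epsilon>" using h e by (auto simp: \<theta>_def powr_powr)
  define \<epsilon>0 where "\<epsilon>0 = min \<epsilon> (\<epsilon> * \<theta> powr \<gamma> / 2)"
  have e0: "\<epsilon>0 > 0" "\<epsilon>0 \<le> \<epsilon>" "2 * \<epsilon>0 \<le> \<epsilon> * \<theta> powr \<gamma>" using e th by (auto simp: \<epsilon>0_def)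
  show ?thesis
  proof (intro exI[of _ \<epsilon>0] conjI e0(1) allI impI)
    fix f :: "real \<Rightarrow> real"
    assume "(\<forall>s. 0 \<le> s \<and> s \<le> 1 \<longrightarrow> \<bar>f s\<bar> \<le> \<epsilon>0) \<and>
    (\<forall>s1 s2. 0 \<le> s1 \<and> s1 \<le> 1 \<and> 0 \<le> s2 \<and> s2 \<le> 1 \<longrightarrow> \<bar>f s1 - f s2\<bar> \<le> C * \<bar>s1 - s2\<bar> powr \<beta>)"
    then have f: "\<And>s. 0 \<le> s \<Longrightarrow> s \<le> 1 \<Longrightarrow> \<bar>f s\<bar> \<le> \<epsilon>0"
      "\<And>s1 s2. 0 \<le> s1 \<Longrightarrow> s1 \<le> 1 \<Longrightarrow> 0 \<le> s2 \<Longrightarrow> s2 \<le> 1 \<Longrightarrow> \<bar>f s1 - f s2\<bar> \<le> C * \<bar>s1 - s2\<bar> powr \<beta>" by auto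
    show "holder_le \<gamma> \<epsilon> f" unfolding holder_le_def
    proof (intro conjI ballI)
      fix s :: real assume "s \<in> {0..1}"
      then show "\<bar>f s\<bar> \<le> \<epsilon>" using f(1)[of s] e0 by auto
    next
      fix s s' :: real assume s: "s \<in> {0..1}" "s' \<in> {0..1}"
      define d where "d = \<bar>s - s'\<bar>"
      have d0: "d \<ge> 0" by (simp add: d_def)
      show "\<bar>f s - f s'\<bar> \<le> \<epsilon> * \<bar>s - s'\<bar> powr \<gamma>" unfolding d_def[symmetric]
      proof (cases "d < \<theta>")
        case True
        have "\<bar>f s - f s'\<bar> \<le> C * d powr \<beta>" using f(2)[of s s'] s by (simp add: d_def)
        also have "d powr \<beta> = d powr (\<beta> - \<gamma>) * d powr \<gamma>" by (simp add: powr_add[symmetric])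
        also have "C * (d powr (\<beta> - \<gamma>) * d powr \<gamma>) \<le> C * (\<theta> powr (\<beta> - \<gamma>) * d powr \<gamma>)"
          using True d0 h by (intro mult_left_mono mult_right_mono powr_mono2) auto
        also have "\<dots> = \<epsilon> * d powr \<gamma>" using th(2) by (simp add: mult.assoc[symmetric])
        finally show "\<bar>f s - f s'\<bar> \<le> \<epsilon> * d powr \<gamma>" .
      next
        case False
        have "\<bar>f s - f s'\<bar> \<le> 2 * \<epsilon>0" using f(1)[of s] f(1)[of s'] s by auto
        also have "\<dots> \<le> \<epsilon> * \<theta> powr \<gamma>" by (rule e0)
        also have "\<dots> \<le> \<epsilon> * d powr \<gamma>" using False th h e by (intro mult_left_mono powr_mono2) auto
        finally show "\<bar>f s - f s'\<bar> \<le> \<epsilon> * d powr \<gamma>" .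
      qed
    qed
  qed
qed

text \<open>Scaling by \<open>\<tau> \<le> 1\<close> contracts distances and the weight is at most
  1, so the average keeps the constant.\<close>

lemma holder_le_average:
  assumes h: "holder_le \<gamma> a f" and c: "continuous_on {0..1} f" and g: "0 < \<gamma>"
  shows "holder_le \<gamma> a (\<lambda>s. integral {0..1} (\<lambda>\<tau>. \<tau>\<^sup>2 * f (s * \<tau>)))"
proof -
  have a0: "a \<ge> 0" by (rule holder_le_nonneg[OF h])
  have i: "(\<lambda>\<tau>. \<tau>\<^sup>2 * f (s * \<tau>)) integrable_on {0..1}" if "0 \<le> s" "s \<le> 1" for s
    by (rule integrable_continuous_interval)
      (use that in \<open>auto intro!: continuous_intros continuous_on_compose2[OF c] mult_le_one\<close>)
  have bound: "norm (integral {0..1} k) \<le> b" if "k integrable_on {0..1}" "\<And>\<tau>. 0 \<le> \<tau> \<Longrightarrow> \<tau> \<le> 1 \<Longrightarrow> \<bar>k \<tau>\<bar> \<le> b" for k :: "real \<Rightarrow> real" and b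
    using integral_norm_bound_integral[OF that(1) integrable_const_ivl[of b 0 1]] that(2) by auto
  show ?thesis unfolding holder_le_def
  proof (intro conjI ballI)
    fix s :: real assume s: "s \<in> {0..1}"
    have "\<bar>\<tau>\<^sup>2 * f (s * \<tau>)\<bar> \<le> a" if t: "0 \<le> \<tau>" "\<tau> \<le> 1" for \<tau>
    proof -
      have "\<bar>\<tau>\<^sup>2 * f (s * \<tau>)\<bar> = \<tau>\<^sup>2 * \<bar>f (s * \<tau>)\<bar>" by (simp add: abs_mult)
      also have "\<dots> \<le> 1 * a" using s t a0 holder_leD(1)[OF h, of "s * \<tau>"]
        by (intro mult_mono) (auto simp: power_le_one mult_le_one)
      finally show ?thesis by simp
    qed
    with bound[OF i, of s a] s show "\<bar>integral {0..1} (\<lambda>\<tau>. \<tau>\<^sup>2 * f (s * \<tau>))\<bar> \<le> a" by auto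
  next
    fix s s' :: real assume s: "s \<in> {0..1}" "s' \<in> {0..1}"
    have "\<bar>\<tau>\<^sup>2 * f (s * \<tau>) - \<tau>\<^sup>2 * f (s' * \<tau>)\<bar> \<le> a * \<bar>s - s'\<bar> powr \<gamma>" if t: "0 \<le> \<tau>" "\<tau> \<le> 1" for \<tau>
    proof -
      have "\<bar>\<tau>\<^sup>2 * f (s * \<tau>) - \<tau>\<^sup>2 * f (s' * \<tau>)\<bar> = \<tau>\<^sup>2 * \<bar>f (s * \<tau>) - f (s' * \<tau>)\<bar>"
        by (simp add: abs_mult right_diff_distrib[symmetric])
      also have "\<dots> \<le> 1 * (a * \<bar>s * \<tau> - s' * \<tau>\<bar> powr \<gamma>)" using s t a0 holder_leD(2)[OF h, of "s * \<tau>" "s' * \<tau>"]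
        by (intro mult_mono) (auto simp: power_le_one mult_le_one)
      also have "\<bar>s * \<tau> - s' * \<tau>\<bar> = \<bar>s - s'\<bar> * \<tau>" using t by (simp add: left_diff_distrib[symmetric] abs_mult)
      also have "(\<bar>s - s'\<bar> * \<tau>) powr \<gamma> \<le> \<bar>s - s'\<bar> powr \<gamma>" using t g by (intro powr_mono2) (auto intro: mult_left_le)
      finally show ?thesis using a0 by (simp add: mult_left_mono)
    qed
    moreover have "integral {0..1} (\<lambda>\<tau>. \<tau>\<^sup>2 * f (s * \<tau>)) - integral {0..1} (\<lambda>\<tau>. \<tau>\<^sup>2 * f (s' * \<tau>))
      = integral {0..1} (\<lambda>\<tau>. \<tau>\<^sup>2 * f (s * \<tau>) - \<tau>\<^sup>2 * f (s' * \<tau>))"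
      by (rule integral_diff[symmetric]) (use i s in auto)
    ultimately show "\<bar>integral {0..1} (\<lambda>\<tau>. \<tau>\<^sup>2 * f (s * \<tau>)) - integral {0..1} (\<lambda>\<tau>. \<tau>\<^sup>2 * f (s' * \<tau>))\<bar> \<le> a * \<bar>s - s'\<bar> powr \<gamma>"
      using bound[OF integrable_diff[OF i i], of s s' "a * \<bar>s - s'\<bar> powr \<gamma>"] s by auto
  qed
qed

text \<open>A radial gradient \<open>f\<close> with Laplacian \<open>g\<close> satisfies
  \<open>(s^2 f)' = s^2 g\<close>; this is integrated from the centre and rescaled to the unit
  interval. In this form the gradient inherits Hoelder bounds of the Laplacian up to the
  centre.\<close>

lemma radial_gradient_average:
  assumes cf: "continuous_on {0..1} f" and f0: "f 0 = 0"
    and d: "\<And>s. 0 < s \<Longrightarrow> s < 1 \<Longrightarrow> (f has_real_derivative g s - 2 * f s / s) (at s)" and s: "0 \<le> s" "s \<le> 1"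
  shows "f s = s * integral {0..1} (\<lambda>\<tau>. \<tau>\<^sup>2 * g (s * \<tau>))"
proof (cases "s = 0")
  case False
  then have s0: "s > 0" using s by simp
  have "((\<lambda>\<tau>. s * (\<tau>\<^sup>2 * g (s * \<tau>))) has_integral 1\<^sup>2 * f (s * 1) - 0\<^sup>2 * f (s * 0)) {0..1}"
  proof (rule fundamental_theorem_of_calculus_interior)
    show "continuous_on {0..1} (\<lambda>\<tau>. \<tau>\<^sup>2 * f (s * \<tau>))"
      by (auto intro!: continuous_intros continuous_on_compose2[OF cf] mult_le_one simp: s)
    fix \<tau> :: real assume t: "\<tau> \<in> {0<..<1}"
    have "s * \<tau> < s * 1" using t s0 by (intro mult_strict_left_mono) auto
    then have "s * \<tau> < 1" using s(2) by linarith
    moreover have "0 < s * \<tau>" using t s0 by simp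
    ultimately have st: "0 < s * \<tau>" "s * \<tau> < 1" by blast+
    have d1: "((\<lambda>\<tau>. f (s * \<tau>)) has_real_derivative (g (s * \<tau>) - 2 * f (s * \<tau>) / (s * \<tau>)) * s) (at \<tau>)"
      by (rule DERIV_chain2[where f=f and g="\<lambda>\<tau>. s * \<tau>", OF d[OF st]]) (auto intro!: derivative_eq_intros)
    have "((\<lambda>\<tau>. \<tau>\<^sup>2 * f (s * \<tau>)) has_real_derivative 2 * \<tau> * f (s * \<tau>) + (g (s * \<tau>) - 2 * f (s * \<tau>) / (s * \<tau>)) * s * \<tau>\<^sup>2) (at \<tau>)"
      by (rule DERIV_cong[OF DERIV_mult[OF DERIV_power[OF DERIV_ident, of 2] d1]]) simp
    moreover have "2 * \<tau> * f (s * \<tau>) + (g (s * \<tau>) - 2 * f (s * \<tau>) / (s * \<tau>)) * s * \<tau>\<^sup>2 = s * (\<tau>\<^sup>2 * g (s * \<tau>))"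
      using t s0 by (simp add: field_simps power2_eq_square)
    ultimately show "((\<lambda>\<tau>. \<tau>\<^sup>2 * f (s * \<tau>)) has_vector_derivative s * (\<tau>\<^sup>2 * g (s * \<tau>))) (at \<tau>)"
      by (simp add: has_real_derivative_iff_has_vector_derivative)
  qed simp
  from integral_unique[OF this] show ?thesis by simp
qed (simp add: f0)

lemma sgn_diff: fixes x y :: "'a::real_normed_vector" assumes "y \<noteq> 0" shows "norm (sgn x - sgn y) \<le> 2 * norm (x - y) / norm y"
proof -
  have "norm y *\<^sub>R (sgn x - sgn y) = (norm y - norm x) *\<^sub>R sgn x + (x - y)"
    using assms by (cases "x = 0") (simp_all add: sgn_div_norm algebra_simps)
  then have "norm y * norm (sgn x - sgn y) = norm ((norm y - norm x) *\<^sub>R sgn x + (x - y))"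
    by (metis norm_scaleR abs_norm_cancel)
  also have "\<dots> \<le> \<bar>norm y - norm x\<bar> * norm (sgn x) + norm (x - y)"
    by (metis norm_triangle_ineq norm_scaleR)
  also have "\<bar>norm y - norm x\<bar> * norm (sgn x) \<le> norm (x - y) * 1"
    using norm_triangle_ineq3[of y x] by (intro mult_mono) (auto simp: norm_sgn norm_minus_commute)
  finally show ?thesis using assms by (simp add: pos_le_divide_eq mult.commute)
qed

text \<open>The direction \<open>sgn x\<close> jumps at the origin, and the vanishing of
  \<open>K\<close> there compensates. If \<open>norm y\<close> is at most the distance
  \<open>d\<close>, then \<open>K (norm y)\<close> is of order \<open>d powr \<gamma>\<close>.
  Otherwise the directions differ by at most \<open>2 * d / norm y\<close>; replacing
  \<open>d / norm y\<close> by its power \<open>\<gamma>\<close> lets the factor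
  \<open>norm y powr \<gamma>\<close> cancel the denominator.\<close>

lemma radial_tensor_holder:
  fixes x y i j :: "'a::euclidean_space"
  assumes h: "holder_le \<gamma> a K" and K0: "K 0 = 0" and g: "0 < \<gamma>" "\<gamma> \<le> 1" and n: "norm x < 1" "norm y < 1"
    and ij: "i \<in> Basis" "j \<in> Basis"
  shows "\<bar>K (norm x) * ((sgn x \<bullet> i) * (sgn x \<bullet> j)) - K (norm y) * ((sgn y \<bullet> i) * (sgn y \<bullet> j))\<bar> \<le> 5 * a * dist x y powr \<gamma>"
    "\<bar>K (norm x) * ((sgn x \<bullet> i) * (sgn x \<bullet> j))\<bar> \<le> a"
proof -
  have a0: "a \<ge> 0" by (rule holder_le_nonneg[OF h])
  have c: "\<bar>sgn z \<bullet> k\<bar> \<le> 1" if "k \<in> Basis" for z k :: 'a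
  proof -
    have "\<bar>sgn z \<bullet> k\<bar> \<le> norm (sgn z)" by (rule Basis_le_norm[OF that])
    also have "\<dots> \<le> 1" by (simp add: norm_sgn)
    finally show ?thesis .
  qed
  define N where "N z = (sgn z \<bullet> i) * (sgn z \<bullet> j)" for z :: 'a
  have N: "\<bar>N z\<bar> \<le> 1" for z unfolding N_def abs_mult using c[OF ij(1), of z] c[OF ij(2), of z] by (intro mult_le_one) auto
  define d where "d = norm (x - y)"
  have d: "dist x y = d" "d \<ge> 0" by (auto simp: d_def dist_norm)
  have 1: "\<bar>K (norm x) - K (norm y)\<bar> \<le> a * d powr \<gamma>"
  proof -
    have "\<bar>K (norm x) - K (norm y)\<bar> \<le> a * \<bar>norm x - norm y\<bar> powr \<gamma>" using holder_leD(2)[OF h] n by simp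
    also have "\<dots> \<le> a * d powr \<gamma>" unfolding d_def using norm_triangle_ineq3[of x y] g a0 by (intro mult_left_mono powr_mono2) auto
    finally show ?thesis .
  qed
  have 2: "\<bar>K (norm y)\<bar> * \<bar>N x - N y\<bar> \<le> 4 * a * d powr \<gamma>"
  proof -
    have Ky: "\<bar>K (norm y)\<bar> \<le> a * norm y powr \<gamma>" using holder_leD(2)[OF h, of "norm y" 0] K0 n by simp
    show ?thesis
    proof (cases "norm y \<le> d")
      case True
      have "\<bar>K (norm y)\<bar> * \<bar>N x - N y\<bar> \<le> (a * d powr \<gamma>) * 2"
      proof (rule mult_mono)
        have "a * norm y powr \<gamma> \<le> a * d powr \<gamma>" using True g a0 by (intro mult_left_mono powr_mono2) auto
        with Ky show "\<bar>K (norm y)\<bar> \<le> a * d powr \<gamma>" by linarith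
        show "\<bar>N x - N y\<bar> \<le> 2" using N[of x] N[of y] unfolding abs_le_iff by linarith
      qed (use a0 in auto)
      moreover have "0 \<le> a * d powr \<gamma>" using a0 by simp
      ultimately show ?thesis by linarith
    next
      case False
      then have y: "norm y > 0" "d < norm y" using d by auto
      have q: "0 \<le> d / norm y" "d / norm y \<le> 1" using y d by auto
      have sd: "\<bar>sgn x \<bullet> k - sgn y \<bullet> k\<bar> \<le> 2 * (d / norm y)" if "k \<in> Basis" for k
      proof -
        have "\<bar>sgn x \<bullet> k - sgn y \<bullet> k\<bar> \<le> norm (sgn x - sgn y)" using Basis_le_norm[OF that, of "sgn x - sgn y"] by (simp add: inner_diff_left)
        also have "\<dots> \<le> 2 * (d / norm y)" using sgn_diff[of y x] y by (simp add: d_def)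
        finally show ?thesis .
      qed
      have "N x - N y = (sgn x \<bullet> i) * (sgn x \<bullet> j - sgn y \<bullet> j) + (sgn x \<bullet> i - sgn y \<bullet> i) * (sgn y \<bullet> j)"
        by (simp add: N_def algebra_simps)
      also have "\<bar>\<dots>\<bar> \<le> \<bar>sgn x \<bullet> i\<bar> * \<bar>sgn x \<bullet> j - sgn y \<bullet> j\<bar> + \<bar>sgn x \<bullet> i - sgn y \<bullet> i\<bar> * \<bar>sgn y \<bullet> j\<bar>"
        by (metis abs_triangle_ineq abs_mult)
      also have "\<dots> \<le> 1 * (2 * (d / norm y)) + (2 * (d / norm y)) * 1"
        by (intro add_mono mult_mono c sd ij) (use q in auto)
      finally have "\<bar>N x - N y\<bar> \<le> 4 * (d / norm y)" by simp
      also have "d / norm y \<le> (d / norm y) powr \<gamma>" using powr_mono'[of \<gamma> 1 "d / norm y"] q g d by simp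
      finally have "\<bar>N x - N y\<bar> \<le> 4 * (d / norm y) powr \<gamma>" by simp
      then have "\<bar>K (norm y)\<bar> * \<bar>N x - N y\<bar> \<le> (a * norm y powr \<gamma>) * (4 * (d / norm y) powr \<gamma>)"
        using Ky a0 by (intro mult_mono) auto
      also have "\<dots> = 4 * a * (norm y powr \<gamma> * (d / norm y) powr \<gamma>)" by simp
      also have "norm y powr \<gamma> * (d / norm y) powr \<gamma> = d powr \<gamma>" using y d by (simp add: powr_mult[symmetric])
      finally show ?thesis .
    qed
  qed
  have "K (norm x) * N x - K (norm y) * N y = (K (norm x) - K (norm y)) * N x + K (norm y) * (N x - N y)"
    by (simp add: algebra_simps)
  also have "\<bar>\<dots>\<bar> \<le> \<bar>K (norm x) - K (norm y)\<bar> * \<bar>N x\<bar> + \<bar>K (norm y)\<bar> * \<bar>N x - N y\<bar>"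
    by (metis abs_triangle_ineq abs_mult)
  also have "\<dots> \<le> a * d powr \<gamma> * 1 + 4 * a * d powr \<gamma>"
    by (intro add_mono mult_mono 1 2 N) (use a0 in auto)
  finally show "\<bar>K (norm x) * ((sgn x \<bullet> i) * (sgn x \<bullet> j)) - K (norm y) * ((sgn y \<bullet> i) * (sgn y \<bullet> j))\<bar> \<le> 5 * a * dist x y powr \<gamma>"
    by (simp add: N_def d algebra_simps)
  have "\<bar>K (norm x)\<bar> * \<bar>N x\<bar> \<le> a * 1" using holder_leD(1)[OF h, of "norm x"] n N by (intro mult_mono) (auto simp: a0)
  then show "\<bar>K (norm x) * ((sgn x \<bullet> i) * (sgn x \<bullet> j))\<bar> \<le> a" by (simp add: N_def abs_mult)
qed

text \<open>The constant is \<open>76 = 1 + 3 + 9 * (2 + 6)\<close>: \<open>2\<close> for the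
  suprema of the two Hessian terms, and \<open>6 = 1 + 5\<close> for their Hoelder
  seminorms.\<close>

lemma C2_holder_norm_radial:
  fixes f :: "real ^ 3 \<Rightarrow> real"
  assumes f: "\<And>x. norm x < 1 \<Longrightarrow> \<bar>f x\<bar> \<le> a"
    and d: "\<And>x i. norm x < 1 \<Longrightarrow> i \<in> Basis \<Longrightarrow> partial_deriv i f x = H (norm x) * (x \<bullet> i)"
    and dd: "\<And>x i j. norm x < 1 \<Longrightarrow> i \<in> Basis \<Longrightarrow> j \<in> Basis \<Longrightarrow> partial_deriv j (partial_deriv i f) x =
      H (norm x) * (i \<bullet> j) + K (norm x) * ((sgn x \<bullet> i) * (sgn x \<bullet> j))"
    and H: "holder_le \<gamma> a H" and K: "holder_le \<gamma> a K" "K 0 = 0" and g: "0 < \<gamma>" "\<gamma> \<le> 1"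
  shows "C2_holder_norm \<gamma> (ball 0 1) f \<le> 76 * a" "0 \<le> C2_holder_norm \<gamma> (ball 0 1) f"
proof -
  have a0: "a \<ge> 0" by (rule holder_le_nonneg[OF H])
  have n: "\<bar>partial_deriv i f x\<bar> \<le> a" if "norm x < 1" "i \<in> Basis" for x i
  proof -
    have "\<bar>H (norm x)\<bar> * \<bar>x \<bullet> i\<bar> \<le> a * 1"
      using holder_leD(1)[OF H, of "norm x"] Basis_le_norm[OF that(2), of x] that a0 by (intro mult_mono) auto
    then show ?thesis using d that by (simp add: abs_mult)
  qed
  have de: "\<bar>i \<bullet> j\<bar> \<le> 1" if "i \<in> Basis" "j \<in> Basis" for i j :: "real^3"
    using that by (simp add: inner_Basis)
  have n2: "\<bar>partial_deriv j (partial_deriv i f) x\<bar> \<le> 2 * a" if x: "norm x < 1" and ij: "i \<in> Basis" "j \<in> Basis" for x i j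
  proof -
    have "\<bar>H (norm x)\<bar> * \<bar>i \<bullet> j\<bar> \<le> a * 1" using holder_leD(1)[OF H, of "norm x"] x de[OF ij] a0 by (intro mult_mono) auto
    then have "\<bar>H (norm x) * (i \<bullet> j)\<bar> \<le> a" by (simp add: abs_mult)
    moreover have "\<bar>K (norm x) * ((sgn x \<bullet> i) * (sgn x \<bullet> j))\<bar> \<le> a" by (rule radial_tensor_holder(2)[OF K g x x ij])
    ultimately show ?thesis unfolding dd[OF x ij] unfolding abs_le_iff by linarith
  qed
  have h: "\<bar>partial_deriv j (partial_deriv i f) x - partial_deriv j (partial_deriv i f) y\<bar> \<le> (6 * a) * dist x y powr \<gamma>"
    if x: "norm x < 1" "norm y < 1" and ij: "i \<in> Basis" "j \<in> Basis" for x y i j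
  proof -
    have "\<bar>H (norm x) - H (norm y)\<bar> \<le> a * \<bar>norm x - norm y\<bar> powr \<gamma>" using holder_leD(2)[OF H] x by simp
    also have "\<dots> \<le> a * dist x y powr \<gamma>" unfolding dist_norm using norm_triangle_ineq3[of x y] g a0 by (intro mult_left_mono powr_mono2) auto
    finally have "\<bar>H (norm x) - H (norm y)\<bar> * \<bar>i \<bullet> j\<bar> \<le> (a * dist x y powr \<gamma>) * 1" using de[OF ij] a0 by (intro mult_mono) auto
    then have 1: "\<bar>H (norm x) * (i \<bullet> j) - H (norm y) * (i \<bullet> j)\<bar> \<le> a * dist x y powr \<gamma>" by (simp add: abs_mult left_diff_distrib[symmetric])
    show ?thesis unfolding dd[OF x(1) ij] dd[OF x(2) ij]
      using 1 radial_tensor_holder(1)[OF K g x ij] unfolding abs_le_iff by (simp add: algebra_simps)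
  qed
  show "C2_holder_norm \<gamma> (ball 0 1) f \<le> 76 * a" "0 \<le> C2_holder_norm \<gamma> (ball 0 1) f"
    using C2_holder_norm_bounds(1,2)[of f a a "2 * a" "6 * a" \<gamma>] f n n2 h by auto
qed

section \<open>Gradient and Hessian of the scaled density, and the initial data\<close>

context bubble_solution
begin

text \<open>Equals \<open>U_ss - U_s / s\<close>, the coefficient of the tensor of
  \<open>sgn x\<close> with itself in the Hessian.\<close>

definition "K s t = Ul s t - 3 * H s t"

lemma cont_space:
  assumes "t \<ge> 0"
  shows "continuous_on {0..1} (\<lambda>s. U s t)" "continuous_on {0..1} (\<lambda>s. Us s t)" "continuous_on {0..1} (\<lambda>s. Uss s t)"
    "continuous_on {0..1} (\<lambda>s. Ul s t)" "continuous_on {0..1} (\<lambda>s. H s t)" "continuous_on {0..1} (\<lambda>s. L s t)"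
    "continuous_on {0..1} (\<lambda>s. Ls s t)" "continuous_on {0..1} (\<lambda>s. LL s t)"
proof -
  have "continuous_on {0..1} (\<lambda>s. F s t)" if "continuous_on ({0..1} \<times> {0..}) (\<lambda>(s, t). F s t)" for F :: "real \<Rightarrow> real \<Rightarrow> real"
    by (rule cont_pair[OF that]) (use assms in \<open>auto intro!: continuous_intros\<close>)
  from this[OF contU] this[OF contUs] this[OF Uss(1)] this[OF contUl] this[OF contH] this[OF contL(1)] this[OF contL(2)] this[OF contL(3)]
  show "continuous_on {0..1} (\<lambda>s. U s t)" "continuous_on {0..1} (\<lambda>s. Us s t)" "continuous_on {0..1} (\<lambda>s. Uss s t)"
    "continuous_on {0..1} (\<lambda>s. Ul s t)" "continuous_on {0..1} (\<lambda>s. H s t)" "continuous_on {0..1} (\<lambda>s. L s t)"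
    "continuous_on {0..1} (\<lambda>s. Ls s t)" "continuous_on {0..1} (\<lambda>s. LL s t)" .
qed

lemma H_0: "H 0 t = Uss 0 t" by (simp add: H_def)

text \<open>Expresses \<open>H\<close> by the Laplacian instead of the full second derivative, so
  that a Hoelder bound for \<open>Ul\<close> alone controls the Hessian. At the centre, where
  division by \<open>s\<close> fails, \<open>Ul\<close> is \<open>3 * Uss\<close>.\<close>

lemma H_average:
  assumes t: "t \<ge> 0" and s: "0 \<le> s" "s \<le> 1"
  shows "H s t = integral {0..1} (\<lambda>\<tau>. \<tau>\<^sup>2 * Ul (s * \<tau>) t)"
proof (cases "s = 0")
  case True
  have "((\<lambda>\<tau>. \<tau>\<^sup>2 * (3 * Uss 0 t)) has_integral 1 ^ 3 * Uss 0 t - 0 ^ 3 * Uss 0 t) {0..1}"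
    by (rule fundamental_theorem_of_calculus)
      (auto intro!: derivative_eq_intros simp: has_real_derivative_iff_has_vector_derivative[symmetric])
  from integral_unique[OF this] show ?thesis unfolding True by (simp add: H_0 Ul_def)
next
  case False
  have "Us s t = s * integral {0..1} (\<lambda>\<tau>. \<tau>\<^sup>2 * Ul (s * \<tau>) t)"
    by (rule radial_gradient_average[OF cont_space(2)[OF t] _ dUs[OF t] s]) (simp_all add: Us_def)
  then show ?thesis using False by (simp add: Us_def)
qed

lemma Ls_average:
  assumes t: "t \<ge> 0" and s: "0 \<le> s" "s \<le> 1"
  shows "Ls s t = s * integral {0..1} (\<lambda>\<tau>. \<tau>\<^sup>2 * LL (s * \<tau>) t)"
  by (rule radial_gradient_average[OF cont_space(7)[OF t] _ dLs'(2)[OF t] s]) (simp_all add: Ls_def Us_def)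

lemma dH: assumes "t \<ge> 0" "0 < s" "s < 1" shows "((\<lambda>s. H s t) has_real_derivative K s t / s) (at s)"
proof -
  have "((\<lambda>s. Us s t / s) has_real_derivative ((Ul s t - 2 * Us s t / s) * s - Us s t * 1) / (s * s)) (at s)"
    by (rule DERIV_divide[OF dUs[OF assms] DERIV_ident]) (use assms in simp)
  moreover have "((Ul s t - 2 * Us s t / s) * s - Us s t * 1) / (s * s) = K s t / s"
    using assms by (simp add: K_def Us_def field_simps)
  ultimately have "((\<lambda>s. Us s t / s) has_real_derivative K s t / s) (at s)" by simp
  then show ?thesis
    by (rule has_field_derivative_transform_within_open[of _ _ _ "{0<..<1}"]) (use assms in \<open>auto simp: Us_def\<close>)
qed

lemma norm_deriv: "x \<noteq> 0 \<Longrightarrow> (norm has_derivative (\<lambda>h. h \<bullet> sgn x)) (at (x::real^3))"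
  using GDERIV_norm[of x] unfolding gderiv_def .

lemma u_gradient:
  assumes t: "t \<ge> 0" and x: "norm x < 1"
  shows "partial_deriv i (\<lambda>x. u x t) x = H (norm x) t * (x \<bullet> i)"
proof (cases "x = 0")
  case True
  then show ?thesis using partial_deriv_0[OF t] by simp
next
  case False
  have "((\<lambda>x. U (norm x) t) has_derivative (\<lambda>h. (h \<bullet> sgn x) * Us (norm x) t)) (at x)"
    by (rule DERIV_compose_FDERIV[OF dU[OF t] norm_deriv]) (use x False in auto)
  from partial_deriv_eqI[OF this, of i] show ?thesis using False
    by (simp add: u_def U_def Us_def sgn_div_norm inner_commute)
qed

lemma u_hessian:
  assumes t: "t \<ge> 0" and x: "norm x < 1" and ij: "i \<in> Basis" "j \<in> Basis"
  shows "partial_deriv j (partial_deriv i (\<lambda>x. u x t)) x =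
    H (norm x) t * (i \<bullet> j) + K (norm x) t * ((sgn x \<bullet> i) * (sgn x \<bullet> j))"
proof (cases "x = 0")
  case False
  have "((\<lambda>y. H (norm y) t) has_derivative (\<lambda>h. (h \<bullet> sgn x) * (K (norm x) t / norm x))) (at x)"
    by (rule DERIV_compose_FDERIV[OF dH[OF t] norm_deriv]) (use x False in auto)
  then have "((\<lambda>y. H (norm y) t * (y \<bullet> i)) has_derivative
      (\<lambda>h. H (norm x) t * (h \<bullet> i) + (h \<bullet> sgn x) * (K (norm x) t / norm x) * (x \<bullet> i))) (at x)"
    by (rule has_derivative_mult) (auto intro!: derivative_eq_intros)
  from partial_deriv_eqI[OF this, of j]
  have "partial_deriv j (\<lambda>y. H (norm y) t * (y \<bullet> i)) x = H (norm x) t * (j \<bullet> i) + (j \<bullet> sgn x) * (K (norm x) t / norm x) * (x \<bullet> i)" .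
  moreover have "partial_deriv j (partial_deriv i (\<lambda>x. u x t)) x = partial_deriv j (\<lambda>y. H (norm y) t * (y \<bullet> i)) x"
    by (rule partial_deriv_cong_open[of "ball 0 1"]) (use x u_gradient[OF t] in auto)
  ultimately show ?thesis using False by (simp add: sgn_div_norm inner_commute divide_inverse)
next
  \<comment> \<open>At the origin the norm is not differentiable. The derivative is taken along the
    line of \<open>j\<close>, where the gradient is \<open>H\<close> times a linear function and
    continuity of \<open>H\<close> suffices.\<close>
  case True
  have c: "continuous_on UNIV (\<lambda>z. H (min \<bar>z\<bar> 1) t)"
    by (rule continuous_on_compose2[OF cont_space(5)[OF t]]) (auto intro!: continuous_intros)
  have "((\<lambda>s. H (min \<bar>s\<bar> 1) t * (i \<bullet> j) * s) has_real_derivative H 0 t * (i \<bullet> j)) (at 0)"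
    unfolding DERIV_caratheodory_within
  proof (intro exI[of _ "\<lambda>s. H (min \<bar>s\<bar> 1) t * (i \<bullet> j)"] conjI allI)
    show "isCont (\<lambda>s. H (min \<bar>s\<bar> 1) t * (i \<bullet> j)) 0"
      using c by (intro continuous_intros) (simp add: continuous_on_eq_continuous_at)
  qed auto
  then have 1: "((\<lambda>s. partial_deriv i (\<lambda>x. u x t) (s *\<^sub>R j)) has_real_derivative H 0 t * (i \<bullet> j)) (at 0)"
  proof (rule has_field_derivative_transform_within_open[of _ _ _ "{-1<..<1}"])
    fix s :: real assume s: "s \<in> {-1<..<1}"
    show "H (min \<bar>s\<bar> 1) t * (i \<bullet> j) * s = partial_deriv i (\<lambda>x. u x t) (s *\<^sub>R j)"
      using u_gradient[OF t, of "s *\<^sub>R j" i] s ij by (auto simp: inner_commute min_def)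
  qed auto
  have "((\<lambda>s. partial_deriv i (\<lambda>x. u x t) (s *\<^sub>R j)) has_real_derivative partial_deriv j (partial_deriv i (\<lambda>x. u x t)) 0) (at 0)"
    using line_deriv[OF u_diff2, of t 0 j i] t ij by simp
  from DERIV_unique[OF this 1] show ?thesis using True by simp
qed

lemma K_0: "K 0 t = 0" by (simp add: K_def Ul_def H_0)

lemma state_dist_eq:
  "state_dist \<alpha> (\<lambda>r. \<rho> r t, R t, V) (\<lambda>_. c, b, 0) = C2_holder_norm (2 * \<alpha>) (ball 0 1) (\<lambda>x. u x t - c) + \<bar>R t - b\<bar> + \<bar>V\<bar>"
  by (simp add: state_dist_def u_def)

lemma initial_state_dist_eq:
  "state_dist \<alpha> (\<rho>0, R0, V0) (\<lambda>_. c, b, 0) = C2_holder_norm (2 * \<alpha>) (ball 0 1) (\<lambda>x. u x 0 - c) + \<bar>R 0 - b\<bar> + \<bar>R1 0\<bar>"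
proof -
  have "C2_holder_norm (2 * \<alpha>) (ball 0 1) (\<lambda>y::real^3. \<rho>0 (R0 * norm y) - c) = C2_holder_norm (2 * \<alpha>) (ball 0 1) (\<lambda>x. u x 0 - c)"
  proof (rule C2_holder_norm_cong)
    fix y :: "real^3" assume "y \<in> ball 0 1"
    then have "R0 * norm y \<in> {0..R0}" using Rpos[of 0] init(2) by (auto intro!: mult_left_le)
    from init(1)[OF this] show "\<rho>0 (R0 * norm y) - c = u y 0 - c" by (simp add: u_def init(2))
  qed simp
  then show ?thesis using init by (simp add: state_dist_def R1_def)
qed

text \<open>A bound on a real supremum gives pointwise bounds only for bounded sets, which the
  parabolic class at time zero secures. The estimates along the ray of \<open>e1\<close> extend to
  the wall by continuity, and the factor \<open>3 = 1 + 2\<close> comes from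
  \<open>Ul = Uss + 2 * H\<close>.\<close>

lemma initial_bounds:
  assumes d: "state_dist \<alpha> (\<rho>0, R0, V0) (\<lambda>_. c, b, 0) \<le> \<eta>" and s: "0 \<le> s" "s \<le> 1"
  shows "\<bar>U s 0 - c\<bar> \<le> \<eta>" "\<bar>Ul s 0\<bar> \<le> 3 * \<eta>" "\<bar>Us s 0\<bar> \<le> \<eta>" "\<bar>R 0 - b\<bar> \<le> \<eta>" "\<bar>R1 0\<bar> \<le> \<eta>"
proof -
  define w where "w x = u x 0 - c" for x
  have pw: "partial_deriv i w = partial_deriv i (\<lambda>x. u x 0)" for i unfolding w_def by (rule partial_deriv_diff_const)
  have bd: "\<exists>a. \<forall>s\<in>{0..1}. \<bar>f s\<bar> \<le> a" if "continuous_on {0..1} f" for f :: "real \<Rightarrow> real"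
    using compact_imp_bounded[OF compact_continuous_image[OF that]] unfolding bounded_iff by auto
  obtain a0 where a0: "\<forall>s\<in>{0..1}. \<bar>U s 0 - c\<bar> \<le> a0" 
    using bd[OF continuous_on_diff[OF cont_space(1)[OF order_refl] continuous_on_const]] by blast
  obtain a1 where a1: "\<forall>s\<in>{0..1}. \<bar>Us s 0\<bar> \<le> a1" using bd[OF cont_space(2)[OF order_refl]] by blast
  have "\<exists>C. \<forall>x y. norm x < 1 \<and> norm y < 1 \<longrightarrow>
      \<bar>partial_deriv j (partial_deriv i w) x - partial_deriv j (partial_deriv i w) y\<bar> \<le> C * dist x y powr (2 * \<alpha>)"
    if ij: "i \<in> Basis" "j \<in> Basis" for i j
  proof -
    have "parabolic_holder_on \<alpha> (ball 0 1 \<times> {0..1}) (\<lambda>(x, t). partial_deriv j (partial_deriv i (\<lambda>x. u x t)) x)"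
      using pc ij unfolding parabolic_C2_holder_def by simp
    then obtain C where C: "\<And>z z'. z \<in> ball 0 1 \<times> {0..1} \<Longrightarrow> z' \<in> ball 0 1 \<times> {0..1} \<Longrightarrow>
      \<bar>partial_deriv j (partial_deriv i (\<lambda>x. u x (snd z))) (fst z) - partial_deriv j (partial_deriv i (\<lambda>x. u x (snd z'))) (fst z')\<bar>
        \<le> C * (dist (fst z) (fst z') powr (2 * \<alpha>) + \<bar>snd z - snd z'\<bar> powr \<alpha>)"
      unfolding parabolic_holder_on_def split_beta fst_conv snd_conv by blast
    show ?thesis unfolding pw
    proof (intro exI[of _ C] allI impI)
      fix x y :: "real^3" assume "norm x < 1 \<and> norm y < 1"
      then show "\<bar>partial_deriv j (partial_deriv i (\<lambda>x. u x 0)) x - partial_deriv j (partial_deriv i (\<lambda>x. u x 0)) y\<bar> \<le> C * dist x y powr (2 * \<alpha>)"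
        using C[of "(x, 0)" "(y, 0)"] by simp
    qed
  qed
  then obtain C where C: "\<And>i j x y. i \<in> Basis \<Longrightarrow> j \<in> Basis \<Longrightarrow> norm x < 1 \<Longrightarrow> norm y < 1 \<Longrightarrow>
      \<bar>partial_deriv j (partial_deriv i w) x - partial_deriv j (partial_deriv i w) y\<bar> \<le> C i j * dist x y powr (2 * \<alpha>)"
    by metis
  define a3 where "a3 = Max ((\<lambda>(i, j). C i j) ` (Basis \<times> Basis))"
  have a3: "C i j \<le> a3" if "i \<in> Basis" "j \<in> Basis" for i j
    unfolding a3_def by (rule Max_ge) (use that in auto)
  define a2 where "a2 = Max ((\<lambda>(i, j). \<bar>partial_deriv j (partial_deriv i w) 0\<bar> + \<bar>C i j\<bar>) ` (Basis \<times> Basis))"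
  have a2: "\<bar>partial_deriv j (partial_deriv i w) 0\<bar> + \<bar>C i j\<bar> \<le> a2" if "i \<in> Basis" "j \<in> Basis" for i j
    unfolding a2_def by (rule Max_ge) (use that in auto)
  have b0: "\<bar>w x\<bar> \<le> a0" if "norm x < 1" for x using a0 that by (auto simp: w_def u_def U_def)
  have b1: "\<bar>partial_deriv i w x\<bar> \<le> a1" if "norm x < 1" "i \<in> Basis" for x i
  proof -
    have "\<bar>partial_deriv i w x\<bar> = \<bar>H (norm x) 0\<bar> * \<bar>x \<bullet> i\<bar>" unfolding pw using u_gradient[OF order_refl that(1)] by (simp add: abs_mult)
    also have "\<dots> \<le> \<bar>H (norm x) 0\<bar> * norm x" using Basis_le_norm[OF that(2)] by (intro mult_left_mono) auto
    also have "\<dots> = \<bar>Us (norm x) 0\<bar>" by (simp add: Us_def abs_mult)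
    also have "\<dots> \<le> a1" using a1 that by simp
    finally show ?thesis .
  qed
  have b3: "\<bar>partial_deriv j (partial_deriv i w) x - partial_deriv j (partial_deriv i w) y\<bar> \<le> a3 * dist x y powr (2 * \<alpha>)"
    if "norm x < 1" "norm y < 1" "i \<in> Basis" "j \<in> Basis" for x y i j
    using C[OF that(3,4,1,2)] mult_right_mono[OF a3[OF that(3,4)], of "dist x y powr (2 * \<alpha>)"] by simp
  have b2: "\<bar>partial_deriv j (partial_deriv i w) x\<bar> \<le> a2" if "norm x < 1" "i \<in> Basis" "j \<in> Basis" for x i j
  proof -
    have "C i j * dist x 0 powr (2 * \<alpha>) \<le> \<bar>C i j\<bar> * 1"
    proof (rule mult_mono)
      show "dist x 0 powr (2 * \<alpha>) \<le> 1" using that(1) al by (intro powr_le1) auto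
    qed auto
    then show ?thesis using C[OF that(2,3,1), of 0] a2[OF that(2,3)]
        abs_triangle_ineq2[of "partial_deriv j (partial_deriv i w) x" "partial_deriv j (partial_deriv i w) 0"] by simp
  qed
  note N = C2_holder_norm_bounds[of w a0 a1 a2 a3 "2 * \<alpha>", OF b0 b1 b2 b3]
  have dn: "C2_holder_norm (2 * \<alpha>) (ball 0 1) w + \<bar>R 0 - b\<bar> + \<bar>R1 0\<bar> \<le> \<eta>"
    using d unfolding initial_state_dist_eq w_def .
  have n0: "0 \<le> C2_holder_norm (2 * \<alpha>) (ball 0 1) w" by (rule N(2)) auto
  then have n: "C2_holder_norm (2 * \<alpha>) (ball 0 1) w \<le> \<eta>" using dn by linarith
  show "\<bar>R 0 - b\<bar> \<le> \<eta>" "\<bar>R1 0\<bar> \<le> \<eta>" using dn n0 by linarith+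
  have n3: "\<bar>w x\<bar> \<le> \<eta>" if "norm x < 1" for x
  proof -
    have "\<bar>w x\<bar> \<le> C2_holder_norm (2 * \<alpha>) (ball 0 1) w" by (rule N(3)) (use that in auto)
    with n show ?thesis by linarith
  qed
  have n4: "\<bar>partial_deriv e1 (partial_deriv e1 w) x\<bar> \<le> \<eta>" if "norm x < 1" for x
  proof -
    have "\<bar>partial_deriv e1 (partial_deriv e1 w) x\<bar> \<le> C2_holder_norm (2 * \<alpha>) (ball 0 1) w" by (rule N(4)) (use that e1 in auto)
    with n show ?thesis by linarith
  qed
  have ext: "\<bar>f s\<bar> \<le> \<eta>" if "continuous_on {0..1} f" "\<And>s. 0 \<le> s \<Longrightarrow> s < 1 \<Longrightarrow> \<bar>f s\<bar> \<le> \<eta>" "0 \<le> s" "s \<le> 1" for f :: "real \<Rightarrow> real" and s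
  proof -
    have cl: "closure {0..<1} = {0..1::real}" by simp
    show ?thesis
      by (rule continuous_le_on_closure[of "{0..<1}" "\<lambda>s. \<bar>f s\<bar>"]) (use that in \<open>auto simp: cl intro!: continuous_intros\<close>)
  qed
  show "\<bar>U s 0 - c\<bar> \<le> \<eta>"
  proof (rule ext[of "\<lambda>s. U s 0 - c"])
    show "continuous_on {0..1} (\<lambda>s. U s 0 - c)" by (intro continuous_intros cont_space) simp
    show "\<bar>U s 0 - c\<bar> \<le> \<eta>" if "0 \<le> s" "s < 1" for s
      using n3[of "s *\<^sub>R e1"] that e1 by (simp add: w_def u_ray)
  qed (use s in auto)
  have ss: "\<bar>Uss s 0\<bar> \<le> \<eta>" if "0 \<le> s" "s \<le> 1" for s
  proof (rule ext[of "\<lambda>s. Uss s 0"])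
    show "continuous_on {0..1} (\<lambda>s. Uss s 0)" by (rule cont_space) simp
    show "\<bar>Uss s 0\<bar> \<le> \<eta>" if "0 \<le> s" "s < 1" for s
      using n4[of "s *\<^sub>R e1"] that e1 Uss(2)[OF that, of 0] by (simp add: g2_def pw)
  qed (use that in auto)
  have h: "\<bar>H s 0\<bar> \<le> \<eta>"
  proof -
    have i: "(\<lambda>\<tau>. Uss (s * \<tau>) 0) integrable_on {0..1}"
      by (rule integrable_continuous_interval)
        (use s in \<open>auto intro!: continuous_intros continuous_on_compose2[OF cont_space(3)] mult_le_one\<close>)
    have "norm (integral {0..1} (\<lambda>\<tau>. Uss (s * \<tau>) 0)) \<le> integral {0..1} (\<lambda>\<tau>::real. \<eta>)"
      by (rule integral_norm_bound_integral[OF i]) (use ss s in \<open>auto simp: mult_le_one\<close>)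
    then show ?thesis by (simp add: H_def)
  qed
  show "\<bar>Ul s 0\<bar> \<le> 3 * \<eta>" using ss[OF s] h unfolding Ul_def abs_le_iff by linarith
  have "s * \<bar>H s 0\<bar> \<le> 1 * \<eta>" using s h by (intro mult_mono) auto
  then show "\<bar>Us s 0\<bar> \<le> \<eta>" using s by (simp add: Us_def abs_mult)
qed

end

section \<open>Convergence in the full norm\<close>

lemma holder_le_cong: "holder_le \<gamma> a f \<Longrightarrow> (\<And>s. 0 \<le> s \<Longrightarrow> s \<le> 1 \<Longrightarrow> f s = g s) \<Longrightarrow> holder_le \<gamma> a g"
  unfolding holder_le_def by simp

lemma exp_close_1: fixes x :: real assumes "\<bar>x\<bar> \<le> 1 / 2" shows "\<bar>exp x - 1\<bar> \<le> 2 * \<bar>x\<bar>"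
proof -
  have "exp x \<le> 1 + 2 * \<bar>x\<bar>" using exp_bound_lemma[of x] assms by simp
  moreover have "1 - \<bar>x\<bar> \<le> exp x" using exp_ge_add_one_self[of x] abs_ge_minus_self[of x] by linarith
  ultimately show ?thesis unfolding abs_le_iff using abs_ge_zero[of x] by linarith
qed

lemma ln_close: fixes x c :: real assumes "c > 0" "\<bar>x - c\<bar> \<le> \<eta>" "\<eta> \<le> c / 2" shows "\<bar>ln x - ln c\<bar> \<le> 2 * \<eta> / c"
proof -
  have x: "x \<ge> c / 2" "x > 0" using assms by (auto simp: abs_le_iff)
  have "ln x - ln c \<le> (x - c) / c" using ln_diff_le[of x c] x assms by simp
  also have "\<dots> \<le> \<eta> / c" using assms by (intro divide_right_mono) auto
  also have "\<eta> / c \<le> 2 * \<eta> / c" using assms by (intro divide_right_mono) auto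
  finally have 1: "ln x - ln c \<le> 2 * \<eta> / c" .
  have "ln c - ln x \<le> (c - x) / x" using ln_diff_le[of c x] x assms by simp
  also have "\<dots> \<le> \<eta> / x" using assms x by (intro divide_right_mono) (auto simp: abs_le_iff)
  also have "\<dots> \<le> \<eta> / (c / 2)" using x assms by (intro divide_left_mono) auto
  finally have 2: "ln c - ln x \<le> 2 * \<eta> / c" by (simp add: mult.commute)
  show ?thesis using 1 2 unfolding abs_le_iff by linarith
qed

context bubble_solution
begin

text \<open>The bound on \<open>LL\<close> is passed on: \<open>Ls\<close> is an average of
  \<open>LL\<close>, \<open>Ul\<close> is \<open>U * (LL + Ls\<^sup>2)\<close>, \<open>H\<close> is
  an average of \<open>Ul\<close>, and \<open>K\<close> is \<open>Ul - 3 * H\<close>. The constant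
  is \<open>21888 = 76 * 288\<close> with \<open>288 = 4 * 72\<close> and
  \<open>72 = 2 * 4 * 9\<close>.\<close>

lemma profile_norm_le:
  assumes t: "t \<ge> 0" and c: "c > 0" and al2: "2 * \<alpha> \<le> 1" and e: "0 < \<epsilon>" "\<epsilon> \<le> 1"
    and L: "\<And>s. 0 \<le> s \<Longrightarrow> s \<le> 1 \<Longrightarrow> \<bar>L s t - ln c\<bar> \<le> \<epsilon> / 2" and LL: "holder_le (2 * \<alpha>) \<epsilon> (\<lambda>s. LL s t)"
  shows "C2_holder_norm (2 * \<alpha>) (ball 0 1) (\<lambda>x. u x t - c) \<le> 21888 * c * \<epsilon>"
    "0 \<le> C2_holder_norm (2 * \<alpha>) (ball 0 1) (\<lambda>x. u x t - c)"
proof -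
  let ?g = "2 * \<alpha>"
  have g: "0 < ?g" "?g \<le> 1" using al al2 by auto
  have U: "\<bar>U s t - c\<bar> \<le> c * \<epsilon>" if s: "0 \<le> s" "s \<le> 1" for s
  proof -
    have "U s t = c * exp (L s t - ln c)" using Upos[OF t s] c by (simp add: L_def exp_diff)
    then have "U s t - c = c * (exp (L s t - ln c) - 1)" by (simp add: right_diff_distrib)
    then have "\<bar>U s t - c\<bar> = c * \<bar>exp (L s t - ln c) - 1\<bar>" using c by (simp add: abs_mult)
    also have "\<dots> \<le> c * \<epsilon>"
      using exp_close_1[of "L s t - ln c"] L[OF s] e c by (intro mult_left_mono) auto
    finally show ?thesis .
  qed
  have U2: "\<bar>U s t\<bar> \<le> 2 * c" if s: "0 \<le> s" "s \<le> 1" for s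
  proof -
    have "c * \<epsilon> \<le> c * 1" using e c by (intro mult_left_mono) auto
    with U[OF s] show ?thesis unfolding abs_le_iff by linarith
  qed
  have id: "holder_le ?g 1 (\<lambda>s. s)"
    by (rule holder_le_C1[where f'="\<lambda>_. 1"]) (use g in \<open>auto intro!: derivative_eq_intros continuous_intros\<close>)
  have "holder_le ?g (2 * \<epsilon>) (\<lambda>s. s * integral {0..1} (\<lambda>\<tau>. \<tau>\<^sup>2 * LL (s * \<tau>) t))"
    using holder_le_mult[OF id holder_le_average[OF LL cont_space(8)[OF t] g(1)]] by simp
  then have Ls: "holder_le ?g (2 * \<epsilon>) (\<lambda>s. Ls s t)"
    by (rule holder_le_cong) (simp add: Ls_average[OF t])
  have hU: "holder_le ?g (4 * c) (\<lambda>s. U s t)"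
  proof (rule holder_le_C1[OF cont_space(1)[OF t] dU[OF t] _ _ g])
    show "\<bar>U s t\<bar> \<le> 4 * c" if "0 \<le> s" "s \<le> 1" for s using U2[OF that] c by linarith
    show "\<bar>Us s t\<bar> \<le> 4 * c" if s: "0 < s" "s < 1" for s
    proof -
      have "Us s t = U s t * Ls s t" using Upos[OF t, of s] s by (simp add: Ls_def)
      then have "\<bar>Us s t\<bar> = \<bar>U s t\<bar> * \<bar>Ls s t\<bar>" by (simp add: abs_mult)
      also have "\<dots> \<le> (2 * c) * (2 * \<epsilon>)" using U2[of s] holder_leD(1)[OF Ls, of s] s c by (intro mult_mono) auto
      also have "\<dots> \<le> (2 * c) * (2 * 1)" using e c by (intro mult_left_mono) auto
      finally show ?thesis by simp
    qed
  qed
  have "holder_le ?g (\<epsilon> + 2 * (2 * \<epsilon>) * (2 * \<epsilon>)) (\<lambda>s. LL s t + Ls s t * Ls s t)"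
    by (intro holder_le_add holder_le_mult LL Ls)
  moreover have "\<epsilon> + 2 * (2 * \<epsilon>) * (2 * \<epsilon>) \<le> 9 * \<epsilon>" using mult_left_mono[OF e(2), of \<epsilon>] e by simp
  ultimately have "holder_le ?g (9 * \<epsilon>) (\<lambda>s. LL s t + Ls s t * Ls s t)" by (rule holder_le_mono)
  from holder_le_mult[OF hU this] have "holder_le ?g (72 * c * \<epsilon>) (\<lambda>s. U s t * (LL s t + Ls s t * Ls s t))"
    by (simp add: mult.assoc)
  then have hUl: "holder_le ?g (72 * c * \<epsilon>) (\<lambda>s. Ul s t)"
    by (rule holder_le_cong) (use Upos[OF t] in \<open>auto simp: LL_def Ls_def field_simps power2_eq_square less_imp_neq[symmetric]\<close>)
  have hH: "holder_le ?g (72 * c * \<epsilon>) (\<lambda>s. H s t)"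
    by (rule holder_le_cong[OF holder_le_average[OF hUl cont_space(4)[OF t] g(1)]]) (simp add: H_average[OF t])
  have "holder_le ?g (72 * c * \<epsilon> + \<bar>- 3\<bar> * (72 * c * \<epsilon>)) (\<lambda>s. Ul s t + (- 3) * H s t)"
    by (intro holder_le_add holder_le_cmult hUl hH)
  moreover have "72 * c * \<epsilon> + \<bar>- 3\<bar> * (72 * c * \<epsilon>) = 288 * c * \<epsilon>" by simp
  moreover have "(\<lambda>s. Ul s t + (- 3) * H s t) = (\<lambda>s. K s t)" by (simp add: K_def)
  ultimately have hK: "holder_le ?g (288 * c * \<epsilon>) (\<lambda>s. K s t)" by (simp only:)
  have hH': "holder_le ?g (288 * c * \<epsilon>) (\<lambda>s. H s t)" by (rule holder_le_mono[OF hH]) (use c e in simp)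
  have fb: "\<bar>u x t - c\<bar> \<le> 288 * c * \<epsilon>" if "norm x < 1" for x
  proof -
    have "\<bar>u x t - c\<bar> \<le> c * \<epsilon>" using U[of "norm x"] that by (simp add: u_def U_def)
    also have "\<dots> \<le> 288 * c * \<epsilon>" using c e by simp
    finally show ?thesis .
  qed
  have N: "C2_holder_norm ?g (ball 0 1) (\<lambda>x. u x t - c) \<le> 76 * (288 * c * \<epsilon>) \<and> 0 \<le> C2_holder_norm ?g (ball 0 1) (\<lambda>x. u x t - c)"
    by (rule conjI; rule C2_holder_norm_radial[of "\<lambda>x. u x t - c" _ "\<lambda>s. H s t" "\<lambda>s. K s t", unfolded partial_deriv_diff_const,
          OF fb u_gradient[OF t] u_hessian[OF t] hH' hK K_0 g]; assumption)
  then show "C2_holder_norm ?g (ball 0 1) (\<lambda>x. u x t - c) \<le> 21888 * c * \<epsilon>" "0 \<le> C2_holder_norm ?g (ball 0 1) (\<lambda>x. u x t - c)"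
    by simp_all
qed

lemma state_dist_tendsto:
  assumes c: "c > 0" and al2: "2 * \<alpha> < \<beta>" "\<beta> \<le> 1"
    and L: "unif_0 (\<lambda>s t. L s t - ln c)" and LL: "unif_0 LL" and C: "C > 0"
    and hLL: "\<And>t s1 s2. t \<ge> 2 \<Longrightarrow> 0 \<le> s1 \<Longrightarrow> s1 \<le> 1 \<Longrightarrow> 0 \<le> s2 \<Longrightarrow> s2 \<le> 1 \<Longrightarrow>
      \<bar>LL s1 t - LL s2 t\<bar> \<le> C * \<bar>s1 - s2\<bar> powr \<beta>"
    and R: "(R \<longlongrightarrow> b) at_top" and R1: "(R1 \<longlongrightarrow> 0) at_top"
  shows "((\<lambda>t. state_dist \<alpha> (\<lambda>r. \<rho> r t, R t, R1 t) (\<lambda>_. c, b, 0)) \<longlongrightarrow> 0) at_top"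
proof -
  let ?N = "\<lambda>t. C2_holder_norm (2 * \<alpha>) (ball 0 1) (\<lambda>x. u x t - c)"
  have "(?N \<longlongrightarrow> 0) at_top"
  proof (rule tendstoI)
    fix d :: real assume d: "d > 0"
    \<comment> \<open>\<open>43776 = 2 * 21888\<close>, so that the profile bound stays strictly
      below \<open>d\<close>.\<close>
    define \<epsilon> where "\<epsilon> = min 1 (d / (43776 * c))"
    have e: "0 < \<epsilon>" "\<epsilon> \<le> 1" "\<epsilon> \<le> d / (43776 * c)" using c d by (auto simp: \<epsilon>_def)
    have "21888 * c * \<epsilon> \<le> 21888 * c * (d / (43776 * c))" using e c by (intro mult_left_mono) auto
    also have "\<dots> < d" using c d by (simp add: field_simps)
    finally have ed: "21888 * c * \<epsilon> < d" .
    have g0: "0 < 2 * \<alpha>" using al by simp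
    obtain \<epsilon>0 where e0: "\<epsilon>0 > 0" "\<And>f. (\<forall>s. 0 \<le> s \<and> s \<le> 1 \<longrightarrow> \<bar>f s\<bar> \<le> \<epsilon>0) \<and>
      (\<forall>s1 s2. 0 \<le> s1 \<and> s1 \<le> 1 \<and> 0 \<le> s2 \<and> s2 \<le> 1 \<longrightarrow> \<bar>f s1 - f s2\<bar> \<le> C * \<bar>s1 - s2\<bar> powr \<beta>) \<Longrightarrow> holder_le (2 * \<alpha>) \<epsilon> f"
      using interpolation[OF g0 al2(1) C e(1)] by blast
    obtain T1 where T1: "\<forall>t\<ge>T1. \<forall>s. 0 \<le> s \<and> s \<le> 1 \<longrightarrow> \<bar>LL s t\<bar> \<le> \<epsilon>0" using unif_0D[OF LL e0(1)] by blast
    obtain T2 where T2: "\<forall>t\<ge>T2. \<forall>s. 0 \<le> s \<and> s \<le> 1 \<longrightarrow> \<bar>L s t - ln c\<bar> \<le> \<epsilon> / 2"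
      using unif_0D[OF L, of "\<epsilon> / 2"] e by auto
    show "eventually (\<lambda>t. dist (?N t) 0 < d) at_top"
      using eventually_ge_at_top[of T1] eventually_ge_at_top[of T2] eventually_ge_at_top[of 2]
    proof eventually_elim
      case (elim t)
      have h: "holder_le (2 * \<alpha>) \<epsilon> (\<lambda>s. LL s t)" by (rule e0(2)) (use elim T1 hLL in auto)
      have Lt: "\<And>s. 0 \<le> s \<Longrightarrow> s \<le> 1 \<Longrightarrow> \<bar>L s t - ln c\<bar> \<le> \<epsilon> / 2" using T2 elim by blast
      have t0: "t \<ge> 0" and a1: "2 * \<alpha> \<le> 1" using elim al2 by auto
      from profile_norm_le[OF t0 c a1 e(1,2) Lt h] ed show ?case by simp
    qed
  qed
  moreover have "((\<lambda>t. R t - b) \<longlongrightarrow> 0) at_top" using R by (simp add: LIM_zero)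
  ultimately have "((\<lambda>t. ?N t + \<bar>R t - b\<bar> + \<bar>R1 t\<bar>) \<longlongrightarrow> 0 + \<bar>0\<bar> + \<bar>0\<bar>) at_top"
    by (intro tendsto_add tendsto_rabs R1)
  then show ?thesis unfolding state_dist_eq by simp
qed

end

section \<open>Equilibrium radius and conclusion\<close>

lemma equilibrium_radius:
  assumes "admissible_params P" "M > 0"
  shows "R_eq P M > 0" "p_inf_star P * R_eq P M ^ 3 + 2 * sigma P * (R_eq P M)\<^sup>2 = 3 * (Rg P * T_inf P) * (M / (4 * pi))"
proof -
  define a where "a = p_inf_star P"
  define s where "s = 2 * sigma P"
  define c where "c = 3 * Rg P * T_inf P * M / (4 * pi)"
  define f where "f r = a * r ^ 3 + s * r\<^sup>2" for r
  have pos: "a > 0" "s > 0" "c > 0" using assms by (auto simp: admissible_params_def a_def s_def c_def)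
  have mono: "f x < f y" if "0 \<le> x" "x < y" for x y
    unfolding f_def using that pos by (intro add_strict_mono mult_strict_left_mono power_strict_mono) auto
  \<comment> \<open>As \<open>b \<ge> 1\<close>, the cubic term at \<open>b\<close> is at least
    \<open>a * b\<close>, which exceeds \<open>c\<close>; thus the root lies below
    \<open>b\<close>.\<close>
  define b where "b = 1 + c / a"
  have b: "b \<ge> 1" "b > 0" using pos by (auto simp: b_def intro: add_pos_pos)
  have "c \<le> a * b" using pos by (simp add: b_def field_simps)
  also have "\<dots> \<le> a * b ^ 3" using pos b power_increasing[of 1 3 b] by simp
  also have "\<dots> \<le> f b" using pos by (simp add: f_def)
  finally have "c \<le> f b" .
  moreover have "f 0 \<le> c" using pos by (simp add: f_def)
  moreover have "continuous_on {0..b} f" unfolding f_def by (intro continuous_intros)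
  ultimately obtain x where x: "0 \<le> x" "x \<le> b" "f x = c" using IVT'[of f 0 c b] b by auto
  have x0: "x > 0" using x pos by (cases "x = 0") (auto simp: f_def)
  have "\<exists>!r. r > 0 \<and> f r - c = 0"
  proof (rule ex1I[of _ x])
    fix r assume r: "r > 0 \<and> f r - c = 0"
    show "r = x" using mono[of r x] mono[of x r] r x by (cases r x rule: linorder_cases) auto
  qed (use x x0 in auto)
  from theI'[OF this] have "R_eq P M > 0 \<and> f (R_eq P M) - c = 0"
    unfolding R_eq_def f_def a_def s_def c_def .
  then show "R_eq P M > 0" "p_inf_star P * R_eq P M ^ 3 + 2 * sigma P * (R_eq P M)\<^sup>2 = 3 * (Rg P * T_inf P) * (M / (4 * pi))"
    by (simp_all add: f_def a_def s_def c_def)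
qed

theorem proposition8p1:
  fixes P :: bubble_params and \<alpha> M0 :: real
  assumes "admissible_params P" and "0 < \<alpha>" and "\<alpha> < 1 / 2" and "M0 > 0"
  shows "\<exists>\<eta>0>0. \<forall>\<eta>. 0 < \<eta> \<and> \<eta> \<le> \<eta>0 \<longrightarrow>
    (\<forall>(\<rho>0 :: real \<Rightarrow> real) (R0 :: real) (V0 :: real)
       (\<rho> :: real \<Rightarrow> real \<Rightarrow> real) (R :: real \<Rightarrow> real).
      initial_data P \<alpha> (p_inf_star P) \<rho>0 R0 V0 \<and>
      RS_global_solution P \<alpha> (\<lambda>_. p_inf_star P) \<rho>0 R0 V0 \<rho> R \<and>
      M0 = bubble_mass \<rho>0 R0 \<and>
      state_dist \<alpha> (\<rho>0, R0, V0) (\<lambda>_. rho_eq P M0, R_eq P M0, 0) \<le> \<eta> \<longrightarrow>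
      ((\<lambda>t. state_dist \<alpha> (\<lambda>r. \<rho> r t, R t, time_deriv R t) (\<lambda>_. rho_eq P M0, R_eq P M0, 0))
         \<longlongrightarrow> 0) at_top \<and>
      ((\<lambda>t. \<bar>(time_deriv ^^ 2) R t\<bar> + \<bar>(time_deriv ^^ 3) R t\<bar>) \<longlongrightarrow> 0) at_top)"
proof -
  let ?kap = "kappa P / (gam P * cv P)" and ?c0 = "Rg P * T_inf P" and ?m = "M0 / (4 * pi)"
  define Rs where "Rs = R_eq P M0"
  have gam: "gam P > 1" using assms(1) by (simp add: gam_def admissible_params_def)
  have bp: "bubble_par ?kap (gam P) ?c0 (sigma P) (p_inf_star P) (rho_l P) (mu_l P) ?m Rs"
    using assms gam equilibrium_radius[OF assms(1,4)] unfolding bubble_par_def Rs_def admissible_params_def by auto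
  interpret bubble_par ?kap "gam P" ?c0 "sigma P" "p_inf_star P" "rho_l P" "mu_l P" ?m Rs by (rule bp)
  have rs_eq: "rs = rho_eq P M0" unfolding rs_def rho_eq_def by (simp add: Rs_def)
  define c where "c = rs"
  have c: "c > 0" using rs(1) by (simp add: c_def)
  \<comment> \<open>Midpoint of \<open>2 * \<alpha>\<close> and \<open>1\<close>: below 1 for the
    flow estimate, above \<open>2 * \<alpha>\<close> for the interpolation.\<close>
  define \<beta> where "\<beta> = (1 + 2 * \<alpha>) / 2"
  have be: "0 < \<beta>" "\<beta> < 1" "2 * \<alpha> < \<beta>" "\<beta> \<le> 1" using assms by (auto simp: \<beta>_def)
  obtain \<delta> where de: "\<delta> > 0" and stab: "\<And>L Ls LL Lt R R1 R2 R3.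
     bubble_flow ?kap (gam P) ?c0 (sigma P) (p_inf_star P) (rho_l P) (mu_l P) ?m Rs L Ls LL Lt R R1 R2 R3 \<Longrightarrow>
     (\<forall>s. 0 \<le> s \<and> s \<le> 1 \<longrightarrow> \<bar>L s 0 - ln rs\<bar> \<le> \<delta> \<and> \<bar>LL s 0\<bar> \<le> \<delta>) \<Longrightarrow> \<bar>R 0 - Rs\<bar> \<le> \<delta> \<Longrightarrow> \<bar>R1 0\<bar> \<le> \<delta> \<Longrightarrow>
     unif_0 (\<lambda>s t. L s t - ln rs) \<and> unif_0 LL \<and>
     (R \<longlongrightarrow> Rs) at_top \<and> (R1 \<longlongrightarrow> 0) at_top \<and> (R2 \<longlongrightarrow> 0) at_top \<and> (R3 \<longlongrightarrow> 0) at_top \<and>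
     (\<exists>C>0. \<forall>t\<ge>2. \<forall>s1 s2. 0 \<le> s1 \<and> s1 \<le> 1 \<and> 0 \<le> s2 \<and> s2 \<le> 1 \<longrightarrow> \<bar>LL s1 t - LL s2 t\<bar> \<le> C * \<bar>s1 - s2\<bar> powr \<beta>)"
    by (rule flow_stability[OF be(1,2)]) (rule that)
  \<comment> \<open>\<open>c / 2\<close> keeps the density away from zero,
    \<open>c * \<delta> / 10\<close> turns the bounds for the profile and its derivatives into
    bounds by \<open>\<delta>\<close> for \<open>L\<close> and \<open>LL\<close>, and
    \<open>\<delta>\<close> serves the radius and its velocity.\<close>
  define \<eta>0 where "\<eta>0 = min (min (c / 2) (c * \<delta> / 10)) \<delta>"
  have e0: "\<eta>0 > 0" "\<eta>0 \<le> c / 2" "\<eta>0 \<le> c * \<delta> / 10" "\<eta>0 \<le> \<delta>" using c de by (auto simp: \<eta>0_def)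
  show ?thesis
  proof (intro exI[of _ \<eta>0] conjI[OF e0(1)] allI impI, goal_cases)
    case (1 \<eta> \<rho>0 R0 V0 \<rho> R)
    then have eta: "0 < \<eta>" "\<eta> \<le> \<eta>0" by auto
    have sol: "RS_global_solution P \<alpha> (\<lambda>_. p_inf_star P) \<rho>0 R0 V0 \<rho> R" and mass: "bubble_mass \<rho>0 R0 = M0"
      and dist: "state_dist \<alpha> (\<rho>0, R0, V0) (\<lambda>_. c, Rs, 0) \<le> \<eta>"
      using 1 unfolding c_def unfolding rs_eq unfolding Rs_def by auto
    interpret S: bubble_solution P \<alpha> \<rho>0 R0 V0 \<rho> R by unfold_locales (use assms sol in auto)
    note ib = S.initial_bounds[OF dist]
    have e1: "\<eta> \<le> c / 2" "\<eta> \<le> \<delta>" "10 * \<eta> / c \<le> \<delta>" using eta e0 c by (auto simp: pos_divide_le_eq mult.commute)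
    have small: "\<bar>S.L s 0 - ln rs\<bar> \<le> \<delta> \<and> \<bar>S.LL s 0\<bar> \<le> \<delta>" if s: "0 \<le> s" "s \<le> 1" for s
    proof
      have "\<bar>S.L s 0 - ln c\<bar> \<le> 2 * \<eta> / c" unfolding S.L_def by (rule ln_close[OF c ib(1)[OF s] e1(1)])
      also have "\<dots> \<le> 10 * \<eta> / c" using eta c by (intro divide_right_mono) auto
      finally show "\<bar>S.L s 0 - ln rs\<bar> \<le> \<delta>" using e1(3) unfolding c_def by linarith
      have U: "S.U s 0 \<ge> c / 2" using ib(1)[OF s] e1(1) unfolding abs_le_iff by linarith
      have "\<bar>S.Ul s 0 / S.U s 0\<bar> \<le> 3 * \<eta> / (c / 2)" unfolding abs_divide
        using U c ib(2)[OF s] by (intro frac_le) auto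
      then have 1: "\<bar>S.Ul s 0 / S.U s 0\<bar> \<le> 6 * (\<eta> / c)" by simp
      have "\<bar>S.Us s 0 / S.U s 0\<bar> \<le> \<eta> / (c / 2)" unfolding abs_divide using U c ib(3)[OF s] by (intro frac_le) auto
      then have 2: "\<bar>S.Us s 0 / S.U s 0\<bar> \<le> 2 * (\<eta> / c)" by (simp add: mult.commute)
      have h: "\<eta> / c \<le> 1 / 2" "0 \<le> \<eta> / c" using e1(1) c eta by (auto simp: field_simps)
      have "\<bar>S.Us s 0 / S.U s 0\<bar> \<le> 1" using 2 h by linarith
      note 2 = 2 this
      have "(S.Us s 0 / S.U s 0)\<^sup>2 = \<bar>S.Us s 0 / S.U s 0\<bar> * \<bar>S.Us s 0 / S.U s 0\<bar>" by (simp add: power2_eq_square abs_mult_self_eq)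
      also have "\<dots> \<le> (2 * (\<eta> / c)) * 1" by (rule mult_mono[OF 2]) (use h in auto)
      finally have 3: "(S.Us s 0 / S.U s 0)\<^sup>2 \<le> 2 * (\<eta> / c)" by simp
      have "\<bar>S.LL s 0\<bar> \<le> \<bar>S.Ul s 0 / S.U s 0\<bar> + (S.Us s 0 / S.U s 0)\<^sup>2"
        unfolding S.LL_def using abs_triangle_ineq4[of "S.Ul s 0 / S.U s 0" "(S.Us s 0 / S.U s 0)\<^sup>2"] by simp
      also have "\<dots> \<le> 10 * (\<eta> / c)" using 1 3 h by linarith
      also have "\<dots> \<le> \<delta>" using e1(3) by simp
      finally show "\<bar>S.LL s 0\<bar> \<le> \<delta>" .
    qed
    have "bubble_mass \<rho>0 R0 = 4 * pi * ?m" using mass by simp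
    note flow = S.flow[OF bp this]
    have r: "\<bar>R 0 - Rs\<bar> \<le> \<delta>" "\<bar>S.R1 0\<bar> \<le> \<delta>" using ib(4,5)[of 0] e1(2) by auto
    have st: "unif_0 (\<lambda>s t. S.L s t - ln rs) \<and> unif_0 S.LL \<and>
     (R \<longlongrightarrow> Rs) at_top \<and> (S.R1 \<longlongrightarrow> 0) at_top \<and> (S.R2 \<longlongrightarrow> 0) at_top \<and> (S.R3 \<longlongrightarrow> 0) at_top \<and>
     (\<exists>C>0. \<forall>t\<ge>2. \<forall>s1 s2. 0 \<le> s1 \<and> s1 \<le> 1 \<and> 0 \<le> s2 \<and> s2 \<le> 1 \<longrightarrow> \<bar>S.LL s1 t - S.LL s2 t\<bar> \<le> C * \<bar>s1 - s2\<bar> powr \<beta>)"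
      by (rule stab[OF flow _ r]) (use small in blast)
    then obtain C where C: "C > 0" "\<And>t s1 s2. t \<ge> 2 \<Longrightarrow> 0 \<le> s1 \<Longrightarrow> s1 \<le> 1 \<Longrightarrow> 0 \<le> s2 \<Longrightarrow> s2 \<le> 1 \<Longrightarrow>
      \<bar>S.LL s1 t - S.LL s2 t\<bar> \<le> C * \<bar>s1 - s2\<bar> powr \<beta>" by blast
    have u: "unif_0 (\<lambda>s t. S.L s t - ln c)" "unif_0 S.LL" and lim: "(R \<longlongrightarrow> Rs) at_top" "(S.R1 \<longlongrightarrow> 0) at_top"
      "(S.R2 \<longlongrightarrow> 0) at_top" "(S.R3 \<longlongrightarrow> 0) at_top" using st unfolding c_def by blast+
    have "((\<lambda>t. state_dist \<alpha> (\<lambda>r. \<rho> r t, R t, S.R1 t) (\<lambda>_. c, Rs, 0)) \<longlongrightarrow> 0) at_top"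
      by (rule S.state_dist_tendsto[OF c be(3,4) u C lim(1,2)])
    then have "((\<lambda>t. state_dist \<alpha> (\<lambda>r. \<rho> r t, R t, time_deriv R t) (\<lambda>_. rho_eq P M0, R_eq P M0, 0)) \<longlongrightarrow> 0) at_top"
      unfolding S.R1_def c_def unfolding rs_eq unfolding Rs_def .
    moreover have "((\<lambda>t. \<bar>S.R2 t\<bar> + \<bar>S.R3 t\<bar>) \<longlongrightarrow> \<bar>0\<bar> + \<bar>0\<bar>) at_top"
      by (intro tendsto_add tendsto_rabs lim)
    ultimately show ?case unfolding S.R2_def S.R3_def by simp
  qed
qed

end
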